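(* The functor $\mathrm{2Spec}({}^{\Box}\mathrm{Set}):\mathrm{Gpd}\to\mathrm{Af2Sch}$, $G\mapsto\mathrm{2Spec}({}^G\mathrm{Set})$, is a fully faithful embedding of 2-categories; i.e. for all small groupoids $H,G$ the functor $\mathrm{Hom}_{\mathrm{Gpd}}(H,G)\to\mathrm{Hom}_{\mathrm{Com2Ring}}({}^G\mathrm{Set},{}^H\mathrm{Set})$, $f\mapsto f^*$, is an equivalence of categories.
   Context: Presentable category: a locally small cocomplete category that is the closure under small colimits of a small set of little objects ($x$ is little if, for some cardinal $\kappa$, $\mathrm{Hom}(x,-)$ preserves $\kappa$-directed colimits). A commutative 2-ring is a presentable symmetric monoidal category whose tensor product preserves small colimits in each variable; 1-morphisms are cocontinuous (strong) symmetric monoidal functors and 2-morphisms are monoidal natural transformations; these form the 2-category $\mathrm{Com2Ring}$. $\mathrm{Af2Sch}$ is the 1-opposite of $\mathrm{Com2Ring}$ and $\mathrm{2Spec}(A)$ is the object of $\mathrm{Af2Sch}$ corresponding to $A$. $\mathrm{Gpd}$ is the 2-category of small groupoids, functors and natural transformations. ${}^G\mathrm{Set}=\mathrm{Fun}(G,\mathrm{Set})$ is a commutative 2-ring with $\otimes=\times$, and a functor $f:H\to G$ induces the pullback 1-morphism $f^*:{}^G\mathrm{Set}\to{}^H\mathrm{Set}$. *)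

theory Defs
  imports Main "HOL-Library.FuncSet"
begin

unbundle cardinal_syntax

section \<open>Smallness\<close>

text \<open>
  A type \<open>'u\<close> of strongly inaccessible cardinality plays the role of a Grothendieck universe: a set
  (over any type) is small if it has fewer elements than \<open>'u\<close>.  Up to equivalence, the category of
  small sets is then the category of small subsets of \<open>'u\<close>, and a small category is one whose
  objects and arrows form small subsets of \<open>'u\<close>.
\<close>

definition inaccessible_universe :: "'u itself \<Rightarrow> bool" where
  "inaccessible_universe u \<longleftrightarrow>
     natLeq <o |UNIV :: 'u set| \<and>
     regularCard |UNIV :: 'u set| \<and>
     (\<forall>A :: 'u set. |A| <o |UNIV :: 'u set| \<longrightarrow> |Pow A| <o |UNIV :: 'u set| )"

definition small :: "'u itself \<Rightarrow> 'x set \<Rightarrow> bool" where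
  "small u A \<longleftrightarrow> |A| <o |UNIV :: 'u set|"


section \<open>Categories, functors and natural transformations\<close>

record ('o, 'a) cat =
  Obj :: "'o set"
  Arr :: "'a set"
  Dom :: "'a \<Rightarrow> 'o"
  Cod :: "'a \<Rightarrow> 'o"
  Ident :: "'o \<Rightarrow> 'a"
  Comp :: "'a \<Rightarrow> 'a \<Rightarrow> 'a"  (infixr \<open>\<cdot>\<index>\<close> 60)

definition hom :: "('o, 'a, 'z) cat_scheme \<Rightarrow> 'o \<Rightarrow> 'o \<Rightarrow> 'a set" where
  "hom C a b = {f \<in> Arr C. Dom C f = a \<and> Cod C f = b}"

definition category :: "('o, 'a, 'z) cat_scheme \<Rightarrow> bool" where
  "category C \<longleftrightarrow>
     (\<forall>f \<in> Arr C. Dom C f \<in> Obj C \<and> Cod C f \<in> Obj C) \<and>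
     (\<forall>a \<in> Obj C. Ident C a \<in> hom C a a) \<and>
     (\<forall>f \<in> Arr C. \<forall>g \<in> Arr C. Dom C g = Cod C f \<longrightarrow> g \<cdot>\<^bsub>C\<^esub> f \<in> hom C (Dom C f) (Cod C g)) \<and>
     (\<forall>f \<in> Arr C. f \<cdot>\<^bsub>C\<^esub> Ident C (Dom C f) = f \<and> Ident C (Cod C f) \<cdot>\<^bsub>C\<^esub> f = f) \<and>
     (\<forall>f \<in> Arr C. \<forall>g \<in> Arr C. \<forall>h \<in> Arr C. Dom C g = Cod C f \<and> Dom C h = Cod C g \<longrightarrow>
        (h \<cdot>\<^bsub>C\<^esub> g) \<cdot>\<^bsub>C\<^esub> f = h \<cdot>\<^bsub>C\<^esub> (g \<cdot>\<^bsub>C\<^esub> f))"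

definition is_iso :: "('o, 'a, 'z) cat_scheme \<Rightarrow> 'a \<Rightarrow> bool" where
  "is_iso C f \<longleftrightarrow> f \<in> Arr C \<and>
     (\<exists>g \<in> hom C (Cod C f) (Dom C f). g \<cdot>\<^bsub>C\<^esub> f = Ident C (Dom C f) \<and> f \<cdot>\<^bsub>C\<^esub> g = Ident C (Cod C f))"

definition groupoid :: "('o, 'a, 'z) cat_scheme \<Rightarrow> bool" where
  "groupoid C \<longleftrightarrow> category C \<and> (\<forall>f \<in> Arr C. is_iso C f)"

definition small_category :: "('u, 'u) cat \<Rightarrow> bool" where
  "small_category C \<longleftrightarrow> category C \<and> small TYPE('u) (Obj C) \<and> small TYPE('u) (Arr C)"

definition small_groupoid :: "('u, 'u) cat \<Rightarrow> bool" where
  "small_groupoid C \<longleftrightarrow> small_category C \<and> groupoid C"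

definition locally_small :: "'u itself \<Rightarrow> ('o, 'a, 'z) cat_scheme \<Rightarrow> bool" where
  "locally_small u C \<longleftrightarrow> (\<forall>a \<in> Obj C. \<forall>b \<in> Obj C. small u (hom C a b))"

text \<open>
  All maps that occur as data of functors and transformations are required to be \<open>undefined\<close> off
  their domain, so that equality of records is equality of functors and of transformations.
\<close>

record ('o1, 'a1, 'o2, 'a2) ftor =
  fobj :: "'o1 \<Rightarrow> 'o2"
  farr :: "'a1 \<Rightarrow> 'a2"

definition is_functor ::
  "('o1, 'a1, 'y) cat_scheme \<Rightarrow> ('o2, 'a2, 'z) cat_scheme \<Rightarrow> ('o1, 'a1, 'o2, 'a2, 'w) ftor_scheme \<Rightarrow> bool"
where
  "is_functor C D F \<longleftrightarrow>
     fobj F \<in> Obj C \<rightarrow>\<^sub>E Obj D \<and>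
     farr F \<in> Arr C \<rightarrow>\<^sub>E Arr D \<and>
     (\<forall>f \<in> Arr C. farr F f \<in> hom D (fobj F (Dom C f)) (fobj F (Cod C f))) \<and>
     (\<forall>a \<in> Obj C. farr F (Ident C a) = Ident D (fobj F a)) \<and>
     (\<forall>f \<in> Arr C. \<forall>g \<in> Arr C. Dom C g = Cod C f \<longrightarrow>
        farr F (g \<cdot>\<^bsub>C\<^esub> f) = farr F g \<cdot>\<^bsub>D\<^esub> farr F f)"

definition id_functor :: "('o, 'a, 'z) cat_scheme \<Rightarrow> ('o, 'a, 'o, 'a) ftor" where
  "id_functor C = \<lparr>fobj = (\<lambda>a \<in> Obj C. a), farr = (\<lambda>f \<in> Arr C. f)\<rparr>"

text \<open>In \<open>comp_functor C G F\<close>, the category \<open>C\<close> is the source of \<open>F\<close>.\<close>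

definition comp_functor ::
  "('o1, 'a1, 'z) cat_scheme \<Rightarrow> ('o2, 'a2, 'o3, 'a3, 'v) ftor_scheme \<Rightarrow>
   ('o1, 'a1, 'o2, 'a2, 'w) ftor_scheme \<Rightarrow> ('o1, 'a1, 'o3, 'a3) ftor"
where
  "comp_functor C G F =
     \<lparr>fobj = (\<lambda>a \<in> Obj C. fobj G (fobj F a)), farr = (\<lambda>f \<in> Arr C. farr G (farr F f))\<rparr>"

text \<open>The type \<open>'f\<close> is that of functors, or of monoidal functors, from \<open>C\<close> to \<open>D\<close>.\<close>

record ('f, 'o, 'a) ntrans =
  nsrc :: 'f
  ntgt :: 'f
  ncomp :: "'o \<Rightarrow> 'a"

definition natural ::
  "('o1, 'a1, 'y) cat_scheme \<Rightarrow> ('o2, 'a2, 'z) cat_scheme \<Rightarrow>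
   (('o1, 'a1, 'o2, 'a2, 'w) ftor_scheme, 'o1, 'a2) ntrans \<Rightarrow> bool"
where
  "natural C D t \<longleftrightarrow>
     is_functor C D (nsrc t) \<and> is_functor C D (ntgt t) \<and>
     ncomp t \<in> extensional (Obj C) \<and>
     (\<forall>a \<in> Obj C. ncomp t a \<in> hom D (fobj (nsrc t) a) (fobj (ntgt t) a)) \<and>
     (\<forall>f \<in> Arr C. ncomp t (Cod C f) \<cdot>\<^bsub>D\<^esub> farr (nsrc t) f = farr (ntgt t) f \<cdot>\<^bsub>D\<^esub> ncomp t (Dom C f))"

definition ntrans_id ::
  "('o1, 'a1, 'y) cat_scheme \<Rightarrow> ('o2, 'a2, 'z) cat_scheme \<Rightarrow> ('o1, 'a1, 'o2, 'a2, 'w) ftor_scheme \<Rightarrow>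
   (('o1, 'a1, 'o2, 'a2, 'w) ftor_scheme, 'o1, 'a2) ntrans"
where
  "ntrans_id C D F = \<lparr>nsrc = F, ntgt = F, ncomp = (\<lambda>a \<in> Obj C. Ident D (fobj F a))\<rparr>"

definition ntrans_comp ::
  "('o1, 'a1, 'y) cat_scheme \<Rightarrow> ('o2, 'a2, 'z) cat_scheme \<Rightarrow>
   ('f, 'o1, 'a2) ntrans \<Rightarrow> ('f, 'o1, 'a2) ntrans \<Rightarrow> ('f, 'o1, 'a2) ntrans"
where
  "ntrans_comp C D t s =
     \<lparr>nsrc = nsrc s, ntgt = ntgt t, ncomp = (\<lambda>a \<in> Obj C. ncomp t a \<cdot>\<^bsub>D\<^esub> ncomp s a)\<rparr>"

text \<open>The components of the horizontal composite of \<open>s : F \<Rightarrow> F' : A \<rightarrow> B\<close> and \<open>t : G \<Rightarrow> G' : B \<rightarrow> C\<close>.\<close>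

definition hcomp_components ::
  "('o1, 'a1, 'y) cat_scheme \<Rightarrow> ('o3, 'a3, 'z) cat_scheme \<Rightarrow>
   (('o2, 'a2, 'o3, 'a3, 'v) ftor_scheme, 'o2, 'a3) ntrans \<Rightarrow>
   (('o1, 'a1, 'o2, 'a2, 'w) ftor_scheme, 'o1, 'a2) ntrans \<Rightarrow> 'o1 \<Rightarrow> 'a3"
where
  "hcomp_components A C t s =
     (\<lambda>a \<in> Obj A. ncomp t (fobj (ntgt s) a) \<cdot>\<^bsub>C\<^esub> farr (nsrc t) (ncomp s a))"

definition functor_category ::
  "('o1, 'a1, 'y) cat_scheme \<Rightarrow> ('o2, 'a2, 'z) cat_scheme \<Rightarrow>
   (('o1, 'a1, 'o2, 'a2) ftor, (('o1, 'a1, 'o2, 'a2) ftor, 'o1, 'a2) ntrans) cat"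
where
  "functor_category C D =
     \<lparr>Obj = {F. is_functor C D F}, Arr = {t. natural C D t}, Dom = nsrc, Cod = ntgt,
      Ident = ntrans_id C D, Comp = ntrans_comp C D\<rparr>"

definition naturally_isomorphic ::
  "('o1, 'a1, 'y) cat_scheme \<Rightarrow> ('o2, 'a2, 'z) cat_scheme \<Rightarrow>
   ('o1, 'a1, 'o2, 'a2) ftor \<Rightarrow> ('o1, 'a1, 'o2, 'a2) ftor \<Rightarrow> bool"
where
  "naturally_isomorphic C D F G \<longleftrightarrow>
     (\<exists>t \<in> hom (functor_category C D) F G. is_iso (functor_category C D) t)"

definition is_equivalence ::
  "('o1, 'a1, 'y) cat_scheme \<Rightarrow> ('o2, 'a2, 'z) cat_scheme \<Rightarrow> ('o1, 'a1, 'o2, 'a2) ftor \<Rightarrow> bool"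
where
  "is_equivalence C D F \<longleftrightarrow>
     category C \<and> category D \<and> is_functor C D F \<and>
     (\<exists>G :: ('o2, 'a2, 'o1, 'a1) ftor. is_functor D C G \<and>
        naturally_isomorphic C C (comp_functor C G F) (id_functor C) \<and>
        naturally_isomorphic D D (comp_functor D F G) (id_functor D))"


section \<open>Colimits\<close>

definition is_cocone ::
  "('i, 'j, 'y) cat_scheme \<Rightarrow> ('o, 'a, 'z) cat_scheme \<Rightarrow> ('i, 'j, 'o, 'a, 'w) ftor_scheme \<Rightarrow>
   'o \<Rightarrow> ('i \<Rightarrow> 'a) \<Rightarrow> bool"
where
  "is_cocone J C X c l \<longleftrightarrow>
     c \<in> Obj C \<and>
     (\<forall>i \<in> Obj J. l i \<in> hom C (fobj X i) c) \<and>
     (\<forall>k \<in> Arr J. l (Cod J k) \<cdot>\<^bsub>C\<^esub> farr X k = l (Dom J k))"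

definition is_colimit ::
  "('i, 'j, 'y) cat_scheme \<Rightarrow> ('o, 'a, 'z) cat_scheme \<Rightarrow> ('i, 'j, 'o, 'a, 'w) ftor_scheme \<Rightarrow>
   'o \<Rightarrow> ('i \<Rightarrow> 'a) \<Rightarrow> bool"
where
  "is_colimit J C X c l \<longleftrightarrow>
     is_cocone J C X c l \<and>
     (\<forall>c' l'. is_cocone J C X c' l' \<longrightarrow>
        (\<exists>!h. h \<in> hom C c c' \<and> (\<forall>i \<in> Obj J. h \<cdot>\<^bsub>C\<^esub> l i = l' i)))"

definition cocomplete :: "'u itself \<Rightarrow> ('o, 'a, 'z) cat_scheme \<Rightarrow> bool" where
  "cocomplete u C \<longleftrightarrow>
     (\<forall>(J :: ('u, 'u) cat) (X :: ('u, 'u, 'o, 'a) ftor).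
        small_category J \<and> is_functor J C X \<longrightarrow> (\<exists>c l. is_colimit J C X c l))"

text \<open>Preservation of the colimits of all small diagrams whose shape satisfies \<open>P\<close>.\<close>

definition preserves_colimits ::
  "(('u, 'u) cat \<Rightarrow> bool) \<Rightarrow> ('o1, 'a1, 'y) cat_scheme \<Rightarrow> ('o2, 'a2, 'z) cat_scheme \<Rightarrow>
   ('o1, 'a1, 'o2, 'a2, 'w) ftor_scheme \<Rightarrow> bool"
where
  "preserves_colimits P C D F \<longleftrightarrow>
     (\<forall>(J :: ('u, 'u) cat) (X :: ('u, 'u, 'o1, 'a1) ftor) c l.
        small_category J \<and> P J \<and> is_functor J C X \<and> is_colimit J C X c l \<longrightarrow>
        is_colimit J D (comp_functor J F X) (fobj F c) (\<lambda>i. farr F (l i)))"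

definition cocontinuous ::
  "'u itself \<Rightarrow> ('o1, 'a1, 'y) cat_scheme \<Rightarrow> ('o2, 'a2, 'z) cat_scheme \<Rightarrow>
   ('o1, 'a1, 'o2, 'a2, 'w) ftor_scheme \<Rightarrow> bool"
where
  "cocontinuous u C D F \<longleftrightarrow> preserves_colimits (\<lambda>J :: ('u, 'u) cat. True) C D F"


section \<open>The category of small sets\<close>

record 'x set_map =
  sdom :: "'x set"
  scod :: "'x set"
  sfun :: "'x \<Rightarrow> 'x"

definition set_category :: "'u itself \<Rightarrow> ('x set, 'x set_map) cat" where
  "set_category u =
     \<lparr>Obj = {A. small u A},
      Arr = {f. small u (sdom f) \<and> small u (scod f) \<and> sfun f \<in> sdom f \<rightarrow>\<^sub>E scod f},
      Dom = sdom,
      Cod = scod,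
      Ident = (\<lambda>A. \<lparr>sdom = A, scod = A, sfun = (\<lambda>x \<in> A. x)\<rparr>),
      Comp = (\<lambda>g f. \<lparr>sdom = sdom f, scod = scod g, sfun = (\<lambda>x \<in> sdom f. sfun g (sfun f x))\<rparr>)\<rparr>"


section \<open>Presentable categories\<close>

text \<open>
  \<open>Hom(x,-)\<close> takes values in small subsets of \<open>'a + 'u\<close> rather than of \<open>'a\<close>, so that its target is
  the category of all small sets (up to equivalence) whatever the size of the type \<open>'a\<close> of arrows.
\<close>

definition hom_functor ::
  "'u itself \<Rightarrow> ('o, 'a, 'z) cat_scheme \<Rightarrow> 'o \<Rightarrow> ('o, 'a, ('a + 'u) set, ('a + 'u) set_map) ftor"
where
  "hom_functor u C x =
     \<lparr>fobj = (\<lambda>y \<in> Obj C. Inl ` hom C x y),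
      farr = (\<lambda>f \<in> Arr C.
        \<lparr>sdom = Inl ` hom C x (Dom C f), scod = Inl ` hom C x (Cod C f),
         sfun = (\<lambda>p \<in> Inl ` hom C x (Dom C f). Inl (f \<cdot>\<^bsub>C\<^esub> projl p))\<rparr>)\<rparr>"

text \<open>
  A poset is a category with at most one arrow between any two objects and with \<open>a = b\<close> whenever
  there are arrows \<open>a \<rightarrow> b\<close> and \<open>b \<rightarrow> a\<close>.  It is \<open>\<kappa>\<close>-directed if every set of fewer than \<open>\<kappa>\<close> objects
  has an upper bound.
\<close>

definition directed_poset :: "'u rel \<Rightarrow> ('o, 'a, 'z) cat_scheme \<Rightarrow> bool" where
  "directed_poset \<kappa> J \<longleftrightarrow>
     (\<forall>f \<in> Arr J. \<forall>g \<in> Arr J. Dom J f = Dom J g \<and> Cod J f = Cod J g \<longrightarrow> f = g) \<and>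
     (\<forall>a \<in> Obj J. \<forall>b \<in> Obj J. hom J a b \<noteq> {} \<and> hom J b a \<noteq> {} \<longrightarrow> a = b) \<and>
     (\<forall>S \<subseteq> Obj J. |S| <o \<kappa> \<longrightarrow> (\<exists>b \<in> Obj J. \<forall>a \<in> S. hom J a b \<noteq> {}))"

text \<open>The bound on \<open>\<kappa>\<close> says that it is a cardinal of the universe; without it the notion is vacuous.\<close>

definition little :: "'u itself \<Rightarrow> ('o, 'a, 'z) cat_scheme \<Rightarrow> 'o \<Rightarrow> bool" where
  "little u C x \<longleftrightarrow>
     (\<exists>\<kappa> :: 'u rel. Card_order \<kappa> \<and> \<kappa> <o |UNIV :: 'u set| \<and>
        preserves_colimits (directed_poset \<kappa> :: ('u, 'u) cat \<Rightarrow> bool) C (set_category u) (hom_functor u C x))"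

inductive_set colimit_closure :: "'u itself \<Rightarrow> ('o, 'a, 'z) cat_scheme \<Rightarrow> 'o set \<Rightarrow> 'o set"
  for u :: "'u itself" and C :: "('o, 'a, 'z) cat_scheme" and S :: "'o set"
where
  base: "x \<in> S \<Longrightarrow> x \<in> colimit_closure u C S"
| colim: "\<lbrakk>small_category (J :: ('u, 'u) cat); is_functor J C (X :: ('u, 'u, 'o, 'a) ftor);
          \<forall>i \<in> Obj J. fobj X i \<in> colimit_closure u C S; is_colimit J C X c l\<rbrakk>
         \<Longrightarrow> c \<in> colimit_closure u C S"

definition presentable :: "'u itself \<Rightarrow> ('o, 'a, 'z) cat_scheme \<Rightarrow> bool" where
  "presentable u C \<longleftrightarrow>
     category C \<and> locally_small u C \<and> cocomplete u C \<and>
     (\<exists>S \<subseteq> Obj C. small u S \<and> (\<forall>x \<in> S. little u C x) \<and> Obj C = colimit_closure u C S)"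


section \<open>Symmetric monoidal categories\<close>

record ('o, 'a) smcat = "('o, 'a) cat" +
  Tobj :: "'o \<Rightarrow> 'o \<Rightarrow> 'o"  (infixr \<open>\<otimes>\<index>\<close> 70)
  Tarr :: "'a \<Rightarrow> 'a \<Rightarrow> 'a"  (infixr \<open>\<boxtimes>\<index>\<close> 70)
  Unit :: "'o"
  Assoc :: "'o \<Rightarrow> 'o \<Rightarrow> 'o \<Rightarrow> 'a"
  Lunit :: "'o \<Rightarrow> 'a"
  Runit :: "'o \<Rightarrow> 'a"
  Braid :: "'o \<Rightarrow> 'o \<Rightarrow> 'a"

definition tensor_bifunctor :: "('o, 'a, 'z) smcat_scheme \<Rightarrow> bool" where
  "tensor_bifunctor C \<longleftrightarrow>
     (\<forall>a \<in> Obj C. \<forall>b \<in> Obj C. a \<otimes>\<^bsub>C\<^esub> b \<in> Obj C) \<and>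
     (\<forall>f \<in> Arr C. \<forall>g \<in> Arr C.
        f \<boxtimes>\<^bsub>C\<^esub> g \<in> hom C (Dom C f \<otimes>\<^bsub>C\<^esub> Dom C g) (Cod C f \<otimes>\<^bsub>C\<^esub> Cod C g)) \<and>
     (\<forall>a \<in> Obj C. \<forall>b \<in> Obj C. Ident C a \<boxtimes>\<^bsub>C\<^esub> Ident C b = Ident C (a \<otimes>\<^bsub>C\<^esub> b)) \<and>
     (\<forall>f \<in> Arr C. \<forall>f' \<in> Arr C. \<forall>g \<in> Arr C. \<forall>g' \<in> Arr C.
        Dom C f' = Cod C f \<and> Dom C g' = Cod C g \<longrightarrow>
        (f' \<cdot>\<^bsub>C\<^esub> f) \<boxtimes>\<^bsub>C\<^esub> (g' \<cdot>\<^bsub>C\<^esub> g) = (f' \<boxtimes>\<^bsub>C\<^esub> g') \<cdot>\<^bsub>C\<^esub> (f \<boxtimes>\<^bsub>C\<^esub> g))"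

definition monoidal_constraints :: "('o, 'a, 'z) smcat_scheme \<Rightarrow> bool" where
  "monoidal_constraints C \<longleftrightarrow>
     Unit C \<in> Obj C \<and>
     (\<forall>a \<in> Obj C. \<forall>b \<in> Obj C. \<forall>c \<in> Obj C.
        Assoc C a b c \<in> hom C ((a \<otimes>\<^bsub>C\<^esub> b) \<otimes>\<^bsub>C\<^esub> c) (a \<otimes>\<^bsub>C\<^esub> (b \<otimes>\<^bsub>C\<^esub> c)) \<and> is_iso C (Assoc C a b c)) \<and>
     (\<forall>a \<in> Obj C. Lunit C a \<in> hom C (Unit C \<otimes>\<^bsub>C\<^esub> a) a \<and> is_iso C (Lunit C a)) \<and>
     (\<forall>a \<in> Obj C. Runit C a \<in> hom C (a \<otimes>\<^bsub>C\<^esub> Unit C) a \<and> is_iso C (Runit C a)) \<and>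
     (\<forall>a \<in> Obj C. \<forall>b \<in> Obj C. Braid C a b \<in> hom C (a \<otimes>\<^bsub>C\<^esub> b) (b \<otimes>\<^bsub>C\<^esub> a)) \<and>
     (\<forall>f \<in> Arr C. \<forall>g \<in> Arr C. \<forall>h \<in> Arr C.
        Assoc C (Cod C f) (Cod C g) (Cod C h) \<cdot>\<^bsub>C\<^esub> ((f \<boxtimes>\<^bsub>C\<^esub> g) \<boxtimes>\<^bsub>C\<^esub> h) =
        (f \<boxtimes>\<^bsub>C\<^esub> (g \<boxtimes>\<^bsub>C\<^esub> h)) \<cdot>\<^bsub>C\<^esub> Assoc C (Dom C f) (Dom C g) (Dom C h)) \<and>
     (\<forall>f \<in> Arr C. Lunit C (Cod C f) \<cdot>\<^bsub>C\<^esub> (Ident C (Unit C) \<boxtimes>\<^bsub>C\<^esub> f) = f \<cdot>\<^bsub>C\<^esub> Lunit C (Dom C f)) \<and>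
     (\<forall>f \<in> Arr C. Runit C (Cod C f) \<cdot>\<^bsub>C\<^esub> (f \<boxtimes>\<^bsub>C\<^esub> Ident C (Unit C)) = f \<cdot>\<^bsub>C\<^esub> Runit C (Dom C f)) \<and>
     (\<forall>f \<in> Arr C. \<forall>g \<in> Arr C.
        Braid C (Cod C f) (Cod C g) \<cdot>\<^bsub>C\<^esub> (f \<boxtimes>\<^bsub>C\<^esub> g) = (g \<boxtimes>\<^bsub>C\<^esub> f) \<cdot>\<^bsub>C\<^esub> Braid C (Dom C f) (Dom C g))"

text \<open>Pentagon, triangle, hexagon and symmetry.\<close>

definition monoidal_coherence :: "('o, 'a, 'z) smcat_scheme \<Rightarrow> bool" where
  "monoidal_coherence C \<longleftrightarrow>
     (\<forall>a \<in> Obj C. \<forall>b \<in> Obj C. \<forall>c \<in> Obj C. \<forall>d \<in> Obj C.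
        (Ident C a \<boxtimes>\<^bsub>C\<^esub> Assoc C b c d) \<cdot>\<^bsub>C\<^esub> Assoc C a (b \<otimes>\<^bsub>C\<^esub> c) d \<cdot>\<^bsub>C\<^esub> (Assoc C a b c \<boxtimes>\<^bsub>C\<^esub> Ident C d) =
        Assoc C a b (c \<otimes>\<^bsub>C\<^esub> d) \<cdot>\<^bsub>C\<^esub> Assoc C (a \<otimes>\<^bsub>C\<^esub> b) c d) \<and>
     (\<forall>a \<in> Obj C. \<forall>b \<in> Obj C.
        (Ident C a \<boxtimes>\<^bsub>C\<^esub> Lunit C b) \<cdot>\<^bsub>C\<^esub> Assoc C a (Unit C) b = Runit C a \<boxtimes>\<^bsub>C\<^esub> Ident C b) \<and>
     (\<forall>a \<in> Obj C. \<forall>b \<in> Obj C. \<forall>c \<in> Obj C.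
        Assoc C b c a \<cdot>\<^bsub>C\<^esub> Braid C a (b \<otimes>\<^bsub>C\<^esub> c) \<cdot>\<^bsub>C\<^esub> Assoc C a b c =
        (Ident C b \<boxtimes>\<^bsub>C\<^esub> Braid C a c) \<cdot>\<^bsub>C\<^esub> Assoc C b a c \<cdot>\<^bsub>C\<^esub> (Braid C a b \<boxtimes>\<^bsub>C\<^esub> Ident C c)) \<and>
     (\<forall>a \<in> Obj C. \<forall>b \<in> Obj C. Braid C b a \<cdot>\<^bsub>C\<^esub> Braid C a b = Ident C (a \<otimes>\<^bsub>C\<^esub> b))"

definition symmetric_monoidal_category :: "('o, 'a, 'z) smcat_scheme \<Rightarrow> bool" where
  "symmetric_monoidal_category C \<longleftrightarrow>
     category C \<and> tensor_bifunctor C \<and> monoidal_constraints C \<and> monoidal_coherence C"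

record ('o1, 'a1, 'o2, 'a2) smftor = "('o1, 'a1, 'o2, 'a2) ftor" +
  Mu :: "'o1 \<Rightarrow> 'o1 \<Rightarrow> 'a2"
  Eps :: "'a2"

text \<open>
  Strong symmetric monoidal functors, with structure isomorphisms
  \<open>Mu a b : F a \<otimes> F b \<rightarrow> F (a \<otimes> b)\<close> and \<open>Eps : 1 \<rightarrow> F 1\<close>.
\<close>

definition symmetric_monoidal_functor ::
  "('o1, 'a1, 'y) smcat_scheme \<Rightarrow> ('o2, 'a2, 'z) smcat_scheme \<Rightarrow>
   ('o1, 'a1, 'o2, 'a2, 'w) smftor_scheme \<Rightarrow> bool"
where
  "symmetric_monoidal_functor C D F \<longleftrightarrow>
     is_functor C D F \<and>
     (\<forall>a b. a \<notin> Obj C \<or> b \<notin> Obj C \<longrightarrow> Mu F a b = undefined) \<and>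
     (\<forall>a \<in> Obj C. \<forall>b \<in> Obj C.
        Mu F a b \<in> hom D (fobj F a \<otimes>\<^bsub>D\<^esub> fobj F b) (fobj F (a \<otimes>\<^bsub>C\<^esub> b)) \<and> is_iso D (Mu F a b)) \<and>
     Eps F \<in> hom D (Unit D) (fobj F (Unit C)) \<and> is_iso D (Eps F) \<and>
     (\<forall>f \<in> Arr C. \<forall>g \<in> Arr C.
        Mu F (Cod C f) (Cod C g) \<cdot>\<^bsub>D\<^esub> (farr F f \<boxtimes>\<^bsub>D\<^esub> farr F g) =
        farr F (f \<boxtimes>\<^bsub>C\<^esub> g) \<cdot>\<^bsub>D\<^esub> Mu F (Dom C f) (Dom C g)) \<and>
     (\<forall>a \<in> Obj C. \<forall>b \<in> Obj C. \<forall>c \<in> Obj C.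
        farr F (Assoc C a b c) \<cdot>\<^bsub>D\<^esub> Mu F (a \<otimes>\<^bsub>C\<^esub> b) c \<cdot>\<^bsub>D\<^esub> (Mu F a b \<boxtimes>\<^bsub>D\<^esub> Ident D (fobj F c)) =
        Mu F a (b \<otimes>\<^bsub>C\<^esub> c) \<cdot>\<^bsub>D\<^esub> (Ident D (fobj F a) \<boxtimes>\<^bsub>D\<^esub> Mu F b c) \<cdot>\<^bsub>D\<^esub>
          Assoc D (fobj F a) (fobj F b) (fobj F c)) \<and>
     (\<forall>a \<in> Obj C.
        farr F (Lunit C a) \<cdot>\<^bsub>D\<^esub> Mu F (Unit C) a \<cdot>\<^bsub>D\<^esub> (Eps F \<boxtimes>\<^bsub>D\<^esub> Ident D (fobj F a)) = Lunit D (fobj F a)) \<and>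
     (\<forall>a \<in> Obj C.
        farr F (Runit C a) \<cdot>\<^bsub>D\<^esub> Mu F a (Unit C) \<cdot>\<^bsub>D\<^esub> (Ident D (fobj F a) \<boxtimes>\<^bsub>D\<^esub> Eps F) = Runit D (fobj F a)) \<and>
     (\<forall>a \<in> Obj C. \<forall>b \<in> Obj C.
        farr F (Braid C a b) \<cdot>\<^bsub>D\<^esub> Mu F a b = Mu F b a \<cdot>\<^bsub>D\<^esub> Braid D (fobj F a) (fobj F b))"

definition monoidal_transformation ::
  "('o1, 'a1, 'y) smcat_scheme \<Rightarrow> ('o2, 'a2, 'z) smcat_scheme \<Rightarrow>
   (('o1, 'a1, 'o2, 'a2, 'w) smftor_scheme, 'o1, 'a2) ntrans \<Rightarrow> bool"
where
  "monoidal_transformation C D t \<longleftrightarrow>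
     natural C D t \<and>
     (\<forall>a \<in> Obj C. \<forall>b \<in> Obj C.
        ncomp t (a \<otimes>\<^bsub>C\<^esub> b) \<cdot>\<^bsub>D\<^esub> Mu (nsrc t) a b = Mu (ntgt t) a b \<cdot>\<^bsub>D\<^esub> (ncomp t a \<boxtimes>\<^bsub>D\<^esub> ncomp t b)) \<and>
     ncomp t (Unit C) \<cdot>\<^bsub>D\<^esub> Eps (nsrc t) = Eps (ntgt t)"

definition id_smfunctor :: "('o, 'a, 'z) smcat_scheme \<Rightarrow> ('o, 'a, 'o, 'a) smftor" where
  "id_smfunctor C =
     \<lparr>fobj = (\<lambda>a \<in> Obj C. a), farr = (\<lambda>f \<in> Arr C. f),
      Mu = (\<lambda>a b. if a \<in> Obj C \<and> b \<in> Obj C then Ident C (a \<otimes>\<^bsub>C\<^esub> b) else undefined),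
      Eps = Ident C (Unit C)\<rparr>"

definition comp_smfunctor ::
  "('o1, 'a1, 'y) smcat_scheme \<Rightarrow> ('o3, 'a3, 'z) smcat_scheme \<Rightarrow>
   ('o2, 'a2, 'o3, 'a3) smftor \<Rightarrow> ('o1, 'a1, 'o2, 'a2) smftor \<Rightarrow> ('o1, 'a1, 'o3, 'a3) smftor"
where
  "comp_smfunctor A C G F =
     \<lparr>fobj = (\<lambda>a \<in> Obj A. fobj G (fobj F a)),
      farr = (\<lambda>f \<in> Arr A. farr G (farr F f)),
      Mu = (\<lambda>a b. if a \<in> Obj A \<and> b \<in> Obj A
                  then farr G (Mu F a b) \<cdot>\<^bsub>C\<^esub> Mu G (fobj F a) (fobj F b) else undefined),
      Eps = farr G (Eps F) \<cdot>\<^bsub>C\<^esub> Eps G\<rparr>"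


section \<open>Strict 2-categories and 2-functors\<close>

text \<open>
  In \<open>HComp1 T A B C g f\<close> and \<open>HComp2 T A B C t s\<close>, the 1-cell \<open>f\<close> and the 2-cell \<open>s\<close> are in
  \<open>HomCat T A B\<close>, while \<open>g\<close> and \<open>t\<close> are in \<open>HomCat T B C\<close>.
\<close>

record ('o, 'f, 't) two_cat =
  Cell0 :: "'o set"
  HomCat :: "'o \<Rightarrow> 'o \<Rightarrow> ('f, 't) cat"
  Ident1 :: "'o \<Rightarrow> 'f"
  HComp1 :: "'o \<Rightarrow> 'o \<Rightarrow> 'o \<Rightarrow> 'f \<Rightarrow> 'f \<Rightarrow> 'f"
  HComp2 :: "'o \<Rightarrow> 'o \<Rightarrow> 'o \<Rightarrow> 't \<Rightarrow> 't \<Rightarrow> 't"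

definition two_category :: "('o, 'f, 't) two_cat \<Rightarrow> bool" where
  "two_category T \<longleftrightarrow>
     (\<forall>A \<in> Cell0 T. \<forall>B \<in> Cell0 T. category (HomCat T A B)) \<and>
     (\<forall>A \<in> Cell0 T. Ident1 T A \<in> Obj (HomCat T A A)) \<and>
     (\<forall>A \<in> Cell0 T. \<forall>B \<in> Cell0 T. \<forall>C \<in> Cell0 T.
        (\<forall>f \<in> Obj (HomCat T A B). \<forall>g \<in> Obj (HomCat T B C).
           HComp1 T A B C g f \<in> Obj (HomCat T A C) \<and>
           HComp2 T A B C (Ident (HomCat T B C) g) (Ident (HomCat T A B) f) =
             Ident (HomCat T A C) (HComp1 T A B C g f)) \<and>
        (\<forall>s \<in> Arr (HomCat T A B). \<forall>t \<in> Arr (HomCat T B C).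
           HComp2 T A B C t s \<in> hom (HomCat T A C)
             (HComp1 T A B C (Dom (HomCat T B C) t) (Dom (HomCat T A B) s))
             (HComp1 T A B C (Cod (HomCat T B C) t) (Cod (HomCat T A B) s))) \<and>
        (\<forall>s \<in> Arr (HomCat T A B). \<forall>s' \<in> Arr (HomCat T A B).
         \<forall>t \<in> Arr (HomCat T B C). \<forall>t' \<in> Arr (HomCat T B C).
           Dom (HomCat T A B) s' = Cod (HomCat T A B) s \<and> Dom (HomCat T B C) t' = Cod (HomCat T B C) t \<longrightarrow>
           HComp2 T A B C (t' \<cdot>\<^bsub>HomCat T B C\<^esub> t) (s' \<cdot>\<^bsub>HomCat T A B\<^esub> s) =
             HComp2 T A B C t' s' \<cdot>\<^bsub>HomCat T A C\<^esub> HComp2 T A B C t s)) \<and>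
     (\<forall>A \<in> Cell0 T. \<forall>B \<in> Cell0 T.
        (\<forall>f \<in> Obj (HomCat T A B).
           HComp1 T A A B f (Ident1 T A) = f \<and> HComp1 T A B B (Ident1 T B) f = f) \<and>
        (\<forall>s \<in> Arr (HomCat T A B).
           HComp2 T A A B s (Ident (HomCat T A A) (Ident1 T A)) = s \<and>
           HComp2 T A B B (Ident (HomCat T B B) (Ident1 T B)) s = s)) \<and>
     (\<forall>A \<in> Cell0 T. \<forall>B \<in> Cell0 T. \<forall>C \<in> Cell0 T. \<forall>D \<in> Cell0 T.
        (\<forall>f \<in> Obj (HomCat T A B). \<forall>g \<in> Obj (HomCat T B C). \<forall>h \<in> Obj (HomCat T C D).
           HComp1 T A B D (HComp1 T B C D h g) f = HComp1 T A C D h (HComp1 T A B C g f)) \<and>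
        (\<forall>r \<in> Arr (HomCat T A B). \<forall>s \<in> Arr (HomCat T B C). \<forall>t \<in> Arr (HomCat T C D).
           HComp2 T A B D (HComp2 T B C D t s) r = HComp2 T A C D t (HComp2 T A B C s r)))"

text \<open>The 1-opposite reverses 1-cells but not 2-cells.\<close>

definition one_opposite :: "('o, 'f, 't) two_cat \<Rightarrow> ('o, 'f, 't) two_cat" where
  "one_opposite T =
     \<lparr>Cell0 = Cell0 T,
      HomCat = (\<lambda>A B. HomCat T B A),
      Ident1 = Ident1 T,
      HComp1 = (\<lambda>A B C g f. HComp1 T C B A f g),
      HComp2 = (\<lambda>A B C t s. HComp2 T C B A s t)\<rparr>"

record ('o, 'f, 't, 'o2, 'f2, 't2) two_ftor =
  two_obj :: "'o \<Rightarrow> 'o2"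
  two_hom :: "'o \<Rightarrow> 'o \<Rightarrow> ('f, 't, 'f2, 't2) ftor"

definition two_functor ::
  "('o, 'f, 't) two_cat \<Rightarrow> ('o2, 'f2, 't2) two_cat \<Rightarrow> ('o, 'f, 't, 'o2, 'f2, 't2) two_ftor \<Rightarrow> bool"
where
  "two_functor S T F \<longleftrightarrow>
     two_category S \<and> two_category T \<and>
     (\<forall>A \<in> Cell0 S. two_obj F A \<in> Cell0 T) \<and>
     (\<forall>A \<in> Cell0 S. \<forall>B \<in> Cell0 S.
        is_functor (HomCat S A B) (HomCat T (two_obj F A) (two_obj F B)) (two_hom F A B)) \<and>
     (\<forall>A \<in> Cell0 S. fobj (two_hom F A A) (Ident1 S A) = Ident1 T (two_obj F A)) \<and>
     (\<forall>A \<in> Cell0 S. \<forall>B \<in> Cell0 S. \<forall>C \<in> Cell0 S.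
        (\<forall>f \<in> Obj (HomCat S A B). \<forall>g \<in> Obj (HomCat S B C).
           fobj (two_hom F A C) (HComp1 S A B C g f) =
           HComp1 T (two_obj F A) (two_obj F B) (two_obj F C)
             (fobj (two_hom F B C) g) (fobj (two_hom F A B) f)) \<and>
        (\<forall>s \<in> Arr (HomCat S A B). \<forall>t \<in> Arr (HomCat S B C).
           farr (two_hom F A C) (HComp2 S A B C t s) =
           HComp2 T (two_obj F A) (two_obj F B) (two_obj F C)
             (farr (two_hom F B C) t) (farr (two_hom F A B) s)))"

definition fully_faithful_two_functor ::
  "('o, 'f, 't) two_cat \<Rightarrow> ('o2, 'f2, 't2) two_cat \<Rightarrow> ('o, 'f, 't, 'o2, 'f2, 't2) two_ftor \<Rightarrow> bool"
where
  "fully_faithful_two_functor S T F \<longleftrightarrow>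
     two_functor S T F \<and>
     (\<forall>A \<in> Cell0 S. \<forall>B \<in> Cell0 S.
        is_equivalence (HomCat S A B) (HomCat T (two_obj F A) (two_obj F B)) (two_hom F A B))"


section \<open>The 2-category of small groupoids\<close>

type_synonym 'u gfun = "('u, 'u, 'u, 'u) ftor"
type_synonym 'u gtrans = "('u gfun, 'u, 'u) ntrans"

definition Gpd :: "(('u, 'u) cat, 'u gfun, 'u gtrans) two_cat" where
  "Gpd =
     \<lparr>Cell0 = {G. small_groupoid G},
      HomCat = functor_category,
      Ident1 = id_functor,
      HComp1 = (\<lambda>A B C g f. comp_functor A g f),
      HComp2 = (\<lambda>A B C t s.
        \<lparr>nsrc = comp_functor A (nsrc t) (nsrc s), ntgt = comp_functor A (ntgt t) (ntgt s),
         ncomp = hcomp_components A C t s\<rparr>)\<rparr>"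


section \<open>Commutative 2-rings and affine 2-schemes\<close>

definition tensor_left :: "('o, 'a, 'z) smcat_scheme \<Rightarrow> 'o \<Rightarrow> ('o, 'a, 'o, 'a) ftor" where
  "tensor_left C a = \<lparr>fobj = (\<lambda>b \<in> Obj C. a \<otimes>\<^bsub>C\<^esub> b), farr = (\<lambda>f \<in> Arr C. Ident C a \<boxtimes>\<^bsub>C\<^esub> f)\<rparr>"

definition tensor_right :: "('o, 'a, 'z) smcat_scheme \<Rightarrow> 'o \<Rightarrow> ('o, 'a, 'o, 'a) ftor" where
  "tensor_right C a = \<lparr>fobj = (\<lambda>b \<in> Obj C. b \<otimes>\<^bsub>C\<^esub> a), farr = (\<lambda>f \<in> Arr C. f \<boxtimes>\<^bsub>C\<^esub> Ident C a)\<rparr>"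

definition commutative_2_ring :: "'u itself \<Rightarrow> ('o, 'a, 'z) smcat_scheme \<Rightarrow> bool" where
  "commutative_2_ring u C \<longleftrightarrow>
     symmetric_monoidal_category C \<and> presentable u C \<and>
     (\<forall>a \<in> Obj C. cocontinuous u C C (tensor_left C a) \<and> cocontinuous u C C (tensor_right C a))"

type_synonym ('o, 'a) sm_endo = "('o, 'a, 'o, 'a) smftor"
type_synonym ('o, 'a) sm_trans = "(('o, 'a) sm_endo, 'o, 'a) ntrans"

definition Hom_Com2Ring ::
  "'u itself \<Rightarrow> ('o, 'a) smcat \<Rightarrow> ('o, 'a) smcat \<Rightarrow> (('o, 'a) sm_endo, ('o, 'a) sm_trans) cat"
where
  "Hom_Com2Ring u A B =
     \<lparr>Obj = {F. symmetric_monoidal_functor A B F \<and> cocontinuous u A B F},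
      Arr = {t. symmetric_monoidal_functor A B (nsrc t) \<and> cocontinuous u A B (nsrc t) \<and>
                symmetric_monoidal_functor A B (ntgt t) \<and> cocontinuous u A B (ntgt t) \<and>
                monoidal_transformation A B t},
      Dom = nsrc, Cod = ntgt, Ident = ntrans_id A B, Comp = ntrans_comp A B\<rparr>"

text \<open>
  The types \<open>'o\<close> and \<open>'a\<close> bound the 2-rings that occur as 0-cells; they do not affect the hom-category
  of two given 2-rings.
\<close>

definition Com2Ring ::
  "'u itself \<Rightarrow> (('o, 'a) smcat, ('o, 'a) sm_endo, ('o, 'a) sm_trans) two_cat"
where
  "Com2Ring u =
     \<lparr>Cell0 = {A. commutative_2_ring u A},
      HomCat = Hom_Com2Ring u,
      Ident1 = id_smfunctor,
      HComp1 = (\<lambda>A B C g f. comp_smfunctor A C g f),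
      HComp2 = (\<lambda>A B C t s.
        \<lparr>nsrc = comp_smfunctor A C (nsrc t) (nsrc s), ntgt = comp_smfunctor A C (ntgt t) (ntgt s),
         ncomp = hcomp_components A C t s\<rparr>)\<rparr>"

definition Af2Sch ::
  "'u itself \<Rightarrow> (('o, 'a) smcat, ('o, 'a) sm_endo, ('o, 'a) sm_trans) two_cat"
where
  "Af2Sch u = one_opposite (Com2Ring u)"

text \<open>A 2-category and its 1-opposite have the same 0-cells.\<close>

definition two_Spec :: "('o, 'a) smcat \<Rightarrow> ('o, 'a) smcat" where
  "two_Spec A = A"


section \<open>The commutative 2-ring of \<open>G\<close>-sets\<close>

text \<open>
  The cartesian product of subsets of \<open>'u\<close> is formed by means of a fixed injection
  \<open>'u \<times> 'u \<rightarrow> 'u\<close>, which exists as soon as \<open>'u\<close> is infinite.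
\<close>

definition upair :: "'u \<Rightarrow> 'u \<Rightarrow> 'u" where
  "upair x y = (SOME p :: 'u \<times> 'u \<Rightarrow> 'u. inj p) (x, y)"

definition ufst :: "'u \<Rightarrow> 'u" where
  "ufst z = (THE x. \<exists>y. z = upair x y)"

definition usnd :: "'u \<Rightarrow> 'u" where
  "usnd z = (THE y. \<exists>x. z = upair x y)"

definition uprod :: "'u set \<Rightarrow> 'u set \<Rightarrow> 'u set" where
  "uprod A B = {upair x y | x y. x \<in> A \<and> y \<in> B}"

definition upoint :: "'u set" where
  "upoint = {SOME x. True}"

definition set_smcat :: "('u set, 'u set_map) smcat" where
  "set_smcat = cat.extend (set_category TYPE('u)) (smcat.fields
     uprod
     (\<lambda>f g. \<lparr>sdom = uprod (sdom f) (sdom g), scod = uprod (scod f) (scod g),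
             sfun = (\<lambda>z \<in> uprod (sdom f) (sdom g). upair (sfun f (ufst z)) (sfun g (usnd z)))\<rparr>)
     upoint
     (\<lambda>A B C. \<lparr>sdom = uprod (uprod A B) C, scod = uprod A (uprod B C),
               sfun = (\<lambda>z \<in> uprod (uprod A B) C. upair (ufst (ufst z)) (upair (usnd (ufst z)) (usnd z)))\<rparr>)
     (\<lambda>A. \<lparr>sdom = uprod upoint A, scod = A, sfun = (\<lambda>z \<in> uprod upoint A. usnd z)\<rparr>)
     (\<lambda>A. \<lparr>sdom = uprod A upoint, scod = A, sfun = (\<lambda>z \<in> uprod A upoint. ufst z)\<rparr>)
     (\<lambda>A B. \<lparr>sdom = uprod A B, scod = uprod B A,
             sfun = (\<lambda>z \<in> uprod A B. upair (usnd z) (ufst z))\<rparr>))"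

text \<open>The pointwise symmetric monoidal structure on \<open>Fun(C, M)\<close>.\<close>

definition functor_tensor ::
  "('o1, 'a1, 'y) cat_scheme \<Rightarrow> ('o2, 'a2, 'z) smcat_scheme \<Rightarrow>
   ('o1, 'a1, 'o2, 'a2) ftor \<Rightarrow> ('o1, 'a1, 'o2, 'a2) ftor \<Rightarrow> ('o1, 'a1, 'o2, 'a2) ftor"
where
  "functor_tensor C M X Y =
     \<lparr>fobj = (\<lambda>a \<in> Obj C. fobj X a \<otimes>\<^bsub>M\<^esub> fobj Y a), farr = (\<lambda>f \<in> Arr C. farr X f \<boxtimes>\<^bsub>M\<^esub> farr Y f)\<rparr>"

definition functor_unit ::
  "('o1, 'a1, 'y) cat_scheme \<Rightarrow> ('o2, 'a2, 'z) smcat_scheme \<Rightarrow> ('o1, 'a1, 'o2, 'a2) ftor"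
where
  "functor_unit C M = \<lparr>fobj = (\<lambda>a \<in> Obj C. Unit M), farr = (\<lambda>f \<in> Arr C. Ident M (Unit M))\<rparr>"

definition functor_smcat ::
  "('o1, 'a1, 'y) cat_scheme \<Rightarrow> ('o2, 'a2, 'z) smcat_scheme \<Rightarrow>
   (('o1, 'a1, 'o2, 'a2) ftor, (('o1, 'a1, 'o2, 'a2) ftor, 'o1, 'a2) ntrans) smcat"
where
  "functor_smcat C M = cat.extend (functor_category C M) (smcat.fields
     (functor_tensor C M)
     (\<lambda>s t. \<lparr>nsrc = functor_tensor C M (nsrc s) (nsrc t), ntgt = functor_tensor C M (ntgt s) (ntgt t),
             ncomp = (\<lambda>a \<in> Obj C. ncomp s a \<boxtimes>\<^bsub>M\<^esub> ncomp t a)\<rparr>)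
     (functor_unit C M)
     (\<lambda>X Y Z. \<lparr>nsrc = functor_tensor C M (functor_tensor C M X Y) Z,
               ntgt = functor_tensor C M X (functor_tensor C M Y Z),
               ncomp = (\<lambda>a \<in> Obj C. Assoc M (fobj X a) (fobj Y a) (fobj Z a))\<rparr>)
     (\<lambda>X. \<lparr>nsrc = functor_tensor C M (functor_unit C M) X, ntgt = X,
           ncomp = (\<lambda>a \<in> Obj C. Lunit M (fobj X a))\<rparr>)
     (\<lambda>X. \<lparr>nsrc = functor_tensor C M X (functor_unit C M), ntgt = X,
           ncomp = (\<lambda>a \<in> Obj C. Runit M (fobj X a))\<rparr>)
     (\<lambda>X Y. \<lparr>nsrc = functor_tensor C M X Y, ntgt = functor_tensor C M Y X,
             ncomp = (\<lambda>a \<in> Obj C. Braid M (fobj X a) (fobj Y a))\<rparr>))"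

type_synonym 'u gset = "('u, 'u, 'u set, 'u set_map) ftor"
type_synonym 'u gset_map = "('u gset, 'u, 'u set_map) ntrans"

definition GSet :: "('u, 'u) cat \<Rightarrow> ('u gset, 'u gset_map) smcat" where
  "GSet G = functor_smcat G set_smcat"


section \<open>Pullback\<close>

text \<open>
  The pullback \<open>f\<^sup>* : GSet G \<rightarrow> GSet H\<close> along \<open>f : H \<rightarrow> G\<close>; it preserves the tensor product and the unit
  on the nose, so that its structure isomorphisms are identities.
\<close>

definition pullback1 ::
  "('u, 'u) cat \<Rightarrow> ('u, 'u) cat \<Rightarrow> 'u gfun \<Rightarrow> ('u gset, 'u gset_map) sm_endo"
where
  "pullback1 H G f =
     \<lparr>fobj = (\<lambda>X \<in> Obj (GSet G). comp_functor H X f),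
      farr = (\<lambda>t \<in> Arr (GSet G).
        \<lparr>nsrc = comp_functor H (nsrc t) f, ntgt = comp_functor H (ntgt t) f,
         ncomp = (\<lambda>h \<in> Obj H. ncomp t (fobj f h))\<rparr>),
      Mu = (\<lambda>X Y. if X \<in> Obj (GSet G) \<and> Y \<in> Obj (GSet G)
                  then Ident (GSet H) (comp_functor H X f \<otimes>\<^bsub>GSet H\<^esub> comp_functor H Y f) else undefined),
      Eps = Ident (GSet H) (Unit (GSet H))\<rparr>"

text \<open>For \<open>\<alpha> : f \<Rightarrow> f'\<close>, the component of \<open>\<alpha>\<^sup>*\<close> at \<open>X\<close> is \<open>X \<alpha> : X \<circ> f \<Rightarrow> X \<circ> f'\<close>.\<close>

definition pullback2 ::
  "('u, 'u) cat \<Rightarrow> ('u, 'u) cat \<Rightarrow> 'u gtrans \<Rightarrow> ('u gset, 'u gset_map) sm_trans"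
where
  "pullback2 H G \<alpha> =
     \<lparr>nsrc = pullback1 H G (nsrc \<alpha>), ntgt = pullback1 H G (ntgt \<alpha>),
      ncomp = (\<lambda>X \<in> Obj (GSet G).
        \<lparr>nsrc = comp_functor H X (nsrc \<alpha>), ntgt = comp_functor H X (ntgt \<alpha>),
         ncomp = (\<lambda>h \<in> Obj H. farr X (ncomp \<alpha> h))\<rparr>)\<rparr>"

definition pullback_functor ::
  "('u, 'u) cat \<Rightarrow> ('u, 'u) cat \<Rightarrow>
   ('u gfun, 'u gtrans, ('u gset, 'u gset_map) sm_endo, ('u gset, 'u gset_map) sm_trans) ftor"
where
  "pullback_functor H G =
     \<lparr>fobj = (\<lambda>f \<in> Obj (functor_category H G). pullback1 H G f),
      farr = (\<lambda>\<alpha> \<in> Arr (functor_category H G). pullback2 H G \<alpha>)\<rparr>"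

definition two_Spec_GSet ::
  "(('u, 'u) cat, 'u gfun, 'u gtrans,
    ('u gset, 'u gset_map) smcat, ('u gset, 'u gset_map) sm_endo, ('u gset, 'u gset_map) sm_trans) two_ftor"
where
  "two_Spec_GSet = \<lparr>two_obj = (\<lambda>G. two_Spec (GSet G)), two_hom = pullback_functor\<rparr>"

end

theory Submission
  imports Defs
begin

text \<open>
  Let \<open>F : GSet G \<rightarrow> GSet H\<close> be cocontinuous and symmetric monoidal.  Its fibre over an object \<open>h\<close> of \<open>H\<close> is
  the set-valued functor \<open>X \<mapsto> F X h\<close>, which preserves colimits and, the tensor product being cartesian,
  finite products.  The theorem holds because such a functor is evaluation at an object of the groupoid \<open>G\<close>,
  unique up to unique isomorphism.

  Every \<open>G\<close>-set \<open>X\<close> is a colimit of representables \<open>rep g = Hom(g, -)\<close>, so each point of \<open>F X h\<close> is the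
  image of a point of some \<open>F (rep g) h\<close> under a map \<open>rep g \<rightarrow> X\<close> (\<open>generated\<close>).  Apply this to
  \<open>rep g \<times> rep g'\<close>: points \<open>p\<close> of \<open>F (rep g) h\<close> and \<open>q\<close> of \<open>F (rep g') h\<close> are both images of one point over
  some \<open>k\<close>, and since \<open>G\<close> is a groupoid the maps involved are invertible; so an arrow \<open>g' \<rightarrow> g\<close> carries \<open>p\<close>
  to \<open>q\<close> (\<open>connecting_arrow\<close>).  That arrow is unique, and more generally a map \<open>rep g \<rightarrow> X\<close> is determined by
  the image of one point (\<open>app_yo_inject\<close>): the graphs of two different maps are disjoint, hence separated by a
  map from \<open>rep g \<times> X\<close> to \<open>1 + 1\<close>, and \<open>F\<close> preserves the coproduct \<open>1 + 1\<close>.  Consequently any point of any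
  \<open>F (rep g) h\<close> yields a bijection \<open>X g \<rightarrow> F X h\<close> that is natural in \<open>X\<close> (\<open>\<theta>_bij\<close>).  Choosing such a
  point for each \<open>h\<close> gives a functor \<open>f : H \<rightarrow> G\<close>, on arrows by the uniqueness of connecting arrows, and a
  monoidal isomorphism between \<open>f\<^sup>*\<close> and \<open>F\<close> (\<open>F_isomorphic_pullback\<close>).

  That \<open>f \<mapsto> f\<^sup>*\<close> is full and faithful is the Yoneda lemma: a transformation \<open>f\<^sup>* \<Rightarrow> f'\<^sup>*\<close> is determined by
  its values at the universal elements of the representables \<open>rep (f h)\<close>, and these values are the components
  of a transformation \<open>f \<Rightarrow> f'\<close> (\<open>pullback_full\<close>, \<open>pullback_faithful\<close>).

  For \<open>GSet G\<close> to be a commutative 2-ring, and for pullback to be cocontinuous, one has to control colimits of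
  \<open>G\<close>-sets.  They are computed fibrewise (\<open>GSet_colimitI\<close>, \<open>GSet_colimit_fibrewise\<close>), and colimits of sets are
  recognised by the criterion \<open>colimiting\<close>, which refers to predicates only and thereby applies to sets of
  elements and of arrows alike.
\<close>

section \<open>Small sets\<close>

text \<open>The term \<open>u\<close> carries the type \<open>'u\<close>, which is the actual parameter of this locale.\<close>

locale universe =
  fixes u :: "'u itself"
  assumes inaccessible: "inaccessible_universe TYPE('u)"
begin

lemma infinite_universe: "infinite (UNIV :: 'u set)"
proof
  assume "finite (UNIV :: 'u set)"
  then have "|UNIV :: 'u set| <o natLeq" by (simp only: finite_iff_ordLess_natLeq)
  moreover have "natLeq <o |UNIV :: 'u set|"
    using inaccessible by (simp only: inaccessible_universe_def)
  ultimately show False using ordLess_transitive ordLess_irreflexive by blast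
qed

lemma stable_universe: "stable |UNIV :: 'u set|"
proof (rule regularCard_stable)
  show "regularCard |UNIV :: 'u set|"
    using inaccessible by (simp only: inaccessible_universe_def)
qed (use infinite_universe card_of_Card_order in \<open>auto simp: Field_card_of\<close>)

lemma small_UN: "small TYPE('u) A \<Longrightarrow> (\<And>a. a \<in> A \<Longrightarrow> small TYPE('u) (B a)) \<Longrightarrow> small TYPE('u) (\<Union>a\<in>A. B a)"
  unfolding small_def by (rule stable_UNION[OF stable_universe])

lemma small_Sigma: "small TYPE('u) A \<Longrightarrow> (\<And>a. a \<in> A \<Longrightarrow> small TYPE('u) (B a)) \<Longrightarrow> small TYPE('u) (Sigma A B)"
  unfolding small_def by (rule stable_elim[OF stable_universe])

lemma small_subset: "small TYPE('u) B \<Longrightarrow> A \<subseteq> B \<Longrightarrow> small TYPE('u) A"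
  unfolding small_def by (metis card_of_mono1 ordLeq_ordLess_trans)

lemma small_image: "small TYPE('u) A \<Longrightarrow> small TYPE('u) (f ` A)"
  unfolding small_def by (metis card_of_image ordLeq_ordLess_trans)

lemma small_inj_on: "small TYPE('u) B \<Longrightarrow> inj_on f A \<Longrightarrow> f ` A \<subseteq> B \<Longrightarrow> small TYPE('u) A"
  unfolding small_def by (metis card_of_ordLeqI image_subset_iff ordLeq_ordLess_trans)

lemma small_finite: "finite A \<Longrightarrow> small TYPE('u) A"
  unfolding small_def using infinite_universe
  by (metis Field_card_of card_of_Well_order card_of_card_order_on card_of_ordLess2 finite_ordLess_infinite)

lemma small_Pow: "small TYPE('u) A \<Longrightarrow> small TYPE('u) (Pow A)" for A :: "'u set"
  using inaccessible unfolding small_def inaccessible_universe_def by blast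

end


section \<open>Categories and functors\<close>

lemma hom_iff: "f \<in> hom C a b \<longleftrightarrow> f \<in> Arr C \<and> Dom C f = a \<and> Cod C f = b"
  by (auto simp: hom_def)

lemma arr_in_hom: "f \<in> Arr C \<Longrightarrow> f \<in> hom C (Dom C f) (Cod C f)"
  by (auto simp: hom_def)

lemma hom_Obj: "category C \<Longrightarrow> f \<in> hom C a b \<Longrightarrow> a \<in> Obj C \<and> b \<in> Obj C"
  by (auto simp: category_def hom_def)

lemma Ident_in_hom: "category C \<Longrightarrow> a \<in> Obj C \<Longrightarrow> Ident C a \<in> hom C a a"
  by (auto simp: category_def)

lemma Comp_in_hom: "category C \<Longrightarrow> f \<in> hom C a b \<Longrightarrow> g \<in> hom C b c \<Longrightarrow> g \<cdot>\<^bsub>C\<^esub> f \<in> hom C a c"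
  by (auto simp: category_def hom_def)

lemma Comp_Ident_right: "category C \<Longrightarrow> f \<in> hom C a b \<Longrightarrow> f \<cdot>\<^bsub>C\<^esub> Ident C a = f"
  by (auto simp: category_def hom_def)

lemma Comp_Ident_left: "category C \<Longrightarrow> f \<in> hom C a b \<Longrightarrow> Ident C b \<cdot>\<^bsub>C\<^esub> f = f"
  by (auto simp: category_def hom_def)

lemma Comp_assoc:
  "category C \<Longrightarrow> f \<in> hom C a b \<Longrightarrow> g \<in> hom C b c \<Longrightarrow> h \<in> hom C c d \<Longrightarrow>
     (h \<cdot>\<^bsub>C\<^esub> g) \<cdot>\<^bsub>C\<^esub> f = h \<cdot>\<^bsub>C\<^esub> (g \<cdot>\<^bsub>C\<^esub> f)"
  by (auto simp: category_def hom_def)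

lemma categoryI:
  assumes "\<And>f a b. f \<in> hom C a b \<Longrightarrow> a \<in> Obj C \<and> b \<in> Obj C"
    and "\<And>a. a \<in> Obj C \<Longrightarrow> Ident C a \<in> hom C a a"
    and "\<And>f g a b c. f \<in> hom C a b \<Longrightarrow> g \<in> hom C b c \<Longrightarrow> g \<cdot>\<^bsub>C\<^esub> f \<in> hom C a c"
    and "\<And>f a b. f \<in> hom C a b \<Longrightarrow> f \<cdot>\<^bsub>C\<^esub> Ident C a = f"
    and "\<And>f a b. f \<in> hom C a b \<Longrightarrow> Ident C b \<cdot>\<^bsub>C\<^esub> f = f"
    and "\<And>f g h a b c d. f \<in> hom C a b \<Longrightarrow> g \<in> hom C b c \<Longrightarrow> h \<in> hom C c d \<Longrightarrow>
           (h \<cdot>\<^bsub>C\<^esub> g) \<cdot>\<^bsub>C\<^esub> f = h \<cdot>\<^bsub>C\<^esub> (g \<cdot>\<^bsub>C\<^esub> f)"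
  shows "category C"
  unfolding category_def using assms by (auto simp: hom_iff)

lemma is_isoI:
  "f \<in> hom C a b \<Longrightarrow> g \<in> hom C b a \<Longrightarrow> g \<cdot>\<^bsub>C\<^esub> f = Ident C a \<Longrightarrow> f \<cdot>\<^bsub>C\<^esub> g = Ident C b \<Longrightarrow> is_iso C f"
  by (auto simp: is_iso_def hom_iff)

lemma is_isoE:
  assumes "is_iso C f" "f \<in> hom C a b"
  obtains g where "g \<in> hom C b a" "g \<cdot>\<^bsub>C\<^esub> f = Ident C a" "f \<cdot>\<^bsub>C\<^esub> g = Ident C b"
  using assms by (auto simp: is_iso_def hom_iff)

lemma is_iso_Ident: "category C \<Longrightarrow> a \<in> Obj C \<Longrightarrow> is_iso C (Ident C a)"
  by (metis Comp_Ident_left Ident_in_hom is_isoI)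

lemma Comp_cancel_left:
  assumes C: "category C" and f: "f \<in> hom C a b" and g: "g \<in> hom C b c" "g' \<in> hom C c b"
    and eq: "g' \<cdot>\<^bsub>C\<^esub> g = Ident C b"
  shows "g' \<cdot>\<^bsub>C\<^esub> (g \<cdot>\<^bsub>C\<^esub> f) = f"
  using Comp_assoc[OF C f g] Comp_Ident_left[OF C f] eq by simp

lemma is_iso_Comp:
  assumes C: "category C" and f: "f \<in> hom C a b" "is_iso C f" and g: "g \<in> hom C b c" "is_iso C g"
  shows "is_iso C (g \<cdot>\<^bsub>C\<^esub> f)"
proof -
  obtain f' where f': "f' \<in> hom C b a" "f' \<cdot>\<^bsub>C\<^esub> f = Ident C a" "f \<cdot>\<^bsub>C\<^esub> f' = Ident C b"
    using is_isoE[OF f(2,1)] by blast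
  obtain g' where g': "g' \<in> hom C c b" "g' \<cdot>\<^bsub>C\<^esub> g = Ident C b" "g \<cdot>\<^bsub>C\<^esub> g' = Ident C c"
    using is_isoE[OF g(2,1)] by blast
  have "(f' \<cdot>\<^bsub>C\<^esub> g') \<cdot>\<^bsub>C\<^esub> (g \<cdot>\<^bsub>C\<^esub> f) = Ident C a"
    using Comp_assoc[OF C Comp_in_hom[OF C f(1) g(1)] g'(1) f'(1)] f'(2)
      Comp_cancel_left[OF C f(1) g(1) g'(1,2)] by simp
  moreover have "(g \<cdot>\<^bsub>C\<^esub> f) \<cdot>\<^bsub>C\<^esub> (f' \<cdot>\<^bsub>C\<^esub> g') = Ident C c"
    using Comp_assoc[OF C Comp_in_hom[OF C g'(1) f'(1)] f(1) g(1)] g'(3)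
      Comp_cancel_left[OF C g'(1) f'(1) f(1) f'(3)] by simp
  ultimately show ?thesis
    using is_isoI[OF Comp_in_hom[OF C f(1) g(1)] Comp_in_hom[OF C g'(1) f'(1)]] by simp
qed

lemma is_functorI:
  assumes "category C"
    and "fobj F \<in> extensional (Obj C)" "farr F \<in> extensional (Arr C)"
    and "\<And>a. a \<in> Obj C \<Longrightarrow> fobj F a \<in> Obj D"
    and "\<And>f a b. f \<in> hom C a b \<Longrightarrow> farr F f \<in> hom D (fobj F a) (fobj F b)"
    and "\<And>a. a \<in> Obj C \<Longrightarrow> farr F (Ident C a) = Ident D (fobj F a)"
    and "\<And>f g a b c. f \<in> hom C a b \<Longrightarrow> g \<in> hom C b c \<Longrightarrow> farr F (g \<cdot>\<^bsub>C\<^esub> f) = farr F g \<cdot>\<^bsub>D\<^esub> farr F f"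
  shows "is_functor C D F"
  unfolding is_functor_def using assms by (auto simp: PiE_def hom_iff)

lemma functor_fobj: "is_functor C D F \<Longrightarrow> a \<in> Obj C \<Longrightarrow> fobj F a \<in> Obj D"
  by (auto simp: is_functor_def)

lemma functor_farr: "is_functor C D F \<Longrightarrow> f \<in> hom C a b \<Longrightarrow> farr F f \<in> hom D (fobj F a) (fobj F b)"
  by (auto simp: is_functor_def hom_iff)

lemma functor_Ident: "is_functor C D F \<Longrightarrow> a \<in> Obj C \<Longrightarrow> farr F (Ident C a) = Ident D (fobj F a)"
  by (auto simp: is_functor_def)

lemma functor_Comp:
  "is_functor C D F \<Longrightarrow> f \<in> hom C a b \<Longrightarrow> g \<in> hom C b c \<Longrightarrow> farr F (g \<cdot>\<^bsub>C\<^esub> f) = farr F g \<cdot>\<^bsub>D\<^esub> farr F f"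
  by (auto simp: is_functor_def hom_iff)

lemma functor_fobj_extensional: "is_functor C D F \<Longrightarrow> fobj F \<in> extensional (Obj C)"
  by (auto simp: is_functor_def PiE_def)

lemma functor_farr_extensional: "is_functor C D F \<Longrightarrow> farr F \<in> extensional (Arr C)"
  by (auto simp: is_functor_def PiE_def)

lemma functor_eqI:
  fixes F G :: "('o1, 'a1, 'o2, 'a2) ftor"
  assumes "is_functor C D F" "is_functor C D' G"
    and "\<And>a. a \<in> Obj C \<Longrightarrow> fobj F a = fobj G a"
    and "\<And>f. f \<in> Arr C \<Longrightarrow> farr F f = farr G f"
  shows "F = G"
proof -
  have "fobj F = fobj G"
    using assms by (intro extensionalityI[of _ "Obj C"]) (auto simp: is_functor_def PiE_def)
  moreover have "farr F = farr G"
    using assms by (intro extensionalityI[of _ "Arr C"]) (auto simp: is_functor_def PiE_def)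
  ultimately show ?thesis by simp
qed

lemma functor_is_iso:
  assumes F: "is_functor C D F" and f: "f \<in> hom C a b" "is_iso C f"
    and C: "category C"
  shows "is_iso D (farr F f)"
proof -
  obtain g where g: "g \<in> hom C b a" "g \<cdot>\<^bsub>C\<^esub> f = Ident C a" "f \<cdot>\<^bsub>C\<^esub> g = Ident C b"
    using is_isoE[OF f(2,1)] by blast
  have "farr F g \<cdot>\<^bsub>D\<^esub> farr F f = Ident D (fobj F a)" "farr F f \<cdot>\<^bsub>D\<^esub> farr F g = Ident D (fobj F b)"
    using functor_Comp[OF F] functor_Ident[OF F] f g hom_Obj[OF C f(1)] by metis+
  then show ?thesis
    using functor_farr[OF F] f g is_isoI by metis
qed

lemma fobj_id_functor [simp]: "a \<in> Obj C \<Longrightarrow> fobj (id_functor C) a = a"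
  by (simp add: id_functor_def)

lemma farr_id_functor [simp]: "f \<in> Arr C \<Longrightarrow> farr (id_functor C) f = f"
  by (simp add: id_functor_def)

lemma fobj_comp_functor [simp]: "a \<in> Obj C \<Longrightarrow> fobj (comp_functor C G F) a = fobj G (fobj F a)"
  by (simp add: comp_functor_def)

lemma farr_comp_functor [simp]: "f \<in> Arr C \<Longrightarrow> farr (comp_functor C G F) f = farr G (farr F f)"
  by (simp add: comp_functor_def)

lemma is_functor_id: "category C \<Longrightarrow> is_functor C C (id_functor C)"
  by (intro is_functorI) (auto simp: id_functor_def hom_iff category_def)

lemma is_functor_comp:
  assumes F: "is_functor B C F" and G: "is_functor C D G" and B: "category B"
  shows "is_functor B D (comp_functor B G F)"
proof (rule is_functorI[OF B])
  fix f a b assume "f \<in> hom B a b"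
  then show "farr (comp_functor B G F) f \<in> hom D (fobj (comp_functor B G F) a) (fobj (comp_functor B G F) b)"
    using hom_Obj[OF B, of f a b] functor_farr[OF G functor_farr[OF F]] by (auto simp: hom_iff)
next
  fix f g a b c assume f: "f \<in> hom B a b" and g: "g \<in> hom B b c"
  then have "f \<in> Arr B" "g \<in> Arr B" "g \<cdot>\<^bsub>B\<^esub> f \<in> Arr B"
    using Comp_in_hom[OF B] by (auto simp: hom_iff)
  then show "farr (comp_functor B G F) (g \<cdot>\<^bsub>B\<^esub> f) =
      farr (comp_functor B G F) g \<cdot>\<^bsub>D\<^esub> farr (comp_functor B G F) f"
    using functor_Comp[OF F f g] functor_Comp[OF G functor_farr[OF F f] functor_farr[OF F g]] by simp
next
  fix a assume a: "a \<in> Obj B"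
  then have "Ident B a \<in> Arr B" using Ident_in_hom[OF B] by (auto simp: hom_iff)
  then show "farr (comp_functor B G F) (Ident B a) = Ident D (fobj (comp_functor B G F) a)"
    using a functor_Ident[OF F] functor_Ident[OF G] functor_fobj[OF F] by simp
qed (use functor_fobj[OF F] functor_fobj[OF G] in \<open>auto simp: comp_functor_def\<close>)


section \<open>Natural transformations\<close>

lemma naturalI:
  assumes "is_functor C D (nsrc t)" "is_functor C D (ntgt t)" "ncomp t \<in> extensional (Obj C)"
    and "\<And>a. a \<in> Obj C \<Longrightarrow> ncomp t a \<in> hom D (fobj (nsrc t) a) (fobj (ntgt t) a)"
    and "\<And>f a b. f \<in> hom C a b \<Longrightarrow> ncomp t b \<cdot>\<^bsub>D\<^esub> farr (nsrc t) f = farr (ntgt t) f \<cdot>\<^bsub>D\<^esub> ncomp t a"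
  shows "natural C D t"
  using assms unfolding natural_def by (auto simp: hom_iff)

lemma naturalD:
  assumes "natural C D t"
  shows "is_functor C D (nsrc t)" "is_functor C D (ntgt t)" "ncomp t \<in> extensional (Obj C)"
    and "\<And>a. a \<in> Obj C \<Longrightarrow> ncomp t a \<in> hom D (fobj (nsrc t) a) (fobj (ntgt t) a)"
    and "\<And>f a b. f \<in> hom C a b \<Longrightarrow> ncomp t b \<cdot>\<^bsub>D\<^esub> farr (nsrc t) f = farr (ntgt t) f \<cdot>\<^bsub>D\<^esub> ncomp t a"
  using assms unfolding natural_def by (auto simp: hom_iff)

lemma ntrans_eqI:
  fixes s t :: "('f, 'o, 'a) ntrans"
  assumes "nsrc s = nsrc t" "ntgt s = ntgt t" "ncomp s \<in> extensional A" "ncomp t \<in> extensional A"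
    and "\<And>a. a \<in> A \<Longrightarrow> ncomp s a = ncomp t a"
  shows "s = t"
  using assms extensionalityI[of "ncomp s" A "ncomp t"] by simp

lemma ntrans_id_simps [simp]:
  "nsrc (ntrans_id C D F) = F" "ntgt (ntrans_id C D F) = F"
  "a \<in> Obj C \<Longrightarrow> ncomp (ntrans_id C D F) a = Ident D (fobj F a)"
  "ncomp (ntrans_id C D F) \<in> extensional (Obj C)"
  by (auto simp: ntrans_id_def)

lemma ntrans_comp_simps [simp]:
  "nsrc (ntrans_comp C D t s) = nsrc s" "ntgt (ntrans_comp C D t s) = ntgt t"
  "a \<in> Obj C \<Longrightarrow> ncomp (ntrans_comp C D t s) a = ncomp t a \<cdot>\<^bsub>D\<^esub> ncomp s a"
  "ncomp (ntrans_comp C D t s) \<in> extensional (Obj C)"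
  by (auto simp: ntrans_comp_def)

lemma natural_id:
  assumes C: "category C" and D: "category D" and F: "is_functor C D F"
  shows "natural C D (ntrans_id C D F)"
proof (rule naturalI)
  fix f a b assume f: "f \<in> hom C a b"
  show "ncomp (ntrans_id C D F) b \<cdot>\<^bsub>D\<^esub> farr (nsrc (ntrans_id C D F)) f =
      farr (ntgt (ntrans_id C D F)) f \<cdot>\<^bsub>D\<^esub> ncomp (ntrans_id C D F) a"
    using hom_Obj[OF C f] functor_farr[OF F f] Comp_Ident_left[OF D] Comp_Ident_right[OF D] by simp
qed (use F functor_fobj[OF F] Ident_in_hom[OF D] in auto)

lemma natural_comp:
  assumes C: "category C" and D: "category D" and s: "natural C D s" and t: "natural C D t"
    and eq: "nsrc t = ntgt s"
  shows "natural C D (ntrans_comp C D t s)"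
proof (rule naturalI)
  fix a assume a: "a \<in> Obj C"
  show "ncomp (ntrans_comp C D t s) a
      \<in> hom D (fobj (nsrc (ntrans_comp C D t s)) a) (fobj (ntgt (ntrans_comp C D t s)) a)"
    using a naturalD(4)[OF s a] naturalD(4)[OF t a] eq Comp_in_hom[OF D] by simp
next
  fix f a b assume f: "f \<in> hom C a b"
  then have ab: "a \<in> Obj C" "b \<in> Obj C" using hom_Obj[OF C] by auto
  let ?F = "nsrc s" and ?G = "nsrc t" and ?H = "ntgt t"
  have F: "farr ?F f \<in> hom D (fobj ?F a) (fobj ?F b)"
    and G: "farr ?G f \<in> hom D (fobj ?G a) (fobj ?G b)"
    and H: "farr ?H f \<in> hom D (fobj ?H a) (fobj ?H b)"
    using functor_farr f naturalD(1,2)[OF s] naturalD(1,2)[OF t] by metis+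
  note sa = naturalD(4)[OF s ab(1), folded eq] and sb = naturalD(4)[OF s ab(2), folded eq]
  note ta = naturalD(4)[OF t ab(1)] and tb = naturalD(4)[OF t ab(2)]
  have "(ncomp t b \<cdot>\<^bsub>D\<^esub> ncomp s b) \<cdot>\<^bsub>D\<^esub> farr ?F f = ncomp t b \<cdot>\<^bsub>D\<^esub> (farr ?G f \<cdot>\<^bsub>D\<^esub> ncomp s a)"
    using Comp_assoc[OF D F sb tb] naturalD(5)[OF s f] eq by simp
  also have "\<dots> = (farr ?H f \<cdot>\<^bsub>D\<^esub> ncomp t a) \<cdot>\<^bsub>D\<^esub> ncomp s a"
    using Comp_assoc[OF D sa G tb] naturalD(5)[OF t f] by simp
  finally show "ncomp (ntrans_comp C D t s) b \<cdot>\<^bsub>D\<^esub> farr (nsrc (ntrans_comp C D t s)) f =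
      farr (ntgt (ntrans_comp C D t s)) f \<cdot>\<^bsub>D\<^esub> ncomp (ntrans_comp C D t s) a"
    using ab Comp_assoc[OF D sa ta H] by simp
qed (use naturalD[OF s] naturalD[OF t] in auto)

lemma ntrans_comp_id_right:
  assumes "category D" "natural C D s"
  shows "ntrans_comp C D s (ntrans_id C D (nsrc s)) = s"
  using naturalD[OF assms(2)]
  by (intro ntrans_eqI[where A = "Obj C"]) (simp_all add: Comp_Ident_right[OF assms(1) naturalD(4)[OF assms(2)]])

lemma ntrans_comp_id_left:
  assumes "category D" "natural C D s"
  shows "ntrans_comp C D (ntrans_id C D (ntgt s)) s = s"
  using naturalD[OF assms(2)]
  by (intro ntrans_eqI[where A = "Obj C"]) (simp_all add: Comp_Ident_left[OF assms(1) naturalD(4)[OF assms(2)]])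

lemma ntrans_comp_assoc:
  assumes D: "category D" and "natural C D r" "natural C D s" "natural C D t"
    and "nsrc s = ntgt r" "nsrc t = ntgt s"
  shows "ntrans_comp C D (ntrans_comp C D t s) r = ntrans_comp C D t (ntrans_comp C D s r)"
  using assms naturalD(4)[of C D r] naturalD(4)[of C D s] naturalD(4)[of C D t]
  by (intro ntrans_eqI[where A = "Obj C"]) (auto intro!: Comp_assoc[OF D])

lemma functor_category_simps [simp]:
  "Obj (functor_category C D) = {F. is_functor C D F}"
  "Arr (functor_category C D) = {t. natural C D t}"
  "Dom (functor_category C D) = nsrc" "Cod (functor_category C D) = ntgt"
  "Ident (functor_category C D) = ntrans_id C D" "Comp (functor_category C D) = ntrans_comp C D"
  by (simp_all add: functor_category_def)

lemma category_functor_category: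
  assumes C: "category C" and D: "category D"
  shows "category (functor_category C D)"
proof (rule categoryI)
  fix f g h a b c d
  assume "f \<in> hom (functor_category C D) a b" "g \<in> hom (functor_category C D) b c"
    "h \<in> hom (functor_category C D) c d"
  then show "(h \<cdot>\<^bsub>functor_category C D\<^esub> g) \<cdot>\<^bsub>functor_category C D\<^esub> f =
      h \<cdot>\<^bsub>functor_category C D\<^esub> (g \<cdot>\<^bsub>functor_category C D\<^esub> f)"
    using ntrans_comp_assoc[OF D] by (auto simp: hom_iff)
qed (auto simp: hom_iff naturalD natural_id[OF C D] natural_comp[OF C D]
    ntrans_comp_id_right[OF D] ntrans_comp_id_left[OF D])

text \<open>The inverse is taken componentwise; naturality of it is automatic.\<close>

lemma natural_inverse:
  assumes C: "category C" and D: "category D" and t: "natural C D t"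
    and iso: "\<And>a. a \<in> Obj C \<Longrightarrow> is_iso D (ncomp t a)"
  obtains s where "natural C D s" "nsrc s = ntgt t" "ntgt s = nsrc t"
    "ntrans_comp C D s t = ntrans_id C D (nsrc t)" "ntrans_comp C D t s = ntrans_id C D (ntgt t)"
proof -
  let ?F = "nsrc t" and ?G = "ntgt t"
  have "\<forall>a\<in>Obj C. \<exists>g. g \<in> hom D (fobj ?G a) (fobj ?F a) \<and>
      g \<cdot>\<^bsub>D\<^esub> ncomp t a = Ident D (fobj ?F a) \<and> ncomp t a \<cdot>\<^bsub>D\<^esub> g = Ident D (fobj ?G a)"
    using is_isoE[OF iso] naturalD(4)[OF t] by metis
  then obtain g where g: "\<And>a. a \<in> Obj C \<Longrightarrow> g a \<in> hom D (fobj ?G a) (fobj ?F a)"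
    "\<And>a. a \<in> Obj C \<Longrightarrow> g a \<cdot>\<^bsub>D\<^esub> ncomp t a = Ident D (fobj ?F a)"
    "\<And>a. a \<in> Obj C \<Longrightarrow> ncomp t a \<cdot>\<^bsub>D\<^esub> g a = Ident D (fobj ?G a)"
    by (auto dest!: bchoice)
  define s where "s = \<lparr>nsrc = ?G, ntgt = ?F, ncomp = restrict g (Obj C)\<rparr>"
  have "natural C D s"
  proof (rule naturalI)
    fix f a b assume f: "f \<in> hom C a b"
    then have ab: "a \<in> Obj C" "b \<in> Obj C" using hom_Obj[OF C] by auto
    have F: "farr ?F f \<in> hom D (fobj ?F a) (fobj ?F b)" and G: "farr ?G f \<in> hom D (fobj ?G a) (fobj ?G b)"
      using functor_farr f naturalD(1,2)[OF t] by metis+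
    have "g b \<cdot>\<^bsub>D\<^esub> farr ?G f = g b \<cdot>\<^bsub>D\<^esub> (farr ?G f \<cdot>\<^bsub>D\<^esub> (ncomp t a \<cdot>\<^bsub>D\<^esub> g a))"
      using g ab Comp_Ident_right[OF D G] by simp
    also have "\<dots> = g b \<cdot>\<^bsub>D\<^esub> (ncomp t b \<cdot>\<^bsub>D\<^esub> (farr ?F f \<cdot>\<^bsub>D\<^esub> g a))"
      using naturalD(5)[OF t f] Comp_assoc[OF D g(1)[OF ab(1)] naturalD(4)[OF t ab(1)] G]
        Comp_assoc[OF D g(1)[OF ab(1)] F naturalD(4)[OF t ab(2)]] by simp
    also have "\<dots> = farr ?F f \<cdot>\<^bsub>D\<^esub> g a"
      using g ab Comp_assoc[OF D Comp_in_hom[OF D g(1)[OF ab(1)] F] naturalD(4)[OF t ab(2)] g(1)[OF ab(2)]]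
        Comp_Ident_left[OF D Comp_in_hom[OF D g(1)[OF ab(1)] F]] by simp
    finally show "ncomp s b \<cdot>\<^bsub>D\<^esub> farr (nsrc s) f = farr (ntgt s) f \<cdot>\<^bsub>D\<^esub> ncomp s a"
      using ab by (simp add: s_def)
  qed (use naturalD[OF t] g in \<open>auto simp: s_def\<close>)
  moreover have "ntrans_comp C D s t = ntrans_id C D (nsrc t)" "ntrans_comp C D t s = ntrans_id C D (ntgt t)"
    by (rule ntrans_eqI[where A = "Obj C"]; use g in \<open>simp add: s_def\<close>)+
  ultimately show ?thesis using that[of s] by (simp add: s_def)
qed

lemma is_iso_functor_category:
  assumes C: "category C" and D: "category D" and t: "natural C D t"
    and iso: "\<And>a. a \<in> Obj C \<Longrightarrow> is_iso D (ncomp t a)"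
  shows "is_iso (functor_category C D) t"
proof -
  obtain s where "natural C D s" "nsrc s = ntgt t" "ntgt s = nsrc t"
    "ntrans_comp C D s t = ntrans_id C D (nsrc t)" "ntrans_comp C D t s = ntrans_id C D (ntgt t)"
    using natural_inverse[OF assms] by blast
  then show ?thesis
    using t by (intro is_isoI[where a = "nsrc t" and b = "ntgt t" and g = s]) (auto simp: hom_iff)
qed

text \<open>The usual inverse equivalence chooses a preimage of each object up to isomorphism.\<close>

lemma is_equivalenceI:
  fixes F :: "('o1, 'a1, 'o2, 'a2) ftor"
  assumes C: "category C" and D: "category D" and F: "is_functor C D F"
    and full: "\<And>a b t. a \<in> Obj C \<Longrightarrow> b \<in> Obj C \<Longrightarrow> t \<in> hom D (fobj F a) (fobj F b) \<Longrightarrow>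
      \<exists>s \<in> hom C a b. farr F s = t"
    and faithful: "\<And>a b s s'. s \<in> hom C a b \<Longrightarrow> s' \<in> hom C a b \<Longrightarrow> farr F s = farr F s' \<Longrightarrow> s = s'"
    and eso: "\<And>d. d \<in> Obj D \<Longrightarrow> \<exists>c \<in> Obj C. \<exists>e \<in> hom D (fobj F c) d. is_iso D e"
  shows "is_equivalence C D F"
proof -
  have "\<forall>d\<in>Obj D. \<exists>c e e'. c \<in> Obj C \<and> e \<in> hom D (fobj F c) d \<and> e' \<in> hom D d (fobj F c) \<and>
      e' \<cdot>\<^bsub>D\<^esub> e = Ident D (fobj F c) \<and> e \<cdot>\<^bsub>D\<^esub> e' = Ident D d"
    using eso is_isoE by metis
  then obtain g e e' where ge: "\<And>d. d \<in> Obj D \<Longrightarrow> g d \<in> Obj C"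
      "\<And>d. d \<in> Obj D \<Longrightarrow> e d \<in> hom D (fobj F (g d)) d"
      "\<And>d. d \<in> Obj D \<Longrightarrow> e' d \<in> hom D d (fobj F (g d))"
      "\<And>d. d \<in> Obj D \<Longrightarrow> e' d \<cdot>\<^bsub>D\<^esub> e d = Ident D (fobj F (g d))"
      "\<And>d. d \<in> Obj D \<Longrightarrow> e d \<cdot>\<^bsub>D\<^esub> e' d = Ident D d"
    by (metis (no_types))
  \<comment> \<open>On arrows the inverse is conjugation with the chosen isomorphisms.\<close>
  define k where "k t = (SOME s. s \<in> hom C (g (Dom D t)) (g (Cod D t)) \<and>
      farr F s = e' (Cod D t) \<cdot>\<^bsub>D\<^esub> (t \<cdot>\<^bsub>D\<^esub> e (Dom D t)))" for t
  have k: "k t \<in> hom C (g d) (g d')" "farr F (k t) = e' d' \<cdot>\<^bsub>D\<^esub> (t \<cdot>\<^bsub>D\<^esub> e d)"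
    if t: "t \<in> hom D d d'" for t d d'
  proof -
    have dd': "d \<in> Obj D" "d' \<in> Obj D" using hom_Obj[OF D t] by auto
    have "e' d' \<cdot>\<^bsub>D\<^esub> (t \<cdot>\<^bsub>D\<^esub> e d) \<in> hom D (fobj F (g d)) (fobj F (g d'))"
      using Comp_in_hom[OF D Comp_in_hom[OF D ge(2)[OF dd'(1)] t] ge(3)[OF dd'(2)]] .
    from full[OF ge(1)[OF dd'(1)] ge(1)[OF dd'(2)] this]
    have "\<exists>s. s \<in> hom C (g (Dom D t)) (g (Cod D t)) \<and>
      farr F s = e' (Cod D t) \<cdot>\<^bsub>D\<^esub> (t \<cdot>\<^bsub>D\<^esub> e (Dom D t))"
      using t by (auto simp: hom_iff)
    from someI_ex[OF this] show "k t \<in> hom C (g d) (g d')" "farr F (k t) = e' d' \<cdot>\<^bsub>D\<^esub> (t \<cdot>\<^bsub>D\<^esub> e d)"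
      using t unfolding k_def[symmetric] by (auto simp: hom_iff)
  qed
  have ek: "e d' \<cdot>\<^bsub>D\<^esub> farr F (k t) = t \<cdot>\<^bsub>D\<^esub> e d" if t: "t \<in> hom D d d'" for t d d'
  proof -
    have dd': "d \<in> Obj D" "d' \<in> Obj D" using hom_Obj[OF D t] by auto
    show ?thesis
      using Comp_cancel_left[OF D Comp_in_hom[OF D ge(2)[OF dd'(1)] t] ge(3,2)[OF dd'(2)] ge(5)[OF dd'(2)]]
        k(2)[OF t] by simp
  qed
  have e_mono: "x = y" if "x \<in> hom D c (fobj F (g d))" "y \<in> hom D c (fobj F (g d))" "d \<in> Obj D"
    "e d \<cdot>\<^bsub>D\<^esub> x = e d \<cdot>\<^bsub>D\<^esub> y" for x y c d
    using Comp_cancel_left[OF D that(1) ge(2,3,4)[OF that(3)]] that(4)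
      Comp_cancel_left[OF D that(2) ge(2,3,4)[OF that(3)]] by simp
  have k_unique: "k t = s" if t: "t \<in> hom D d d'" and s: "s \<in> hom C (g d) (g d')"
    and eq: "e d' \<cdot>\<^bsub>D\<^esub> farr F s = t \<cdot>\<^bsub>D\<^esub> e d" for t s d d'
    using faithful[OF k(1)[OF t] s]
      e_mono[OF functor_farr[OF F k(1)[OF t]] functor_farr[OF F s]] eq ek[OF t] hom_Obj[OF D t] by simp
  define G :: "('o2, 'a2, 'o1, 'a1) ftor" where "G = \<lparr>fobj = restrict g (Obj D), farr = restrict k (Arr D)\<rparr>"
  have Go [simp]: "fobj G d = g d" if "d \<in> Obj D" for d using that by (simp add: G_def)
  have Ga [simp]: "farr G t = k t" if "t \<in> Arr D" for t using that by (simp add: G_def)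
  have G: "is_functor D C G"
  proof (rule is_functorI[OF D])
    fix t a b assume t: "t \<in> hom D a b"
    then show "farr G t \<in> hom C (fobj G a) (fobj G b)"
      using k(1)[OF t] hom_Obj[OF D t] by (simp add: hom_iff)
  next
    fix d assume d: "d \<in> Obj D"
    have "k (Ident D d) = Ident C (g d)"
      using k_unique[OF Ident_in_hom[OF D d] Ident_in_hom[OF C ge(1)[OF d]]] functor_Ident[OF F ge(1)[OF d]]
        Comp_Ident_left[OF D ge(2)[OF d]] Comp_Ident_right[OF D ge(2)[OF d]] by simp
    then show "farr G (Ident D d) = Ident C (fobj G d)"
      using d Ident_in_hom[OF D d] by (simp add: hom_iff)
  next
    fix t s a b c assume t: "t \<in> hom D a b" and s: "s \<in> hom D b c"
    have abc: "a \<in> Obj D" "b \<in> Obj D" "c \<in> Obj D" using hom_Obj[OF D] t s by auto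
    note kt = k(1)[OF t] and ks = k(1)[OF s]
    have "e c \<cdot>\<^bsub>D\<^esub> farr F (k s \<cdot>\<^bsub>C\<^esub> k t) = (e c \<cdot>\<^bsub>D\<^esub> farr F (k s)) \<cdot>\<^bsub>D\<^esub> farr F (k t)"
      using functor_Comp[OF F kt ks] Comp_assoc[OF D functor_farr[OF F kt] functor_farr[OF F ks] ge(2)[OF abc(3)]]
      by simp
    also have "\<dots> = s \<cdot>\<^bsub>D\<^esub> (e b \<cdot>\<^bsub>D\<^esub> farr F (k t))"
      using ek[OF s] Comp_assoc[OF D functor_farr[OF F kt] ge(2)[OF abc(2)] s] by simp
    also have "\<dots> = (s \<cdot>\<^bsub>D\<^esub> t) \<cdot>\<^bsub>D\<^esub> e a"
      using ek[OF t] Comp_assoc[OF D ge(2)[OF abc(1)] t s] by simp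
    finally have "k (s \<cdot>\<^bsub>D\<^esub> t) = k s \<cdot>\<^bsub>C\<^esub> k t"
      using k_unique[OF Comp_in_hom[OF D t s] Comp_in_hom[OF C kt ks]] by simp
    then show "farr G (s \<cdot>\<^bsub>D\<^esub> t) = farr G s \<cdot>\<^bsub>C\<^esub> farr G t"
      using t s Comp_in_hom[OF D t s] by (simp add: hom_iff)
  qed (use ge in \<open>auto simp: G_def\<close>)
  have FG: "is_functor D D (comp_functor D F G)" using is_functor_comp[OF G F D] .
  have GF: "is_functor C C (comp_functor C G F)" using is_functor_comp[OF F G C] .
  define \<epsilon> where "\<epsilon> = \<lparr>nsrc = comp_functor D F G, ntgt = id_functor D, ncomp = restrict e (Obj D)\<rparr>"
  have \<epsilon>: "natural D D \<epsilon>"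
  proof (rule naturalI)
    fix t a b assume t: "t \<in> hom D a b"
    then show "ncomp \<epsilon> b \<cdot>\<^bsub>D\<^esub> farr (nsrc \<epsilon>) t = farr (ntgt \<epsilon>) t \<cdot>\<^bsub>D\<^esub> ncomp \<epsilon> a"
      using ek[OF t] hom_Obj[OF D t] by (simp add: \<epsilon>_def hom_iff)
  qed (use FG is_functor_id[OF D] ge in \<open>auto simp: \<epsilon>_def\<close>)
  have "is_iso D (ncomp \<epsilon> d)" if "d \<in> Obj D" for d
    using is_isoI[OF ge(2)[OF that] ge(3)[OF that]] ge(4,5)[OF that] that by (simp add: \<epsilon>_def)
  then have 1: "naturally_isomorphic D D (comp_functor D F G) (id_functor D)"
    unfolding naturally_isomorphic_def using \<epsilon> is_iso_functor_category[OF D D \<epsilon>]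
    by (intro bexI[of _ \<epsilon>]) (auto simp: hom_iff \<epsilon>_def)
  have "\<forall>c\<in>Obj C. \<exists>h h'. h \<in> hom C (g (fobj F c)) c \<and> farr F h = e (fobj F c) \<and>
      h' \<in> hom C c (g (fobj F c)) \<and> farr F h' = e' (fobj F c)"
    using full ge(1,2,3) functor_fobj[OF F] by metis
  then obtain h h' where h: "\<And>c. c \<in> Obj C \<Longrightarrow> h c \<in> hom C (g (fobj F c)) c"
    "\<And>c. c \<in> Obj C \<Longrightarrow> farr F (h c) = e (fobj F c)"
    "\<And>c. c \<in> Obj C \<Longrightarrow> h' c \<in> hom C c (g (fobj F c))"
    "\<And>c. c \<in> Obj C \<Longrightarrow> farr F (h' c) = e' (fobj F c)"
    by (metis (no_types))
  define \<eta> where "\<eta> = \<lparr>nsrc = comp_functor C G F, ntgt = id_functor C, ncomp = restrict h (Obj C)\<rparr>"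
  have \<eta>: "natural C C \<eta>"
  proof (rule naturalI)
    fix s a b assume s: "s \<in> hom C a b"
    then have ab: "a \<in> Obj C" "b \<in> Obj C" using hom_Obj[OF C] by auto
    note Fs = functor_farr[OF F s]
    have "farr F (h b \<cdot>\<^bsub>C\<^esub> k (farr F s)) = farr F (s \<cdot>\<^bsub>C\<^esub> h a)"
      using ek[OF Fs] functor_Comp[OF F k(1)[OF Fs] h(1)[OF ab(2)]] functor_Comp[OF F h(1)[OF ab(1)] s]
        h(2)[OF ab(1)] h(2)[OF ab(2)] by simp
    then have "h b \<cdot>\<^bsub>C\<^esub> k (farr F s) = s \<cdot>\<^bsub>C\<^esub> h a"
      using faithful[OF Comp_in_hom[OF C k(1)[OF Fs] h(1)[OF ab(2)]] Comp_in_hom[OF C h(1)[OF ab(1)] s]] by simp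
    then show "ncomp \<eta> b \<cdot>\<^bsub>C\<^esub> farr (nsrc \<eta>) s = farr (ntgt \<eta>) s \<cdot>\<^bsub>C\<^esub> ncomp \<eta> a"
      using ab s Fs by (simp add: \<eta>_def hom_iff)
  qed (use GF is_functor_id[OF C] h functor_fobj[OF F] in \<open>auto simp: \<eta>_def\<close>)
  have "is_iso C (ncomp \<eta> c)" if c: "c \<in> Obj C" for c
  proof -
    have Fc: "fobj F c \<in> Obj D" using functor_fobj[OF F c] .
    have "h' c \<cdot>\<^bsub>C\<^esub> h c = Ident C (g (fobj F c))"
      using functor_Comp[OF F h(1)[OF c] h(3)[OF c]] h(2,4)[OF c] ge(4)[OF Fc] functor_Ident[OF F ge(1)[OF Fc]]
        faithful[OF Comp_in_hom[OF C h(1)[OF c] h(3)[OF c]] Ident_in_hom[OF C ge(1)[OF Fc]]] by simp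
    moreover have "h c \<cdot>\<^bsub>C\<^esub> h' c = Ident C c"
      using functor_Comp[OF F h(3)[OF c] h(1)[OF c]] h(2,4)[OF c] ge(5)[OF Fc] functor_Ident[OF F c]
        faithful[OF Comp_in_hom[OF C h(3)[OF c] h(1)[OF c]] Ident_in_hom[OF C c]] by simp
    ultimately show ?thesis
      using is_isoI[OF h(1)[OF c] h(3)[OF c]] c by (simp add: \<eta>_def)
  qed
  then have "naturally_isomorphic C C (comp_functor C G F) (id_functor C)"
    unfolding naturally_isomorphic_def using \<eta> is_iso_functor_category[OF C C \<eta>]
    by (intro bexI[of _ \<eta>]) (auto simp: hom_iff \<eta>_def)
  with 1 C D F G show ?thesis
    unfolding is_equivalence_def by blast
qed

section \<open>Horizontal composition and the 2-category of small groupoids\<close>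

lemma is_functor_cong: "fobj F = fobj G \<Longrightarrow> farr F = farr G \<Longrightarrow> is_functor C D F = is_functor C D G"
  by (simp add: is_functor_def)

lemma comp_functor_assoc:
  assumes "is_functor A B F" "is_functor B C G" "is_functor C D H" "category A" "category B"
  shows "comp_functor A (comp_functor B H G) F = comp_functor A H (comp_functor A G F)"
proof (rule functor_eqI)
  show "is_functor A D (comp_functor A (comp_functor B H G) F)" "is_functor A D (comp_functor A H (comp_functor A G F))"
    by (rule is_functor_comp[OF assms(1) is_functor_comp[OF assms(2,3,5)] assms(4)],
        rule is_functor_comp[OF is_functor_comp[OF assms(1,2,4)] assms(3,4)])
qed (use functor_fobj[OF assms(1)] functor_farr[OF assms(1) arr_in_hom] in \<open>auto simp: hom_iff\<close>)

lemma comp_functor_id_right: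
  fixes F :: "('o1, 'a1, 'o2, 'a2) ftor"
  assumes "is_functor A B F" "category A" shows "comp_functor A F (id_functor A) = F"
  using assms by (intro functor_eqI[of A B _ B] is_functor_comp[of A A] is_functor_id) auto

lemma comp_functor_id_left:
  fixes F :: "('o1, 'a1, 'o2, 'a2) ftor"
  assumes "is_functor A B F" "category A" "category B" shows "comp_functor A (id_functor B) F = F"
  using assms functor_fobj[OF assms(1)] functor_farr[OF assms(1) arr_in_hom]
  by (intro functor_eqI[of A B _ B] is_functor_comp[of A B] is_functor_id) (auto simp: hom_iff)

lemma hcomp_components_extensional [simp]: "hcomp_components A C t s \<in> extensional (Obj A)"
  by (simp add: hcomp_components_def)

context
  fixes A :: "('o1, 'a1, 'x) cat_scheme" and B :: "('o2, 'a2, 'y) cat_scheme"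
    and C :: "('o3, 'a3, 'z) cat_scheme"
  assumes A: "category A" and B: "category B" and C: "category C"
begin

lemma hcomp_components_in_hom:
  assumes s: "natural A B s" and t: "natural B C t" and a: "a \<in> Obj A"
  shows "hcomp_components A C t s a
    \<in> hom C (fobj (nsrc t) (fobj (nsrc s) a)) (fobj (ntgt t) (fobj (ntgt s) a))"
proof -
  have "fobj (ntgt s) a \<in> Obj B" using functor_fobj[OF naturalD(2)[OF s] a] .
  then show ?thesis
    using Comp_in_hom[OF C functor_farr[OF naturalD(1)[OF t] naturalD(4)[OF s a]] naturalD(4)[OF t]] a
    by (simp add: hcomp_components_def)
qed

text \<open>
  The composite \<open>r\<close> is characterised by its values, so that the lemma applies to composites of functors and of
  monoidal functors, which are records of different types.
\<close>

lemma natural_hcomp: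
  assumes s: "natural A B s" and t: "natural B C t"
    and K: "is_functor A C (nsrc r)" "is_functor A C (ntgt r)"
    and obj: "\<And>a. a \<in> Obj A \<Longrightarrow> fobj (nsrc r) a = fobj (nsrc t) (fobj (nsrc s) a)"
      "\<And>a. a \<in> Obj A \<Longrightarrow> fobj (ntgt r) a = fobj (ntgt t) (fobj (ntgt s) a)"
    and arr: "\<And>f. f \<in> Arr A \<Longrightarrow> farr (nsrc r) f = farr (nsrc t) (farr (nsrc s) f)"
      "\<And>f. f \<in> Arr A \<Longrightarrow> farr (ntgt r) f = farr (ntgt t) (farr (ntgt s) f)"
    and r: "ncomp r = hcomp_components A C t s"
  shows "natural A C r"
proof (rule naturalI)
  fix a assume "a \<in> Obj A"
  then show "ncomp r a \<in> hom C (fobj (nsrc r) a) (fobj (ntgt r) a)"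
    using hcomp_components_in_hom[OF s t] obj r by simp
next
  fix f a b assume f: "f \<in> hom A a b"
  then have ab: "a \<in> Obj A" "b \<in> Obj A" using hom_Obj[OF A] by auto
  let ?F = "nsrc s" and ?F' = "ntgt s" and ?G = "nsrc t" and ?G' = "ntgt t"
  note Ff = functor_farr[OF naturalD(1)[OF s] f] and F'f = functor_farr[OF naturalD(2)[OF s] f]
  note GFf = functor_farr[OF naturalD(1)[OF t] Ff] and GF'f = functor_farr[OF naturalD(1)[OF t] F'f]
  note G'F'f = functor_farr[OF naturalD(2)[OF t] F'f]
  have F'ab: "fobj ?F' a \<in> Obj B" "fobj ?F' b \<in> Obj B" using functor_fobj[OF naturalD(2)[OF s]] ab by auto
  note sa = naturalD(4)[OF s ab(1)] and sb = naturalD(4)[OF s ab(2)]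
  note Gsa = functor_farr[OF naturalD(1)[OF t] sa] and Gsb = functor_farr[OF naturalD(1)[OF t] sb]
  note ta = naturalD(4)[OF t F'ab(1)] and tb = naturalD(4)[OF t F'ab(2)]
  have "(ncomp t (fobj ?F' b) \<cdot>\<^bsub>C\<^esub> farr ?G (ncomp s b)) \<cdot>\<^bsub>C\<^esub> farr ?G (farr ?F f) =
      ncomp t (fobj ?F' b) \<cdot>\<^bsub>C\<^esub> farr ?G (ncomp s b \<cdot>\<^bsub>B\<^esub> farr ?F f)"
    using Comp_assoc[OF C GFf Gsb tb] functor_Comp[OF naturalD(1)[OF t] Ff sb] by simp
  also have "\<dots> = (ncomp t (fobj ?F' b) \<cdot>\<^bsub>C\<^esub> farr ?G (farr ?F' f)) \<cdot>\<^bsub>C\<^esub> farr ?G (ncomp s a)"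
    using naturalD(5)[OF s f] Comp_assoc[OF C Gsa GF'f tb] functor_Comp[OF naturalD(1)[OF t] sa F'f] by simp
  also have "\<dots> = farr ?G' (farr ?F' f) \<cdot>\<^bsub>C\<^esub> (ncomp t (fobj ?F' a) \<cdot>\<^bsub>C\<^esub> farr ?G (ncomp s a))"
    using naturalD(5)[OF t F'f] Comp_assoc[OF C Gsa ta G'F'f] by simp
  finally show "ncomp r b \<cdot>\<^bsub>C\<^esub> farr (nsrc r) f = farr (ntgt r) f \<cdot>\<^bsub>C\<^esub> ncomp r a"
    using ab f arr r by (simp add: hcomp_components_def hom_iff)
qed (use K r in auto)

lemma hcomp_components_id:
  assumes f: "is_functor A B f" and g: "is_functor B C g" and a: "a \<in> Obj A"
  shows "hcomp_components A C (ntrans_id B C g) (ntrans_id A B f) a = Ident C (fobj g (fobj f a))"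
  using a functor_fobj[OF f a] functor_Ident[OF g functor_fobj[OF f a]]
    Comp_Ident_left[OF C Ident_in_hom[OF C functor_fobj[OF g functor_fobj[OF f a]]]]
  by (simp add: hcomp_components_def)

lemma hcomp_components_interchange:
  assumes s: "natural A B s" "natural A B s'" "nsrc s' = ntgt s"
    and t: "natural B C t" "natural B C t'" "nsrc t' = ntgt t" and a: "a \<in> Obj A"
  shows "hcomp_components A C (ntrans_comp B C t' t) (ntrans_comp A B s' s) a =
    hcomp_components A C t' s' a \<cdot>\<^bsub>C\<^esub> hcomp_components A C t s a"
proof -
  let ?F'' = "ntgt s'" and ?F' = "ntgt s" and ?G = "nsrc t" and ?G' = "ntgt t"
  have F: "fobj ?F'' a \<in> Obj B" "fobj ?F' a \<in> Obj B"
    using functor_fobj[OF naturalD(2)[OF s(1)] a] functor_fobj[OF naturalD(2)[OF s(2)] a] by auto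
  note sa = naturalD(4)[OF s(1) a] and s'a = naturalD(4)[OF s(2) a, unfolded s(3)]
  note Gs = functor_farr[OF naturalD(1)[OF t(1)] sa] and Gs' = functor_farr[OF naturalD(1)[OF t(1)] s'a]
  note G's' = functor_farr[OF naturalD(2)[OF t(1)] s'a]
  note tF' = naturalD(4)[OF t(1) F(2)] and tF'' = naturalD(4)[OF t(1) F(1)]
  note t'F'' = naturalD(4)[OF t(2) F(1), unfolded t(3)]
  have "(ncomp t' (fobj ?F'' a) \<cdot>\<^bsub>C\<^esub> ncomp t (fobj ?F'' a)) \<cdot>\<^bsub>C\<^esub> farr ?G (ncomp s' a \<cdot>\<^bsub>B\<^esub> ncomp s a) =
      ncomp t' (fobj ?F'' a) \<cdot>\<^bsub>C\<^esub> ((ncomp t (fobj ?F'' a) \<cdot>\<^bsub>C\<^esub> farr ?G (ncomp s' a)) \<cdot>\<^bsub>C\<^esub> farr ?G (ncomp s a))"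
    using functor_Comp[OF naturalD(1)[OF t(1)] sa s'a] Comp_assoc[OF C Gs Gs' tF'']
      Comp_assoc[OF C Comp_in_hom[OF C Gs Gs'] tF'' t'F''] by simp
  also have "\<dots> = ncomp t' (fobj ?F'' a) \<cdot>\<^bsub>C\<^esub> (farr ?G' (ncomp s' a) \<cdot>\<^bsub>C\<^esub> (ncomp t (fobj ?F' a) \<cdot>\<^bsub>C\<^esub> farr ?G (ncomp s a)))"
    using naturalD(5)[OF t(1) s'a] Comp_assoc[OF C Gs tF' G's'] by simp
  also have "\<dots> = (ncomp t' (fobj ?F'' a) \<cdot>\<^bsub>C\<^esub> farr ?G' (ncomp s' a)) \<cdot>\<^bsub>C\<^esub> (ncomp t (fobj ?F' a) \<cdot>\<^bsub>C\<^esub> farr ?G (ncomp s a))"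
    using Comp_assoc[OF C Comp_in_hom[OF C Gs tF'] G's' t'F''] by simp
  finally show ?thesis using a F t(3) by (simp add: hcomp_components_def)
qed

lemma hcomp_components_id_right:
  assumes s: "natural A B s" and i: "\<And>a. a \<in> Obj A \<Longrightarrow> fobj i a = a" and a: "a \<in> Obj A"
  shows "hcomp_components A B s (ntrans_id A A i) a = ncomp s a"
  using a i functor_Ident[OF naturalD(1)[OF s] a] Comp_Ident_right[OF B naturalD(4)[OF s a]]
  by (simp add: hcomp_components_def)

lemma hcomp_components_id_left:
  assumes s: "natural A B s" and i: "\<And>b. b \<in> Obj B \<Longrightarrow> fobj i b = b" "\<And>f. f \<in> Arr B \<Longrightarrow> farr i f = f"
    and a: "a \<in> Obj A"
  shows "hcomp_components A B (ntrans_id B B i) s a = ncomp s a"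
  using a i functor_fobj[OF naturalD(2)[OF s] a] Comp_Ident_left[OF B naturalD(4)[OF s a]]
    naturalD(4)[OF s a] by (simp add: hcomp_components_def hom_iff)

lemma hcomp_components_assoc:
  assumes r: "natural A B r" and s: "natural B C s" and t: "natural C D t" and D: "category D"
    and ts: "\<And>f. f \<in> Arr B \<Longrightarrow> farr (nsrc ts) f = farr (nsrc t) (farr (nsrc s) f)"
      "ncomp ts = hcomp_components B D t s"
    and sr: "\<And>a. a \<in> Obj A \<Longrightarrow> fobj (ntgt sr) a = fobj (ntgt s) (fobj (ntgt r) a)"
      "ncomp sr = hcomp_components A C s r"
    and a: "a \<in> Obj A"
  shows "hcomp_components A D ts r a = hcomp_components A D t sr a"
proof -
  note R = functor_fobj[OF naturalD(2)[OF r] a]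
  note ra = naturalD(4)[OF r a]
  note Sr = functor_farr[OF naturalD(1)[OF s] ra] and sR = naturalD(4)[OF s R]
  note TSr = functor_farr[OF naturalD(1)[OF t] Sr] and TsR = functor_farr[OF naturalD(1)[OF t] sR]
  note tSR = naturalD(4)[OF t functor_fobj[OF naturalD(2)[OF s] R]]
  show ?thesis
    using a R ra ts sr Comp_assoc[OF D TSr TsR tSR] functor_Comp[OF naturalD(1)[OF t] Sr sR]
    by (simp add: hcomp_components_def hom_iff)
qed

end

lemma small_groupoid_category: "small_groupoid G \<Longrightarrow> category G"
  by (simp add: small_groupoid_def small_category_def)

lemma Gpd_simps [simp]:
  "Cell0 Gpd = {G. small_groupoid G}" "HomCat Gpd = functor_category" "Ident1 Gpd = id_functor"
  "HComp1 Gpd A B C g f = comp_functor A g f"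
  "HComp2 Gpd A B C t s = \<lparr>nsrc = comp_functor A (nsrc t) (nsrc s), ntgt = comp_functor A (ntgt t) (ntgt s),
     ncomp = hcomp_components A C t s\<rparr>"
  by (simp_all add: Gpd_def)

lemma HComp2_Gpd_in_hom:
  assumes "category A" "category B" "category C" and s: "natural A B s" and t: "natural B C t"
  shows "HComp2 Gpd A B C t s \<in> hom (functor_category A C) (comp_functor A (nsrc t) (nsrc s))
      (comp_functor A (ntgt t) (ntgt s))"
  using natural_hcomp[OF assms(1-3) s t, of "HComp2 Gpd A B C t s"] assms
    is_functor_comp[OF naturalD(1)[OF s] naturalD(1)[OF t]] is_functor_comp[OF naturalD(2)[OF s] naturalD(2)[OF t]]
  by (simp add: hom_iff)

lemma two_category_Gpd: "two_category (Gpd :: (('u, 'u) cat, 'u gfun, 'u gtrans) two_cat)"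
proof -
  note cat = small_groupoid_category
  have "HComp2 Gpd A B C (ntrans_id B C g) (ntrans_id A B f) = ntrans_id A C (comp_functor A g f)"
    if "category A" "category B" "category C" "is_functor A B f" "is_functor B C g"
    for A B C :: "('u, 'u) cat" and f g
    by (rule ntrans_eqI[where A = "Obj A"]) (use hcomp_components_id[OF that(1-3)] that in auto)
  moreover have "HComp2 Gpd A B C (ntrans_comp B C t' t) (ntrans_comp A B s' s) =
      ntrans_comp A C (HComp2 Gpd A B C t' s') (HComp2 Gpd A B C t s)"
    if "category A" "category B" "category C" "natural A B s" "natural A B s'" "nsrc s' = ntgt s"
      "natural B C t" "natural B C t'" "nsrc t' = ntgt t"
    for A B C :: "('u, 'u) cat" and s s' t t'
    by (rule ntrans_eqI[where A = "Obj A"]) (use hcomp_components_interchange[OF that(1-3)] that in auto)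
  moreover have "HComp2 Gpd A A B s (ntrans_id A A (id_functor A)) = s"
      "HComp2 Gpd A B B (ntrans_id B B (id_functor B)) s = s"
    if "category A" "category B" "natural A B s" for A B :: "('u, 'u) cat" and s
    by (rule ntrans_eqI[where A = "Obj A"];
      simp add: hcomp_components_id_right[OF that(1,2,2)] hcomp_components_id_left[OF that(1,2,2)] that
        naturalD[OF that(3)] comp_functor_id_right[OF naturalD(1)[OF that(3)]]
        comp_functor_id_right[OF naturalD(2)[OF that(3)]] comp_functor_id_left[OF naturalD(1)[OF that(3)]]
        comp_functor_id_left[OF naturalD(2)[OF that(3)]])+
  moreover have "HComp2 Gpd A B D (HComp2 Gpd B C D t s) r = HComp2 Gpd A C D t (HComp2 Gpd A B C s r)"
    if "category A" "category B" "category C" "category D" "natural A B r" "natural B C s" "natural C D t"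
    for A B C D :: "('u, 'u) cat" and r s t
    by (rule ntrans_eqI[where A = "Obj A"])
      (use hcomp_components_assoc[OF that(1-3,5-7,4), of "HComp2 Gpd B C D t s" "HComp2 Gpd A B C s r"] that
        naturalD[OF that(5)] naturalD[OF that(6)] naturalD[OF that(7)] comp_functor_assoc in auto)
  ultimately show ?thesis
    unfolding two_category_def
    by (auto simp del: Gpd_simps(5) intro!: HComp2_Gpd_in_hom category_functor_category is_functor_id is_functor_comp
        comp_functor_id_right comp_functor_id_left comp_functor_assoc dest!: cat)
qed

section \<open>Symmetric monoidal functors and the 2-category of commutative 2-rings\<close>

text \<open>
  In this form the laws of a category are conditional rewrite rules whose side conditions the simplifier
  decides by computing domains and codomains.
\<close>

locale cat_laws =
  fixes C :: "('o, 'a, 'z) cat_scheme"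
  assumes cat: "category C"
begin

lemma Dom_Obj [simp]: "f \<in> Arr C \<Longrightarrow> Dom C f \<in> Obj C"
  using cat by (simp add: category_def)

lemma Cod_Obj [simp]: "f \<in> Arr C \<Longrightarrow> Cod C f \<in> Obj C"
  using cat by (simp add: category_def)

lemma Ident_simps [simp]:
  "a \<in> Obj C \<Longrightarrow> Ident C a \<in> Arr C" "a \<in> Obj C \<Longrightarrow> Dom C (Ident C a) = a"
  "a \<in> Obj C \<Longrightarrow> Cod C (Ident C a) = a"
  using Ident_in_hom[OF cat] by (auto simp: hom_iff)

lemma Comp_simps [simp]:
  "f \<in> Arr C \<Longrightarrow> g \<in> Arr C \<Longrightarrow> Dom C g = Cod C f \<Longrightarrow> g \<cdot>\<^bsub>C\<^esub> f \<in> Arr C"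
  "f \<in> Arr C \<Longrightarrow> g \<in> Arr C \<Longrightarrow> Dom C g = Cod C f \<Longrightarrow> Dom C (g \<cdot>\<^bsub>C\<^esub> f) = Dom C f"
  "f \<in> Arr C \<Longrightarrow> g \<in> Arr C \<Longrightarrow> Dom C g = Cod C f \<Longrightarrow> Cod C (g \<cdot>\<^bsub>C\<^esub> f) = Cod C g"
  using cat by (auto simp: category_def hom_iff)

lemma Comp_Ident [simp]:
  "f \<in> Arr C \<Longrightarrow> Dom C f = a \<Longrightarrow> f \<cdot>\<^bsub>C\<^esub> Ident C a = f"
  "f \<in> Arr C \<Longrightarrow> Cod C f = a \<Longrightarrow> Ident C a \<cdot>\<^bsub>C\<^esub> f = f"
  using cat by (auto simp: category_def)

lemma assoc [simp]:
  "f \<in> Arr C \<Longrightarrow> g \<in> Arr C \<Longrightarrow> h \<in> Arr C \<Longrightarrow> Dom C g = Cod C f \<Longrightarrow> Dom C h = Cod C g \<Longrightarrow>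
     (h \<cdot>\<^bsub>C\<^esub> g) \<cdot>\<^bsub>C\<^esub> f = h \<cdot>\<^bsub>C\<^esub> (g \<cdot>\<^bsub>C\<^esub> f)"
  using cat by (simp add: category_def)

text \<open>An equation between composites may be applied to the head of a longer composite.\<close>

lemma reassoc:
  assumes "g \<cdot>\<^bsub>C\<^esub> f = g' \<cdot>\<^bsub>C\<^esub> f'"
    and "k \<in> Arr C" "f \<in> Arr C" "g \<in> Arr C" "Dom C g = Cod C f" "Dom C f = Cod C k"
      "f' \<in> Arr C" "g' \<in> Arr C" "Dom C g' = Cod C f'" "Dom C f' = Cod C k"
  shows "g \<cdot>\<^bsub>C\<^esub> (f \<cdot>\<^bsub>C\<^esub> k) = g' \<cdot>\<^bsub>C\<^esub> (f' \<cdot>\<^bsub>C\<^esub> k)"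
  using assms assoc[of k f g] assoc[of k f' g'] by simp

end

locale sm_category =
  fixes C :: "('o, 'a, 'z) smcat_scheme"
  assumes sm: "symmetric_monoidal_category C"

sublocale sm_category \<subseteq> cat_laws C
  using sm by unfold_locales (simp add: symmetric_monoidal_category_def)

context sm_category
begin

lemma tensor_simps [simp]:
  "a \<in> Obj C \<Longrightarrow> b \<in> Obj C \<Longrightarrow> a \<otimes>\<^bsub>C\<^esub> b \<in> Obj C"
  "f \<in> Arr C \<Longrightarrow> g \<in> Arr C \<Longrightarrow> f \<boxtimes>\<^bsub>C\<^esub> g \<in> Arr C"
  "f \<in> Arr C \<Longrightarrow> g \<in> Arr C \<Longrightarrow> Dom C (f \<boxtimes>\<^bsub>C\<^esub> g) = Dom C f \<otimes>\<^bsub>C\<^esub> Dom C g"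
  "f \<in> Arr C \<Longrightarrow> g \<in> Arr C \<Longrightarrow> Cod C (f \<boxtimes>\<^bsub>C\<^esub> g) = Cod C f \<otimes>\<^bsub>C\<^esub> Cod C g"
  "a \<in> Obj C \<Longrightarrow> b \<in> Obj C \<Longrightarrow> Ident C a \<boxtimes>\<^bsub>C\<^esub> Ident C b = Ident C (a \<otimes>\<^bsub>C\<^esub> b)"
  using sm by (auto simp: symmetric_monoidal_category_def tensor_bifunctor_def hom_iff)

lemma interchange:
  "f \<in> Arr C \<Longrightarrow> f' \<in> Arr C \<Longrightarrow> g \<in> Arr C \<Longrightarrow> g' \<in> Arr C \<Longrightarrow> Dom C f' = Cod C f \<Longrightarrow> Dom C g' = Cod C g \<Longrightarrow>
    (f' \<boxtimes>\<^bsub>C\<^esub> g') \<cdot>\<^bsub>C\<^esub> (f \<boxtimes>\<^bsub>C\<^esub> g) = (f' \<cdot>\<^bsub>C\<^esub> f) \<boxtimes>\<^bsub>C\<^esub> (g' \<cdot>\<^bsub>C\<^esub> g)"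
  using sm by (auto simp: symmetric_monoidal_category_def tensor_bifunctor_def hom_iff)

lemma constraint_simps [simp]:
  "Unit C \<in> Obj C"
  "a \<in> Obj C \<Longrightarrow> b \<in> Obj C \<Longrightarrow> c \<in> Obj C \<Longrightarrow> Assoc C a b c \<in> Arr C"
  "a \<in> Obj C \<Longrightarrow> b \<in> Obj C \<Longrightarrow> c \<in> Obj C \<Longrightarrow> Dom C (Assoc C a b c) = (a \<otimes>\<^bsub>C\<^esub> b) \<otimes>\<^bsub>C\<^esub> c"
  "a \<in> Obj C \<Longrightarrow> b \<in> Obj C \<Longrightarrow> c \<in> Obj C \<Longrightarrow> Cod C (Assoc C a b c) = a \<otimes>\<^bsub>C\<^esub> b \<otimes>\<^bsub>C\<^esub> c"
  "a \<in> Obj C \<Longrightarrow> Lunit C a \<in> Arr C" "a \<in> Obj C \<Longrightarrow> Dom C (Lunit C a) = Unit C \<otimes>\<^bsub>C\<^esub> a"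
  "a \<in> Obj C \<Longrightarrow> Cod C (Lunit C a) = a"
  "a \<in> Obj C \<Longrightarrow> Runit C a \<in> Arr C" "a \<in> Obj C \<Longrightarrow> Dom C (Runit C a) = a \<otimes>\<^bsub>C\<^esub> Unit C"
  "a \<in> Obj C \<Longrightarrow> Cod C (Runit C a) = a"
  "a \<in> Obj C \<Longrightarrow> b \<in> Obj C \<Longrightarrow> Braid C a b \<in> Arr C"
  "a \<in> Obj C \<Longrightarrow> b \<in> Obj C \<Longrightarrow> Dom C (Braid C a b) = a \<otimes>\<^bsub>C\<^esub> b"
  "a \<in> Obj C \<Longrightarrow> b \<in> Obj C \<Longrightarrow> Cod C (Braid C a b) = b \<otimes>\<^bsub>C\<^esub> a"
  using sm by (auto simp: symmetric_monoidal_category_def monoidal_constraints_def hom_iff)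

end

locale sm_functor = A: sm_category A + B: sm_category B
  for A :: "('o1, 'a1, 'y) smcat_scheme" and B :: "('o2, 'a2, 'z) smcat_scheme" +
  fixes F :: "('o1, 'a1, 'o2, 'a2, 'w) smftor_scheme"
  assumes smf: "symmetric_monoidal_functor A B F"
begin

lemma ftor: "is_functor A B F"
  using smf by (simp add: symmetric_monoidal_functor_def)

lemma ftor_simps [simp]:
  "a \<in> Obj A \<Longrightarrow> fobj F a \<in> Obj B"
  "f \<in> Arr A \<Longrightarrow> farr F f \<in> Arr B"
  "f \<in> Arr A \<Longrightarrow> Dom B (farr F f) = fobj F (Dom A f)"
  "f \<in> Arr A \<Longrightarrow> Cod B (farr F f) = fobj F (Cod A f)"
  "a \<in> Obj A \<Longrightarrow> farr F (Ident A a) = Ident B (fobj F a)"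
  using ftor by (auto simp: is_functor_def hom_iff)

lemma farr_Comp:
  "f \<in> Arr A \<Longrightarrow> g \<in> Arr A \<Longrightarrow> Dom A g = Cod A f \<Longrightarrow> farr F (g \<cdot>\<^bsub>A\<^esub> f) = farr F g \<cdot>\<^bsub>B\<^esub> farr F f"
  using ftor by (auto simp: is_functor_def hom_iff)

lemma Mu_simps [simp]:
  "a \<in> Obj A \<Longrightarrow> b \<in> Obj A \<Longrightarrow> Mu F a b \<in> Arr B"
  "a \<in> Obj A \<Longrightarrow> b \<in> Obj A \<Longrightarrow> Dom B (Mu F a b) = fobj F a \<otimes>\<^bsub>B\<^esub> fobj F b"
  "a \<in> Obj A \<Longrightarrow> b \<in> Obj A \<Longrightarrow> Cod B (Mu F a b) = fobj F (a \<otimes>\<^bsub>A\<^esub> b)"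
  "a \<in> Obj A \<Longrightarrow> b \<in> Obj A \<Longrightarrow> is_iso B (Mu F a b)"
  "Eps F \<in> Arr B" "Dom B (Eps F) = Unit B" "Cod B (Eps F) = fobj F (Unit A)" "is_iso B (Eps F)"
  using smf by (simp_all add: symmetric_monoidal_functor_def hom_iff)

lemma Mu_natural:
  "f \<in> Arr A \<Longrightarrow> g \<in> Arr A \<Longrightarrow> Mu F (Cod A f) (Cod A g) \<cdot>\<^bsub>B\<^esub> (farr F f \<boxtimes>\<^bsub>B\<^esub> farr F g) =
    farr F (f \<boxtimes>\<^bsub>A\<^esub> g) \<cdot>\<^bsub>B\<^esub> Mu F (Dom A f) (Dom A g)"
  using smf by (simp add: symmetric_monoidal_functor_def)

lemma Mu_Assoc:
  "a \<in> Obj A \<Longrightarrow> b \<in> Obj A \<Longrightarrow> c \<in> Obj A \<Longrightarrow>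
     farr F (Assoc A a b c) \<cdot>\<^bsub>B\<^esub> Mu F (a \<otimes>\<^bsub>A\<^esub> b) c \<cdot>\<^bsub>B\<^esub> (Mu F a b \<boxtimes>\<^bsub>B\<^esub> Ident B (fobj F c)) =
     Mu F a (b \<otimes>\<^bsub>A\<^esub> c) \<cdot>\<^bsub>B\<^esub> (Ident B (fobj F a) \<boxtimes>\<^bsub>B\<^esub> Mu F b c) \<cdot>\<^bsub>B\<^esub>
       Assoc B (fobj F a) (fobj F b) (fobj F c)"
  using smf by (simp add: symmetric_monoidal_functor_def)

lemma Mu_Lunit:
  "a \<in> Obj A \<Longrightarrow> farr F (Lunit A a) \<cdot>\<^bsub>B\<^esub> Mu F (Unit A) a \<cdot>\<^bsub>B\<^esub> (Eps F \<boxtimes>\<^bsub>B\<^esub> Ident B (fobj F a)) = Lunit B (fobj F a)"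
  using smf by (simp add: symmetric_monoidal_functor_def)

lemma Mu_Runit:
  "a \<in> Obj A \<Longrightarrow> farr F (Runit A a) \<cdot>\<^bsub>B\<^esub> Mu F a (Unit A) \<cdot>\<^bsub>B\<^esub> (Ident B (fobj F a) \<boxtimes>\<^bsub>B\<^esub> Eps F) = Runit B (fobj F a)"
  using smf by (simp add: symmetric_monoidal_functor_def)

lemma Mu_Braid:
  "a \<in> Obj A \<Longrightarrow> b \<in> Obj A \<Longrightarrow>
     farr F (Braid A a b) \<cdot>\<^bsub>B\<^esub> Mu F a b = Mu F b a \<cdot>\<^bsub>B\<^esub> Braid B (fobj F a) (fobj F b)"
  using smf by (simp add: symmetric_monoidal_functor_def)

end

lemma symmetric_monoidal_functorI:
  assumes "is_functor C D F"
    and "\<And>a b. a \<notin> Obj C \<or> b \<notin> Obj C \<Longrightarrow> Mu F a b = undefined"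
    and "\<And>a b. a \<in> Obj C \<Longrightarrow> b \<in> Obj C \<Longrightarrow> Mu F a b \<in> hom D (fobj F a \<otimes>\<^bsub>D\<^esub> fobj F b) (fobj F (a \<otimes>\<^bsub>C\<^esub> b))"
    and "\<And>a b. a \<in> Obj C \<Longrightarrow> b \<in> Obj C \<Longrightarrow> is_iso D (Mu F a b)"
    and "Eps F \<in> hom D (Unit D) (fobj F (Unit C))" "is_iso D (Eps F)"
    and "\<And>f g. f \<in> Arr C \<Longrightarrow> g \<in> Arr C \<Longrightarrow> Mu F (Cod C f) (Cod C g) \<cdot>\<^bsub>D\<^esub> (farr F f \<boxtimes>\<^bsub>D\<^esub> farr F g) =
      farr F (f \<boxtimes>\<^bsub>C\<^esub> g) \<cdot>\<^bsub>D\<^esub> Mu F (Dom C f) (Dom C g)"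
    and "\<And>a b c. a \<in> Obj C \<Longrightarrow> b \<in> Obj C \<Longrightarrow> c \<in> Obj C \<Longrightarrow>
      farr F (Assoc C a b c) \<cdot>\<^bsub>D\<^esub> Mu F (a \<otimes>\<^bsub>C\<^esub> b) c \<cdot>\<^bsub>D\<^esub> (Mu F a b \<boxtimes>\<^bsub>D\<^esub> Ident D (fobj F c)) =
      Mu F a (b \<otimes>\<^bsub>C\<^esub> c) \<cdot>\<^bsub>D\<^esub> (Ident D (fobj F a) \<boxtimes>\<^bsub>D\<^esub> Mu F b c) \<cdot>\<^bsub>D\<^esub>
        Assoc D (fobj F a) (fobj F b) (fobj F c)"
    and "\<And>a. a \<in> Obj C \<Longrightarrow>
      farr F (Lunit C a) \<cdot>\<^bsub>D\<^esub> Mu F (Unit C) a \<cdot>\<^bsub>D\<^esub> (Eps F \<boxtimes>\<^bsub>D\<^esub> Ident D (fobj F a)) = Lunit D (fobj F a)"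
    and "\<And>a. a \<in> Obj C \<Longrightarrow>
      farr F (Runit C a) \<cdot>\<^bsub>D\<^esub> Mu F a (Unit C) \<cdot>\<^bsub>D\<^esub> (Ident D (fobj F a) \<boxtimes>\<^bsub>D\<^esub> Eps F) = Runit D (fobj F a)"
    and "\<And>a b. a \<in> Obj C \<Longrightarrow> b \<in> Obj C \<Longrightarrow>
      farr F (Braid C a b) \<cdot>\<^bsub>D\<^esub> Mu F a b = Mu F b a \<cdot>\<^bsub>D\<^esub> Braid D (fobj F a) (fobj F b)"
  shows "symmetric_monoidal_functor C D F"
  unfolding symmetric_monoidal_functor_def by (intro conjI allI ballI impI assms; assumption)

lemma comp_smfunctor_simps [simp]:
  "a \<in> Obj A \<Longrightarrow> fobj (comp_smfunctor A C G F) a = fobj G (fobj F a)"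
  "f \<in> Arr A \<Longrightarrow> farr (comp_smfunctor A C G F) f = farr G (farr F f)"
  "a \<in> Obj A \<Longrightarrow> b \<in> Obj A \<Longrightarrow>
     Mu (comp_smfunctor A C G F) a b = farr G (Mu F a b) \<cdot>\<^bsub>C\<^esub> Mu G (fobj F a) (fobj F b)"
  "a \<notin> Obj A \<or> b \<notin> Obj A \<Longrightarrow> Mu (comp_smfunctor A C G F) a b = undefined"
  "Eps (comp_smfunctor A C G F) = farr G (Eps F) \<cdot>\<^bsub>C\<^esub> Eps G"
  by (auto simp: comp_smfunctor_def)

lemma id_smfunctor_simps [simp]:
  "a \<in> Obj A \<Longrightarrow> fobj (id_smfunctor A) a = a"
  "f \<in> Arr A \<Longrightarrow> farr (id_smfunctor A) f = f"
  "a \<in> Obj A \<Longrightarrow> b \<in> Obj A \<Longrightarrow> Mu (id_smfunctor A) a b = Ident A (a \<otimes>\<^bsub>A\<^esub> b)"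
  "a \<notin> Obj A \<or> b \<notin> Obj A \<Longrightarrow> Mu (id_smfunctor A) a b = undefined"
  "Eps (id_smfunctor A) = Ident A (Unit A)"
  by (auto simp: id_smfunctor_def)

lemma is_functor_comp_smfunctor:
  "is_functor A B F \<Longrightarrow> is_functor B C G \<Longrightarrow> category A \<Longrightarrow> is_functor A C (comp_smfunctor A D G F)"
  using is_functor_comp[of A B F C G] is_functor_cong[of "comp_smfunctor A D G F" "comp_functor A G F" A C]
  by (simp add: comp_smfunctor_def comp_functor_def)

lemma is_functor_id_smfunctor: "category A \<Longrightarrow> is_functor A A (id_smfunctor A)"
  using is_functor_id[of A] is_functor_cong[of "id_smfunctor A" "id_functor A" A A]
  by (simp add: id_smfunctor_def id_functor_def)

lemma symmetric_monoidal_functor_id: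
  assumes "symmetric_monoidal_category A"
  shows "symmetric_monoidal_functor A A (id_smfunctor A)"
proof -
  interpret A: sm_category A using assms by unfold_locales
  show ?thesis
    by (rule symmetric_monoidal_functorI)
      (simp_all add: is_functor_id_smfunctor A.cat is_iso_Ident hom_iff)
qed

lemma symmetric_monoidal_functor_comp:
  assumes A: "symmetric_monoidal_category A" and B: "symmetric_monoidal_category B"
    and C: "symmetric_monoidal_category C"
    and F: "symmetric_monoidal_functor A B F" and G: "symmetric_monoidal_functor B C G"
  shows "symmetric_monoidal_functor A C (comp_smfunctor A C G F)"
proof -
  interpret F: sm_functor A B F using A B F by unfold_locales
  interpret G: sm_functor B C G using B C G by unfold_locales
  let ?K = "comp_smfunctor A C G F"
  note nat = G.B.reassoc[OF G.Mu_natural]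
  show ?thesis
  proof (rule symmetric_monoidal_functorI)
    fix a b assume "a \<in> Obj A" "b \<in> Obj A"
    then show "is_iso C (Mu ?K a b)"
      using is_iso_Comp[OF G.B.cat arr_in_hom _ _ _] functor_is_iso[OF G.ftor arr_in_hom _ F.B.cat]
      by (simp add: is_iso_Comp[OF G.B.cat arr_in_hom _ _] hom_iff)
  next
    show "is_iso C (Eps ?K)"
      using functor_is_iso[OF G.ftor arr_in_hom _ F.B.cat]
      by (simp add: is_iso_Comp[OF G.B.cat arr_in_hom _ _] hom_iff)
  next
    fix f g assume fg: "f \<in> Arr A" "g \<in> Arr A"
    have "Mu ?K (Cod A f) (Cod A g) \<cdot>\<^bsub>C\<^esub> (farr ?K f \<boxtimes>\<^bsub>C\<^esub> farr ?K g) =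
        farr G (Mu F (Cod A f) (Cod A g)) \<cdot>\<^bsub>C\<^esub> farr G (farr F f \<boxtimes>\<^bsub>B\<^esub> farr F g) \<cdot>\<^bsub>C\<^esub> Mu G (fobj F (Dom A f)) (fobj F (Dom A g))"
      using fg G.Mu_natural[of "farr F f" "farr F g"] by simp
    also have "\<dots> = farr G (farr F (f \<boxtimes>\<^bsub>A\<^esub> g)) \<cdot>\<^bsub>C\<^esub> farr G (Mu F (Dom A f) (Dom A g)) \<cdot>\<^bsub>C\<^esub> Mu G (fobj F (Dom A f)) (fobj F (Dom A g))"
      using fg F.Mu_natural[of f g] by (intro G.B.reassoc) (simp_all flip: G.farr_Comp)
    finally show "Mu ?K (Cod A f) (Cod A g) \<cdot>\<^bsub>C\<^esub> (farr ?K f \<boxtimes>\<^bsub>C\<^esub> farr ?K g) =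
        farr ?K (f \<boxtimes>\<^bsub>A\<^esub> g) \<cdot>\<^bsub>C\<^esub> Mu ?K (Dom A f) (Dom A g)"
      using fg by simp
  next
    fix a b c assume abc: "a \<in> Obj A" "b \<in> Obj A" "c \<in> Obj A"
    let ?a = "fobj F a" and ?b = "fobj F b" and ?c = "fobj F c"
    let ?ab = "Mu F a b" and ?bc = "Mu F b c"
    have 1: "(farr G ?ab \<cdot>\<^bsub>C\<^esub> Mu G ?a ?b) \<boxtimes>\<^bsub>C\<^esub> Ident C (fobj G ?c) =
        (farr G ?ab \<boxtimes>\<^bsub>C\<^esub> farr G (Ident B ?c)) \<cdot>\<^bsub>C\<^esub> (Mu G ?a ?b \<boxtimes>\<^bsub>C\<^esub> Ident C (fobj G ?c))"
      using abc by (simp add: G.B.interchange)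
    have 2: "Ident C (fobj G ?a) \<boxtimes>\<^bsub>C\<^esub> (farr G ?bc \<cdot>\<^bsub>C\<^esub> Mu G ?b ?c) =
        (farr G (Ident B ?a) \<boxtimes>\<^bsub>C\<^esub> farr G ?bc) \<cdot>\<^bsub>C\<^esub> (Ident C (fobj G ?a) \<boxtimes>\<^bsub>C\<^esub> Mu G ?b ?c)"
      using abc by (simp add: G.B.interchange)
    have "farr ?K (Assoc A a b c) \<cdot>\<^bsub>C\<^esub> Mu ?K (a \<otimes>\<^bsub>A\<^esub> b) c \<cdot>\<^bsub>C\<^esub> (Mu ?K a b \<boxtimes>\<^bsub>C\<^esub> Ident C (fobj ?K c)) =
        farr G (farr F (Assoc A a b c)) \<cdot>\<^bsub>C\<^esub> farr G (Mu F (a \<otimes>\<^bsub>A\<^esub> b) c) \<cdot>\<^bsub>C\<^esub>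
          farr G (?ab \<boxtimes>\<^bsub>B\<^esub> Ident B ?c) \<cdot>\<^bsub>C\<^esub> Mu G (?a \<otimes>\<^bsub>B\<^esub> ?b) ?c \<cdot>\<^bsub>C\<^esub> (Mu G ?a ?b \<boxtimes>\<^bsub>C\<^esub> Ident C (fobj G ?c))"
      using abc nat[of ?ab "Ident B ?c" "Mu G ?a ?b \<boxtimes>\<^bsub>C\<^esub> Ident C (fobj G ?c)"] by (simp add: 1)
    also have "\<dots> = farr G (farr F (Assoc A a b c) \<cdot>\<^bsub>B\<^esub> Mu F (a \<otimes>\<^bsub>A\<^esub> b) c \<cdot>\<^bsub>B\<^esub> (?ab \<boxtimes>\<^bsub>B\<^esub> Ident B ?c)) \<cdot>\<^bsub>C\<^esub>
        Mu G (?a \<otimes>\<^bsub>B\<^esub> ?b) ?c \<cdot>\<^bsub>C\<^esub> (Mu G ?a ?b \<boxtimes>\<^bsub>C\<^esub> Ident C (fobj G ?c))"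
      using abc by (simp add: G.farr_Comp)
    also have "\<dots> = farr G (Mu F a (b \<otimes>\<^bsub>A\<^esub> c)) \<cdot>\<^bsub>C\<^esub> farr G (Ident B ?a \<boxtimes>\<^bsub>B\<^esub> ?bc) \<cdot>\<^bsub>C\<^esub> farr G (Assoc B ?a ?b ?c) \<cdot>\<^bsub>C\<^esub>
        Mu G (?a \<otimes>\<^bsub>B\<^esub> ?b) ?c \<cdot>\<^bsub>C\<^esub> (Mu G ?a ?b \<boxtimes>\<^bsub>C\<^esub> Ident C (fobj G ?c))"
      unfolding F.Mu_Assoc[OF abc] using abc by (simp add: G.farr_Comp)
    also have "\<dots> = farr G (Mu F a (b \<otimes>\<^bsub>A\<^esub> c)) \<cdot>\<^bsub>C\<^esub> farr G (Ident B ?a \<boxtimes>\<^bsub>B\<^esub> ?bc) \<cdot>\<^bsub>C\<^esub>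
        Mu G ?a (?b \<otimes>\<^bsub>B\<^esub> ?c) \<cdot>\<^bsub>C\<^esub> (Ident C (fobj G ?a) \<boxtimes>\<^bsub>C\<^esub> Mu G ?b ?c) \<cdot>\<^bsub>C\<^esub> Assoc C (fobj G ?a) (fobj G ?b) (fobj G ?c)"
      using abc by (simp add: G.Mu_Assoc)
    also have "\<dots> = Mu ?K a (b \<otimes>\<^bsub>A\<^esub> c) \<cdot>\<^bsub>C\<^esub> (Ident C (fobj ?K a) \<boxtimes>\<^bsub>C\<^esub> Mu ?K b c) \<cdot>\<^bsub>C\<^esub>
        Assoc C (fobj ?K a) (fobj ?K b) (fobj ?K c)"
      using abc nat[of "Ident B ?a" ?bc "(Ident C (fobj G ?a) \<boxtimes>\<^bsub>C\<^esub> Mu G ?b ?c) \<cdot>\<^bsub>C\<^esub> Assoc C (fobj G ?a) (fobj G ?b) (fobj G ?c)"]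
      by (simp add: 2)
    finally show "farr ?K (Assoc A a b c) \<cdot>\<^bsub>C\<^esub> Mu ?K (a \<otimes>\<^bsub>A\<^esub> b) c \<cdot>\<^bsub>C\<^esub> (Mu ?K a b \<boxtimes>\<^bsub>C\<^esub> Ident C (fobj ?K c)) =
        Mu ?K a (b \<otimes>\<^bsub>A\<^esub> c) \<cdot>\<^bsub>C\<^esub> (Ident C (fobj ?K a) \<boxtimes>\<^bsub>C\<^esub> Mu ?K b c) \<cdot>\<^bsub>C\<^esub>
        Assoc C (fobj ?K a) (fobj ?K b) (fobj ?K c)" .
  next
    fix a assume a: "a \<in> Obj A"
    let ?a = "fobj F a"
    have 1: "(farr G (Eps F) \<cdot>\<^bsub>C\<^esub> Eps G) \<boxtimes>\<^bsub>C\<^esub> Ident C (fobj G ?a) =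
        (farr G (Eps F) \<boxtimes>\<^bsub>C\<^esub> farr G (Ident B ?a)) \<cdot>\<^bsub>C\<^esub> (Eps G \<boxtimes>\<^bsub>C\<^esub> Ident C (fobj G ?a))"
      using a by (simp add: G.B.interchange)
    have "farr ?K (Lunit A a) \<cdot>\<^bsub>C\<^esub> Mu ?K (Unit A) a \<cdot>\<^bsub>C\<^esub> (Eps ?K \<boxtimes>\<^bsub>C\<^esub> Ident C (fobj ?K a)) =
        farr G (farr F (Lunit A a) \<cdot>\<^bsub>B\<^esub> Mu F (Unit A) a \<cdot>\<^bsub>B\<^esub> (Eps F \<boxtimes>\<^bsub>B\<^esub> Ident B ?a)) \<cdot>\<^bsub>C\<^esub>
        Mu G (Unit B) ?a \<cdot>\<^bsub>C\<^esub> (Eps G \<boxtimes>\<^bsub>C\<^esub> Ident C (fobj G ?a))"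
      using a nat[of "Eps F" "Ident B ?a" "Eps G \<boxtimes>\<^bsub>C\<^esub> Ident C (fobj G ?a)"] by (simp add: 1 G.farr_Comp)
    then show "farr ?K (Lunit A a) \<cdot>\<^bsub>C\<^esub> Mu ?K (Unit A) a \<cdot>\<^bsub>C\<^esub> (Eps ?K \<boxtimes>\<^bsub>C\<^esub> Ident C (fobj ?K a)) = Lunit C (fobj ?K a)"
      unfolding F.Mu_Lunit[OF a] using a by (simp add: G.Mu_Lunit)
    have 2: "Ident C (fobj G ?a) \<boxtimes>\<^bsub>C\<^esub> (farr G (Eps F) \<cdot>\<^bsub>C\<^esub> Eps G) =
        (farr G (Ident B ?a) \<boxtimes>\<^bsub>C\<^esub> farr G (Eps F)) \<cdot>\<^bsub>C\<^esub> (Ident C (fobj G ?a) \<boxtimes>\<^bsub>C\<^esub> Eps G)"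
      using a by (simp add: G.B.interchange)
    have "farr ?K (Runit A a) \<cdot>\<^bsub>C\<^esub> Mu ?K a (Unit A) \<cdot>\<^bsub>C\<^esub> (Ident C (fobj ?K a) \<boxtimes>\<^bsub>C\<^esub> Eps ?K) =
        farr G (farr F (Runit A a) \<cdot>\<^bsub>B\<^esub> Mu F a (Unit A) \<cdot>\<^bsub>B\<^esub> (Ident B ?a \<boxtimes>\<^bsub>B\<^esub> Eps F)) \<cdot>\<^bsub>C\<^esub>
        Mu G ?a (Unit B) \<cdot>\<^bsub>C\<^esub> (Ident C (fobj G ?a) \<boxtimes>\<^bsub>C\<^esub> Eps G)"
      using a nat[of "Ident B ?a" "Eps F" "Ident C (fobj G ?a) \<boxtimes>\<^bsub>C\<^esub> Eps G"] by (simp add: 2 G.farr_Comp)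
    then show "farr ?K (Runit A a) \<cdot>\<^bsub>C\<^esub> Mu ?K a (Unit A) \<cdot>\<^bsub>C\<^esub> (Ident C (fobj ?K a) \<boxtimes>\<^bsub>C\<^esub> Eps ?K) = Runit C (fobj ?K a)"
      unfolding F.Mu_Runit[OF a] using a by (simp add: G.Mu_Runit)
  next
    fix a b assume ab: "a \<in> Obj A" "b \<in> Obj A"
    let ?a = "fobj F a" and ?b = "fobj F b"
    have "farr ?K (Braid A a b) \<cdot>\<^bsub>C\<^esub> Mu ?K a b = farr G (farr F (Braid A a b) \<cdot>\<^bsub>B\<^esub> Mu F a b) \<cdot>\<^bsub>C\<^esub> Mu G ?a ?b"
      using ab by (simp add: G.farr_Comp)
    also have "\<dots> = farr G (Mu F b a) \<cdot>\<^bsub>C\<^esub> farr G (Braid B ?a ?b) \<cdot>\<^bsub>C\<^esub> Mu G ?a ?b"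
      unfolding F.Mu_Braid[OF ab] using ab by (simp add: G.farr_Comp)
    finally show "farr ?K (Braid A a b) \<cdot>\<^bsub>C\<^esub> Mu ?K a b = Mu ?K b a \<cdot>\<^bsub>C\<^esub> Braid C (fobj ?K a) (fobj ?K b)"
      using ab by (simp add: G.Mu_Braid)
  qed (simp_all add: hom_iff is_functor_comp_smfunctor[OF F.ftor G.ftor F.A.cat])
qed


locale monoidal_trans = F: sm_functor A B "nsrc t" + G: sm_functor A B "ntgt t"
  for A :: "('o1, 'a1, 'y) smcat_scheme" and B :: "('o2, 'a2, 'z) smcat_scheme"
    and t :: "(('o1, 'a1, 'o2, 'a2, 'w) smftor_scheme, 'o1, 'a2) ntrans" +
  assumes mon: "monoidal_transformation A B t"
begin

lemma nat: "natural A B t"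
  using mon by (simp add: monoidal_transformation_def)

lemma ncomp_simps [simp]:
  "a \<in> Obj A \<Longrightarrow> ncomp t a \<in> Arr B"
  "a \<in> Obj A \<Longrightarrow> Dom B (ncomp t a) = fobj (nsrc t) a"
  "a \<in> Obj A \<Longrightarrow> Cod B (ncomp t a) = fobj (ntgt t) a"
  using naturalD(4)[OF nat] by (auto simp: hom_iff)

lemma natural_eq: "f \<in> Arr A \<Longrightarrow>
    ncomp t (Cod A f) \<cdot>\<^bsub>B\<^esub> farr (nsrc t) f = farr (ntgt t) f \<cdot>\<^bsub>B\<^esub> ncomp t (Dom A f)"
  using naturalD(5)[OF nat arr_in_hom] .

lemma tensor_eq: "a \<in> Obj A \<Longrightarrow> b \<in> Obj A \<Longrightarrow>
    ncomp t (a \<otimes>\<^bsub>A\<^esub> b) \<cdot>\<^bsub>B\<^esub> Mu (nsrc t) a b = Mu (ntgt t) a b \<cdot>\<^bsub>B\<^esub> (ncomp t a \<boxtimes>\<^bsub>B\<^esub> ncomp t b)"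
  using mon by (simp add: monoidal_transformation_def)

lemma unit_eq: "ncomp t (Unit A) \<cdot>\<^bsub>B\<^esub> Eps (nsrc t) = Eps (ntgt t)"
  using mon by (simp add: monoidal_transformation_def)

end

lemma monoidal_transformation_id:
  assumes "symmetric_monoidal_category A" "symmetric_monoidal_category B" "symmetric_monoidal_functor A B F"
  shows "monoidal_transformation A B (ntrans_id A B F)"
proof -
  interpret F: sm_functor A B F using assms by unfold_locales
  show ?thesis
    unfolding monoidal_transformation_def
    by (simp add: natural_id[OF F.A.cat F.B.cat F.ftor])
qed

lemma monoidal_transformation_comp:
  assumes "monoidal_trans A B s" "monoidal_trans A B t" and eq: "nsrc t = ntgt s"
  shows "monoidal_transformation A B (ntrans_comp A B t s)"
proof -
  interpret s: monoidal_trans A B s by fact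
  interpret t: monoidal_trans A B t by fact
  have "ncomp t (a \<otimes>\<^bsub>A\<^esub> b) \<cdot>\<^bsub>B\<^esub> ncomp s (a \<otimes>\<^bsub>A\<^esub> b) \<cdot>\<^bsub>B\<^esub> Mu (nsrc s) a b =
      Mu (ntgt t) a b \<cdot>\<^bsub>B\<^esub> ((ncomp t a \<cdot>\<^bsub>B\<^esub> ncomp s a) \<boxtimes>\<^bsub>B\<^esub> (ncomp t b \<cdot>\<^bsub>B\<^esub> ncomp s b))"
    if ab: "a \<in> Obj A" "b \<in> Obj A" for a b
    using ab s.tensor_eq[OF ab] s.F.B.reassoc[OF t.tensor_eq[OF ab], of "ncomp s a \<boxtimes>\<^bsub>B\<^esub> ncomp s b"] eq
    by (simp add: s.F.B.interchange)
  then show ?thesis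
    unfolding monoidal_transformation_def
    using natural_comp[OF s.F.A.cat s.F.B.cat s.nat t.nat eq] s.unit_eq t.unit_eq eq
    by simp
qed

lemma monoidal_transformation_hcomp:
  assumes "monoidal_trans A B s" "monoidal_trans B C t"
  shows "monoidal_transformation A C \<lparr>nsrc = comp_smfunctor A C (nsrc t) (nsrc s),
     ntgt = comp_smfunctor A C (ntgt t) (ntgt s), ncomp = hcomp_components A C t s\<rparr>"
    (is "monoidal_transformation A C ?r")
proof -
  interpret s: monoidal_trans A B s by fact
  interpret t: monoidal_trans B C t by fact
  let ?F = "nsrc s" and ?F' = "ntgt s" and ?G = "nsrc t" and ?G' = "ntgt t"
  have nat: "natural A C ?r"
    by (rule natural_hcomp[OF s.F.A.cat s.F.B.cat t.F.B.cat s.nat t.nat])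
      (simp_all add: is_functor_comp_smfunctor[OF s.F.ftor t.F.ftor s.F.A.cat]
        is_functor_comp_smfunctor[OF s.G.ftor t.G.ftor s.F.A.cat])
  have tensor: "ncomp ?r (a \<otimes>\<^bsub>A\<^esub> b) \<cdot>\<^bsub>C\<^esub> Mu (nsrc ?r) a b = Mu (ntgt ?r) a b \<cdot>\<^bsub>C\<^esub> (ncomp ?r a \<boxtimes>\<^bsub>C\<^esub> ncomp ?r b)"
    if ab: "a \<in> Obj A" "b \<in> Obj A" for a b
  proof -
    let ?sab = "ncomp s a \<boxtimes>\<^bsub>B\<^esub> ncomp s b"
    have "ncomp ?r (a \<otimes>\<^bsub>A\<^esub> b) \<cdot>\<^bsub>C\<^esub> Mu (nsrc ?r) a b =
        ncomp t (fobj ?F' (a \<otimes>\<^bsub>A\<^esub> b)) \<cdot>\<^bsub>C\<^esub> farr ?G (ncomp s (a \<otimes>\<^bsub>A\<^esub> b) \<cdot>\<^bsub>B\<^esub> Mu ?F a b) \<cdot>\<^bsub>C\<^esub> Mu ?G (fobj ?F a) (fobj ?F b)"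
      using ab by (simp add: hcomp_components_def t.F.farr_Comp)
    also have "\<dots> = ncomp t (fobj ?F' (a \<otimes>\<^bsub>A\<^esub> b)) \<cdot>\<^bsub>C\<^esub> farr ?G (Mu ?F' a b) \<cdot>\<^bsub>C\<^esub> farr ?G ?sab \<cdot>\<^bsub>C\<^esub> Mu ?G (fobj ?F a) (fobj ?F b)"
      using ab by (simp add: t.F.farr_Comp s.tensor_eq)
    also have "farr ?G ?sab \<cdot>\<^bsub>C\<^esub> Mu ?G (fobj ?F a) (fobj ?F b) =
        Mu ?G (fobj ?F' a) (fobj ?F' b) \<cdot>\<^bsub>C\<^esub> (farr ?G (ncomp s a) \<boxtimes>\<^bsub>C\<^esub> farr ?G (ncomp s b))"
      using ab t.F.Mu_natural[of "ncomp s a" "ncomp s b"] by simp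
    also have "ncomp t (fobj ?F' (a \<otimes>\<^bsub>A\<^esub> b)) \<cdot>\<^bsub>C\<^esub> farr ?G (Mu ?F' a b) \<cdot>\<^bsub>C\<^esub>
          Mu ?G (fobj ?F' a) (fobj ?F' b) \<cdot>\<^bsub>C\<^esub> (farr ?G (ncomp s a) \<boxtimes>\<^bsub>C\<^esub> farr ?G (ncomp s b)) =
        farr ?G' (Mu ?F' a b) \<cdot>\<^bsub>C\<^esub> ncomp t (fobj ?F' a \<otimes>\<^bsub>B\<^esub> fobj ?F' b) \<cdot>\<^bsub>C\<^esub>
          Mu ?G (fobj ?F' a) (fobj ?F' b) \<cdot>\<^bsub>C\<^esub> (farr ?G (ncomp s a) \<boxtimes>\<^bsub>C\<^esub> farr ?G (ncomp s b))"
      using ab t.natural_eq[of "Mu ?F' a b"] by (intro t.F.B.reassoc) simp_all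
    also have "ncomp t (fobj ?F' a \<otimes>\<^bsub>B\<^esub> fobj ?F' b) \<cdot>\<^bsub>C\<^esub>
          Mu ?G (fobj ?F' a) (fobj ?F' b) \<cdot>\<^bsub>C\<^esub> (farr ?G (ncomp s a) \<boxtimes>\<^bsub>C\<^esub> farr ?G (ncomp s b)) =
        Mu ?G' (fobj ?F' a) (fobj ?F' b) \<cdot>\<^bsub>C\<^esub> (ncomp t (fobj ?F' a) \<boxtimes>\<^bsub>C\<^esub> ncomp t (fobj ?F' b)) \<cdot>\<^bsub>C\<^esub>
          (farr ?G (ncomp s a) \<boxtimes>\<^bsub>C\<^esub> farr ?G (ncomp s b))"
      using ab t.tensor_eq by (intro t.F.B.reassoc) simp_all
    finally show ?thesis
      using ab by (simp add: hcomp_components_def t.F.B.interchange)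
  qed
  have "ncomp ?r (Unit A) \<cdot>\<^bsub>C\<^esub> Eps (nsrc ?r) =
      ncomp t (fobj ?F' (Unit A)) \<cdot>\<^bsub>C\<^esub> farr ?G (ncomp s (Unit A) \<cdot>\<^bsub>B\<^esub> Eps ?F) \<cdot>\<^bsub>C\<^esub> Eps ?G"
    by (simp add: hcomp_components_def t.F.farr_Comp)
  also have "\<dots> = ncomp t (fobj ?F' (Unit A)) \<cdot>\<^bsub>C\<^esub> farr ?G (Eps ?F') \<cdot>\<^bsub>C\<^esub> Eps ?G"
    by (simp add: s.unit_eq)
  also have "\<dots> = farr ?G' (Eps ?F') \<cdot>\<^bsub>C\<^esub> ncomp t (Unit B) \<cdot>\<^bsub>C\<^esub> Eps ?G"
    using t.natural_eq[of "Eps ?F'"] by (intro t.F.B.reassoc) simp_all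
  also have "\<dots> = Eps (ntgt ?r)" by (simp add: t.unit_eq)
  finally show ?thesis
    unfolding monoidal_transformation_def using nat tensor by blast
qed

text \<open>
  Insert \<open>t \<cdot> s = 1\<close> on the right, move \<open>t\<close> across the structure maps, and cancel it against \<open>s\<close>.
\<close>

lemma monoidal_transformation_inverse:
  assumes "monoidal_trans A B t" and s: "natural A B s" "nsrc s = ntgt t" "ntgt s = nsrc t"
    and st: "ntrans_comp A B s t = ntrans_id A B (nsrc t)" and ts: "ntrans_comp A B t s = ntrans_id A B (ntgt t)"
  shows "monoidal_transformation A B s"
proof -
  interpret t: monoidal_trans A B t by fact
  let ?F = "nsrc t" and ?G = "ntgt t"
  have s_simps [simp]: "ncomp s a \<in> Arr B" "Dom B (ncomp s a) = fobj ?G a" "Cod B (ncomp s a) = fobj ?F a"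
    if "a \<in> Obj A" for a using naturalD(4)[OF s(1) that] s by (auto simp: hom_iff)
  have st': "ncomp s a \<cdot>\<^bsub>B\<^esub> ncomp t a = Ident B (fobj ?F a)" if "a \<in> Obj A" for a
    using arg_cong[OF st, of "\<lambda>r. ncomp r a"] that by simp
  have ts': "ncomp t a \<cdot>\<^bsub>B\<^esub> ncomp s a = Ident B (fobj ?G a)" if "a \<in> Obj A" for a
    using arg_cong[OF ts, of "\<lambda>r. ncomp r a"] that by simp
  have cancel: "ncomp s a \<cdot>\<^bsub>B\<^esub> ncomp t a \<cdot>\<^bsub>B\<^esub> k = k" if "a \<in> Obj A" "k \<in> Arr B" "Cod B k = fobj ?F a" for a k
    using that st' t.F.B.assoc[of k "ncomp t a" "ncomp s a"] by simp
  have "ncomp s (a \<otimes>\<^bsub>A\<^esub> b) \<cdot>\<^bsub>B\<^esub> Mu ?G a b = Mu ?F a b \<cdot>\<^bsub>B\<^esub> (ncomp s a \<boxtimes>\<^bsub>B\<^esub> ncomp s b)"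
    if ab: "a \<in> Obj A" "b \<in> Obj A" for a b
  proof -
    have "ncomp s (a \<otimes>\<^bsub>A\<^esub> b) \<cdot>\<^bsub>B\<^esub> Mu ?G a b = ncomp s (a \<otimes>\<^bsub>A\<^esub> b) \<cdot>\<^bsub>B\<^esub> Mu ?G a b \<cdot>\<^bsub>B\<^esub>
        ((ncomp t a \<boxtimes>\<^bsub>B\<^esub> ncomp t b) \<cdot>\<^bsub>B\<^esub> (ncomp s a \<boxtimes>\<^bsub>B\<^esub> ncomp s b))"
      using ab by (simp add: t.F.B.interchange ts')
    also have "\<dots> = ncomp s (a \<otimes>\<^bsub>A\<^esub> b) \<cdot>\<^bsub>B\<^esub> ncomp t (a \<otimes>\<^bsub>A\<^esub> b) \<cdot>\<^bsub>B\<^esub> Mu ?F a b \<cdot>\<^bsub>B\<^esub> (ncomp s a \<boxtimes>\<^bsub>B\<^esub> ncomp s b)"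
      using ab t.F.B.reassoc[OF t.tensor_eq[OF ab], of "ncomp s a \<boxtimes>\<^bsub>B\<^esub> ncomp s b"] by simp
    also have "\<dots> = Mu ?F a b \<cdot>\<^bsub>B\<^esub> (ncomp s a \<boxtimes>\<^bsub>B\<^esub> ncomp s b)"
      using ab by (intro cancel) simp_all
    finally show ?thesis .
  qed
  moreover have "ncomp s (Unit A) \<cdot>\<^bsub>B\<^esub> Eps ?G = Eps ?F"
    unfolding t.unit_eq[symmetric] by (intro cancel) simp_all
  ultimately show ?thesis
    unfolding monoidal_transformation_def using s by simp
qed

lemma is_colimit_cong:
  assumes "category J" "\<And>i. i \<in> Obj J \<Longrightarrow> l i = l' i"
  shows "is_colimit J C X c l = is_colimit J C X c l'"
proof -
  interpret cat_laws J using assms by unfold_locales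
  show ?thesis unfolding is_colimit_def is_cocone_def by (simp add: assms)
qed

lemma is_colimitD:
  assumes "is_colimit J C X c l"
  shows "c \<in> Obj C" "\<And>i. i \<in> Obj J \<Longrightarrow> l i \<in> hom C (fobj X i) c"
  using assms by (auto simp: is_colimit_def is_cocone_def)

lemma preserves_colimits_id:
  fixes P :: "('u, 'u) cat \<Rightarrow> bool" and A :: "('o, 'a, 'z) smcat_scheme"
  assumes A: "category A"
  shows "preserves_colimits P A A (id_smfunctor A)"
  unfolding preserves_colimits_def
proof safe
  fix J :: "('u, 'u) cat" and X :: "('u, 'u, 'o, 'a) ftor" and c l
  assume J: "small_category J" and X: "is_functor J A X" and l: "is_colimit J A X c l"
  have J': "category J" using J by (simp add: small_category_def)
  have "comp_functor J (id_smfunctor A) X = comp_functor J (id_functor A) X"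
    by (simp add: comp_functor_def id_smfunctor_def id_functor_def)
  then have "comp_functor J (id_smfunctor A) X = X" using comp_functor_id_left[OF X J' A] by simp
  moreover have "is_colimit J A X c (\<lambda>i. farr (id_smfunctor A) (l i)) = is_colimit J A X c l"
    using is_colimitD(2)[OF l] by (intro is_colimit_cong[OF J']) (auto simp: hom_iff)
  ultimately show "is_colimit J A (comp_functor J (id_smfunctor A) X) (fobj (id_smfunctor A) c)
      (\<lambda>i. farr (id_smfunctor A) (l i))"
    using l is_colimitD(1)[OF l] by simp
qed

lemma preserves_colimits_comp:
  fixes P :: "('u, 'u) cat \<Rightarrow> bool" and A :: "('o, 'a, 'z) smcat_scheme"
  assumes F: "preserves_colimits P A B F" "is_functor A B F" and G: "preserves_colimits P B C G" "is_functor B C G"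
  shows "preserves_colimits P A C (comp_smfunctor A D G F)"
  unfolding preserves_colimits_def
proof safe
  fix J :: "('u, 'u) cat" and X :: "('u, 'u, 'o, 'a) ftor" and c l
  assume J: "small_category J" and P: "P J" and X: "is_functor J A X" and l: "is_colimit J A X c l"
  have J': "category J" using J by (simp add: small_category_def)
  have Fl: "is_colimit J B (comp_functor J F X) (fobj F c) (\<lambda>i. farr F (l i))"
    using F(1) J P X l unfolding preserves_colimits_def by blast
  have FX: "is_functor J B (comp_functor J F X)" using is_functor_comp[OF X F(2) J'] .
  have GFl: "is_colimit J C (comp_functor J G (comp_functor J F X)) (fobj G (fobj F c)) (\<lambda>i. farr G (farr F (l i)))"
    using G(1) J P FX Fl unfolding preserves_colimits_def by blast
  have "comp_functor J (comp_smfunctor A D G F) X = comp_functor J G (comp_functor J F X)"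
    using functor_fobj[OF X] functor_farr[OF X arr_in_hom]
    by (auto simp: comp_functor_def hom_iff intro!: ext)
  moreover have "is_colimit J C (comp_functor J G (comp_functor J F X)) (fobj G (fobj F c))
      (\<lambda>i. farr (comp_smfunctor A D G F) (l i)) =
    is_colimit J C (comp_functor J G (comp_functor J F X)) (fobj G (fobj F c)) (\<lambda>i. farr G (farr F (l i)))"
    using is_colimitD(2)[OF l] by (intro is_colimit_cong[OF J']) (auto simp: hom_iff)
  ultimately show "is_colimit J C (comp_functor J (comp_smfunctor A D G F) X) (fobj (comp_smfunctor A D G F) c)
      (\<lambda>i. farr (comp_smfunctor A D G F) (l i))"
    using GFl is_colimitD(1)[OF l] by simp
qed

lemma Hom_Com2Ring_simps [simp]:
  "Obj (Hom_Com2Ring u A B) = {F. symmetric_monoidal_functor A B F \<and> cocontinuous u A B F}"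
  "Arr (Hom_Com2Ring u A B) = {t. symmetric_monoidal_functor A B (nsrc t) \<and> cocontinuous u A B (nsrc t) \<and>
     symmetric_monoidal_functor A B (ntgt t) \<and> cocontinuous u A B (ntgt t) \<and> monoidal_transformation A B t}"
  "Dom (Hom_Com2Ring u A B) = nsrc" "Cod (Hom_Com2Ring u A B) = ntgt"
  "Ident (Hom_Com2Ring u A B) = ntrans_id A B" "Comp (Hom_Com2Ring u A B) = ntrans_comp A B"
  by (simp_all add: Hom_Com2Ring_def)

lemma monoidal_transI:
  "symmetric_monoidal_category A \<Longrightarrow> symmetric_monoidal_category B \<Longrightarrow> t \<in> Arr (Hom_Com2Ring u A B) \<Longrightarrow>
     monoidal_trans A B t"
  by unfold_locales auto

lemma monoidal_transformation_natural: "monoidal_transformation A B t \<Longrightarrow> natural A B t"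
  by (simp add: monoidal_transformation_def)

lemma category_Hom_Com2Ring:
  assumes A: "symmetric_monoidal_category A" and B: "symmetric_monoidal_category B"
  shows "category (Hom_Com2Ring u A B)"
proof -
  have B': "category B" using B by (simp add: symmetric_monoidal_category_def)
  show ?thesis
  proof (rule categoryI)
    fix f g a b c assume "f \<in> hom (Hom_Com2Ring u A B) a b" "g \<in> hom (Hom_Com2Ring u A B) b c"
    then show "g \<cdot>\<^bsub>Hom_Com2Ring u A B\<^esub> f \<in> hom (Hom_Com2Ring u A B) a c"
      using monoidal_transformation_comp[OF monoidal_transI[OF A B, of f u] monoidal_transI[OF A B, of g u]]
      by (auto simp: hom_iff)
  next
    fix f g h a b c d
    assume "f \<in> hom (Hom_Com2Ring u A B) a b" "g \<in> hom (Hom_Com2Ring u A B) b c"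
      "h \<in> hom (Hom_Com2Ring u A B) c d"
    then show "(h \<cdot>\<^bsub>Hom_Com2Ring u A B\<^esub> g) \<cdot>\<^bsub>Hom_Com2Ring u A B\<^esub> f =
        h \<cdot>\<^bsub>Hom_Com2Ring u A B\<^esub> (g \<cdot>\<^bsub>Hom_Com2Ring u A B\<^esub> f)"
      using ntrans_comp_assoc[OF B', of A f g h] by (auto simp: hom_iff monoidal_transformation_natural)
  next
    fix f a b assume "f \<in> hom (Hom_Com2Ring u A B) a b"
    then show "f \<cdot>\<^bsub>Hom_Com2Ring u A B\<^esub> Ident (Hom_Com2Ring u A B) a = f"
      "Ident (Hom_Com2Ring u A B) b \<cdot>\<^bsub>Hom_Com2Ring u A B\<^esub> f = f"
      using ntrans_comp_id_right[OF B', of A f] ntrans_comp_id_left[OF B', of A f]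
      by (auto simp: hom_iff monoidal_transformation_natural)
  qed (auto simp: hom_iff monoidal_transformation_id[OF A B])
qed

lemma smfunctor_eqI:
  fixes F G :: "('o1, 'a1, 'o2, 'a2) smftor"
  assumes "symmetric_monoidal_functor A B F" "symmetric_monoidal_functor A B' G"
    and "\<And>a. a \<in> Obj A \<Longrightarrow> fobj F a = fobj G a" "\<And>f. f \<in> Arr A \<Longrightarrow> farr F f = farr G f"
    and "\<And>a b. a \<in> Obj A \<Longrightarrow> b \<in> Obj A \<Longrightarrow> Mu F a b = Mu G a b" "Eps F = Eps G"
  shows "F = G"
proof -
  have F: "is_functor A B F" and G: "is_functor A B' G"
    using assms(1,2) by (simp_all add: symmetric_monoidal_functor_def)
  have mu: "Mu F a b = undefined \<and> Mu G a b = undefined" if "a \<notin> Obj A \<or> b \<notin> Obj A" for a b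
    using assms(1,2) that by (simp add: symmetric_monoidal_functor_def)
  have "fobj F = fobj G"
    by (rule extensionalityI[OF functor_fobj_extensional[OF F] functor_fobj_extensional[OF G] assms(3)])
  moreover have "farr F = farr G"
    by (rule extensionalityI[OF functor_farr_extensional[OF F] functor_farr_extensional[OF G] assms(4)])
  moreover have "Mu F = Mu G"
  proof (intro ext)
    fix a b show "Mu F a b = Mu G a b"
      using assms(5) mu by (cases "a \<in> Obj A \<and> b \<in> Obj A") auto
  qed
  ultimately show ?thesis using assms(6) by simp
qed

lemma Com2Ring_simps [simp]:
  "Cell0 (Com2Ring u) = {A. commutative_2_ring u A}" "HomCat (Com2Ring u) = Hom_Com2Ring u"
  "Ident1 (Com2Ring u) = id_smfunctor"
  "HComp1 (Com2Ring u) A B C g f = comp_smfunctor A C g f"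
  "HComp2 (Com2Ring u) A B C t s =
     \<lparr>nsrc = comp_smfunctor A C (nsrc t) (nsrc s), ntgt = comp_smfunctor A C (ntgt t) (ntgt s),
      ncomp = hcomp_components A C t s\<rparr>"
  by (simp_all add: Com2Ring_def)

lemma comp_smfunctor_id_right:
  assumes A: "symmetric_monoidal_category A" and B: "symmetric_monoidal_category B"
    and F: "symmetric_monoidal_functor A B F"
  shows "comp_smfunctor A B F (id_smfunctor A) = F"
proof -
  interpret F: sm_functor A B F using assms by unfold_locales
  show ?thesis
    by (rule smfunctor_eqI[OF symmetric_monoidal_functor_comp[OF A A B symmetric_monoidal_functor_id[OF A] F] F])
      simp_all
qed

lemma comp_smfunctor_id_left:
  assumes A: "symmetric_monoidal_category A" and B: "symmetric_monoidal_category B"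
    and F: "symmetric_monoidal_functor A B F"
  shows "comp_smfunctor A B (id_smfunctor B) F = F"
proof -
  interpret F: sm_functor A B F using assms by unfold_locales
  show ?thesis
    by (rule smfunctor_eqI[OF symmetric_monoidal_functor_comp[OF A B B F symmetric_monoidal_functor_id[OF B]] F])
      simp_all
qed

lemma comp_smfunctor_assoc:
  assumes A: "symmetric_monoidal_category A" and B: "symmetric_monoidal_category B"
    and C: "symmetric_monoidal_category C" and D: "symmetric_monoidal_category D"
    and F: "symmetric_monoidal_functor A B F" and G: "symmetric_monoidal_functor B C G"
    and H: "symmetric_monoidal_functor C D H"
  shows "comp_smfunctor A D (comp_smfunctor B D H G) F = comp_smfunctor A D H (comp_smfunctor A C G F)"
proof -
  interpret F: sm_functor A B F using assms by unfold_locales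
  interpret G: sm_functor B C G using assms by unfold_locales
  interpret H: sm_functor C D H using assms by unfold_locales
  note comp = symmetric_monoidal_functor_comp
  show ?thesis
    by (rule smfunctor_eqI[OF comp[OF A B D F comp[OF B C D G H]] comp[OF A C D comp[OF A B C F G] H]])
      (simp_all add: H.farr_Comp)
qed

lemma two_category_Com2Ring:
  fixes u :: "'u itself"
  shows "two_category (Com2Ring u :: (('o, 'a) smcat, ('o, 'a) sm_endo, ('o, 'a) sm_trans) two_cat)"
proof -
  have sm: "symmetric_monoidal_category A" if "commutative_2_ring u A" for A :: "('o, 'a) smcat"
    using that by (simp add: commutative_2_ring_def)
  have cat: "category A" if "commutative_2_ring u A" for A :: "('o, 'a) smcat"
    using sm[OF that] by (simp add: symmetric_monoidal_category_def)
  have Obj_comp: "comp_smfunctor A C g f \<in> Obj (Hom_Com2Ring u A C)"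
    if "commutative_2_ring u A" "commutative_2_ring u B" "commutative_2_ring u C"
      "f \<in> Obj (Hom_Com2Ring u A B)" "g \<in> Obj (Hom_Com2Ring u B C)" for A B C :: "('o, 'a) smcat" and f g
  proof -
    have "symmetric_monoidal_functor A B f" "symmetric_monoidal_functor B C g" using that by auto
    moreover from this have "is_functor A B f" "is_functor B C g"
      by (auto simp: symmetric_monoidal_functor_def)
    moreover have "preserves_colimits (\<lambda>J :: ('u, 'u) cat. True) A B f"
      "preserves_colimits (\<lambda>J :: ('u, 'u) cat. True) B C g" using that by (auto simp: cocontinuous_def)
    ultimately show ?thesis
      using preserves_colimits_comp[of _ A B f C g C] symmetric_monoidal_functor_comp[OF sm sm sm, of A B C f g] that(1-3)
      by (simp add: cocontinuous_def)
  qed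
  have Arr_nat: "natural A B t" "nsrc t \<in> Obj (Hom_Com2Ring u A B)" "ntgt t \<in> Obj (Hom_Com2Ring u A B)"
    if "t \<in> Arr (Hom_Com2Ring u A B)" for A B :: "('o, 'a) smcat" and t
    using that monoidal_transformation_natural by auto
  have Obj_ftor: "is_functor A B f" if "f \<in> Obj (Hom_Com2Ring u A B)" for A B :: "('o, 'a) smcat" and f
    using that by (simp add: symmetric_monoidal_functor_def)
  let ?hcomp = "HComp2 (Com2Ring u) :: ('o, 'a) smcat \<Rightarrow> _"
  have 1: "?hcomp A B C t s \<in> hom (Hom_Com2Ring u A C)
      (comp_smfunctor A C (nsrc t) (nsrc s)) (comp_smfunctor A C (ntgt t) (ntgt s))"
    if "commutative_2_ring u A" "commutative_2_ring u B" "commutative_2_ring u C"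
      and s: "s \<in> Arr (Hom_Com2Ring u A B)" and t: "t \<in> Arr (Hom_Com2Ring u B C)"
    for A B C :: "('o, 'a) smcat" and s t
    using monoidal_transformation_hcomp[OF monoidal_transI[OF sm sm s] monoidal_transI[OF sm sm t]] that
      Obj_comp[OF that(1-3) Arr_nat(2)[OF s] Arr_nat(2)[OF t]]
      Obj_comp[OF that(1-3) Arr_nat(3)[OF s] Arr_nat(3)[OF t]] by (simp add: hom_iff)
  have 2: "?hcomp A B C (ntrans_id B C g) (ntrans_id A B f) = ntrans_id A C (comp_smfunctor A C g f)"
    if "commutative_2_ring u A" "commutative_2_ring u B" "commutative_2_ring u C"
      "f \<in> Obj (Hom_Com2Ring u A B)" "g \<in> Obj (Hom_Com2Ring u B C)" for A B C :: "('o, 'a) smcat" and f g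
    by (rule ntrans_eqI[where A = "Obj A"])
      (simp_all add: hcomp_components_id[OF cat cat cat Obj_ftor Obj_ftor, OF that])
  have 3: "?hcomp A B C (ntrans_comp B C t' t) (ntrans_comp A B s' s) =
      ntrans_comp A C (?hcomp A B C t' s') (?hcomp A B C t s)"
    if "commutative_2_ring u A" "commutative_2_ring u B" "commutative_2_ring u C"
      "s \<in> Arr (Hom_Com2Ring u A B)" "s' \<in> Arr (Hom_Com2Ring u A B)" "nsrc s' = ntgt s"
      "t \<in> Arr (Hom_Com2Ring u B C)" "t' \<in> Arr (Hom_Com2Ring u B C)" "nsrc t' = ntgt t"
    for A B C :: "('o, 'a) smcat" and s s' t t'
    by (rule ntrans_eqI[where A = "Obj A"])
      (simp_all add: hcomp_components_interchange[OF cat cat cat Arr_nat(1) Arr_nat(1) _ Arr_nat(1) Arr_nat(1), OF that])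
  have 4: "?hcomp A A B s (ntrans_id A A (id_smfunctor A)) = s"
      "?hcomp A B B (ntrans_id B B (id_smfunctor B)) s = s"
    if A: "commutative_2_ring u A" and B: "commutative_2_ring u B" and s: "s \<in> Arr (Hom_Com2Ring u A B)"
    for A B :: "('o, 'a) smcat" and s
    using s by (intro ntrans_eqI[where A = "Obj A"];
      simp add: hcomp_components_id_right[OF cat[OF A] cat[OF B] cat[OF B] Arr_nat(1)[OF s]]
        hcomp_components_id_left[OF cat[OF A] cat[OF B] cat[OF B] Arr_nat(1)[OF s]]
        naturalD(3)[OF Arr_nat(1)[OF s]] comp_smfunctor_id_right[OF sm[OF A] sm[OF B]]
        comp_smfunctor_id_left[OF sm[OF A] sm[OF B]])+
  have 5: "?hcomp A B D (?hcomp B C D t s) r = ?hcomp A C D t (?hcomp A B C s r)"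
    if A: "commutative_2_ring u A" and B: "commutative_2_ring u B" and C: "commutative_2_ring u C"
      and D: "commutative_2_ring u D" and r: "r \<in> Arr (Hom_Com2Ring u A B)"
      and s: "s \<in> Arr (Hom_Com2Ring u B C)" and t: "t \<in> Arr (Hom_Com2Ring u C D)"
    for A B C D :: "('o, 'a) smcat" and r s t
  proof -
    have "hcomp_components A D (?hcomp B C D t s) r a = hcomp_components A D t (?hcomp A B C s r) a"
      if "a \<in> Obj A" for a
      by (rule hcomp_components_assoc[OF cat[OF A] cat[OF B] cat[OF C] Arr_nat(1)[OF r] Arr_nat(1)[OF s]
          Arr_nat(1)[OF t] cat[OF D]]) (use that functor_fobj[OF naturalD(2)[OF Arr_nat(1)[OF r]]] in simp_all)
    then show ?thesis
      using r s t
      by (intro ntrans_eqI[where A = "Obj A"])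
        (simp_all add: comp_smfunctor_assoc[OF sm[OF A] sm[OF B] sm[OF C] sm[OF D]])
  qed
  have 6: "id_smfunctor A \<in> Obj (Hom_Com2Ring u A A)" if "commutative_2_ring u A" for A :: "('o, 'a) smcat"
    using symmetric_monoidal_functor_id[OF sm[OF that]] preserves_colimits_id[OF cat[OF that]]
    by (simp add: cocontinuous_def)
  show ?thesis
    unfolding two_category_def Com2Ring_simps(1-4) Hom_Com2Ring_simps(3-6) mem_Collect_eq
    by (intro conjI ballI impI category_Hom_Com2Ring sm Obj_comp 1 2 3 4 5 6
        comp_smfunctor_id_right comp_smfunctor_id_left comp_smfunctor_assoc; (assumption | simp)?)
qed

lemma two_category_one_opposite:
  assumes "two_category T" shows "two_category (one_opposite T)"
  using assms unfolding two_category_def one_opposite_def by (elim conjE, intro conjI ballI impI) simp_all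

section \<open>Colimits and colimits of functors\<close>

lemma is_coconeI:
  assumes "c \<in> Obj C" "\<And>i. i \<in> Obj J \<Longrightarrow> l i \<in> hom C (fobj X i) c"
    and "\<And>k i j. k \<in> hom J i j \<Longrightarrow> l j \<cdot>\<^bsub>C\<^esub> farr X k = l i"
  shows "is_cocone J C X c l"
  using assms by (auto simp: is_cocone_def hom_iff)

lemma is_coconeD:
  assumes "is_cocone J C X c l"
  shows "c \<in> Obj C" "\<And>i. i \<in> Obj J \<Longrightarrow> l i \<in> hom C (fobj X i) c"
    and "\<And>k i j. k \<in> hom J i j \<Longrightarrow> l j \<cdot>\<^bsub>C\<^esub> farr X k = l i"
  using assms by (auto simp: is_cocone_def hom_iff)

lemma is_colimit_cocone: "is_colimit J C X c l \<Longrightarrow> is_cocone J C X c l"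
  by (simp add: is_colimit_def)

lemma is_cocone_postcomp:
  assumes C: "category C" and J: "category J" and X: "is_functor J C X" and l: "is_cocone J C X c l"
    and h: "h \<in> hom C c d"
  shows "is_cocone J C X d (\<lambda>i. h \<cdot>\<^bsub>C\<^esub> l i)"
proof (rule is_coconeI)
  fix k i j assume k: "k \<in> hom J i j"
  then have "i \<in> Obj J" "j \<in> Obj J" using hom_Obj[OF J] by auto
  then show "(h \<cdot>\<^bsub>C\<^esub> l j) \<cdot>\<^bsub>C\<^esub> farr X k = h \<cdot>\<^bsub>C\<^esub> l i"
    using Comp_assoc[OF C functor_farr[OF X k] is_coconeD(2)[OF l] h] is_coconeD(3)[OF l k] by simp
qed (use hom_Obj[OF C h] Comp_in_hom[OF C is_coconeD(2)[OF l] h] in auto)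

lemma colimit_factor:
  assumes "is_colimit J C X c l" "is_cocone J C X c' l'"
  obtains h where "h \<in> hom C c c'" "\<And>i. i \<in> Obj J \<Longrightarrow> h \<cdot>\<^bsub>C\<^esub> l i = l' i"
  using assms unfolding is_colimit_def by blast

lemma colimit_ext:
  assumes C: "category C" and J: "category J" and X: "is_functor J C X" and l: "is_colimit J C X c l"
    and h: "h \<in> hom C c d" "h' \<in> hom C c d"
    and eq: "\<And>i. i \<in> Obj J \<Longrightarrow> h \<cdot>\<^bsub>C\<^esub> l i = h' \<cdot>\<^bsub>C\<^esub> l i"
  shows "h = h'"
proof -
  have "\<exists>!k. k \<in> hom C c d \<and> (\<forall>i\<in>Obj J. k \<cdot>\<^bsub>C\<^esub> l i = h' \<cdot>\<^bsub>C\<^esub> l i)"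
    using l is_cocone_postcomp[OF C J X is_colimit_cocone[OF l] h(2)] unfolding is_colimit_def by simp
  then show ?thesis using h eq by blast
qed

lemma is_colimitI:
  assumes "is_cocone J C X c l"
    and "\<And>c' l'. is_cocone J C X c' l' \<Longrightarrow> \<exists>h \<in> hom C c c'. \<forall>i \<in> Obj J. h \<cdot>\<^bsub>C\<^esub> l i = l' i"
    and "\<And>d h h'. h \<in> hom C c d \<Longrightarrow> h' \<in> hom C c d \<Longrightarrow>
      (\<And>i. i \<in> Obj J \<Longrightarrow> h \<cdot>\<^bsub>C\<^esub> l i = h' \<cdot>\<^bsub>C\<^esub> l i) \<Longrightarrow> h = h'"
  shows "is_colimit J C X c l"
  unfolding is_colimit_def
proof (intro conjI allI impI)
  fix c' l' assume l': "is_cocone J C X c' l'"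
  obtain h where h: "h \<in> hom C c c'" "\<forall>i \<in> Obj J. h \<cdot>\<^bsub>C\<^esub> l i = l' i" using assms(2)[OF l'] by blast
  show "\<exists>!h. h \<in> hom C c c' \<and> (\<forall>i\<in>Obj J. h \<cdot>\<^bsub>C\<^esub> l i = l' i)"
  proof (rule ex1I[of _ h])
    fix k assume "k \<in> hom C c c' \<and> (\<forall>i\<in>Obj J. k \<cdot>\<^bsub>C\<^esub> l i = l' i)"
    then show "k = h" using h by (intro assms(3)[of k c' h]) simp_all
  qed (use h in simp)
qed (fact assms(1))

lemma colimit_transport:
  assumes C: "category C" and J: "category J" and X: "is_functor J C X" and l: "is_colimit J C X c l"
    and h: "h \<in> hom C c d" "is_iso C h"
  shows "is_colimit J C X d (\<lambda>i. h \<cdot>\<^bsub>C\<^esub> l i)"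
proof -
  obtain g where g: "g \<in> hom C d c" "g \<cdot>\<^bsub>C\<^esub> h = Ident C c" "h \<cdot>\<^bsub>C\<^esub> g = Ident C d"
    using is_isoE[OF h(2,1)] by blast
  note li = is_coconeD(2)[OF is_colimit_cocone[OF l]]
  show ?thesis
  proof (rule is_colimitI)
    show "is_cocone J C X d (\<lambda>i. h \<cdot>\<^bsub>C\<^esub> l i)"
      using is_cocone_postcomp[OF C J X is_colimit_cocone[OF l] h(1)] .
  next
    fix c' l' assume l': "is_cocone J C X c' l'"
    obtain k where k: "k \<in> hom C c c'" "\<And>i. i \<in> Obj J \<Longrightarrow> k \<cdot>\<^bsub>C\<^esub> l i = l' i" using colimit_factor[OF l l'] by blast
    have "(k \<cdot>\<^bsub>C\<^esub> g) \<cdot>\<^bsub>C\<^esub> (h \<cdot>\<^bsub>C\<^esub> l i) = l' i" if i: "i \<in> Obj J" for i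
      using Comp_assoc[OF C Comp_in_hom[OF C li[OF i] h(1)] g(1) k(1)]
        Comp_cancel_left[OF C li[OF i] h(1) g(1) g(2)] k(2)[OF i] by simp
    then show "\<exists>h'\<in>hom C d c'. \<forall>i\<in>Obj J. h' \<cdot>\<^bsub>C\<^esub> (h \<cdot>\<^bsub>C\<^esub> l i) = l' i"
      using Comp_in_hom[OF C g(1) k(1)] by blast
  next
    fix e k k' assume k: "k \<in> hom C d e" "k' \<in> hom C d e"
      and eq: "\<And>i. i \<in> Obj J \<Longrightarrow> k \<cdot>\<^bsub>C\<^esub> (h \<cdot>\<^bsub>C\<^esub> l i) = k' \<cdot>\<^bsub>C\<^esub> (h \<cdot>\<^bsub>C\<^esub> l i)"
    have "k \<cdot>\<^bsub>C\<^esub> h = k' \<cdot>\<^bsub>C\<^esub> h"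
      using eq Comp_assoc[OF C li h(1) k(1)] Comp_assoc[OF C li h(1) k(2)]
      by (intro colimit_ext[OF C J X l Comp_in_hom[OF C h(1) k(1)] Comp_in_hom[OF C h(1) k(2)]]) simp
    then have "(k \<cdot>\<^bsub>C\<^esub> h) \<cdot>\<^bsub>C\<^esub> g = (k' \<cdot>\<^bsub>C\<^esub> h) \<cdot>\<^bsub>C\<^esub> g" by simp
    then show "k = k'"
      using Comp_assoc[OF C g(1) h(1) k(1)] Comp_assoc[OF C g(1) h(1) k(2)] g(3)
        Comp_Ident_right[OF C k(1)] Comp_Ident_right[OF C k(2)] by simp
  qed
qed

lemma colimit_unique:
  assumes C: "category C" and J: "category J" and X: "is_functor J C X"
    and l: "is_colimit J C X c l" and l': "is_colimit J C X c' l'"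
  obtains h where "h \<in> hom C c c'" "is_iso C h" "\<And>i. i \<in> Obj J \<Longrightarrow> h \<cdot>\<^bsub>C\<^esub> l i = l' i"
proof -
  obtain h where h: "h \<in> hom C c c'" "\<And>i. i \<in> Obj J \<Longrightarrow> h \<cdot>\<^bsub>C\<^esub> l i = l' i"
    using colimit_factor[OF l is_colimit_cocone[OF l']] by blast
  obtain g where g: "g \<in> hom C c' c" "\<And>i. i \<in> Obj J \<Longrightarrow> g \<cdot>\<^bsub>C\<^esub> l' i = l i"
    using colimit_factor[OF l' is_colimit_cocone[OF l]] by blast
  note li = is_coconeD(2)[OF is_colimit_cocone[OF l]] and li' = is_coconeD(2)[OF is_colimit_cocone[OF l']]
  have cc: "c \<in> Obj C" "c' \<in> Obj C" using hom_Obj[OF C h(1)] by auto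
  have "g \<cdot>\<^bsub>C\<^esub> h = Ident C c"
    using Comp_assoc[OF C li h(1) g(1)] h(2) g(2) Comp_Ident_left[OF C li]
    by (intro colimit_ext[OF C J X l Comp_in_hom[OF C h(1) g(1)] Ident_in_hom[OF C cc(1)]]) simp
  moreover have "h \<cdot>\<^bsub>C\<^esub> g = Ident C c'"
    using Comp_assoc[OF C li' g(1) h(1)] h(2) g(2) Comp_Ident_left[OF C li']
    by (intro colimit_ext[OF C J X l' Comp_in_hom[OF C g(1) h(1)] Ident_in_hom[OF C cc(2)]]) simp
  ultimately show ?thesis using that[OF h(1) is_isoI[OF h(1) g(1)] h(2)] by blast
qed

definition evaluation ::
  "('o1, 'a1, 'y) cat_scheme \<Rightarrow> ('o2, 'a2, 'z) cat_scheme \<Rightarrow> 'o1 \<Rightarrow>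
   (('o1, 'a1, 'o2, 'a2) ftor, (('o1, 'a1, 'o2, 'a2) ftor, 'o1, 'a2) ntrans, 'o2, 'a2) ftor"
where
  "evaluation C D a = \<lparr>fobj = (\<lambda>X \<in> {F. is_functor C D F}. fobj X a), farr = (\<lambda>t \<in> {t. natural C D t}. ncomp t a)\<rparr>"

lemma evaluation_simps [simp]:
  "is_functor C D X \<Longrightarrow> fobj (evaluation C D a) X = fobj X a"
  "natural C D t \<Longrightarrow> farr (evaluation C D a) t = ncomp t a"
  by (simp_all add: evaluation_def)

lemma is_functor_evaluation:
  fixes C :: "('o1, 'a1, 'y) cat_scheme" and D :: "('o2, 'a2, 'z) cat_scheme"
  assumes C: "category C" and D: "category D" and a: "a \<in> Obj C"
  shows "is_functor (functor_category C D) D (evaluation C D a)"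
proof (rule is_functorI[OF category_functor_category[OF C D]])
  fix s t F G H assume "s \<in> hom (functor_category C D) F G" "t \<in> hom (functor_category C D) G H"
  then show "farr (evaluation C D a) (t \<cdot>\<^bsub>functor_category C D\<^esub> s) =
      farr (evaluation C D a) t \<cdot>\<^bsub>D\<^esub> farr (evaluation C D a) s"
    using natural_comp[OF C D, of s t] a by (auto simp: hom_iff)
next
  fix t F G assume "t \<in> hom (functor_category C D) F G"
  then show "farr (evaluation C D a) t \<in> hom D (fobj (evaluation C D a) F) (fobj (evaluation C D a) G)"
    using naturalD(1,2,4)[of C D t] a by (auto simp: hom_iff)
qed (use a natural_id[OF C D] in \<open>auto simp: evaluation_def functor_fobj\<close>)

context
  fixes J :: "('i, 'j, 'x) cat_scheme" and C :: "('o1, 'a1, 'y) cat_scheme" and D :: "('o2, 'a2, 'z) cat_scheme"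
    and X :: "('i, 'j, ('o1, 'a1, 'o2, 'a2) ftor, (('o1, 'a1, 'o2, 'a2) ftor, 'o1, 'a2) ntrans) ftor"
  assumes J: "category J" and C: "category C" and D: "category D"
    and X: "is_functor J (functor_category C D) X"
begin

abbreviation "at a \<equiv> comp_functor J (evaluation C D a) X"

lemma diagram_at:
  shows "i \<in> Obj J \<Longrightarrow> is_functor C D (fobj X i)"
    and "k \<in> hom J i j \<Longrightarrow> natural C D (farr X k)"
    and "k \<in> hom J i j \<Longrightarrow> nsrc (farr X k) = fobj X i"
    and "k \<in> hom J i j \<Longrightarrow> ntgt (farr X k) = fobj X j"
    and "i \<in> Obj J \<Longrightarrow> fobj (at a) i = fobj (fobj X i) a"
    and "k \<in> hom J i j \<Longrightarrow> farr (at a) k = ncomp (farr X k) a"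
  using functor_fobj[OF X] functor_farr[OF X] by (auto simp: hom_iff)

lemma is_functor_at: "a \<in> Obj C \<Longrightarrow> is_functor J D (at a)"
  using is_functor_comp[OF X is_functor_evaluation[OF C D] J] .

lemma cocone_at:
  assumes l: "is_cocone J (functor_category C D) X c l" and a: "a \<in> Obj C"
  shows "is_cocone J D (at a) (fobj c a) (\<lambda>i. ncomp (l i) a)"
proof (rule is_coconeI)
  fix i assume "i \<in> Obj J"
  then show "ncomp (l i) a \<in> hom D (fobj (at a) i) (fobj c a)"
    using is_coconeD(2)[OF l] diagram_at(5) naturalD(4)[of C D "l i" a] a by (auto simp: hom_iff)
next
  fix k i j assume k: "k \<in> hom J i j"
  show "ncomp (l j) a \<cdot>\<^bsub>D\<^esub> farr (at a) k = ncomp (l i) a"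
    using arg_cong[OF is_coconeD(3)[OF l k], of "\<lambda>r. ncomp r a"] diagram_at(6)[OF k] a by simp
qed (use is_coconeD(1)[OF l] functor_fobj a in auto)

lemma cocone_natural:
  assumes l: "is_cocone J (functor_category C D) X c l" and i: "i \<in> Obj J" and f: "f \<in> hom C a b"
  shows "ncomp (l i) b \<cdot>\<^bsub>D\<^esub> farr (fobj X i) f = farr c f \<cdot>\<^bsub>D\<^esub> ncomp (l i) a"
  using is_coconeD(2)[OF l i] naturalD(5)[OF _ f, of D "l i"] by (auto simp: hom_iff)

text \<open>
  The factorisations at the single objects are natural because they are unique.
\<close>

lemma colimit_if_pointwise:
  assumes l: "is_cocone J (functor_category C D) X c l"
    and pt: "\<And>a. a \<in> Obj C \<Longrightarrow> is_colimit J D (at a) (fobj c a) (\<lambda>i. ncomp (l i) a)"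
  shows "is_colimit J (functor_category C D) X c l"
proof (rule is_colimitI[OF l])
  fix c' l' assume l': "is_cocone J (functor_category C D) X c' l'"
  have "\<forall>a\<in>Obj C. \<exists>h. h \<in> hom D (fobj c a) (fobj c' a) \<and> (\<forall>i\<in>Obj J. h \<cdot>\<^bsub>D\<^esub> ncomp (l i) a = ncomp (l' i) a)"
    using colimit_factor[OF pt cocone_at[OF l']] by metis
  then obtain h where h: "\<And>a. a \<in> Obj C \<Longrightarrow> h a \<in> hom D (fobj c a) (fobj c' a)"
      "\<And>a i. a \<in> Obj C \<Longrightarrow> i \<in> Obj J \<Longrightarrow> h a \<cdot>\<^bsub>D\<^esub> ncomp (l i) a = ncomp (l' i) a"
    by (auto dest!: bchoice)
  have c: "is_functor C D c" "is_functor C D c'" using is_coconeD(1)[OF l] is_coconeD(1)[OF l'] by auto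
  define t where "t = \<lparr>nsrc = c, ntgt = c', ncomp = restrict h (Obj C)\<rparr>"
  have t: "natural C D t"
  proof (rule naturalI)
    fix f a b assume f: "f \<in> hom C a b"
    then have ab: "a \<in> Obj C" "b \<in> Obj C" using hom_Obj[OF C] by auto
    note cf = functor_farr[OF c(1) f] and c'f = functor_farr[OF c(2) f]
    have "h b \<cdot>\<^bsub>D\<^esub> farr c f = farr c' f \<cdot>\<^bsub>D\<^esub> h a"
    proof (rule colimit_ext[OF D J is_functor_at[OF ab(1)] pt[OF ab(1)]])
      fix i assume i: "i \<in> Obj J"
      note Xf = functor_farr[OF diagram_at(1)[OF i] f]
      have la: "ncomp (l i) a \<in> hom D (fobj (fobj X i) a) (fobj c a)"
        and lb: "ncomp (l i) b \<in> hom D (fobj (fobj X i) b) (fobj c b)"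
        using is_coconeD(2)[OF cocone_at[OF l] i] ab diagram_at(5)[OF i] by auto
      show "(h b \<cdot>\<^bsub>D\<^esub> farr c f) \<cdot>\<^bsub>D\<^esub> ncomp (l i) a = (farr c' f \<cdot>\<^bsub>D\<^esub> h a) \<cdot>\<^bsub>D\<^esub> ncomp (l i) a"
        using Comp_assoc[OF D la cf h(1)[OF ab(2)]] cocone_natural[OF l i f]
          Comp_assoc[OF D Xf lb h(1)[OF ab(2)]] h(2)[OF ab(2) i] cocone_natural[OF l' i f]
          Comp_assoc[OF D la h(1)[OF ab(1)] c'f] h(2)[OF ab(1) i] by simp
    qed (use Comp_in_hom[OF D cf h(1)[OF ab(2)]] Comp_in_hom[OF D h(1)[OF ab(1)] c'f] in auto)
    then show "ncomp t b \<cdot>\<^bsub>D\<^esub> farr (nsrc t) f = farr (ntgt t) f \<cdot>\<^bsub>D\<^esub> ncomp t a"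
      using ab by (simp add: t_def)
  qed (use c h in \<open>auto simp: t_def\<close>)
  have "ntrans_comp C D t (l i) = l' i" if i: "i \<in> Obj J" for i
    using is_coconeD(2)[OF l i] is_coconeD(2)[OF l' i] h(2)[OF _ i] naturalD(3)[of C D "l' i"]
    by (intro ntrans_eqI[where A = "Obj C"]) (auto simp: hom_iff t_def)
  then show "\<exists>h\<in>hom (functor_category C D) c c'. \<forall>i\<in>Obj J. h \<cdot>\<^bsub>functor_category C D\<^esub> l i = l' i"
    using t by (intro bexI[of _ t]) (auto simp: hom_iff t_def)
next
  fix d s s' assume s: "s \<in> hom (functor_category C D) c d" "s' \<in> hom (functor_category C D) c d"
    and eq: "\<And>i. i \<in> Obj J \<Longrightarrow> s \<cdot>\<^bsub>functor_category C D\<^esub> l i = s' \<cdot>\<^bsub>functor_category C D\<^esub> l i"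
  have nat: "natural C D s" "natural C D s'" using s by (auto simp: hom_iff)
  have "ncomp s a = ncomp s' a" if a: "a \<in> Obj C" for a
  proof (rule colimit_ext[OF D J is_functor_at[OF a] pt[OF a]])
    show "ncomp s a \<in> hom D (fobj c a) (fobj d a)" "ncomp s' a \<in> hom D (fobj c a) (fobj d a)"
      using naturalD(4)[OF nat(1) a] naturalD(4)[OF nat(2) a] s by (auto simp: hom_iff)
    show "ncomp s a \<cdot>\<^bsub>D\<^esub> ncomp (l i) a = ncomp s' a \<cdot>\<^bsub>D\<^esub> ncomp (l i) a" if "i \<in> Obj J" for i
      using arg_cong[OF eq[OF that], of "\<lambda>r. ncomp r a"] a by simp
  qed
  then show "s = s'"
    using s naturalD(3)[OF nat(1)] naturalD(3)[OF nat(2)]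
    by (intro ntrans_eqI[where A = "Obj C"]) (auto simp: hom_iff)
qed

text \<open>
  The universal properties of the chosen colimits make them functorial.
\<close>

lemma pointwise_colimit_exists:
  assumes ex: "\<And>a. a \<in> Obj C \<Longrightarrow> \<exists>c l. is_colimit J D (at a) c l"
  obtains c l where "is_cocone J (functor_category C D) X c l"
    "\<And>a. a \<in> Obj C \<Longrightarrow> is_colimit J D (at a) (fobj c a) (\<lambda>i. ncomp (l i) a)"
proof -
  obtain c0 l0 where colim: "\<And>a. a \<in> Obj C \<Longrightarrow> is_colimit J D (at a) (c0 a) (l0 a)"
    using ex by metis
  note l0 = is_coconeD(2)[OF is_colimit_cocone[OF colim]]
  have l0': "l0 a i \<in> hom D (fobj (fobj X i) a) (c0 a)" if "a \<in> Obj C" "i \<in> Obj J" for a i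
    using l0[OF that] diagram_at(5)[OF that(2)] by simp
  note ext = colimit_ext[OF D J is_functor_at colim]
  have "\<forall>f\<in>Arr C. \<exists>h. h \<in> hom D (c0 (Dom C f)) (c0 (Cod C f)) \<and>
      (\<forall>i\<in>Obj J. h \<cdot>\<^bsub>D\<^esub> l0 (Dom C f) i = l0 (Cod C f) i \<cdot>\<^bsub>D\<^esub> farr (fobj X i) f)"
  proof
    fix f assume "f \<in> Arr C"
    from arr_in_hom[OF this] obtain a b where f: "f \<in> hom C a b" by blast
    then have ab: "a \<in> Obj C" "b \<in> Obj C" using hom_Obj[OF C] by auto
    have "is_cocone J D (at a) (c0 b) (\<lambda>i. l0 b i \<cdot>\<^bsub>D\<^esub> farr (fobj X i) f)"
    proof (rule is_coconeI)
      fix i assume i: "i \<in> Obj J"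
      show "l0 b i \<cdot>\<^bsub>D\<^esub> farr (fobj X i) f \<in> hom D (fobj (at a) i) (c0 b)"
        using Comp_in_hom[OF D functor_farr[OF diagram_at(1)[OF i] f] l0'[OF ab(2) i]] diagram_at(5)[OF i] by simp
    next
      fix k i j assume k: "k \<in> hom J i j"
      then have ij: "i \<in> Obj J" "j \<in> Obj J" using hom_Obj[OF J] by auto
      note nat = diagram_at(2)[OF k] and src = diagram_at(3)[OF k] and tgt = diagram_at(4)[OF k]
      note ka = naturalD(4)[OF nat ab(1), unfolded src tgt] and kb = naturalD(4)[OF nat ab(2), unfolded src tgt]
      show "(l0 b j \<cdot>\<^bsub>D\<^esub> farr (fobj X j) f) \<cdot>\<^bsub>D\<^esub> farr (at a) k = l0 b i \<cdot>\<^bsub>D\<^esub> farr (fobj X i) f"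
        using Comp_assoc[OF D ka functor_farr[OF diagram_at(1)[OF ij(2)] f] l0'[OF ab(2) ij(2)]]
          naturalD(5)[OF nat f] src tgt diagram_at(6)[OF k]
          Comp_assoc[OF D functor_farr[OF diagram_at(1)[OF ij(1)] f] kb l0'[OF ab(2) ij(2)]]
          is_coconeD(3)[OF is_colimit_cocone[OF colim[OF ab(2)]] k] by simp
    qed (use is_colimitD(1)[OF colim[OF ab(2)]] in auto)
    from colimit_factor[OF colim[OF ab(1)] this] obtain h where "h \<in> hom D (c0 a) (c0 b)"
      "\<And>i. i \<in> Obj J \<Longrightarrow> h \<cdot>\<^bsub>D\<^esub> l0 a i = l0 b i \<cdot>\<^bsub>D\<^esub> farr (fobj X i) f" by blast
    moreover have "Dom C f = a" "Cod C f = b" using f by (simp_all add: hom_iff)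
    ultimately show "\<exists>h. h \<in> hom D (c0 (Dom C f)) (c0 (Cod C f)) \<and>
        (\<forall>i\<in>Obj J. h \<cdot>\<^bsub>D\<^esub> l0 (Dom C f) i = l0 (Cod C f) i \<cdot>\<^bsub>D\<^esub> farr (fobj X i) f)"
      by blast
  qed
  then obtain m where "\<And>f. f \<in> Arr C \<Longrightarrow> m f \<in> hom D (c0 (Dom C f)) (c0 (Cod C f)) \<and>
      (\<forall>i\<in>Obj J. m f \<cdot>\<^bsub>D\<^esub> l0 (Dom C f) i = l0 (Cod C f) i \<cdot>\<^bsub>D\<^esub> farr (fobj X i) f)"
    by (auto dest!: bchoice)
  then have m: "m f \<in> hom D (c0 a) (c0 b)"
      "\<And>i. i \<in> Obj J \<Longrightarrow> m f \<cdot>\<^bsub>D\<^esub> l0 a i = l0 b i \<cdot>\<^bsub>D\<^esub> farr (fobj X i) f" if "f \<in> hom C a b" for f a b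
    using that by (auto simp: hom_iff)
  define c where "c = \<lparr>fobj = restrict c0 (Obj C), farr = restrict m (Arr C)\<rparr>"
  have c: "is_functor C D c"
  proof (rule is_functorI[OF C])
    fix f a b assume f: "f \<in> hom C a b"
    then show "farr c f \<in> hom D (fobj c a) (fobj c b)"
      using m(1)[OF f] hom_Obj[OF C f] by (simp add: c_def hom_iff)
  next
    fix a assume a: "a \<in> Obj C"
    note id = Ident_in_hom[OF C a]
    have "m (Ident C a) = Ident D (c0 a)"
      using m(2)[OF id] functor_Ident[OF diagram_at(1) a] Comp_Ident_left[OF D l0'[OF a]]
        Comp_Ident_right[OF D l0'[OF a]]
      by (intro ext[OF a a m(1)[OF id] Ident_in_hom[OF D]]) (use is_colimitD(1)[OF colim[OF a]] in auto)
    then show "farr c (Ident C a) = Ident D (fobj c a)" using a id by (simp add: c_def hom_iff)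
  next
    fix f g a b d assume f: "f \<in> hom C a b" and g: "g \<in> hom C b d"
    then have abd: "a \<in> Obj C" "b \<in> Obj C" "d \<in> Obj C" using hom_Obj[OF C] by auto
    note gf = Comp_in_hom[OF C f g]
    have "m (g \<cdot>\<^bsub>C\<^esub> f) = m g \<cdot>\<^bsub>D\<^esub> m f"
    proof (rule ext[OF abd(1) abd(1) m(1)[OF gf] Comp_in_hom[OF D m(1)[OF f] m(1)[OF g]]])
      fix i assume i: "i \<in> Obj J"
      note Xf = functor_farr[OF diagram_at(1)[OF i] f] and Xg = functor_farr[OF diagram_at(1)[OF i] g]
      have "(m g \<cdot>\<^bsub>D\<^esub> m f) \<cdot>\<^bsub>D\<^esub> l0 a i = m g \<cdot>\<^bsub>D\<^esub> (l0 b i \<cdot>\<^bsub>D\<^esub> farr (fobj X i) f)"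
        using Comp_assoc[OF D l0'[OF abd(1) i] m(1)[OF f] m(1)[OF g]] m(2)[OF f i] by simp
      also have "\<dots> = l0 d i \<cdot>\<^bsub>D\<^esub> (farr (fobj X i) g \<cdot>\<^bsub>D\<^esub> farr (fobj X i) f)"
        using Comp_assoc[OF D Xf l0'[OF abd(2) i] m(1)[OF g]] m(2)[OF g i]
          Comp_assoc[OF D Xf Xg l0'[OF abd(3) i]] by simp
      finally show "m (g \<cdot>\<^bsub>C\<^esub> f) \<cdot>\<^bsub>D\<^esub> l0 a i = (m g \<cdot>\<^bsub>D\<^esub> m f) \<cdot>\<^bsub>D\<^esub> l0 a i"
        using m(2)[OF gf i] functor_Comp[OF diagram_at(1)[OF i] f g] by simp
    qed
    then show "farr c (g \<cdot>\<^bsub>C\<^esub> f) = farr c g \<cdot>\<^bsub>D\<^esub> farr c f" using f g gf by (simp add: c_def hom_iff)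
  qed (use is_colimitD(1)[OF colim] in \<open>auto simp: c_def\<close>)
  define l where "l i = \<lparr>nsrc = fobj X i, ntgt = c, ncomp = (\<lambda>a\<in>Obj C. l0 a i)\<rparr>" for i
  have l: "natural C D (l i)" if i: "i \<in> Obj J" for i
  proof (rule naturalI)
    fix f a b assume f: "f \<in> hom C a b"
    then show "ncomp (l i) b \<cdot>\<^bsub>D\<^esub> farr (nsrc (l i)) f = farr (ntgt (l i)) f \<cdot>\<^bsub>D\<^esub> ncomp (l i) a"
      using m(2)[OF f i] hom_Obj[OF C f] by (simp add: l_def c_def hom_iff)
  qed (use i c diagram_at(1) l0' in \<open>auto simp: l_def c_def\<close>)
  have "is_cocone J (functor_category C D) X c l"
  proof (rule is_coconeI)
    fix k i j assume k: "k \<in> hom J i j"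
    show "l j \<cdot>\<^bsub>functor_category C D\<^esub> farr X k = l i"
      using diagram_at(2-4)[OF k] is_coconeD(3)[OF is_colimit_cocone[OF colim] k] diagram_at(6)[OF k]
      by (auto intro!: ntrans_eqI[where A = "Obj C"] simp: l_def)
  qed (use c l in \<open>auto simp: hom_iff l_def\<close>)
  moreover have "is_colimit J D (at a) (fobj c a) (\<lambda>i. ncomp (l i) a)" if "a \<in> Obj C" for a
    using colim[OF that] that by (simp add: c_def l_def)
  ultimately show ?thesis by (rule that)
qed

text \<open>If pointwise colimits exist, they compute every colimit, because colimits are unique.\<close>

lemma pointwise_if_colimit:
  assumes ex: "\<And>a. a \<in> Obj C \<Longrightarrow> \<exists>c l. is_colimit J D (at a) c l"
    and l: "is_colimit J (functor_category C D) X c l" and a: "a \<in> Obj C"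
  shows "is_colimit J D (at a) (fobj c a) (\<lambda>i. ncomp (l i) a)"
proof -
  note E = category_functor_category[OF C D]
  obtain c0 l0 where l0: "is_cocone J (functor_category C D) X c0 l0"
    "\<And>a. a \<in> Obj C \<Longrightarrow> is_colimit J D (at a) (fobj c0 a) (\<lambda>i. ncomp (l0 i) a)"
    using pointwise_colimit_exists[OF ex] by blast
  obtain h where h: "h \<in> hom (functor_category C D) c0 c" "is_iso (functor_category C D) h"
    "\<And>i. i \<in> Obj J \<Longrightarrow> h \<cdot>\<^bsub>functor_category C D\<^esub> l0 i = l i"
    using colimit_unique[OF E J X colimit_if_pointwise[OF l0] l] by blast
  have "ncomp h a \<in> hom D (fobj c0 a) (fobj c a)" "is_iso D (ncomp h a)"
    using functor_farr[OF is_functor_evaluation[OF C D a] h(1)] h(1) hom_Obj[OF E h(1)]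
      functor_is_iso[OF is_functor_evaluation[OF C D a] h(1,2) E] by (auto simp: hom_iff)
  from colimit_transport[OF D J is_functor_at[OF a] l0(2)[OF a] this]
  have "is_colimit J D (at a) (fobj c a) (\<lambda>i. ncomp h a \<cdot>\<^bsub>D\<^esub> ncomp (l0 i) a)" .
  moreover have "ncomp h a \<cdot>\<^bsub>D\<^esub> ncomp (l0 i) a = ncomp (l i) a" if "i \<in> Obj J" for i
    using arg_cong[OF h(3)[OF that], of "\<lambda>r. ncomp r a"] a by simp
  ultimately show ?thesis using is_colimit_cong[OF J] by (metis (no_types, lifting))
qed

end

text \<open>
  The colimits in a monoidal category are those of its underlying category.  The latter is the truncated record,
  and it determines everything that concerns functors and colimits.
\<close>

lemma truncate_simps [simp]:
  "Obj (cat.truncate C) = Obj C" "Arr (cat.truncate C) = Arr C" "Dom (cat.truncate C) = Dom C"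
  "Cod (cat.truncate C) = Cod C" "Ident (cat.truncate C) = Ident C" "Comp (cat.truncate C) = Comp C"
  by (simp_all add: cat.truncate_def)

lemma hom_truncate [simp]: "hom (cat.truncate C) = hom C"
  by (simp add: hom_def fun_eq_iff)

lemma category_truncate [simp]: "category (cat.truncate C) = category C"
  by (simp add: category_def)

lemma is_iso_truncate [simp]: "is_iso (cat.truncate C) = is_iso C"
  by (simp add: is_iso_def fun_eq_iff)

lemma is_functor_truncate [simp]:
  "is_functor C (cat.truncate D) = is_functor C D" "is_functor (cat.truncate C) D = is_functor C D"
  by (simp_all add: is_functor_def fun_eq_iff)

lemma natural_truncate [simp]:
  "natural C (cat.truncate D) = natural C D" "natural (cat.truncate C) D = natural C D"
  by (simp_all add: natural_def fun_eq_iff)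

lemma functor_category_truncate [simp]: "functor_category C (cat.truncate D) = functor_category C D"
  by (simp add: functor_category_def ntrans_id_def ntrans_comp_def fun_eq_iff)

lemma is_colimit_truncate [simp]: "is_colimit J (cat.truncate C) = is_colimit J C"
  by (simp add: is_colimit_def is_cocone_def fun_eq_iff)

lemma is_cocone_truncate [simp]: "is_cocone J (cat.truncate C) = is_cocone J C"
  by (simp add: is_cocone_def fun_eq_iff)

section \<open>Small sets and their colimits\<close>

definition set_arr :: "'x set \<Rightarrow> 'x set \<Rightarrow> ('x \<Rightarrow> 'x) \<Rightarrow> 'x set_map" where
  "set_arr A B f = \<lparr>sdom = A, scod = B, sfun = restrict f A\<rparr>"

lemma set_arr_simps [simp]:
  "sdom (set_arr A B f) = A" "scod (set_arr A B f) = B" "x \<in> A \<Longrightarrow> sfun (set_arr A B f) x = f x"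
  "sfun (set_arr A B f) \<in> A \<rightarrow>\<^sub>E B \<longleftrightarrow> f \<in> A \<rightarrow> B"
  by (auto simp: set_arr_def)

lemma set_category_simps [simp]:
  "Obj (set_category u) = {A. small u A}"
  "Arr (set_category u) = {f. small u (sdom f) \<and> small u (scod f) \<and> sfun f \<in> sdom f \<rightarrow>\<^sub>E scod f}"
  "Dom (set_category u) = sdom" "Cod (set_category u) = scod"
  "Ident (set_category u) A = set_arr A A (\<lambda>x. x)"
  "g \<cdot>\<^bsub>set_category u\<^esub> f = set_arr (sdom f) (scod g) (\<lambda>x. sfun g (sfun f x))"
  by (simp_all add: set_category_def set_arr_def)

lemma set_hom_iff:
  "f \<in> hom (set_category u) A B \<longleftrightarrow>
     small u A \<and> small u B \<and> sdom f = A \<and> scod f = B \<and> sfun f \<in> A \<rightarrow>\<^sub>E B"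
  by (auto simp: hom_iff)

lemma set_map_eqI:
  fixes f g :: "'x set_map"
  assumes "sdom f = A" "sdom g = A" "scod f = scod g" "sfun f \<in> extensional A" "sfun g \<in> extensional A"
    and "\<And>x. x \<in> A \<Longrightarrow> sfun f x = sfun g x"
  shows "f = g"
  using assms extensionalityI[of "sfun f" A "sfun g"] by simp

lemma set_hom_eqI:
  assumes "f \<in> hom (set_category u) A B" "g \<in> hom (set_category u) A B"
    and "\<And>x. x \<in> A \<Longrightarrow> sfun f x = sfun g x"
  shows "f = g"
  using assms by (intro set_map_eqI[of f A]) (auto simp: set_hom_iff PiE_def)

lemma set_hom_apply: "f \<in> hom (set_category u) A B \<Longrightarrow> x \<in> A \<Longrightarrow> sfun f x \<in> B"
  by (auto simp: set_hom_iff PiE_iff)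

lemma set_arr_in_hom: "small u A \<Longrightarrow> small u B \<Longrightarrow> f \<in> A \<rightarrow> B \<Longrightarrow> set_arr A B f \<in> hom (set_category u) A B"
  by (simp add: set_hom_iff)

lemma set_arr_extensional [simp]: "sfun (set_arr A B f) \<in> extensional A"
  by (simp add: set_arr_def)

lemma bij_betw_set_arr [simp]: "bij_betw (sfun (set_arr A B f)) A B \<longleftrightarrow> bij_betw f A B"
  by (rule bij_betw_cong) simp

lemma category_set_category: "category (set_category u)"
proof (rule categoryI)
  fix f g h A B C D assume f: "f \<in> hom (set_category u) A B" and g: "g \<in> hom (set_category u) B C"
    and h: "h \<in> hom (set_category u) C D"
  then show "(h \<cdot>\<^bsub>set_category u\<^esub> g) \<cdot>\<^bsub>set_category u\<^esub> f = h \<cdot>\<^bsub>set_category u\<^esub> (g \<cdot>\<^bsub>set_category u\<^esub> f)"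
    by (intro set_map_eqI[where A = A]) (auto simp: set_hom_iff PiE_iff)
qed (auto simp: set_hom_iff PiE_iff intro!: set_map_eqI)

lemma set_is_iso:
  assumes f: "f \<in> hom (set_category u) A B" and bij: "bij_betw (sfun f) A B"
  shows "is_iso (set_category u) f"
proof -
  let ?g = "set_arr B A (inv_into A (sfun f))"
  have B: "\<And>y. y \<in> B \<Longrightarrow> inv_into A (sfun f) y \<in> A \<and> sfun f (inv_into A (sfun f) y) = y"
    using bij by (auto simp: bij_betw_def f_inv_into_f inv_into_into)
  have A: "\<And>x. x \<in> A \<Longrightarrow> inv_into A (sfun f) (sfun f x) = x"
    using bij by (auto simp: bij_betw_def)
  show ?thesis
    using f A B by (intro is_isoI[of f _ A B ?g] set_map_eqI) (auto simp: set_hom_iff PiE_iff)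
qed

lemma set_iso_bij:
  assumes f: "f \<in> hom (set_category u) A B" and iso: "is_iso (set_category u) f"
  shows "bij_betw (sfun f) A B"
proof -
  obtain g where g: "g \<in> hom (set_category u) B A" "g \<cdot>\<^bsub>set_category u\<^esub> f = Ident (set_category u) A"
    "f \<cdot>\<^bsub>set_category u\<^esub> g = Ident (set_category u) B"
    using is_isoE[OF iso f] by blast
  have "sfun g (sfun f x) = x" if "x \<in> A" for x
    using arg_cong[OF g(2), of "\<lambda>r. sfun r x"] that f g(1) by (simp add: set_hom_iff PiE_iff)
  moreover have "sfun f (sfun g x) = x" if "x \<in> B" for x
    using arg_cong[OF g(3), of "\<lambda>r. sfun r x"] that f g(1) by (simp add: set_hom_iff PiE_iff)
  ultimately show ?thesis
    using f g by (intro bij_betw_byWitness[where f' = "sfun g"]) (auto simp: set_hom_iff PiE_iff)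
qed

text \<open>
  A cocone of sets is a colimit if it is jointly surjective and identifies two elements only if no
  compatible family of predicates tells them apart.  Predicates suffice, because they detect equality
  of the values of any compatible family of functions.
\<close>

definition colimiting ::
  "('i, 'j, 'z) cat_scheme \<Rightarrow> ('i \<Rightarrow> 'x set) \<Rightarrow> ('j \<Rightarrow> 'x \<Rightarrow> 'x) \<Rightarrow> 'y set \<Rightarrow> ('i \<Rightarrow> 'x \<Rightarrow> 'y) \<Rightarrow> bool"
where
  "colimiting J A m c L \<longleftrightarrow>
     (\<forall>y \<in> c. \<exists>i \<in> Obj J. \<exists>x \<in> A i. L i x = y) \<and>
     (\<forall>P :: 'i \<Rightarrow> 'x \<Rightarrow> bool. (\<forall>k \<in> Arr J. \<forall>x \<in> A (Dom J k). P (Cod J k) (m k x) = P (Dom J k) x) \<longrightarrow>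
        (\<forall>i \<in> Obj J. \<forall>j \<in> Obj J. \<forall>x \<in> A i. \<forall>y \<in> A j. L i x = L j y \<longrightarrow> P i x = P j y))"

lemma colimitingI:
  fixes A :: "'i \<Rightarrow> 'x set"
  assumes "\<And>y. y \<in> c \<Longrightarrow> \<exists>i \<in> Obj J. \<exists>x \<in> A i. L i x = y"
    and "\<And>(P :: 'i \<Rightarrow> 'x \<Rightarrow> bool) i j x y. (\<And>k x. k \<in> Arr J \<Longrightarrow> x \<in> A (Dom J k) \<Longrightarrow> P (Cod J k) (m k x) = P (Dom J k) x) \<Longrightarrow>
      i \<in> Obj J \<Longrightarrow> j \<in> Obj J \<Longrightarrow> x \<in> A i \<Longrightarrow> y \<in> A j \<Longrightarrow> L i x = L j y \<Longrightarrow> P i x = P j y"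
  shows "colimiting J A m c L"
  unfolding colimiting_def
proof (intro conjI ballI allI impI)
  fix P :: "'i \<Rightarrow> 'x \<Rightarrow> bool" and i j x y assume P: "\<forall>k\<in>Arr J. \<forall>x\<in>A (Dom J k). P (Cod J k) (m k x) = P (Dom J k) x"
    and ij: "i \<in> Obj J" "j \<in> Obj J" "x \<in> A i" "y \<in> A j" "L i x = L j y"
  show "P i x = P j y" by (rule assms(2)[OF _ ij]) (use P in simp)
qed (rule assms(1))

lemma colimiting_surj:
  assumes "colimiting J A m c L" "y \<in> c"
  obtains i x where "i \<in> Obj J" "x \<in> A i" "L i x = y"
  using assms(1)[unfolded colimiting_def, THEN conjunct1] assms(2) by blast

lemma colimiting_predicate:
  fixes P :: "'i \<Rightarrow> 'x \<Rightarrow> bool"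
  assumes "colimiting J A m c L"
    and "\<And>k x. k \<in> Arr J \<Longrightarrow> x \<in> A (Dom J k) \<Longrightarrow> P (Cod J k) (m k x) = P (Dom J k) x"
    and "i \<in> Obj J" "j \<in> Obj J" "x \<in> A i" "y \<in> A j" "L i x = L j y"
  shows "P i x = P j y"
  by (rule assms(1)[unfolded colimiting_def, THEN conjunct2, rule_format, OF _ assms(3-7)]) (rule assms(2))

lemma colimiting_function:
  assumes c: "colimiting J A m c L"
    and f: "\<And>k x. k \<in> Arr J \<Longrightarrow> x \<in> A (Dom J k) \<Longrightarrow> f (Cod J k) (m k x) = f (Dom J k) x"
    and "i \<in> Obj J" "j \<in> Obj J" "x \<in> A i" "y \<in> A j" "L i x = L j y"
  shows "f i x = f j y"
  using colimiting_predicate[OF c, of "\<lambda>i' x'. f i' x' = f j y" i j x y] assms by simp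

lemma set_diagram:
  assumes "is_functor J (set_category u) X"
  shows "i \<in> Obj J \<Longrightarrow> small u (fobj X i)"
    and "k \<in> Arr J \<Longrightarrow> farr X k \<in> hom (set_category u) (fobj X (Dom J k)) (fobj X (Cod J k))"
  using functor_fobj[OF assms] functor_farr[OF assms arr_in_hom] by auto

lemma set_cocone_apply:
  assumes J: "category J" and X: "is_functor J (set_category u) X" and l: "is_cocone J (set_category u) X c l"
    and k: "k \<in> Arr J" and x: "x \<in> fobj X (Dom J k)"
  shows "sfun (l (Cod J k)) (sfun (farr X k) x) = sfun (l (Dom J k)) x"
  using arg_cong[OF is_coconeD(3)[OF l arr_in_hom[OF k]], of "\<lambda>r. sfun r x"] set_diagram(2)[OF X k] x
  by (simp add: set_hom_iff)

lemma set_colimit_if_colimiting: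
  assumes J: "category J" and X: "is_functor J (set_category u) X" and l: "is_cocone J (set_category u) X c l"
    and c: "colimiting J (fobj X) (\<lambda>k. sfun (farr X k)) c (\<lambda>i. sfun (l i))"
  shows "is_colimit J (set_category u) X c l"
proof (rule is_colimitI[OF l])
  note li = is_coconeD(2)[OF l]
  fix c' l' assume l': "is_cocone J (set_category u) X c' l'"
  note li' = is_coconeD(2)[OF l']
  have "\<forall>y\<in>c. \<exists>z\<in>c'. \<forall>i\<in>Obj J. \<forall>x\<in>fobj X i. sfun (l i) x = y \<longrightarrow> sfun (l' i) x = z"
  proof
    fix y assume "y \<in> c"
    then obtain i x where ix: "i \<in> Obj J" "x \<in> fobj X i" "sfun (l i) x = y" using colimiting_surj[OF c] by metis
    have "sfun (l' j) x' = sfun (l' i) x" if "j \<in> Obj J" "x' \<in> fobj X j" "sfun (l j) x' = y" for j x'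
      by (rule colimiting_function[OF c, of "\<lambda>i. sfun (l' i)", OF set_cocone_apply[OF J X l'] that(1) ix(1) that(2) ix(2)])
        (simp_all add: that ix)
    then show "\<exists>z\<in>c'. \<forall>i\<in>Obj J. \<forall>x\<in>fobj X i. sfun (l i) x = y \<longrightarrow> sfun (l' i) x = z"
      using set_hom_apply[OF li'[OF ix(1)] ix(2)] by blast
  qed
  then obtain h where h: "\<And>y. y \<in> c \<Longrightarrow> h y \<in> c'"
      "\<And>y i x. y \<in> c \<Longrightarrow> i \<in> Obj J \<Longrightarrow> x \<in> fobj X i \<Longrightarrow> sfun (l i) x = y \<Longrightarrow> sfun (l' i) x = h y"
    by (metis (no_types))
  have cc': "small u c" "small u c'" using is_coconeD(1)[OF l] is_coconeD(1)[OF l'] by auto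
  have "set_arr c c' h \<cdot>\<^bsub>set_category u\<^esub> l i = l' i" if i: "i \<in> Obj J" for i
  proof (rule set_map_eqI[where A = "fobj X i"])
    fix x assume "x \<in> fobj X i"
    then show "sfun (set_arr c c' h \<cdot>\<^bsub>set_category u\<^esub> l i) x = sfun (l' i) x"
      using li[OF i] h(2)[OF _ i] by (auto simp: set_hom_iff PiE_iff)
  qed (use li[OF i] li'[OF i] in \<open>auto simp: set_hom_iff PiE_def\<close>)
  then show "\<exists>h\<in>hom (set_category u) c c'. \<forall>i\<in>Obj J. h \<cdot>\<^bsub>set_category u\<^esub> l i = l' i"
    using set_arr_in_hom[OF cc', of h] h(1) by blast
next
  fix d h h' assume h: "h \<in> hom (set_category u) c d" "h' \<in> hom (set_category u) c d"
    and eq: "\<And>i. i \<in> Obj J \<Longrightarrow> h \<cdot>\<^bsub>set_category u\<^esub> l i = h' \<cdot>\<^bsub>set_category u\<^esub> l i"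
  show "h = h'"
  proof (rule set_hom_eqI[OF h])
    fix y assume "y \<in> c"
    then obtain i x where ix: "i \<in> Obj J" "x \<in> fobj X i" "sfun (l i) x = y" using colimiting_surj[OF c] by metis
    then show "sfun h y = sfun h' y"
      using arg_cong[OF eq[OF ix(1)], of "\<lambda>r. sfun r x"] is_coconeD(2)[OF l ix(1)]
      by (simp add: set_hom_iff)
  qed
qed

context universe
begin

lemma two_points: obtains a b :: 'u where "a \<noteq> b"
  using infinite_universe by (metis (full_types) ex_new_if_finite finite.emptyI finite.insertI insertCI)

text \<open>
  Both conditions are tested by maps into a set of two points: the indicator of the joint image must be constant,
  and a compatible family of predicates is a cocone.
\<close>

lemma colimiting_if_set_colimit:
  fixes X :: "('i, 'j, 'u set, 'u set_map) ftor"
  assumes J: "category J" and X: "is_functor J (set_category TYPE('u)) X"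
    and l: "is_colimit J (set_category TYPE('u)) X c l"
  shows "colimiting J (fobj X) (\<lambda>k. sfun (farr X k)) c (\<lambda>i. sfun (l i))"
proof -
  let ?S = "set_category TYPE('u)"
  obtain a b :: 'u where ab: "a \<noteq> b" by (rule two_points)
  note li = is_coconeD(2)[OF is_colimit_cocone[OF l]]
  have small2: "small TYPE('u) {a, b}" by (rule small_finite) simp
  have smallc: "small TYPE('u) c" using is_colimitD(1)[OF l] by simp
  show ?thesis
  proof (rule colimitingI)
    fix y assume y: "y \<in> c"
    let ?I = "{y. \<exists>i\<in>Obj J. \<exists>x\<in>fobj X i. sfun (l i) x = y}"
    let ?h = "set_arr c {a, b} (\<lambda>y. a)" and ?h' = "set_arr c {a, b} (\<lambda>y. if y \<in> ?I then a else b)"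
    have "?h \<in> hom ?S c {a, b}" "?h' \<in> hom ?S c {a, b}" using smallc small2 by (auto simp: set_hom_iff PiE_iff)
    moreover have "?h \<cdot>\<^bsub>?S\<^esub> l i = ?h' \<cdot>\<^bsub>?S\<^esub> l i" if i: "i \<in> Obj J" for i
      using li[OF i] i by (intro set_map_eqI[where A = "fobj X i"]) (auto simp: set_hom_iff PiE_iff)
    ultimately have "?h = ?h'" by (rule colimit_ext[OF category_set_category J X l])
    then have "sfun ?h y = sfun ?h' y" by simp
    then show "\<exists>i\<in>Obj J. \<exists>x\<in>fobj X i. sfun (l i) x = y" using y ab by (auto split: if_splits)
  next
    fix P :: "'i \<Rightarrow> 'u \<Rightarrow> bool" and i j x y
    assume P: "\<And>k x. k \<in> Arr J \<Longrightarrow> x \<in> fobj X (Dom J k) \<Longrightarrow> P (Cod J k) (sfun (farr X k) x) = P (Dom J k) x"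
      and ij: "i \<in> Obj J" "j \<in> Obj J" "x \<in> fobj X i" "y \<in> fobj X j" and eq: "sfun (l i) x = sfun (l j) y"
    let ?l = "\<lambda>i. set_arr (fobj X i) {a, b} (\<lambda>x. if P i x then a else b)"
    have "is_cocone J ?S X {a, b} ?l"
    proof (rule is_coconeI)
      fix k i j assume k: "k \<in> hom J i j"
      then have k': "k \<in> Arr J" "Dom J k = i" "Cod J k = j" by (auto simp: hom_iff)
      show "?l j \<cdot>\<^bsub>?S\<^esub> farr X k = ?l i"
        using set_diagram(2)[OF X k'(1)] P[OF k'(1)] k'(2,3)
        by (intro set_map_eqI[where A = "fobj X i"]) (auto simp: set_hom_iff PiE_iff)
    qed (use small2 set_diagram(1)[OF X] in \<open>auto simp: set_hom_iff\<close>)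
    then obtain h where h: "h \<in> hom ?S c {a, b}" "\<And>i. i \<in> Obj J \<Longrightarrow> h \<cdot>\<^bsub>?S\<^esub> l i = ?l i"
      using colimit_factor[OF l] by blast
    have "sfun h (sfun (l i) x) = (if P i x then a else b)" if "i \<in> Obj J" "x \<in> fobj X i" for i x
      using arg_cong[OF h(2)[OF that(1)], of "\<lambda>r. sfun r x"] that li[OF that(1)] h(1) by (simp add: set_hom_iff)
    from this[OF ij(1,3)] this[OF ij(2,4)] show "P i x = P j y" using eq ab by (auto split: if_splits)
  qed
qed

lemma upair_inject [simp]: "upair x y = upair x' (y' :: 'u) \<longleftrightarrow> x = x' \<and> y = y'"
proof -
  have "|(UNIV :: 'u set) \<times> (UNIV :: 'u set)| =o |UNIV :: 'u set|"
    using card_of_Times_same_infinite[OF infinite_universe] .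
  then obtain p :: "'u \<times> 'u \<Rightarrow> 'u" where "bij_betw p (UNIV \<times> UNIV) UNIV"
    using card_of_ordIso by blast
  then have "\<exists>p :: 'u \<times> 'u \<Rightarrow> 'u. inj p" by (auto simp: bij_betw_def)
  then have "inj (SOME p :: 'u \<times> 'u \<Rightarrow> 'u. inj p)" by (rule someI_ex)
  then show ?thesis by (auto simp: upair_def inj_eq)
qed

lemma ufst_upair [simp]: "ufst (upair x (y :: 'u)) = x"
  unfolding ufst_def by (rule the_equality) auto

lemma usnd_upair [simp]: "usnd (upair x (y :: 'u)) = y"
  unfolding usnd_def by (rule the_equality) auto

lemma upair_in_uprod [simp]: "upair x (y :: 'u) \<in> uprod A B \<longleftrightarrow> x \<in> A \<and> y \<in> B"
  by (auto simp: uprod_def)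

lemma small_uprod: "small TYPE('u) A \<Longrightarrow> small TYPE('u) B \<Longrightarrow> small TYPE('u) (uprod A B)" for A B :: "'u set"
  using small_image[OF small_Sigma[of A "\<lambda>_. B"], of "\<lambda>(x, y). upair x y"]
  by (rule small_subset) (auto simp: uprod_def)

lemma small_upoint: "small TYPE('u) (upoint :: 'u set)"
  by (rule small_finite) (simp add: upoint_def)

text \<open>
  The colimit is the disjoint union modulo the relation of satisfying the same compatible predicates.
\<close>

lemma set_colimit_exists:
  fixes X :: "('u, 'u, 'u set, 'u set_map) ftor"
  assumes J: "small_category J" and X: "is_functor J (set_category TYPE('u)) X"
  obtains c l where "is_colimit J (set_category TYPE('u)) X c l"
proof -
  let ?S = "set_category TYPE('u)"
  have J': "category J" and smallJ: "small TYPE('u) (Obj J)" using J by (auto simp: small_category_def)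
  define E where "E = Sigma (Obj J) (fobj X)"
  define compat where "compat P \<longleftrightarrow> (\<forall>k\<in>Arr J. \<forall>x\<in>fobj X (Dom J k). P (Cod J k) (sfun (farr X k) x) = P (Dom J k) x)"
    for P :: "'u \<Rightarrow> 'u \<Rightarrow> bool"
  define r where "r p q \<longleftrightarrow> (\<forall>P. compat P \<longrightarrow> P (fst p) (snd p) = P (fst q) (snd q))" for p q :: "'u \<times> 'u"
  \<comment> \<open>Each class of the equivalence relation \<open>r\<close> is represented by the code of one of its members.\<close>
  define rep where "rep p = (SOME q. q \<in> E \<and> r q p)" for p
  have rep: "rep p \<in> E \<and> r (rep p) p" if "p \<in> E" for p
    unfolding rep_def by (rule someI[of _ p]) (use that in \<open>simp add: r_def\<close>)
  have rep_eq: "rep p = rep q" if "r p q" for p q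
  proof -
    have "r q' p = r q' q" for q' using that by (auto simp: r_def)
    then show ?thesis by (simp add: rep_def)
  qed
  define code where "code i x = upair (fst (rep (i, x))) (snd (rep (i, x)))" for i x
  have code_eq: "code i x = code j y \<Longrightarrow> r (i, x) (j, y)" if "(i, x) \<in> E" "(j, y) \<in> E" for i x j y
    using rep[OF that(1)] rep[OF that(2)] by (auto simp: code_def r_def prod_eq_iff)
  define c where "c = (\<lambda>(i, x). code i x) ` E"
  have smallc: "small TYPE('u) c"
    unfolding c_def E_def using set_diagram(1)[OF X] by (intro small_image small_Sigma smallJ)
  define l where "l i = set_arr (fobj X i) c (code i)" for i
  have cocone: "is_cocone J ?S X c l"
  proof (rule is_coconeI)
    fix i assume i: "i \<in> Obj J"
    then have "code i \<in> fobj X i \<rightarrow> c" by (auto simp: c_def E_def)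
    then show "l i \<in> hom ?S (fobj X i) c"
      unfolding l_def by (intro set_arr_in_hom set_diagram(1)[OF X i] smallc)
  next
    fix k i j assume "k \<in> hom J i j"
    then have k: "k \<in> Arr J" "Dom J k = i" "Cod J k = j" by (auto simp: hom_iff)
    have "code j (sfun (farr X k) x) = code i x" if "x \<in> fobj X i" for x
      using k that rep_eq[of "(j, sfun (farr X k) x)" "(i, x)"] by (auto simp: code_def r_def compat_def)
    then show "l j \<cdot>\<^bsub>?S\<^esub> farr X k = l i"
      using set_diagram(2)[OF X k(1)] k
      by (intro set_map_eqI[where A = "fobj X i"]) (auto simp: set_hom_iff PiE_iff l_def)
  qed (use smallc in simp)
  have "colimiting J (fobj X) (\<lambda>k. sfun (farr X k)) c (\<lambda>i. sfun (l i))"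
  proof (rule colimitingI)
    fix P :: "'u \<Rightarrow> 'u \<Rightarrow> bool" and i j x y assume "\<And>k x. k \<in> Arr J \<Longrightarrow> x \<in> fobj X (Dom J k) \<Longrightarrow> P (Cod J k) (sfun (farr X k) x) = P (Dom J k) x"
      and ij: "i \<in> Obj J" "j \<in> Obj J" "x \<in> fobj X i" "y \<in> fobj X j" and eq: "sfun (l i) x = sfun (l j) y"
    then have "compat P" by (simp add: compat_def)
    moreover have "r (i, x) (j, y)" using ij eq by (intro code_eq) (simp_all add: l_def E_def)
    ultimately show "P i x = P j y" by (simp add: r_def)
  qed (auto simp: c_def l_def E_def)
  from set_colimit_if_colimiting[OF J' X cocone this] show ?thesis by (rule that)
qed


section \<open>The cartesian monoidal category of small sets\<close>

lemma set_smcat_simps [simp]: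
  "Obj (set_smcat :: ('u set, 'u set_map) smcat) = {A. small TYPE('u) A}"
  "Arr (set_smcat :: ('u set, 'u set_map) smcat) =
    {f. small TYPE('u) (sdom f) \<and> small TYPE('u) (scod f) \<and> sfun f \<in> sdom f \<rightarrow>\<^sub>E scod f}"
  "Dom (set_smcat :: ('u set, 'u set_map) smcat) = sdom"
  "Cod (set_smcat :: ('u set, 'u set_map) smcat) = scod"
  "Ident (set_smcat :: ('u set, 'u set_map) smcat) A = set_arr A A (\<lambda>x. x)"
  "g \<cdot>\<^bsub>set_smcat :: ('u set, 'u set_map) smcat\<^esub> f = set_arr (sdom f) (scod g) (\<lambda>x. sfun g (sfun f x))"
  "A \<otimes>\<^bsub>set_smcat :: ('u set, 'u set_map) smcat\<^esub> B = uprod A B"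
  "f \<boxtimes>\<^bsub>set_smcat :: ('u set, 'u set_map) smcat\<^esub> g = set_arr (uprod (sdom f) (sdom g)) (uprod (scod f) (scod g))
     (\<lambda>z. upair (sfun f (ufst z)) (sfun g (usnd z)))"
  "Unit (set_smcat :: ('u set, 'u set_map) smcat) = upoint"
  "Assoc (set_smcat :: ('u set, 'u set_map) smcat) A B C = set_arr (uprod (uprod A B) C) (uprod A (uprod B C))
     (\<lambda>z. upair (ufst (ufst z)) (upair (usnd (ufst z)) (usnd z)))"
  "Lunit (set_smcat :: ('u set, 'u set_map) smcat) A = set_arr (uprod upoint A) A usnd"
  "Runit (set_smcat :: ('u set, 'u set_map) smcat) A = set_arr (uprod A upoint) A ufst"
  "Braid (set_smcat :: ('u set, 'u set_map) smcat) A B = set_arr (uprod A B) (uprod B A) (\<lambda>z. upair (usnd z) (ufst z))"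
  by (simp_all add: set_smcat_def set_category_def smcat.fields_def cat.extend_def set_arr_def)

lemma truncate_set_smcat: "cat.truncate (set_smcat :: ('u set, 'u set_map) smcat) = set_category TYPE('u)"
  by (simp add: set_smcat_def cat.truncate_def cat.extend_def smcat.fields_def set_category_def)

lemma hom_set_smcat: "hom (set_smcat :: ('u set, 'u set_map) smcat) = hom (set_category TYPE('u))"
  using hom_truncate[of "set_smcat :: ('u set, 'u set_map) smcat"] unfolding truncate_set_smcat by (rule sym)

lemma is_iso_set_smcat: "is_iso (set_smcat :: ('u set, 'u set_map) smcat) = is_iso (set_category TYPE('u))"
  using is_iso_truncate[of "set_smcat :: ('u set, 'u set_map) smcat"] unfolding truncate_set_smcat by (rule sym)

lemma category_set_smcat: "category (set_smcat :: ('u set, 'u set_map) smcat)"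
  using category_truncate[of "set_smcat :: ('u set, 'u set_map) smcat"] category_set_category[of "TYPE('u)"]
  unfolding truncate_set_smcat by blast

lemma uprodE:
  assumes "z \<in> uprod A B" obtains x y where "z = upair x y" "x \<in> A" "y \<in> B"
  using assms by (auto simp: uprod_def)

lemma symmetric_monoidal_set_smcat: "symmetric_monoidal_category (set_smcat :: ('u set, 'u set_map) smcat)"
proof -
  note [simp] = small_uprod small_upoint
  note [elim!] = uprodE
  note eqI = set_map_eqI[OF set_arr_simps(1)]
  have tensor: "tensor_bifunctor (set_smcat :: ('u set, 'u set_map) smcat)"
    unfolding tensor_bifunctor_def hom_set_smcat
    by (auto simp: set_hom_iff PiE_iff intro!: eqI)
  have "bij_betw (\<lambda>z. upair (ufst (ufst z)) (upair (usnd (ufst z)) (usnd z)))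
      (uprod (uprod A B) C) (uprod A (uprod B C))" for A B C :: "'u set"
    by (rule bij_betw_byWitness[where f' = "\<lambda>z. upair (upair (ufst z) (ufst (usnd z))) (usnd (usnd z))"]) auto
  moreover have "bij_betw usnd (uprod upoint A) A" for A :: "'u set"
    by (rule bij_betw_byWitness[where f' = "upair (SOME x. True)"]) (auto simp: upoint_def)
  moreover have "bij_betw ufst (uprod A upoint) A" for A :: "'u set"
    by (rule bij_betw_byWitness[where f' = "\<lambda>x. upair x (SOME x. True)"]) (auto simp: upoint_def)
  ultimately have "monoidal_constraints (set_smcat :: ('u set, 'u set_map) smcat)"
    unfolding monoidal_constraints_def hom_set_smcat is_iso_set_smcat
    by (auto simp: set_hom_iff PiE_iff intro!: eqI set_is_iso[OF set_arr_in_hom])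
  moreover have "monoidal_coherence (set_smcat :: ('u set, 'u set_map) smcat)"
    unfolding monoidal_coherence_def
    by (auto simp: PiE_iff intro!: eqI)
  ultimately show ?thesis
    by (simp add: symmetric_monoidal_category_def category_set_smcat tensor)
qed

end

section \<open>Pointwise symmetric monoidal structure on functors\<close>

context sm_category
begin

lemma Assoc_natural:
  "f \<in> Arr C \<Longrightarrow> g \<in> Arr C \<Longrightarrow> h \<in> Arr C \<Longrightarrow>
     Assoc C (Cod C f) (Cod C g) (Cod C h) \<cdot>\<^bsub>C\<^esub> ((f \<boxtimes>\<^bsub>C\<^esub> g) \<boxtimes>\<^bsub>C\<^esub> h) =
     (f \<boxtimes>\<^bsub>C\<^esub> (g \<boxtimes>\<^bsub>C\<^esub> h)) \<cdot>\<^bsub>C\<^esub> Assoc C (Dom C f) (Dom C g) (Dom C h)"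
  using sm by (simp add: symmetric_monoidal_category_def monoidal_constraints_def)

lemma Lunit_natural:
  "f \<in> Arr C \<Longrightarrow> Lunit C (Cod C f) \<cdot>\<^bsub>C\<^esub> (Ident C (Unit C) \<boxtimes>\<^bsub>C\<^esub> f) = f \<cdot>\<^bsub>C\<^esub> Lunit C (Dom C f)"
  using sm by (simp add: symmetric_monoidal_category_def monoidal_constraints_def)

lemma Runit_natural:
  "f \<in> Arr C \<Longrightarrow> Runit C (Cod C f) \<cdot>\<^bsub>C\<^esub> (f \<boxtimes>\<^bsub>C\<^esub> Ident C (Unit C)) = f \<cdot>\<^bsub>C\<^esub> Runit C (Dom C f)"
  using sm by (simp add: symmetric_monoidal_category_def monoidal_constraints_def)

lemma Braid_natural:
  "f \<in> Arr C \<Longrightarrow> g \<in> Arr C \<Longrightarrow>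
     Braid C (Cod C f) (Cod C g) \<cdot>\<^bsub>C\<^esub> (f \<boxtimes>\<^bsub>C\<^esub> g) = (g \<boxtimes>\<^bsub>C\<^esub> f) \<cdot>\<^bsub>C\<^esub> Braid C (Dom C f) (Dom C g)"
  using sm by (simp add: symmetric_monoidal_category_def monoidal_constraints_def)

lemma constraints_iso:
  "a \<in> Obj C \<Longrightarrow> b \<in> Obj C \<Longrightarrow> c \<in> Obj C \<Longrightarrow> is_iso C (Assoc C a b c)"
  "a \<in> Obj C \<Longrightarrow> is_iso C (Lunit C a)" "a \<in> Obj C \<Longrightarrow> is_iso C (Runit C a)"
  using sm by (simp_all add: symmetric_monoidal_category_def monoidal_constraints_def)

lemma coherence:
  "a \<in> Obj C \<Longrightarrow> b \<in> Obj C \<Longrightarrow> c \<in> Obj C \<Longrightarrow> d \<in> Obj C \<Longrightarrow>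
    (Ident C a \<boxtimes>\<^bsub>C\<^esub> Assoc C b c d) \<cdot>\<^bsub>C\<^esub> Assoc C a (b \<otimes>\<^bsub>C\<^esub> c) d \<cdot>\<^bsub>C\<^esub> (Assoc C a b c \<boxtimes>\<^bsub>C\<^esub> Ident C d) =
    Assoc C a b (c \<otimes>\<^bsub>C\<^esub> d) \<cdot>\<^bsub>C\<^esub> Assoc C (a \<otimes>\<^bsub>C\<^esub> b) c d"
  "a \<in> Obj C \<Longrightarrow> b \<in> Obj C \<Longrightarrow>
    (Ident C a \<boxtimes>\<^bsub>C\<^esub> Lunit C b) \<cdot>\<^bsub>C\<^esub> Assoc C a (Unit C) b = Runit C a \<boxtimes>\<^bsub>C\<^esub> Ident C b"
  "a \<in> Obj C \<Longrightarrow> b \<in> Obj C \<Longrightarrow> c \<in> Obj C \<Longrightarrow>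
    Assoc C b c a \<cdot>\<^bsub>C\<^esub> Braid C a (b \<otimes>\<^bsub>C\<^esub> c) \<cdot>\<^bsub>C\<^esub> Assoc C a b c =
    (Ident C b \<boxtimes>\<^bsub>C\<^esub> Braid C a c) \<cdot>\<^bsub>C\<^esub> Assoc C b a c \<cdot>\<^bsub>C\<^esub> (Braid C a b \<boxtimes>\<^bsub>C\<^esub> Ident C c)"
  "a \<in> Obj C \<Longrightarrow> b \<in> Obj C \<Longrightarrow> Braid C b a \<cdot>\<^bsub>C\<^esub> Braid C a b = Ident C (a \<otimes>\<^bsub>C\<^esub> b)"
  using sm by (simp_all add: symmetric_monoidal_category_def monoidal_coherence_def)

end

lemma functor_tensor_simps [simp]:
  "a \<in> Obj C \<Longrightarrow> fobj (functor_tensor C M X Y) a = fobj X a \<otimes>\<^bsub>M\<^esub> fobj Y a"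
  "f \<in> Arr C \<Longrightarrow> farr (functor_tensor C M X Y) f = farr X f \<boxtimes>\<^bsub>M\<^esub> farr Y f"
  "a \<in> Obj C \<Longrightarrow> fobj (functor_unit C M) a = Unit M"
  "f \<in> Arr C \<Longrightarrow> farr (functor_unit C M) f = Ident M (Unit M)"
  by (simp_all add: functor_tensor_def functor_unit_def)

lemma functor_smcat_simps [simp]:
  "Obj (functor_smcat C M) = {F. is_functor C M F}"
  "Arr (functor_smcat C M) = {t. natural C M t}"
  "Dom (functor_smcat C M) = nsrc" "Cod (functor_smcat C M) = ntgt"
  "Ident (functor_smcat C M) = ntrans_id C M" "Comp (functor_smcat C M) = ntrans_comp C M"
  "Tobj (functor_smcat C M) = functor_tensor C M"
  "s \<boxtimes>\<^bsub>functor_smcat C M\<^esub> t = \<lparr>nsrc = functor_tensor C M (nsrc s) (nsrc t),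
     ntgt = functor_tensor C M (ntgt s) (ntgt t), ncomp = (\<lambda>a \<in> Obj C. ncomp s a \<boxtimes>\<^bsub>M\<^esub> ncomp t a)\<rparr>"
  "Unit (functor_smcat C M) = functor_unit C M"
  "Assoc (functor_smcat C M) X Y Z = \<lparr>nsrc = functor_tensor C M (functor_tensor C M X Y) Z,
     ntgt = functor_tensor C M X (functor_tensor C M Y Z),
     ncomp = (\<lambda>a \<in> Obj C. Assoc M (fobj X a) (fobj Y a) (fobj Z a))\<rparr>"
  "Lunit (functor_smcat C M) X = \<lparr>nsrc = functor_tensor C M (functor_unit C M) X, ntgt = X,
     ncomp = (\<lambda>a \<in> Obj C. Lunit M (fobj X a))\<rparr>"
  "Runit (functor_smcat C M) X = \<lparr>nsrc = functor_tensor C M X (functor_unit C M), ntgt = X,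
     ncomp = (\<lambda>a \<in> Obj C. Runit M (fobj X a))\<rparr>"
  "Braid (functor_smcat C M) X Y = \<lparr>nsrc = functor_tensor C M X Y, ntgt = functor_tensor C M Y X,
     ncomp = (\<lambda>a \<in> Obj C. Braid M (fobj X a) (fobj Y a))\<rparr>"
  by (simp_all add: functor_smcat_def functor_category_def smcat.fields_def cat.extend_def)

lemma truncate_functor_smcat: "cat.truncate (functor_smcat C M) = functor_category C M"
  by (simp add: functor_smcat_def functor_category_def cat.truncate_def cat.extend_def smcat.fields_def)

lemma is_iso_functor_smcat: "is_iso (functor_smcat C M) t = is_iso (functor_category C M) t"
  using is_iso_truncate[of "functor_smcat C M"] by (simp add: truncate_functor_smcat)

lemma category_functor_smcat: "category C \<Longrightarrow> category M \<Longrightarrow> category (functor_smcat C M)"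
  using category_truncate[of "functor_smcat C M"] category_functor_category[of C M]
  by (simp add: truncate_functor_smcat)

lemma symmetric_monoidal_functor_smcat:
  fixes C :: "('o1, 'a1, 'y) cat_scheme" and M :: "('o2, 'a2, 'z) smcat_scheme"
  assumes C: "category C" and M: "symmetric_monoidal_category M"
  shows "symmetric_monoidal_category (functor_smcat C M)"
proof -
  interpret C: cat_laws C using C by unfold_locales
  interpret M: sm_category M using M by unfold_locales
  let ?E = "functor_smcat C M"
  let ?T = "functor_tensor C M" and ?I = "functor_unit C M"
  have F [simp]: "fobj F a \<in> Obj M" if "is_functor C M F" "a \<in> Obj C"
    for F :: "('o1, 'a1, 'o2, 'a2) ftor" and a
    using functor_fobj[OF that] .
  have F' [simp]: "farr F f \<in> Arr M" "Dom M (farr F f) = fobj F (Dom C f)" "Cod M (farr F f) = fobj F (Cod C f)"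
    if "is_functor C M F" "f \<in> Arr C" for F :: "('o1, 'a1, 'o2, 'a2) ftor" and f
    using functor_farr[OF that(1) arr_in_hom[OF that(2)]] by (auto simp: hom_iff)
  have t [simp]: "ncomp t a \<in> Arr M" "Dom M (ncomp t a) = fobj (nsrc t) a" "Cod M (ncomp t a) = fobj (ntgt t) a"
    if "natural C M t" "a \<in> Obj C" for t :: "(('o1, 'a1, 'o2, 'a2) ftor, 'o1, 'a2) ntrans" and a
    using naturalD(4)[OF that] by (auto simp: hom_iff)
  have t' [simp]: "is_functor C M (nsrc t)" "is_functor C M (ntgt t)"
    if "natural C M t" for t :: "(('o1, 'a1, 'o2, 'a2) ftor, 'o1, 'a2) ntrans"
    using naturalD(1,2)[OF that] by auto
  have nat: "ncomp t (Cod C f) \<cdot>\<^bsub>M\<^esub> farr (nsrc t) f = farr (ntgt t) f \<cdot>\<^bsub>M\<^esub> ncomp t (Dom C f)"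
    if "natural C M t" "f \<in> Arr C" for t :: "(('o1, 'a1, 'o2, 'a2) ftor, 'o1, 'a2) ntrans" and f
    using naturalD(5)[OF that(1) arr_in_hom[OF that(2)]] .
  have T [simp]: "is_functor C M (?T X Y)" if "is_functor C M X" "is_functor C M Y" for X Y
  proof (rule is_functorI[OF C])
    fix f g a b c assume f: "f \<in> hom C a b" and g: "g \<in> hom C b c"
    then show "farr (?T X Y) (g \<cdot>\<^bsub>C\<^esub> f) = farr (?T X Y) g \<cdot>\<^bsub>M\<^esub> farr (?T X Y) f"
      using that functor_Comp[OF that(1) f g] functor_Comp[OF that(2) f g]
      by (simp add: hom_iff M.interchange)
  qed (use that in \<open>auto simp: functor_tensor_def hom_iff functor_Ident\<close>)
  have I [simp]: "is_functor C M ?I"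
    by (rule is_functorI[OF C]) (auto simp: functor_unit_def hom_iff)
  have tensor: "natural C M (s \<boxtimes>\<^bsub>?E\<^esub> t)" if "natural C M s" "natural C M t" for s t
  proof (rule naturalI)
    fix f a b assume "f \<in> hom C a b"
    then have f: "f \<in> Arr C" "a = Dom C f" "b = Cod C f" by (auto simp: hom_iff)
    show "ncomp (s \<boxtimes>\<^bsub>?E\<^esub> t) b \<cdot>\<^bsub>M\<^esub> farr (nsrc (s \<boxtimes>\<^bsub>?E\<^esub> t)) f = farr (ntgt (s \<boxtimes>\<^bsub>?E\<^esub> t)) f \<cdot>\<^bsub>M\<^esub> ncomp (s \<boxtimes>\<^bsub>?E\<^esub> t) a"
      using that f by (simp add: M.interchange nat)
  qed (use that in \<open>auto simp: hom_iff\<close>)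
  have constraint: "natural C M r" if "is_functor C M (nsrc r)" "is_functor C M (ntgt r)"
      "ncomp r = restrict \<phi> (Obj C)" "\<And>a. a \<in> Obj C \<Longrightarrow> \<phi> a \<in> hom M (fobj (nsrc r) a) (fobj (ntgt r) a)"
      "\<And>f. f \<in> Arr C \<Longrightarrow> \<phi> (Cod C f) \<cdot>\<^bsub>M\<^esub> farr (nsrc r) f = farr (ntgt r) f \<cdot>\<^bsub>M\<^esub> \<phi> (Dom C f)"
    for r :: "(('o1, 'a1, 'o2, 'a2) ftor, 'o1, 'a2) ntrans" and \<phi>
    by (rule naturalI) (use that in \<open>auto simp: hom_iff\<close>)
  have assoc: "natural C M (Assoc ?E X Y Z)" if "is_functor C M X" "is_functor C M Y" "is_functor C M Z" for X Y Z
  proof (rule constraint[where \<phi> = "\<lambda>a. Assoc M (fobj X a) (fobj Y a) (fobj Z a)"])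
    fix f assume "f \<in> Arr C"
    then show "Assoc M (fobj X (Cod C f)) (fobj Y (Cod C f)) (fobj Z (Cod C f)) \<cdot>\<^bsub>M\<^esub> farr (nsrc (Assoc ?E X Y Z)) f =
        farr (ntgt (Assoc ?E X Y Z)) f \<cdot>\<^bsub>M\<^esub> Assoc M (fobj X (Dom C f)) (fobj Y (Dom C f)) (fobj Z (Dom C f))"
      using that M.Assoc_natural[of "farr X f" "farr Y f" "farr Z f"] by simp
  qed (use that in \<open>auto simp: hom_iff\<close>)
  have lunit: "natural C M (Lunit ?E X)" if "is_functor C M X" for X
  proof (rule constraint[where \<phi> = "\<lambda>a. Lunit M (fobj X a)"])
    fix f assume "f \<in> Arr C"
    then show "Lunit M (fobj X (Cod C f)) \<cdot>\<^bsub>M\<^esub> farr (nsrc (Lunit ?E X)) f =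
        farr (ntgt (Lunit ?E X)) f \<cdot>\<^bsub>M\<^esub> Lunit M (fobj X (Dom C f))"
      using that M.Lunit_natural[of "farr X f"] by simp
  qed (use that in \<open>auto simp: hom_iff\<close>)
  have runit: "natural C M (Runit ?E X)" if "is_functor C M X" for X
  proof (rule constraint[where \<phi> = "\<lambda>a. Runit M (fobj X a)"])
    fix f assume "f \<in> Arr C"
    then show "Runit M (fobj X (Cod C f)) \<cdot>\<^bsub>M\<^esub> farr (nsrc (Runit ?E X)) f =
        farr (ntgt (Runit ?E X)) f \<cdot>\<^bsub>M\<^esub> Runit M (fobj X (Dom C f))"
      using that M.Runit_natural[of "farr X f"] by simp
  qed (use that in \<open>auto simp: hom_iff\<close>)
  have braid: "natural C M (Braid ?E X Y)" if "is_functor C M X" "is_functor C M Y" for X Y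
  proof (rule constraint[where \<phi> = "\<lambda>a. Braid M (fobj X a) (fobj Y a)"])
    fix f assume "f \<in> Arr C"
    then show "Braid M (fobj X (Cod C f)) (fobj Y (Cod C f)) \<cdot>\<^bsub>M\<^esub> farr (nsrc (Braid ?E X Y)) f =
        farr (ntgt (Braid ?E X Y)) f \<cdot>\<^bsub>M\<^esub> Braid M (fobj X (Dom C f)) (fobj Y (Dom C f))"
      using that M.Braid_natural[of "farr X f" "farr Y f"] by simp
  qed (use that in \<open>auto simp: hom_iff\<close>)
  note iso = is_iso_functor_category[OF C M.cat, folded is_iso_functor_smcat]
  note eqI = ntrans_eqI[where A = "Obj C"]
  have "tensor_bifunctor ?E"
    unfolding tensor_bifunctor_def using tensor
    by (auto simp: hom_iff M.interchange intro!: eqI)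
  moreover have "monoidal_constraints ?E"
  proof -
    have "is_iso ?E (Assoc ?E X Y Z)" if "is_functor C M X" "is_functor C M Y" "is_functor C M Z" for X Y Z
      by (rule iso[OF assoc[OF that]]) (use that in \<open>simp add: M.constraints_iso\<close>)
    moreover have "is_iso ?E (Lunit ?E X)" "is_iso ?E (Runit ?E X)" if "is_functor C M X" for X
      by (rule iso[OF lunit[OF that]] iso[OF runit[OF that]]; use that in \<open>simp add: M.constraints_iso\<close>)+
    moreover have "Assoc ?E (ntgt r) (ntgt s) (ntgt t) \<cdot>\<^bsub>?E\<^esub> ((r \<boxtimes>\<^bsub>?E\<^esub> s) \<boxtimes>\<^bsub>?E\<^esub> t) =
        (r \<boxtimes>\<^bsub>?E\<^esub> (s \<boxtimes>\<^bsub>?E\<^esub> t)) \<cdot>\<^bsub>?E\<^esub> Assoc ?E (nsrc r) (nsrc s) (nsrc t)"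
      if "natural C M r" "natural C M s" "natural C M t" for r s t
    proof (rule eqI)
      fix a assume "a \<in> Obj C"
      then show "ncomp (Assoc ?E (ntgt r) (ntgt s) (ntgt t) \<cdot>\<^bsub>?E\<^esub> ((r \<boxtimes>\<^bsub>?E\<^esub> s) \<boxtimes>\<^bsub>?E\<^esub> t)) a =
          ncomp ((r \<boxtimes>\<^bsub>?E\<^esub> (s \<boxtimes>\<^bsub>?E\<^esub> t)) \<cdot>\<^bsub>?E\<^esub> Assoc ?E (nsrc r) (nsrc s) (nsrc t)) a"
        using that M.Assoc_natural[of "ncomp r a" "ncomp s a" "ncomp t a"] by simp
    qed simp_all
    moreover have "Lunit ?E (ntgt t) \<cdot>\<^bsub>?E\<^esub> (Ident ?E (Unit ?E) \<boxtimes>\<^bsub>?E\<^esub> t) = t \<cdot>\<^bsub>?E\<^esub> Lunit ?E (nsrc t)"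
      "Runit ?E (ntgt t) \<cdot>\<^bsub>?E\<^esub> (t \<boxtimes>\<^bsub>?E\<^esub> Ident ?E (Unit ?E)) = t \<cdot>\<^bsub>?E\<^esub> Runit ?E (nsrc t)"
      if "natural C M t" for t
    proof -
      have "Lunit M (fobj (ntgt t) a) \<cdot>\<^bsub>M\<^esub> (Ident M (Unit M) \<boxtimes>\<^bsub>M\<^esub> ncomp t a) = ncomp t a \<cdot>\<^bsub>M\<^esub> Lunit M (fobj (nsrc t) a)"
        "Runit M (fobj (ntgt t) a) \<cdot>\<^bsub>M\<^esub> (ncomp t a \<boxtimes>\<^bsub>M\<^esub> Ident M (Unit M)) = ncomp t a \<cdot>\<^bsub>M\<^esub> Runit M (fobj (nsrc t) a)"
        if "a \<in> Obj C" for a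
        using that \<open>natural C M t\<close> M.Lunit_natural[of "ncomp t a"] M.Runit_natural[of "ncomp t a"] by simp_all
      then show "Lunit ?E (ntgt t) \<cdot>\<^bsub>?E\<^esub> (Ident ?E (Unit ?E) \<boxtimes>\<^bsub>?E\<^esub> t) = t \<cdot>\<^bsub>?E\<^esub> Lunit ?E (nsrc t)"
        "Runit ?E (ntgt t) \<cdot>\<^bsub>?E\<^esub> (t \<boxtimes>\<^bsub>?E\<^esub> Ident ?E (Unit ?E)) = t \<cdot>\<^bsub>?E\<^esub> Runit ?E (nsrc t)"
        by (auto intro!: eqI)
    qed
    moreover have "Braid ?E (ntgt s) (ntgt t) \<cdot>\<^bsub>?E\<^esub> (s \<boxtimes>\<^bsub>?E\<^esub> t) = (t \<boxtimes>\<^bsub>?E\<^esub> s) \<cdot>\<^bsub>?E\<^esub> Braid ?E (nsrc s) (nsrc t)"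
      if "natural C M s" "natural C M t" for s t
    proof (rule eqI)
      fix a assume "a \<in> Obj C"
      then show "ncomp (Braid ?E (ntgt s) (ntgt t) \<cdot>\<^bsub>?E\<^esub> (s \<boxtimes>\<^bsub>?E\<^esub> t)) a =
          ncomp ((t \<boxtimes>\<^bsub>?E\<^esub> s) \<cdot>\<^bsub>?E\<^esub> Braid ?E (nsrc s) (nsrc t)) a"
        using that M.Braid_natural[of "ncomp s a" "ncomp t a"] by simp
    qed simp_all
    ultimately show ?thesis
      unfolding monoidal_constraints_def using assoc lunit runit braid
      by (simp add: hom_iff del: functor_smcat_simps(5,6,8,10-13)) (simp add: hom_iff)
  qed
  moreover have "monoidal_coherence ?E"
    unfolding monoidal_coherence_def by (auto simp: M.coherence intro!: eqI)
  ultimately show ?thesis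
    by (simp add: symmetric_monoidal_category_def category_functor_smcat[OF C M.cat])
qed

section \<open>The category of \<open>G\<close>-sets\<close>

lemma colimiting_cong:
  assumes J: "category J" and "\<And>i. i \<in> Obj J \<Longrightarrow> A i = A' i"
    and "\<And>k x. k \<in> Arr J \<Longrightarrow> x \<in> A (Dom J k) \<Longrightarrow> m k x = m' k x"
    and "\<And>i x. i \<in> Obj J \<Longrightarrow> x \<in> A i \<Longrightarrow> L i x = L' i x"
  shows "colimiting J A m c L = colimiting J A' m' c L'"
proof -
  interpret cat_laws J using J by unfold_locales
  show ?thesis unfolding colimiting_def using assms(2-4) by (simp cong: ball_cong)
qed

lemma GSet_simps [simp]:
  "Obj (GSet G) = {F. is_functor G set_smcat F}" "Arr (GSet G) = {t. natural G set_smcat t}"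
  "Dom (GSet G) = nsrc" "Cod (GSet G) = ntgt"
  "Ident (GSet G) = ntrans_id G set_smcat" "Comp (GSet G) = ntrans_comp G set_smcat"
  "Tobj (GSet G) = functor_tensor G set_smcat" "Unit (GSet G) = functor_unit G set_smcat"
  by (simp_all add: GSet_def)

definition gset :: "('u, 'u) cat \<Rightarrow> ('u \<Rightarrow> 'u set) \<Rightarrow> ('u \<Rightarrow> 'u \<Rightarrow> 'u) \<Rightarrow> 'u gset" where
  "gset G A m = \<lparr>fobj = restrict A (Obj G), farr = (\<lambda>f\<in>Arr G. set_arr (A (Dom G f)) (A (Cod G f)) (m f))\<rparr>"

definition gmap :: "('u, 'u) cat \<Rightarrow> 'u gset \<Rightarrow> 'u gset \<Rightarrow> ('u \<Rightarrow> 'u \<Rightarrow> 'u) \<Rightarrow> 'u gset_map" where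
  "gmap G X Y \<phi> = \<lparr>nsrc = X, ntgt = Y, ncomp = (\<lambda>a\<in>Obj G. set_arr (fobj X a) (fobj Y a) (\<phi> a))\<rparr>"

lemma gset_simps [simp]:
  "a \<in> Obj G \<Longrightarrow> fobj (gset G A m) a = A a"
  "f \<in> Arr G \<Longrightarrow> farr (gset G A m) f = set_arr (A (Dom G f)) (A (Cod G f)) (m f)"
  by (simp_all add: gset_def)

lemma gmap_simps [simp]:
  "nsrc (gmap G X Y \<phi>) = X" "ntgt (gmap G X Y \<phi>) = Y"
  "a \<in> Obj G \<Longrightarrow> ncomp (gmap G X Y \<phi>) a = set_arr (fobj X a) (fobj Y a) (\<phi> a)"
  "ncomp (gmap G X Y \<phi>) \<in> extensional (Obj G)"
  by (simp_all add: gmap_def)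

locale gsets = universe u for u :: "'u itself" +
  fixes G :: "('u, 'u) cat"
  assumes small_G: "small_category G"

sublocale gsets \<subseteq> G: cat_laws G
  using small_G by unfold_locales (simp add: small_category_def)

context gsets
begin

abbreviation "S \<equiv> set_smcat :: ('u set, 'u set_map) smcat"

lemma small_Obj: "small TYPE('u) (Obj G)" and small_Arr: "small TYPE('u) (Arr G)"
  using small_G by (simp_all add: small_category_def)

lemma hom_S_iff: "f \<in> hom S A B \<longleftrightarrow>
    small TYPE('u) A \<and> small TYPE('u) B \<and> sdom f = A \<and> scod f = B \<and> sfun f \<in> A \<rightarrow>\<^sub>E B"
  by (simp add: hom_set_smcat set_hom_iff)

lemma gset_small: "is_functor G S X \<Longrightarrow> a \<in> Obj G \<Longrightarrow> small TYPE('u) (fobj X a)"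
  using functor_fobj[of G S X a] by simp

lemma gset_farr: "is_functor G S X \<Longrightarrow> f \<in> Arr G \<Longrightarrow>
    sdom (farr X f) = fobj X (Dom G f) \<and> scod (farr X f) = fobj X (Cod G f) \<and>
    sfun (farr X f) \<in> fobj X (Dom G f) \<rightarrow>\<^sub>E fobj X (Cod G f)"
  using functor_farr[of G S X f, OF _ arr_in_hom] by (simp add: hom_S_iff)

lemma gset_act: "is_functor G S X \<Longrightarrow> f \<in> Arr G \<Longrightarrow> x \<in> fobj X (Dom G f) \<Longrightarrow> sfun (farr X f) x \<in> fobj X (Cod G f)"
  using gset_farr[of X f] by (auto simp: PiE_iff)

lemma gset_act_Ident: "is_functor G S X \<Longrightarrow> a \<in> Obj G \<Longrightarrow> x \<in> fobj X a \<Longrightarrow> sfun (farr X (Ident G a)) x = x"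
  using functor_Ident[of G S X a] by simp

lemma gset_act_Comp:
  "is_functor G S X \<Longrightarrow> f \<in> Arr G \<Longrightarrow> g \<in> Arr G \<Longrightarrow> Dom G g = Cod G f \<Longrightarrow> x \<in> fobj X (Dom G f) \<Longrightarrow>
     sfun (farr X (g \<cdot>\<^bsub>G\<^esub> f)) x = sfun (farr X g) (sfun (farr X f) x)"
  using functor_Comp[of G S X f "Dom G f" "Cod G f" g "Cod G g"] gset_farr[of X f]
  by (simp add: hom_iff)

lemma is_functor_gset:
  assumes "\<And>a. a \<in> Obj G \<Longrightarrow> small TYPE('u) (A a)"
    and m: "\<And>f x. f \<in> Arr G \<Longrightarrow> x \<in> A (Dom G f) \<Longrightarrow> m f x \<in> A (Cod G f)"
    and id: "\<And>a x. a \<in> Obj G \<Longrightarrow> x \<in> A a \<Longrightarrow> m (Ident G a) x = x"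
    and comp: "\<And>f g x. f \<in> Arr G \<Longrightarrow> g \<in> Arr G \<Longrightarrow> Dom G g = Cod G f \<Longrightarrow> x \<in> A (Dom G f) \<Longrightarrow>
      m (g \<cdot>\<^bsub>G\<^esub> f) x = m g (m f x)"
  shows "is_functor G S (gset G A m)"
proof (rule is_functorI[OF G.cat])
  fix a assume "a \<in> Obj G"
  then show "farr (gset G A m) (Ident G a) = Ident S (fobj (gset G A m) a)"
    using id by (auto intro!: set_map_eqI[OF set_arr_simps(1)])
next
  fix f g a b c assume f: "f \<in> hom G a b" and g: "g \<in> hom G b c"
  then show "farr (gset G A m) (g \<cdot>\<^bsub>G\<^esub> f) = farr (gset G A m) g \<cdot>\<^bsub>S\<^esub> farr (gset G A m) f"
    using comp m[of f] by (auto simp: hom_iff intro!: set_map_eqI[OF set_arr_simps(1)])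
qed (use assms(1) m in \<open>auto simp: gset_def hom_S_iff hom_iff\<close>)

lemma gmap_ncomp: "natural G S t \<Longrightarrow> a \<in> Obj G \<Longrightarrow>
    sdom (ncomp t a) = fobj (nsrc t) a \<and> scod (ncomp t a) = fobj (ntgt t) a \<and>
    sfun (ncomp t a) \<in> fobj (nsrc t) a \<rightarrow>\<^sub>E fobj (ntgt t) a"
  using naturalD(4)[of G S t a] by (simp add: hom_S_iff)

lemma gmap_apply: "natural G S t \<Longrightarrow> a \<in> Obj G \<Longrightarrow> x \<in> fobj (nsrc t) a \<Longrightarrow> sfun (ncomp t a) x \<in> fobj (ntgt t) a"
  using gmap_ncomp[of t a] by (auto simp: PiE_iff)

lemma gmap_equivariant:
  assumes t: "natural G S t" and f: "f \<in> Arr G" and x: "x \<in> fobj (nsrc t) (Dom G f)"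
  shows "sfun (ncomp t (Cod G f)) (sfun (farr (nsrc t) f) x) = sfun (farr (ntgt t) f) (sfun (ncomp t (Dom G f)) x)"
  using arg_cong[OF naturalD(5)[OF t arr_in_hom[OF f]], of "\<lambda>r. sfun r x"] x
    gset_farr[OF naturalD(1)[OF t] f] gmap_ncomp[OF t, of "Dom G f"] f by simp

lemma natural_gmap:
  assumes X: "is_functor G S X" and Y: "is_functor G S Y"
    and \<phi>: "\<And>a x. a \<in> Obj G \<Longrightarrow> x \<in> fobj X a \<Longrightarrow> \<phi> a x \<in> fobj Y a"
    and eq: "\<And>f x. f \<in> Arr G \<Longrightarrow> x \<in> fobj X (Dom G f) \<Longrightarrow>
      \<phi> (Cod G f) (sfun (farr X f) x) = sfun (farr Y f) (\<phi> (Dom G f) x)"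
  shows "natural G S (gmap G X Y \<phi>)"
proof (rule naturalI)
  fix f a b assume "f \<in> hom G a b"
  then have f: "f \<in> Arr G" "Dom G f = a" "Cod G f = b" by (auto simp: hom_iff)
  then have "a \<in> Obj G" "b \<in> Obj G" by auto
  then show "ncomp (gmap G X Y \<phi>) b \<cdot>\<^bsub>S\<^esub> farr (nsrc (gmap G X Y \<phi>)) f =
      farr (ntgt (gmap G X Y \<phi>)) f \<cdot>\<^bsub>S\<^esub> ncomp (gmap G X Y \<phi>) a"
    using gset_farr[OF X f(1)] gset_farr[OF Y f(1)] eq[OF f(1)] \<phi>[of a] f(2,3) gset_act[OF X f(1)]
    by (auto intro!: set_map_eqI[OF set_arr_simps(1)])
qed (use X Y \<phi> gset_small in \<open>auto simp: hom_S_iff\<close>)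

lemma gmap_eqI:
  assumes s: "natural G S s" and t: "natural G S t" and eq: "nsrc s = nsrc t" "ntgt s = ntgt t"
    and "\<And>a x. a \<in> Obj G \<Longrightarrow> x \<in> fobj (nsrc s) a \<Longrightarrow> sfun (ncomp s a) x = sfun (ncomp t a) x"
  shows "s = t"
proof (rule ntrans_eqI[OF eq naturalD(3)[OF s] naturalD(3)[OF t]])
  fix a assume a: "a \<in> Obj G"
  show "ncomp s a = ncomp t a"
    using gmap_ncomp[OF s a] gmap_ncomp[OF t a] eq assms(5)[OF a]
    by (intro set_map_eqI[where A = "fobj (nsrc s) a"]) (auto simp: PiE_iff)
qed

lemma natural_comp_S: "natural G S s \<Longrightarrow> natural G S t \<Longrightarrow> nsrc t = ntgt s \<Longrightarrow> natural G S (ntrans_comp G S t s)"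
  using natural_comp[OF G.cat category_set_smcat] .

lemma ncomp_comp_apply:
  "natural G S s \<Longrightarrow> natural G S t \<Longrightarrow> nsrc t = ntgt s \<Longrightarrow> a \<in> Obj G \<Longrightarrow> x \<in> fobj (nsrc s) a \<Longrightarrow>
     sfun (ncomp (ntrans_comp G S t s) a) x = sfun (ncomp t a) (sfun (ncomp s a) x)"
  using gmap_ncomp[of s a] by simp

lemma category_GSet: "category (GSet G)"
  unfolding GSet_def using category_functor_smcat[OF G.cat category_set_smcat] .

lemma symmetric_monoidal_GSet: "symmetric_monoidal_category (GSet G)"
  unfolding GSet_def using symmetric_monoidal_functor_smcat[OF G.cat symmetric_monoidal_set_smcat] .

sublocale E: sm_category "GSet G"
  by unfold_locales (rule symmetric_monoidal_GSet)

lemma functor_category_S: "functor_category G (set_category TYPE('u)) = functor_category G S"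
  using functor_category_truncate[of G S] unfolding truncate_set_smcat .

lemma truncate_GSet: "cat.truncate (GSet G) = functor_category G (set_category TYPE('u))"
  unfolding GSet_def truncate_functor_smcat functor_category_S ..

lemma is_functor_GSet: "is_functor J (GSet G) = is_functor J (functor_category G (set_category TYPE('u)))"
  using is_functor_truncate(1)[of J "GSet G"] unfolding truncate_GSet by (rule sym)

lemma is_cocone_GSet: "is_cocone J (GSet G) = is_cocone J (functor_category G (set_category TYPE('u)))"
  using is_cocone_truncate[of J "GSet G"] unfolding truncate_GSet by (rule sym)

lemma is_colimit_GSet: "is_colimit J (GSet G) = is_colimit J (functor_category G (set_category TYPE('u)))"
  using is_colimit_truncate[of J "GSet G"] unfolding truncate_GSet by (rule sym)

lemma diagram_GSet:
  assumes "is_functor J (GSet G) X"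
  shows "i \<in> Obj J \<Longrightarrow> is_functor G S (fobj X i)"
    and "k \<in> Arr J \<Longrightarrow> natural G S (farr X k)"
    and "k \<in> Arr J \<Longrightarrow> nsrc (farr X k) = fobj X (Dom J k)"
    and "k \<in> Arr J \<Longrightarrow> ntgt (farr X k) = fobj X (Cod J k)"
  using functor_fobj[OF assms] functor_farr[OF assms arr_in_hom] by (auto simp: hom_iff)

abbreviation fibrewise_colimit ::
    "('i, 'j, 'y) cat_scheme \<Rightarrow> ('i, 'j, 'u gset, 'u gset_map) ftor \<Rightarrow> 'u gset \<Rightarrow> ('i \<Rightarrow> 'u gset_map) \<Rightarrow> 'u \<Rightarrow> bool" where
  "fibrewise_colimit J X c l a \<equiv> colimiting J (\<lambda>i. fobj (fobj X i) a) (\<lambda>k. sfun (ncomp (farr X k) a))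
     (fobj c a) (\<lambda>i. sfun (ncomp (l i) a))"

lemma colimiting_at:
  fixes X :: "('i, 'j, 'u gset, 'u gset_map) ftor"
  assumes J: "category J" and X: "is_functor J (GSet G) X" and a: "a \<in> Obj G"
  shows "colimiting J (fobj (comp_functor J (evaluation G (set_category TYPE('u)) a) X))
     (\<lambda>k. sfun (farr (comp_functor J (evaluation G (set_category TYPE('u)) a) X) k)) c L =
   colimiting J (\<lambda>i. fobj (fobj X i) a) (\<lambda>k. sfun (ncomp (farr X k) a)) c L"
proof -
  note * = diagram_at[OF J G.cat category_set_category[of "TYPE('u)"] X[unfolded is_functor_GSet]]
  show ?thesis
    using *(5) *(6)[OF arr_in_hom] by (intro colimiting_cong[OF J]) auto
qed

lemma GSet_colimitI:
  assumes J: "category J" and X: "is_functor J (GSet G) X" and l: "is_cocone J (GSet G) X c l"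
    and pt: "\<And>a. a \<in> Obj G \<Longrightarrow> fibrewise_colimit J X c l a"
  shows "is_colimit J (GSet G) X c l"
proof -
  note ctxt = J G.cat category_set_category[of "TYPE('u)"] X[unfolded is_functor_GSet]
  show ?thesis
    unfolding is_colimit_GSet
  proof (rule colimit_if_pointwise[OF ctxt l[unfolded is_cocone_GSet]])
    fix a assume a: "a \<in> Obj G"
    show "is_colimit J (set_category TYPE('u)) (comp_functor J (evaluation G (set_category TYPE('u)) a) X)
        (fobj c a) (\<lambda>i. ncomp (l i) a)"
      by (rule set_colimit_if_colimiting[OF J is_functor_at[OF ctxt a] cocone_at[OF ctxt l[unfolded is_cocone_GSet] a]])
        (rule colimiting_at[OF J X a, THEN iffD2, OF pt[OF a]])
  qed
qed

lemma GSet_colimit_fibrewise: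
  fixes X :: "('u, 'u, 'u gset, 'u gset_map) ftor"
  assumes J: "small_category J" and X: "is_functor J (GSet G) X" and l: "is_colimit J (GSet G) X c l"
    and a: "a \<in> Obj G"
  shows "fibrewise_colimit J X c l a"
proof -
  have J': "category J" using J by (simp add: small_category_def)
  note ctxt = J' G.cat category_set_category[of "TYPE('u)"] X[unfolded is_functor_GSet]
  let ?at = "\<lambda>a. comp_functor J (evaluation G (set_category TYPE('u)) a) X"
  have ex: "\<exists>c l. is_colimit J (set_category TYPE('u)) (?at a) c l" if "a \<in> Obj G" for a
    using set_colimit_exists[OF J is_functor_at[OF ctxt that]] by blast
  have "is_colimit J (set_category TYPE('u)) (?at a) (fobj c a) (\<lambda>i. ncomp (l i) a)"
    by (rule pointwise_if_colimit[OF ctxt ex l[unfolded is_colimit_GSet] a])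
  from colimiting_if_set_colimit[OF J' is_functor_at[OF ctxt a] this]
  show ?thesis by (rule colimiting_at[OF J' X a, THEN iffD1])
qed

lemma cocomplete_GSet: "cocomplete TYPE('u) (GSet G)"
  unfolding cocomplete_def
proof (intro allI impI, elim conjE)
  fix J :: "('u, 'u) cat" and X :: "('u, 'u, 'u gset, 'u gset_map) ftor"
  assume J: "small_category J" and X: "is_functor J (GSet G) X"
  have J': "category J" using J by (simp add: small_category_def)
  note ctxt = J' G.cat category_set_category[of "TYPE('u)"] X[unfolded is_functor_GSet]
  have ex: "\<exists>c l. is_colimit J (set_category TYPE('u)) (comp_functor J (evaluation G (set_category TYPE('u)) a) X) c l"
    if "a \<in> Obj G" for a
    using set_colimit_exists[OF J is_functor_at[OF ctxt that]] by blast
  show "\<exists>c l. is_colimit J (GSet G) X c l"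
    unfolding is_colimit_GSet
    using pointwise_colimit_exists[OF ctxt ex] colimit_if_pointwise[OF ctxt] by metis
qed

lemma cocone_GSet_natural:
  "is_cocone J (GSet G) X c l \<Longrightarrow> i \<in> Obj J \<Longrightarrow>
     natural G S (l i) \<and> nsrc (l i) = fobj X i \<and> ntgt (l i) = c"
  using is_coconeD(2)[of J "GSet G" X c l i] by (auto simp: hom_iff)

text \<open>
  A map of \<open>G\<close>-sets is determined by its graph, which is a subset of a fixed small set.
\<close>

lemma locally_small_GSet: "locally_small TYPE('u) (GSet G)"
  unfolding locally_small_def
proof (intro ballI)
  fix X Y assume "X \<in> Obj (GSet G)" "Y \<in> Obj (GSet G)"
  then have X: "is_functor G S X" and Y: "is_functor G S Y" by auto
  let ?W = "uprod (Obj G) (uprod (\<Union>a\<in>Obj G. fobj X a) (\<Union>a\<in>Obj G. fobj Y a))"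
  let ?graph = "\<lambda>t :: 'u gset_map. {upair a (upair x (sfun (ncomp t a) x)) | a x. a \<in> Obj G \<and> x \<in> fobj X a}"
  have small: "small TYPE('u) (Pow ?W)"
    by (intro small_Pow small_uprod small_Obj small_UN gset_small[OF X] gset_small[OF Y])
  have "inj_on ?graph (hom (GSet G) X Y)"
  proof (rule inj_onI)
    fix s t assume s: "s \<in> hom (GSet G) X Y" and t: "t \<in> hom (GSet G) X Y" and eq: "?graph s = ?graph t"
    show "s = t"
    proof (rule gmap_eqI)
      fix a x assume "a \<in> Obj G" "x \<in> fobj (nsrc s) a"
      then have "upair a (upair x (sfun (ncomp s a) x)) \<in> ?graph s" using s by (auto simp: hom_iff)
      then show "sfun (ncomp s a) x = sfun (ncomp t a) x" unfolding eq by auto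
    qed (use s t in \<open>auto simp: hom_iff\<close>)
  qed
  moreover have "?graph t \<subseteq> ?W" if "t \<in> hom (GSet G) X Y" for t
    using that gmap_apply[of t] by (auto simp: hom_iff) blast+
  ultimately show "small TYPE('u) (hom (GSet G) X Y)"
    by (intro small_inj_on[OF small]) blast+
qed

end

section \<open>\<open>G\<close>-sets form a commutative 2-ring\<close>

lemma cocone_image:
  assumes F: "is_functor C D F" and J: "category J" and X: "is_functor J C X" and l: "is_cocone J C X c l"
  shows "is_cocone J D (comp_functor J F X) (fobj F c) (\<lambda>i. farr F (l i))"
proof (rule is_coconeI)
  fix k i j assume k: "k \<in> hom J i j"
  then show "farr F (l j) \<cdot>\<^bsub>D\<^esub> farr (comp_functor J F X) k = farr F (l i)"
    using functor_Comp[OF F functor_farr[OF X k] is_coconeD(2)[OF l]] is_coconeD(3)[OF l k] hom_Obj[OF J k]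
    by (simp add: hom_iff)
qed (use functor_fobj[OF F is_coconeD(1)[OF l]] functor_farr[OF F is_coconeD(2)[OF l]] in auto)

lemma hom_functor_simps [simp]:
  "y \<in> Obj C \<Longrightarrow> fobj (hom_functor u C x) y = Inl ` hom C x y"
  "f \<in> Arr C \<Longrightarrow> farr (hom_functor u C x) f =
     set_arr (Inl ` hom C x (Dom C f)) (Inl ` hom C x (Cod C f)) (\<lambda>p. Inl (f \<cdot>\<^bsub>C\<^esub> projl p))"
  by (simp_all add: hom_functor_def set_arr_def)

lemma (in universe) is_functor_hom_functor:
  fixes C :: "('o, 'a, 'z) cat_scheme"
  assumes C: "category C" and ls: "locally_small TYPE('u) C" and x: "x \<in> Obj C"
  shows "is_functor C (set_category TYPE('u)) (hom_functor TYPE('u) C x)"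
proof -
  interpret cat_laws C using C by unfold_locales
  have small: "small TYPE('u) (Inl ` hom C x y :: ('a + 'u) set)" if "y \<in> Obj C" for y
    using ls x that by (auto simp: locally_small_def intro: small_image)
  show ?thesis
  proof (rule is_functorI[OF C])
    fix f g a b c assume f: "f \<in> hom C a b" and g: "g \<in> hom C b c"
    then show "farr (hom_functor TYPE('u) C x) (g \<cdot>\<^bsub>C\<^esub> f) =
        farr (hom_functor TYPE('u) C x) g \<cdot>\<^bsub>set_category TYPE('u)\<^esub> farr (hom_functor TYPE('u) C x) f"
      by (auto simp: hom_iff intro!: set_map_eqI[OF set_arr_simps(1)])
  next
    fix a assume "a \<in> Obj C"
    then show "farr (hom_functor TYPE('u) C x) (Ident C a) =
        Ident (set_category TYPE('u)) (fobj (hom_functor TYPE('u) C x) a)"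
      by (auto simp: hom_iff intro!: set_map_eqI[OF set_arr_simps(1)])
  next
    fix f a b assume f: "f \<in> hom C a b"
    then show "farr (hom_functor TYPE('u) C x) f \<in>
        hom (set_category TYPE('u)) (fobj (hom_functor TYPE('u) C x) a) (fobj (hom_functor TYPE('u) C x) b)"
      using small by (auto simp: set_hom_iff hom_iff)
  qed (use small in \<open>auto simp: hom_functor_def\<close>)
qed

text \<open>
  Products with \<open>B\<close> preserve colimits: a compatible family of predicates on the products restricts, for each
  element of \<open>B\<close>, to a compatible family on the factors.
\<close>

lemma (in universe) colimiting_uprod:
  fixes A :: "'i \<Rightarrow> 'u set" and c B :: "'u set"
  assumes c: "colimiting J A m c L"
  shows "colimiting J (\<lambda>i. uprod B (A i)) (\<lambda>k z. upair (ufst z) (m k (usnd z))) (uprod B c)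
      (\<lambda>i z. upair (ufst z) (L i (usnd z)))"
    and "colimiting J (\<lambda>i. uprod (A i) B) (\<lambda>k z. upair (m k (ufst z)) (usnd z)) (uprod c B)
      (\<lambda>i z. upair (L i (ufst z)) (usnd z))"
proof -
  show "colimiting J (\<lambda>i. uprod B (A i)) (\<lambda>k z. upair (ufst z) (m k (usnd z))) (uprod B c)
      (\<lambda>i z. upair (ufst z) (L i (usnd z)))"
  proof (rule colimitingI)
    fix y assume "y \<in> uprod B c"
    then obtain b y' where y: "y = upair b y'" "b \<in> B" "y' \<in> c" by (elim uprodE)
    obtain i x where "i \<in> Obj J" "x \<in> A i" "L i x = y'" using colimiting_surj[OF c y(3)] .
    then show "\<exists>i\<in>Obj J. \<exists>x\<in>uprod B (A i). upair (ufst x) (L i (usnd x)) = y"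
      using y by (intro bexI[of _ i] bexI[of _ "upair b x"]) auto
  next
    fix P :: "'i \<Rightarrow> 'u \<Rightarrow> bool" and i j x y
    assume P: "\<And>k x. k \<in> Arr J \<Longrightarrow> x \<in> uprod B (A (Dom J k)) \<Longrightarrow>
        P (Cod J k) (upair (ufst x) (m k (usnd x))) = P (Dom J k) x"
      and ij: "i \<in> Obj J" "j \<in> Obj J" "x \<in> uprod B (A i)" "y \<in> uprod B (A j)"
      and eq: "upair (ufst x) (L i (usnd x)) = upair (ufst y) (L j (usnd y))"
    obtain b x' b' y' where xy: "x = upair b x'" "b \<in> B" "x' \<in> A i" "y = upair b' y'" "y' \<in> A j"
      using ij(3,4) by (elim uprodE)
    have "P i (upair b x') = P j (upair b y')"
    proof (rule colimiting_predicate[OF c, of "\<lambda>i x. P i (upair b x)", OF _ ij(1,2) xy(3,5)])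
      fix k x assume "k \<in> Arr J" "x \<in> A (Dom J k)"
      then show "P (Cod J k) (upair b (m k x)) = P (Dom J k) (upair b x)" using P[of k "upair b x"] xy by simp
    qed (use eq xy in simp)
    then show "P i x = P j y" using eq xy by simp
  qed
  show "colimiting J (\<lambda>i. uprod (A i) B) (\<lambda>k z. upair (m k (ufst z)) (usnd z)) (uprod c B)
      (\<lambda>i z. upair (L i (ufst z)) (usnd z))"
  proof (rule colimitingI)
    fix y assume "y \<in> uprod c B"
    then obtain b y' where y: "y = upair y' b" "b \<in> B" "y' \<in> c" by (elim uprodE)
    obtain i x where "i \<in> Obj J" "x \<in> A i" "L i x = y'" using colimiting_surj[OF c y(3)] .
    then show "\<exists>i\<in>Obj J. \<exists>x\<in>uprod (A i) B. upair (L i (ufst x)) (usnd x) = y"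
      using y by (intro bexI[of _ i] bexI[of _ "upair x b"]) auto
  next
    fix P :: "'i \<Rightarrow> 'u \<Rightarrow> bool" and i j x y
    assume P: "\<And>k x. k \<in> Arr J \<Longrightarrow> x \<in> uprod (A (Dom J k)) B \<Longrightarrow>
        P (Cod J k) (upair (m k (ufst x)) (usnd x)) = P (Dom J k) x"
      and ij: "i \<in> Obj J" "j \<in> Obj J" "x \<in> uprod (A i) B" "y \<in> uprod (A j) B"
      and eq: "upair (L i (ufst x)) (usnd x) = upair (L j (ufst y)) (usnd y)"
    obtain b x' b' y' where xy: "x = upair x' b" "b \<in> B" "x' \<in> A i" "y = upair y' b'" "y' \<in> A j"
      using ij(3,4) by (elim uprodE)
    have "P i (upair x' b) = P j (upair y' b)"
    proof (rule colimiting_predicate[OF c, of "\<lambda>i x. P i (upair x b)", OF _ ij(1,2) xy(3,5)])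
      fix k x assume "k \<in> Arr J" "x \<in> A (Dom J k)"
      then show "P (Cod J k) (upair (m k x) b) = P (Dom J k) (upair x b)" using P[of k "upair x b"] xy by simp
    qed (use eq xy in simp)
    then show "P i x = P j y" using eq xy by simp
  qed
qed

lemma (in sm_category) is_functor_tensor:
  assumes "a \<in> Obj C"
  shows "is_functor C C (tensor_left C a)" and "is_functor C C (tensor_right C a)"
  by (rule is_functorI[OF cat]; use assms in \<open>auto simp: tensor_left_def tensor_right_def hom_iff interchange\<close>)+

context gsets
begin

definition rep :: "'u \<Rightarrow> 'u gset" where
  "rep g = gset G (hom G g) (\<lambda>f \<phi>. f \<cdot>\<^bsub>G\<^esub> \<phi>)"

text \<open>The map \<open>rep g \<rightarrow> X\<close> that corresponds to \<open>x \<in> X g\<close> under the Yoneda lemma.\<close>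

definition yo :: "'u gset \<Rightarrow> 'u \<Rightarrow> 'u \<Rightarrow> 'u gset_map" where
  "yo X g x = gmap G (rep g) X (\<lambda>a \<phi>. sfun (farr X \<phi>) x)"

lemma rep_simps [simp]:
  "a \<in> Obj G \<Longrightarrow> fobj (rep g) a = hom G g a"
  "f \<in> Arr G \<Longrightarrow> farr (rep g) f = set_arr (hom G g (Dom G f)) (hom G g (Cod G f)) (\<lambda>\<phi>. f \<cdot>\<^bsub>G\<^esub> \<phi>)"
  by (simp_all add: rep_def)

lemma is_functor_rep [simp]: "g \<in> Obj G \<Longrightarrow> is_functor G S (rep g)"
  unfolding rep_def
  by (rule is_functor_gset) (auto simp: hom_iff intro: small_subset[OF small_Arr])

lemma yo_simps [simp]:
  "nsrc (yo X g x) = rep g" "ntgt (yo X g x) = X"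
  "a \<in> Obj G \<Longrightarrow> \<phi> \<in> hom G g a \<Longrightarrow> sfun (ncomp (yo X g x) a) \<phi> = sfun (farr X \<phi>) x"
  by (simp_all add: yo_def)

lemma natural_yo [simp]:
  assumes X: "is_functor G S X" and g: "g \<in> Obj G" and x: "x \<in> fobj X g"
  shows "natural G S (yo X g x)"
  unfolding yo_def
proof (rule natural_gmap[OF is_functor_rep[OF g] X])
  fix f \<phi> assume "f \<in> Arr G" "\<phi> \<in> fobj (rep g) (Dom G f)"
  then show "sfun (farr X (sfun (farr (rep g) f) \<phi>)) x = sfun (farr X f) (sfun (farr X \<phi>) x)"
    using gset_act_Comp[OF X, of \<phi> f x] x by (auto simp: hom_iff)
qed (use gset_act[OF X] x in \<open>auto simp: hom_iff\<close>)

lemma yo_Ident: "is_functor G S X \<Longrightarrow> g \<in> Obj G \<Longrightarrow> x \<in> fobj X g \<Longrightarrow> sfun (ncomp (yo X g x) g) (Ident G g) = x"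
  by (simp add: Ident_in_hom[OF G.cat] gset_act_Ident)

lemma Ident_hom [simp]: "g \<in> Obj G \<Longrightarrow> Ident G g \<in> hom G g g"
  by (simp add: Ident_in_hom[OF G.cat])

lemma yoneda:
  assumes t: "natural G S t" "nsrc t = rep g" and g: "g \<in> Obj G"
  shows "t = yo (ntgt t) g (sfun (ncomp t g) (Ident G g))"
proof (rule gmap_eqI[OF t(1)])
  have x: "sfun (ncomp t g) (Ident G g) \<in> fobj (ntgt t) g" using gmap_apply[OF t(1) g] t(2) g by simp
  then show "natural G S (yo (ntgt t) g (sfun (ncomp t g) (Ident G g)))"
    using naturalD(2)[OF t(1)] g by simp
  fix a \<phi> assume a: "a \<in> Obj G" and "\<phi> \<in> fobj (nsrc t) a"
  then have \<phi>: "\<phi> \<in> hom G g a" "\<phi> \<in> Arr G" "Dom G \<phi> = g" "Cod G \<phi> = a" using t by (auto simp: hom_iff)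
  then show "sfun (ncomp t a) \<phi> = sfun (ncomp (yo (ntgt t) g (sfun (ncomp t g) (Ident G g))) a) \<phi>"
    using gmap_equivariant[OF t(1) \<phi>(2), of "Ident G g"] t(2) a g by (simp add: Ident_in_hom[OF G.cat])
qed (use t in auto)

text \<open>
  The Yoneda correspondence is natural in the \<open>G\<close>-set.
\<close>

lemma comp_yo:
  assumes t: "natural G S t" and g: "g \<in> Obj G" and x: "x \<in> fobj (nsrc t) g"
  shows "ntrans_comp G S t (yo (nsrc t) g x) = yo (ntgt t) g (sfun (ncomp t g) x)"
proof (rule gmap_eqI)
  note X = naturalD(1)[OF t] and Y = naturalD(2)[OF t]
  note yx = natural_yo[OF X g x]
  show "natural G S (ntrans_comp G S t (yo (nsrc t) g x))"
    by (rule natural_comp_S[OF yx t]) simp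
  show "natural G S (yo (ntgt t) g (sfun (ncomp t g) x))"
    using gmap_apply[OF t g x] Y g by simp
  fix a \<phi> assume a: "a \<in> Obj G" and "\<phi> \<in> fobj (nsrc (ntrans_comp G S t (yo (nsrc t) g x))) a"
  then have \<phi>: "\<phi> \<in> hom G g a" "\<phi> \<in> Arr G" "Dom G \<phi> = g" "Cod G \<phi> = a" by (auto simp: hom_iff)
  then show "sfun (ncomp (ntrans_comp G S t (yo (nsrc t) g x)) a) \<phi> =
      sfun (ncomp (yo (ntgt t) g (sfun (ncomp t g) x)) a) \<phi>"
    using ncomp_comp_apply[OF yx t, of a \<phi>] gmap_equivariant[OF t \<phi>(2), of x] a x by simp
qed simp_all

text \<open>
  By the Yoneda lemma \<open>Hom (rep g, -)\<close> is evaluation at \<open>g\<close>, and evaluation preserves all colimits, not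
  only directed ones.
\<close>

lemma little_rep:
  assumes g: "g \<in> Obj G"
  shows "little TYPE('u) (GSet G) (rep g)"
proof -
  let ?H = "hom_functor TYPE('u) (GSet G) (rep g)"
  have H: "is_functor (GSet G) (set_category TYPE('u)) ?H"
    by (rule is_functor_hom_functor[OF category_GSet locally_small_GSet]) (use g in simp)
  have "preserves_colimits P (GSet G) (set_category TYPE('u)) ?H" for P :: "('u, 'u) cat \<Rightarrow> bool"
    unfolding preserves_colimits_def
  proof (intro allI impI, elim conjE)
    fix J :: "('u, 'u) cat" and X :: "('u, 'u, 'u gset, 'u gset_map) ftor" and c l
    assume J: "small_category J" and X: "is_functor J (GSet G) X" and l: "is_colimit J (GSet G) X c l"
    have J': "category J" using J by (simp add: small_category_def)
    interpret J: cat_laws J using J' by unfold_locales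
    note cocone = is_colimit_cocone[OF l]
    note fib = GSet_colimit_fibrewise[OF J X l g]
    note X_simps = diagram_GSet[OF X]
    have l_simps: "natural G S (l i)" "nsrc (l i) = fobj X i" "ntgt (l i) = c" if "i \<in> Obj J" for i
      using cocone_GSet_natural[OF cocone that] by auto
    have c: "is_functor G S c" using is_coconeD(1)[OF cocone] by simp
    show "is_colimit J (set_category TYPE('u)) (comp_functor J ?H X) (fobj ?H c) (\<lambda>i. farr ?H (l i))"
    proof (rule set_colimit_if_colimiting[OF J' is_functor_comp[OF X H J'] cocone_image[OF H J' X cocone]],
        rule colimitingI)
      fix p assume "p \<in> fobj ?H c"
      then obtain t where t: "p = Inl t" "natural G S t" "nsrc t = rep g" "ntgt t = c"
        using c by (auto simp: hom_iff)
      have "sfun (ncomp t g) (Ident G g) \<in> fobj c g" using gmap_apply[OF t(2) g] t(3,4) g by simp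
      then obtain i x where ix: "i \<in> Obj J" "x \<in> fobj (fobj X i) g"
        "sfun (ncomp (l i) g) x = sfun (ncomp t g) (Ident G g)" using colimiting_surj[OF fib] by metis
      have "ntrans_comp G S (l i) (yo (fobj X i) g x) = t"
        using comp_yo[OF l_simps(1)[OF ix(1)] g, of x] l_simps[OF ix(1)] ix yoneda[OF t(2,3) g] t(4) by simp
      then show "\<exists>i\<in>Obj J. \<exists>q\<in>fobj (comp_functor J ?H X) i. sfun (farr ?H (l i)) q = p"
        using ix t(1) g natural_yo[OF X_simps(1)[OF ix(1)] g ix(2)] l_simps[OF ix(1)] X_simps(1)[OF ix(1)]
        by (intro bexI[of _ i] bexI[of _ "Inl (yo (fobj X i) g x)"]) (auto simp: hom_iff)
    next
      fix P :: "'u \<Rightarrow> 'u gset_map + 'u \<Rightarrow> bool" and i j p q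
      assume P: "\<And>k p. k \<in> Arr J \<Longrightarrow> p \<in> fobj (comp_functor J ?H X) (Dom J k) \<Longrightarrow>
          P (Cod J k) (sfun (farr (comp_functor J ?H X) k) p) = P (Dom J k) p"
        and ij: "i \<in> Obj J" "j \<in> Obj J" and pq: "p \<in> fobj (comp_functor J ?H X) i" "q \<in> fobj (comp_functor J ?H X) j"
        and eq: "sfun (farr ?H (l i)) p = sfun (farr ?H (l j)) q"
      obtain s where s: "p = Inl s" "natural G S s" "nsrc s = rep g" "ntgt s = fobj X i"
        using pq(1) ij X_simps(1) by (auto simp: hom_iff)
      obtain t where t: "q = Inl t" "natural G S t" "nsrc t = rep g" "ntgt t = fobj X j"
        using pq(2) ij X_simps(1) by (auto simp: hom_iff)
      have "Inl (ntrans_comp G S (l i) s) = (Inl (ntrans_comp G S (l j) t) :: 'u gset_map + 'u)"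
        using eq s t l_simps[OF ij(1)] l_simps[OF ij(2)] by (simp add: hom_iff image_iff)
      then have st: "ntrans_comp G S (l i) s = ntrans_comp G S (l j) t" by simp
      let ?s = "sfun (ncomp s g) (Ident G g)" and ?t = "sfun (ncomp t g) (Ident G g)"
      have ss: "?s \<in> fobj (fobj X i) g" "?t \<in> fobj (fobj X j) g"
        using gmap_apply[OF s(2) g] gmap_apply[OF t(2) g] s(3,4) t(3,4) g by simp_all
      have "P i (Inl (yo (fobj X i) g ?s)) = P j (Inl (yo (fobj X j) g ?t))"
      proof (rule colimiting_predicate[OF fib, of "\<lambda>i x. P i (Inl (yo (fobj X i) g x))", OF _ ij ss])
        fix k x assume k: "k \<in> Arr J" and x: "x \<in> fobj (fobj X (Dom J k)) g"
        have y: "natural G S (yo (fobj X (Dom J k)) g x)" using X_simps(1) k g x by simp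
        have "Inl (yo (fobj X (Cod J k)) g (sfun (ncomp (farr X k) g) x)) =
            (Inl (ntrans_comp G S (farr X k) (yo (fobj X (Dom J k)) g x)) :: 'u gset_map + 'u)"
          using comp_yo[OF X_simps(2)[OF k] g, of x] X_simps(3,4)[OF k] x by simp
        also have "\<dots> = sfun (farr (comp_functor J ?H X) k) (Inl (yo (fobj X (Dom J k)) g x))"
          using k y X_simps(1)[of "Dom J k"] X_simps(1)[of "Cod J k"] X_simps(2-4)[OF k] by (simp add: hom_iff image_iff)
        finally show "P (Cod J k) (Inl (yo (fobj X (Cod J k)) g (sfun (ncomp (farr X k) g) x))) =
            P (Dom J k) (Inl (yo (fobj X (Dom J k)) g x))"
          using P[OF k, of "Inl (yo (fobj X (Dom J k)) g x)"] k y X_simps(1)[of "Dom J k"]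
          by (simp add: hom_iff image_iff)
      next
        show "sfun (ncomp (l i) g) ?s = sfun (ncomp (l j) g) ?t"
          using arg_cong[OF st, of "\<lambda>r. sfun (ncomp r g) (Ident G g)"]
            ncomp_comp_apply[OF s(2) l_simps(1)[OF ij(1)] _ g, of "Ident G g"]
            ncomp_comp_apply[OF t(2) l_simps(1)[OF ij(2)] _ g, of "Ident G g"] l_simps[OF ij(1)] l_simps[OF ij(2)]
            s t g by simp
      qed
      then show "P i p = P j q" using yoneda[OF s(2,3) g] yoneda[OF t(2,3) g] s(1,4) t(1,4) by simp
    qed
  qed
  moreover have "|{} :: 'u set| <o |UNIV :: 'u set|"
    using small_finite[of "{} :: 'u set"] by (simp add: small_def)
  ultimately show ?thesis
    unfolding little_def by (intro exI[of _ "|{} :: 'u set|"]) (simp add: card_of_Card_order)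
qed

text \<open>
  The opposite of the category of elements of \<open>X\<close>: an object is the code of a point \<open>x \<in> X a\<close>, and the
  code of \<open>f : a \<rightarrow> b\<close> and \<open>x \<in> X a\<close> is an arrow from \<open>f x\<close> to \<open>x\<close>.
\<close>

definition elements :: "'u gset \<Rightarrow> ('u, 'u) cat" where
  "elements X =
     \<lparr>Obj = {upair a x | a x. a \<in> Obj G \<and> x \<in> fobj X a},
      Arr = {upair f x | f x. f \<in> Arr G \<and> x \<in> fobj X (Dom G f)},
      Dom = (\<lambda>k. upair (Cod G (ufst k)) (sfun (farr X (ufst k)) (usnd k))),
      Cod = (\<lambda>k. upair (Dom G (ufst k)) (usnd k)),
      Ident = (\<lambda>i. upair (Ident G (ufst i)) (usnd i)),
      Comp = (\<lambda>k' k. upair (ufst k \<cdot>\<^bsub>G\<^esub> ufst k') (usnd k'))\<rparr>"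

definition elements_diagram :: "'u gset \<Rightarrow> ('u, 'u, 'u gset, 'u gset_map) ftor" where
  "elements_diagram X =
     \<lparr>fobj = (\<lambda>i \<in> Obj (elements X). rep (ufst i)),
      farr = (\<lambda>k \<in> Arr (elements X). yo (rep (Dom G (ufst k))) (Cod G (ufst k)) (ufst k))\<rparr>"

lemma elements_Obj_iff [simp]: "upair a x \<in> Obj (elements X) \<longleftrightarrow> a \<in> Obj G \<and> x \<in> fobj X a"
  and elements_Arr_iff [simp]: "upair f x \<in> Arr (elements X) \<longleftrightarrow> f \<in> Arr G \<and> x \<in> fobj X (Dom G f)"
  and elements_Dom [simp]: "Dom (elements X) (upair f x) = upair (Cod G f) (sfun (farr X f) x)"
  and elements_Cod [simp]: "Cod (elements X) (upair f x) = upair (Dom G f) x"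
  and elements_Ident [simp]: "Ident (elements X) (upair a x) = upair (Ident G a) x"
  and elements_Comp [simp]: "upair f' x' \<cdot>\<^bsub>elements X\<^esub> upair f x = upair (f \<cdot>\<^bsub>G\<^esub> f') x'"
  by (simp_all add: elements_def)

lemma elements_ObjE:
  assumes "i \<in> Obj (elements X)" obtains a x where "i = upair a x" "a \<in> Obj G" "x \<in> fobj X a"
  using assms by (auto simp: elements_def)

lemma elements_ArrE:
  assumes "k \<in> Arr (elements X)" obtains f x where "k = upair f x" "f \<in> Arr G" "x \<in> fobj X (Dom G f)"
  using assms by (auto simp: elements_def)

lemma small_category_elements:
  assumes X: "is_functor G S X"
  shows "small_category (elements X)"
proof -
  have "category (elements X)"
    by (rule categoryI)
      (auto simp: hom_iff gset_act[OF X] gset_act_Ident[OF X] gset_act_Comp[OF X] elim!: elements_ObjE elements_ArrE)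
  moreover have small: "small TYPE('u) (\<Union>a\<in>Obj G. fobj X a)"
    by (intro small_UN small_Obj gset_small[OF X])
  have "small TYPE('u) (Obj (elements X))"
    by (rule small_subset[OF small_uprod[OF small_Obj small]]) (auto elim!: elements_ObjE)
  moreover have "small TYPE('u) (Arr (elements X))"
    by (rule small_subset[OF small_uprod[OF small_Arr small]]) (fastforce elim!: elements_ArrE)
  ultimately show ?thesis by (simp add: small_category_def)
qed

lemma elements_diagram_simps [simp]:
  "a \<in> Obj G \<Longrightarrow> x \<in> fobj X a \<Longrightarrow> fobj (elements_diagram X) (upair a x) = rep a"
  "f \<in> Arr G \<Longrightarrow> x \<in> fobj X (Dom G f) \<Longrightarrow>
     farr (elements_diagram X) (upair f x) = yo (rep (Dom G f)) (Cod G f) f"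
  by (simp_all add: elements_diagram_def)

lemma yo_rep_Comp:
  assumes f: "f \<in> hom G a b" and g: "g \<in> hom G b c"
  shows "ntrans_comp G S (yo (rep a) b f) (yo (rep b) c g) = yo (rep a) c (g \<cdot>\<^bsub>G\<^esub> f)"
  using comp_yo[of "yo (rep a) b f" c g] assms hom_Obj[OF G.cat f] hom_Obj[OF G.cat g]
  by (simp add: hom_iff)

lemma is_functor_elements_diagram:
  assumes X: "is_functor G S X"
  shows "is_functor (elements X) (GSet G) (elements_diagram X)"
proof -
  have cat: "category (elements X)" using small_category_elements[OF X] by (simp add: small_category_def)
  show ?thesis
  proof (rule is_functorI[OF cat])
    fix i assume "i \<in> Obj (elements X)"
    then obtain a x where i: "i = upair a x" "a \<in> Obj G" "x \<in> fobj X a" by (rule elements_ObjE)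
    have "ntrans_id G S (rep a) = yo (rep a) a (Ident G a)"
      using yoneda[of "ntrans_id G S (rep a)" a] natural_id[OF G.cat category_set_smcat, of "rep a"] i by simp
    then show "farr (elements_diagram X) (Ident (elements X) i) = Ident (GSet G) (fobj (elements_diagram X) i)"
      using i by simp
  next
    fix k k' i j j' assume "k \<in> hom (elements X) i j" and "k' \<in> hom (elements X) j j'"
    then show "farr (elements_diagram X) (k' \<cdot>\<^bsub>elements X\<^esub> k) =
        farr (elements_diagram X) k' \<cdot>\<^bsub>GSet G\<^esub> farr (elements_diagram X) k"
      by (auto simp: hom_iff yo_rep_Comp elim!: elements_ArrE)
  qed (auto simp: elements_diagram_def hom_iff elim!: elements_ObjE elements_ArrE intro: gset_act[OF X])
qed

text \<open>
  This is the density of the representables: two elements of the diagram over \<open>b\<close> with the same image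
  \<open>x \<in> X b\<close> are connected through the copy of \<open>rep b\<close> at \<open>x\<close>.
\<close>

lemma is_colimit_elements:
  assumes X: "is_functor G S X"
  shows "is_colimit (elements X) (GSet G) (elements_diagram X) X (\<lambda>i. yo X (ufst i) (usnd i))"
proof (rule GSet_colimitI)
  show cat: "category (elements X)" using small_category_elements[OF X] by (simp add: small_category_def)
  show "is_functor (elements X) (GSet G) (elements_diagram X)" using is_functor_elements_diagram[OF X] .
  show "is_cocone (elements X) (GSet G) (elements_diagram X) X (\<lambda>i. yo X (ufst i) (usnd i))"
  proof (rule is_coconeI)
    fix k i j assume "k \<in> hom (elements X) i j"
    then obtain f x where k: "k = upair f x" "f \<in> Arr G" "x \<in> fobj X (Dom G f)"
        "i = upair (Cod G f) (sfun (farr X f) x)" "j = upair (Dom G f) x"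
      by (auto simp: hom_iff elim!: elements_ArrE)
    then show "yo X (ufst j) (usnd j) \<cdot>\<^bsub>GSet G\<^esub> farr (elements_diagram X) k = yo X (ufst i) (usnd i)"
      using comp_yo[of "yo X (Dom G f) x" "Cod G f" f] X by (simp add: hom_iff)
  qed (use X in \<open>auto simp: hom_iff elim!: elements_ObjE\<close>)
next
  fix b assume b: "b \<in> Obj G"
  show "fibrewise_colimit (elements X) (elements_diagram X) X (\<lambda>i. yo X (ufst i) (usnd i)) b"
  proof (rule colimitingI)
    fix x assume x: "x \<in> fobj X b"
    then show "\<exists>i\<in>Obj (elements X). \<exists>\<phi>\<in>fobj (fobj (elements_diagram X) i) b.
        sfun (ncomp (yo X (ufst i) (usnd i)) b) \<phi> = x"
      using b X by (intro bexI[of _ "upair b x"] bexI[of _ "Ident G b"]) (simp_all add: gset_act_Ident)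
  next
    fix P :: "'u \<Rightarrow> 'u \<Rightarrow> bool" and i j \<phi> \<psi>
    assume P: "\<And>k \<phi>. k \<in> Arr (elements X) \<Longrightarrow> \<phi> \<in> fobj (fobj (elements_diagram X) (Dom (elements X) k)) b \<Longrightarrow>
        P (Cod (elements X) k) (sfun (ncomp (farr (elements_diagram X) k) b) \<phi>) = P (Dom (elements X) k) \<phi>"
      and ij: "i \<in> Obj (elements X)" "j \<in> Obj (elements X)"
      and \<phi>\<psi>: "\<phi> \<in> fobj (fobj (elements_diagram X) i) b" "\<psi> \<in> fobj (fobj (elements_diagram X) j) b"
      and eq: "sfun (ncomp (yo X (ufst i) (usnd i)) b) \<phi> = sfun (ncomp (yo X (ufst j) (usnd j)) b) \<psi>"
    \<comment> \<open>Each element of the diagram agrees with the identity of \<open>b\<close> over its image in \<open>X b\<close>.\<close>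
    have P_norm: "P (upair a x) \<chi> = P (upair b (sfun (farr X \<chi>) x)) (Ident G b)"
      if "a \<in> Obj G" "x \<in> fobj X a" "\<chi> \<in> hom G a b" for a x \<chi>
    proof -
      have \<chi>: "\<chi> \<in> Arr G" "Dom G \<chi> = a" "Cod G \<chi> = b" using that by (auto simp: hom_iff)
      then show ?thesis
        using P[of "upair \<chi> x" "Ident G b"] that b gset_act[OF X \<chi>(1), of x] by simp
    qed
    obtain a x where i: "i = upair a x" "a \<in> Obj G" "x \<in> fobj X a" using ij(1) by (rule elements_ObjE)
    obtain a' x' where j: "j = upair a' x'" "a' \<in> Obj G" "x' \<in> fobj X a'" using ij(2) by (rule elements_ObjE)
    have "\<phi> \<in> hom G a b" "\<psi> \<in> hom G a' b" using \<phi>\<psi> i j b by simp_all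
    then show "P i \<phi> = P j \<psi>"
      using P_norm[OF i(2,3)] P_norm[OF j(2,3)] eq i j b by simp
  qed
qed

lemma colimit_closure_rep: "Obj (GSet G) = colimit_closure TYPE('u) (GSet G) (rep ` Obj G)"
proof (intro equalityI subsetI)
  fix X assume "X \<in> Obj (GSet G)"
  then have X: "is_functor G S X" by simp
  show "X \<in> colimit_closure TYPE('u) (GSet G) (rep ` Obj G)"
    by (rule colimit_closure.colim[OF small_category_elements[OF X] is_functor_elements_diagram[OF X] _ is_colimit_elements[OF X]])
      (auto elim!: elements_ObjE intro: colimit_closure.base)
next
  fix X assume "X \<in> colimit_closure TYPE('u) (GSet G) (rep ` Obj G)"
  then show "X \<in> Obj (GSet G)"
    by cases (auto dest: is_colimitD(1))
qed

lemma presentable_GSet: "presentable TYPE('u) (GSet G)"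
  unfolding presentable_def
  using category_GSet locally_small_GSet cocomplete_GSet colimit_closure_rep little_rep small_image[OF small_Obj]
  by (intro conjI exI[of _ "rep ` Obj G"]) auto

lemma tensor_GSet_apply:
  assumes s: "natural G S s" and t: "natural G S t" and a: "a \<in> Obj G"
    and "x \<in> fobj (nsrc s) a" "y \<in> fobj (nsrc t) a"
  shows "sfun (ncomp (s \<boxtimes>\<^bsub>GSet G\<^esub> t) a) (upair x y) = upair (sfun (ncomp s a) x) (sfun (ncomp t a) y)"
  using assms gmap_ncomp[OF s a] gmap_ncomp[OF t a] by (simp add: GSet_def)

lemma cocontinuous_tensor:
  assumes B: "is_functor G S B"
  shows "cocontinuous TYPE('u) (GSet G) (GSet G) (tensor_left (GSet G) B)"
    and "cocontinuous TYPE('u) (GSet G) (GSet G) (tensor_right (GSet G) B)"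
proof -
  have B': "B \<in> Obj (GSet G)" using B by simp
  have id: "natural G S (ntrans_id G S B)" by (rule natural_id[OF G.cat category_set_smcat B])
  show "cocontinuous TYPE('u) (GSet G) (GSet G) (tensor_left (GSet G) B)"
    unfolding cocontinuous_def preserves_colimits_def
  proof (intro allI impI, elim conjE)
    fix J :: "('u, 'u) cat" and X :: "('u, 'u, 'u gset, 'u gset_map) ftor" and c l
    assume J: "small_category J" and X: "is_functor J (GSet G) X" and l: "is_colimit J (GSet G) X c l"
    have J': "category J" using J by (simp add: small_category_def)
    interpret J: cat_laws J using J' by unfold_locales
    note F = E.is_functor_tensor(1)[OF B'] and cocone = is_colimit_cocone[OF l]
    have c: "is_functor G S c" using is_coconeD(1)[OF cocone] by simp
    show "is_colimit J (GSet G) (comp_functor J (tensor_left (GSet G) B) X) (fobj (tensor_left (GSet G) B) c)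
        (\<lambda>i. farr (tensor_left (GSet G) B) (l i))"
    proof (rule GSet_colimitI[OF J' is_functor_comp[OF X F J'] cocone_image[OF F J' X cocone]])
      fix a assume a: "a \<in> Obj G"
      have obj: "fobj (fobj (tensor_left (GSet G) B) Y) a = uprod (fobj B a) (fobj Y a)" if "is_functor G S Y" for Y
        using that a by (simp add: tensor_left_def)
      have arr: "sfun (ncomp (farr (tensor_left (GSet G) B) t) a) z = upair (ufst z) (sfun (ncomp t a) (usnd z))"
        if "natural G S t" "z \<in> uprod (fobj B a) (fobj (nsrc t) a)" for t z
        using that a tensor_GSet_apply[OF id that(1) a]
        by (auto simp: tensor_left_def elim!: uprodE)
      show "fibrewise_colimit J (comp_functor J (tensor_left (GSet G) B) X) (fobj (tensor_left (GSet G) B) c)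
          (\<lambda>i. farr (tensor_left (GSet G) B) (l i)) a"
        unfolding obj[OF c]
        by (rule iffD2[OF colimiting_cong[OF J'] colimiting_uprod(1)[OF GSet_colimit_fibrewise[OF J X l a], of "fobj B a"]])
          (use diagram_GSet[OF X] cocone_GSet_natural[OF cocone] in \<open>simp_all add: obj arr\<close>)
    qed
  qed
  show "cocontinuous TYPE('u) (GSet G) (GSet G) (tensor_right (GSet G) B)"
    unfolding cocontinuous_def preserves_colimits_def
  proof (intro allI impI, elim conjE)
    fix J :: "('u, 'u) cat" and X :: "('u, 'u, 'u gset, 'u gset_map) ftor" and c l
    assume J: "small_category J" and X: "is_functor J (GSet G) X" and l: "is_colimit J (GSet G) X c l"
    have J': "category J" using J by (simp add: small_category_def)
    interpret J: cat_laws J using J' by unfold_locales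
    note F = E.is_functor_tensor(2)[OF B'] and cocone = is_colimit_cocone[OF l]
    have c: "is_functor G S c" using is_coconeD(1)[OF cocone] by simp
    show "is_colimit J (GSet G) (comp_functor J (tensor_right (GSet G) B) X) (fobj (tensor_right (GSet G) B) c)
        (\<lambda>i. farr (tensor_right (GSet G) B) (l i))"
    proof (rule GSet_colimitI[OF J' is_functor_comp[OF X F J'] cocone_image[OF F J' X cocone]])
      fix a assume a: "a \<in> Obj G"
      have obj: "fobj (fobj (tensor_right (GSet G) B) Y) a = uprod (fobj Y a) (fobj B a)" if "is_functor G S Y" for Y
        using that a by (simp add: tensor_right_def)
      have arr: "sfun (ncomp (farr (tensor_right (GSet G) B) t) a) z = upair (sfun (ncomp t a) (ufst z)) (usnd z)"
        if "natural G S t" "z \<in> uprod (fobj (nsrc t) a) (fobj B a)" for t z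
        using that a tensor_GSet_apply[OF that(1) id a]
        by (auto simp: tensor_right_def elim!: uprodE)
      show "fibrewise_colimit J (comp_functor J (tensor_right (GSet G) B) X) (fobj (tensor_right (GSet G) B) c)
          (\<lambda>i. farr (tensor_right (GSet G) B) (l i)) a"
        unfolding obj[OF c]
        by (rule iffD2[OF colimiting_cong[OF J'] colimiting_uprod(2)[OF GSet_colimit_fibrewise[OF J X l a], of "fobj B a"]])
          (use diagram_GSet[OF X] cocone_GSet_natural[OF cocone] in \<open>simp_all add: obj arr\<close>)
    qed
  qed
qed

lemma commutative_2_ring_GSet: "commutative_2_ring TYPE('u) (GSet G)"
  unfolding commutative_2_ring_def
  using symmetric_monoidal_GSet presentable_GSet cocontinuous_tensor by simp

end

section \<open>Pullback of \<open>G\<close>-sets\<close>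

lemma pullback_functor_simps [simp]:
  "is_functor H G f \<Longrightarrow> fobj (pullback_functor H G) f = pullback1 H G f"
  "natural H G \<alpha> \<Longrightarrow> farr (pullback_functor H G) \<alpha> = pullback2 H G \<alpha>"
  by (simp_all add: pullback_functor_def)

text \<open>
  The value of \<open>f\<^sup>*\<close> at a map and of \<open>\<alpha>\<^sup>*\<close> at an object, defined without a restriction of the argument, so that
  their equations need fewer side conditions.
\<close>

definition pull_map :: "('u, 'u) cat \<Rightarrow> 'u gfun \<Rightarrow> 'u gset_map \<Rightarrow> 'u gset_map" where
  "pull_map H f t = \<lparr>nsrc = comp_functor H (nsrc t) f, ntgt = comp_functor H (ntgt t) f,
     ncomp = (\<lambda>h \<in> Obj H. ncomp t (fobj f h))\<rparr>"

lemma pull_map_simps [simp]: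
  "nsrc (pull_map H f t) = comp_functor H (nsrc t) f" "ntgt (pull_map H f t) = comp_functor H (ntgt t) f"
  "h \<in> Obj H \<Longrightarrow> ncomp (pull_map H f t) h = ncomp t (fobj f h)"
  "ncomp (pull_map H f t) \<in> extensional (Obj H)"
  by (simp_all add: pull_map_def)

definition pull_2cell :: "('u, 'u) cat \<Rightarrow> 'u gtrans \<Rightarrow> 'u gset \<Rightarrow> 'u gset_map" where
  "pull_2cell H \<alpha> X = \<lparr>nsrc = comp_functor H X (nsrc \<alpha>), ntgt = comp_functor H X (ntgt \<alpha>),
     ncomp = (\<lambda>h \<in> Obj H. farr X (ncomp \<alpha> h))\<rparr>"

lemma pull_2cell_simps [simp]:
  "nsrc (pull_2cell H \<alpha> X) = comp_functor H X (nsrc \<alpha>)" "ntgt (pull_2cell H \<alpha> X) = comp_functor H X (ntgt \<alpha>)"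
  "h \<in> Obj H \<Longrightarrow> ncomp (pull_2cell H \<alpha> X) h = farr X (ncomp \<alpha> h)"
  "ncomp (pull_2cell H \<alpha> X) \<in> extensional (Obj H)"
  by (simp_all add: pull_2cell_def)

lemma pullback1_simps [simp]:
  "is_functor G set_smcat X \<Longrightarrow> fobj (pullback1 H G f) X = comp_functor H X f"
  "natural G set_smcat t \<Longrightarrow> farr (pullback1 H G f) t = pull_map H f t"
  "is_functor G set_smcat X \<Longrightarrow> is_functor G set_smcat Y \<Longrightarrow> Mu (pullback1 H G f) X Y =
     ntrans_id H set_smcat (functor_tensor H set_smcat (comp_functor H X f) (comp_functor H Y f))"
  "Eps (pullback1 H G f) = ntrans_id H set_smcat (functor_unit H set_smcat)"
  by (simp_all add: pullback1_def pull_map_def)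

lemma GSet_extensional [simp]:
  "ncomp (ntrans_id (GSet G) D F) \<in> extensional {X. is_functor G set_smcat X}"
  "ncomp (ntrans_comp (GSet G) D t s) \<in> extensional {X. is_functor G set_smcat X}"
  by (auto simp: ntrans_id_def ntrans_comp_def)

lemma pullback2_simps [simp]:
  "nsrc (pullback2 H G \<alpha>) = pullback1 H G (nsrc \<alpha>)" "ntgt (pullback2 H G \<alpha>) = pullback1 H G (ntgt \<alpha>)"
  "is_functor G set_smcat X \<Longrightarrow> ncomp (pullback2 H G \<alpha>) X = pull_2cell H \<alpha> X"
  "ncomp (pullback2 H G \<alpha>) \<in> extensional {X. is_functor G set_smcat X}"
  by (simp_all add: pullback2_def pull_2cell_def)

locale gset_pair = H: gsets u H + G: gsets u G for u :: "'u itself" and H G :: "('u, 'u) cat"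
begin

abbreviation "S \<equiv> set_smcat :: ('u set, 'u set_map) smcat"

context
  fixes f :: "'u gfun"
  assumes f: "is_functor H G f"
begin

lemma f_simps [simp]: "h \<in> Obj H \<Longrightarrow> fobj f h \<in> Obj G" "\<eta> \<in> Arr H \<Longrightarrow> farr f \<eta> \<in> Arr G"
  "\<eta> \<in> Arr H \<Longrightarrow> Dom G (farr f \<eta>) = fobj f (Dom H \<eta>)" "\<eta> \<in> Arr H \<Longrightarrow> Cod G (farr f \<eta>) = fobj f (Cod H \<eta>)"
  using functor_fobj[OF f] functor_farr[OF f arr_in_hom] by (auto simp: hom_iff)

lemma pull_gset [simp]: "is_functor G S X \<Longrightarrow> is_functor H S (comp_functor H X f)"
  using is_functor_comp[OF f _ H.G.cat] .

lemma pull_tensor: "comp_functor H (functor_tensor G S X Y) f =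
    functor_tensor H S (comp_functor H X f) (comp_functor H Y f)"
  by (simp add: comp_functor_def functor_tensor_def cong: restrict_cong)

lemma pull_unit: "comp_functor H (functor_unit G S) f = functor_unit H S"
  by (simp add: comp_functor_def functor_unit_def cong: restrict_cong)

lemma natural_pull_map [simp]:
  assumes t: "natural G S t"
  shows "natural H S (pull_map H f t)"
proof (rule naturalI)
  fix \<eta> h h' assume "\<eta> \<in> hom H h h'"
  then have \<eta>: "\<eta> \<in> Arr H" "h = Dom H \<eta>" "h' = Cod H \<eta>" by (auto simp: hom_iff)
  then show "ncomp (pull_map H f t) h' \<cdot>\<^bsub>S\<^esub> farr (nsrc (pull_map H f t)) \<eta> =
      farr (ntgt (pull_map H f t)) \<eta> \<cdot>\<^bsub>S\<^esub> ncomp (pull_map H f t) h"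
    using naturalD(5)[OF t arr_in_hom, of "farr f \<eta>"] by (simp del: H.set_smcat_simps)
qed (use naturalD[OF t] in \<open>auto simp del: H.set_smcat_simps\<close>)

lemma pull_map_comp:
  "pull_map H f (ntrans_comp G S t s) = ntrans_comp H S (pull_map H f t) (pull_map H f s)"
  by (rule ntrans_eqI[where A = "Obj H"]) (simp_all del: H.set_smcat_simps)

lemma pull_map_id: "pull_map H f (ntrans_id G S X) = ntrans_id H S (comp_functor H X f)"
  by (rule ntrans_eqI[where A = "Obj H"]) (simp_all del: H.set_smcat_simps)

lemma pull_map_tensor:
  "pull_map H f (s \<boxtimes>\<^bsub>GSet G\<^esub> t) = pull_map H f s \<boxtimes>\<^bsub>GSet H\<^esub> pull_map H f t"
  unfolding GSet_def
  by (rule ntrans_eqI[where A = "Obj H"]) (simp_all del: H.set_smcat_simps add: pull_tensor)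

lemma pull_map_constraints:
  "pull_map H f (Assoc (GSet G) X Y Z) = Assoc (GSet H) (comp_functor H X f) (comp_functor H Y f) (comp_functor H Z f)"
  "pull_map H f (Lunit (GSet G) X) = Lunit (GSet H) (comp_functor H X f)"
  "pull_map H f (Runit (GSet G) X) = Runit (GSet H) (comp_functor H X f)"
  "pull_map H f (Braid (GSet G) X Y) = Braid (GSet H) (comp_functor H X f) (comp_functor H Y f)"
  unfolding GSet_def
  by (rule ntrans_eqI[where A = "Obj H"]; simp del: H.set_smcat_simps add: pull_tensor pull_unit)+

lemma is_functor_pullback1: "is_functor (GSet G) (GSet H) (pullback1 H G f)"
proof (rule is_functorI[OF G.category_GSet])
  fix s t X Y Z assume "s \<in> hom (GSet G) X Y" "t \<in> hom (GSet G) Y Z"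
  then show "farr (pullback1 H G f) (t \<cdot>\<^bsub>GSet G\<^esub> s) = farr (pullback1 H G f) t \<cdot>\<^bsub>GSet H\<^esub> farr (pullback1 H G f) s"
    using G.natural_comp_S[of s t] by (simp add: hom_iff pull_map_comp)
qed (auto simp: pullback1_def[unfolded GSet_simps] hom_iff naturalD pull_map_id natural_id[OF G.G.cat H.category_set_smcat]
    simp flip: pull_map_def)

text \<open>
  Tensor products and constraints are formed fibrewise, hence commute strictly with \<open>f\<^sup>*\<close>, and identities
  satisfy the axioms for its structure isomorphisms.
\<close>

lemma symmetric_monoidal_pullback1: "symmetric_monoidal_functor (GSet G) (GSet H) (pullback1 H G f)"
proof -
  let ?P = "pullback1 H G f"
  have Mu: "Mu ?P X Y = Ident (GSet H) (comp_functor H X f \<otimes>\<^bsub>GSet H\<^esub> comp_functor H Y f)"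
    if "X \<in> Obj (GSet G)" "Y \<in> Obj (GSet G)" for X Y using that by simp
  have Mu': "Mu ?P X Y = undefined" if "X \<notin> Obj (GSet G) \<or> Y \<notin> Obj (GSet G)" for X Y
    using that by (auto simp: pullback1_def)
  have Eps: "Eps ?P = Ident (GSet H) (Unit (GSet H))" by simp
  have Arr: "farr ?P t = pull_map H f t" if "t \<in> Arr (GSet G)" for t using that by simp
  have Obj: "fobj ?P X = comp_functor H X f" "comp_functor H X f \<in> Obj (GSet H)" if "X \<in> Obj (GSet G)" for X
    using that by simp_all
  have pArr: "pull_map H f t \<in> Arr (GSet H)" "Dom (GSet H) (pull_map H f t) = comp_functor H (Dom (GSet G) t) f"
    "Cod (GSet H) (pull_map H f t) = comp_functor H (Cod (GSet G) t) f" if "t \<in> Arr (GSet G)" for t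
    using that by simp_all
  have tensor: "comp_functor H (X \<otimes>\<^bsub>GSet G\<^esub> Y) f = comp_functor H X f \<otimes>\<^bsub>GSet H\<^esub> comp_functor H Y f" for X Y
    by (simp add: pull_tensor)
  have unit: "comp_functor H (Unit (GSet G)) f = Unit (GSet H)" by (simp add: pull_unit)
  note [simp del] = GSet_simps pullback1_simps
  note [simp] = Mu Eps Arr Obj pArr tensor unit pull_map_tensor pull_map_constraints
  show ?thesis
    by (rule symmetric_monoidal_functorI)
      (simp_all add: is_functor_pullback1 hom_iff is_iso_Ident[OF H.category_GSet] Mu')
qed

text \<open>
  The fibre of \<open>f\<^sup>* X\<close> over \<open>h\<close> is the fibre of \<open>X\<close> over \<open>f h\<close>, and colimits are fibrewise.
\<close>

lemma cocontinuous_pullback1: "cocontinuous TYPE('u) (GSet G) (GSet H) (pullback1 H G f)"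
  unfolding cocontinuous_def preserves_colimits_def
proof (intro allI impI, elim conjE)
  fix J :: "('u, 'u) cat" and X :: "('u, 'u, 'u gset, 'u gset_map) ftor" and c l
  assume J: "small_category J" and X: "is_functor J (GSet G) X" and l: "is_colimit J (GSet G) X c l"
  have J': "category J" using J by (simp add: small_category_def)
  let ?P = "pullback1 H G f"
  note F = is_functor_pullback1 and cocone = is_colimit_cocone[OF l]
  have c: "is_functor G S c" using is_coconeD(1)[OF cocone] by simp
  show "is_colimit J (GSet H) (comp_functor J ?P X) (fobj ?P c) (\<lambda>i. farr ?P (l i))"
  proof (rule H.GSet_colimitI[OF J' is_functor_comp[OF X F J'] cocone_image[OF F J' X cocone]])
    fix h assume h: "h \<in> Obj H"
    have c_h: "fobj (fobj ?P c) h = fobj c (fobj f h)" using c h by simp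
    show "H.fibrewise_colimit J (comp_functor J ?P X) (fobj ?P c) (\<lambda>i. farr ?P (l i)) h"
      unfolding c_h
      by (rule iffD2[OF colimiting_cong[OF J'] G.GSet_colimit_fibrewise[OF J X l]])
        (use G.diagram_GSet[OF X] G.cocone_GSet_natural[OF cocone] h in simp_all)
  qed
qed

end

lemma pullback1_in_Hom: "is_functor H G f \<Longrightarrow> pullback1 H G f \<in> Obj (Hom_Com2Ring TYPE('u) (GSet G) (GSet H))"
  using symmetric_monoidal_pullback1 cocontinuous_pullback1 by simp

lemma natural_pull_2cell:
  assumes \<alpha>: "natural H G \<alpha>" and X: "is_functor G S X"
  shows "natural H S (pull_2cell H \<alpha> X)"
proof (rule naturalI)
  note f = naturalD(1)[OF \<alpha>] and f' = naturalD(2)[OF \<alpha>]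
  show "is_functor H S (nsrc (pull_2cell H \<alpha> X))" "is_functor H S (ntgt (pull_2cell H \<alpha> X))"
    using pull_gset[OF f X] pull_gset[OF f' X] by simp_all
  fix h assume "h \<in> Obj H"
  then show "ncomp (pull_2cell H \<alpha> X) h \<in> hom S (fobj (nsrc (pull_2cell H \<alpha> X)) h) (fobj (ntgt (pull_2cell H \<alpha> X)) h)"
    using functor_farr[OF X naturalD(4)[OF \<alpha>]] by simp
next
  fix \<eta> h h' assume \<eta>: "\<eta> \<in> hom H h h'"
  then have h: "h \<in> Obj H" "h' \<in> Obj H" using hom_Obj[OF H.G.cat] by auto
  note f = functor_farr[OF naturalD(1)[OF \<alpha>] \<eta>] and f' = functor_farr[OF naturalD(2)[OF \<alpha>] \<eta>]
  have "farr X (ncomp \<alpha> h') \<cdot>\<^bsub>S\<^esub> farr X (farr (nsrc \<alpha>) \<eta>) = farr X (farr (ntgt \<alpha>) \<eta>) \<cdot>\<^bsub>S\<^esub> farr X (ncomp \<alpha> h)"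
    using functor_Comp[OF X f naturalD(4)[OF \<alpha> h(2)]] functor_Comp[OF X naturalD(4)[OF \<alpha> h(1)] f']
      naturalD(5)[OF \<alpha> \<eta>] by simp
  then show "ncomp (pull_2cell H \<alpha> X) h' \<cdot>\<^bsub>S\<^esub> farr (nsrc (pull_2cell H \<alpha> X)) \<eta> =
      farr (ntgt (pull_2cell H \<alpha> X)) \<eta> \<cdot>\<^bsub>S\<^esub> ncomp (pull_2cell H \<alpha> X) h"
    using \<eta> h by (simp add: hom_iff del: H.set_smcat_simps)
qed simp

lemma monoidal_transformation_pullback2:
  assumes \<alpha>: "natural H G \<alpha>"
  shows "monoidal_transformation (GSet G) (GSet H) (pullback2 H G \<alpha>)"
proof -
  note f = naturalD(1)[OF \<alpha>] and f' = naturalD(2)[OF \<alpha>]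
  have cell [simp]: "natural H S (pull_2cell H \<alpha> X)" if "is_functor G S X" for X
    using natural_pull_2cell[OF \<alpha> that] .
  have \<alpha>_simps [simp]: "ncomp \<alpha> h \<in> Arr G" "Dom G (ncomp \<alpha> h) = fobj (nsrc \<alpha>) h" "Cod G (ncomp \<alpha> h) = fobj (ntgt \<alpha>) h"
    if "h \<in> Obj H" for h using naturalD(4)[OF \<alpha> that] by (auto simp: hom_iff)
  have nat: "natural (GSet G) (GSet H) (pullback2 H G \<alpha>)"
  proof (rule naturalI)
    fix t X Y assume "t \<in> hom (GSet G) X Y"
    then have t: "natural G S t" "nsrc t = X" "ntgt t = Y" "is_functor G S X" "is_functor G S Y"
      by (auto simp: hom_iff naturalD)
    have "ntrans_comp H S (pull_2cell H \<alpha> Y) (pull_map H (nsrc \<alpha>) t) =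
        ntrans_comp H S (pull_map H (ntgt \<alpha>) t) (pull_2cell H \<alpha> X)"
      using naturalD(5)[OF t(1) naturalD(4)[OF \<alpha>]] t(2,3)
      by (intro ntrans_eqI[where A = "Obj H"]) (simp_all del: H.set_smcat_simps)
    then show "ncomp (pullback2 H G \<alpha>) Y \<cdot>\<^bsub>GSet H\<^esub> farr (nsrc (pullback2 H G \<alpha>)) t =
        farr (ntgt (pullback2 H G \<alpha>)) t \<cdot>\<^bsub>GSet H\<^esub> ncomp (pullback2 H G \<alpha>) X"
      using t by simp
  qed (simp_all add: is_functor_pullback1 f f' hom_iff)
  have tensor_functor: "is_functor G S (functor_tensor G S X Y)" if "is_functor G S X" "is_functor G S Y" for X Y
    using G.E.tensor_simps(1)[of X Y] that by simp
  have tensor: "ntrans_comp H S (pull_2cell H \<alpha> (functor_tensor G S X Y))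
        (ntrans_id H S (functor_tensor H S (comp_functor H X (nsrc \<alpha>)) (comp_functor H Y (nsrc \<alpha>)))) =
      ntrans_comp H S (ntrans_id H S (functor_tensor H S (comp_functor H X (ntgt \<alpha>)) (comp_functor H Y (ntgt \<alpha>))))
        (pull_2cell H \<alpha> X \<boxtimes>\<^bsub>GSet H\<^esub> pull_2cell H \<alpha> Y)"
    if XY: "is_functor G S X" "is_functor G S Y" for X Y
  proof -
    have eq: "pull_2cell H \<alpha> (functor_tensor G S X Y) = pull_2cell H \<alpha> X \<boxtimes>\<^bsub>GSet H\<^esub> pull_2cell H \<alpha> Y"
      unfolding GSet_def
      by (rule ntrans_eqI[where A = "Obj H"]) (simp_all del: H.set_smcat_simps add: pull_tensor f f')
    have n: "natural H S (pull_2cell H \<alpha> (functor_tensor G S X Y))" using tensor_functor[OF XY] by simp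
    have "nsrc (pull_2cell H \<alpha> (functor_tensor G S X Y)) = functor_tensor H S (comp_functor H X (nsrc \<alpha>)) (comp_functor H Y (nsrc \<alpha>))"
      "ntgt (pull_2cell H \<alpha> (functor_tensor G S X Y)) = functor_tensor H S (comp_functor H X (ntgt \<alpha>)) (comp_functor H Y (ntgt \<alpha>))"
      by (simp_all add: pull_tensor f f')
    then show ?thesis
      using ntrans_comp_id_right[OF H.category_set_smcat n] ntrans_comp_id_left[OF H.category_set_smcat n]
      unfolding eq by simp
  qed
  have unit_functor: "is_functor G S (functor_unit G S)" using G.E.constraint_simps(1) by simp
  have "pull_2cell H \<alpha> (functor_unit G S) = ntrans_id H S (functor_unit H S)"
    by (rule ntrans_eqI[where A = "Obj H"]) (simp_all del: H.set_smcat_simps add: pull_unit f f')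
  then have "ntrans_comp H S (pull_2cell H \<alpha> (functor_unit G S)) (ntrans_id H S (functor_unit H S)) = ntrans_id H S (functor_unit H S)"
    using ntrans_comp_id_right[OF H.category_set_smcat cell[OF unit_functor]] by simp
  then show ?thesis
    unfolding monoidal_transformation_def using nat tensor tensor_functor unit_functor by simp
qed

lemma pullback2_in_Hom:
  assumes "\<alpha> \<in> hom (functor_category H G) f f'"
  shows "pullback2 H G \<alpha> \<in> hom (Hom_Com2Ring TYPE('u) (GSet G) (GSet H)) (pullback1 H G f) (pullback1 H G f')"
  using assms monoidal_transformation_pullback2[of \<alpha>] pullback1_in_Hom naturalD(1,2)[of H G \<alpha>]
  by (auto simp: hom_iff)

lemma category_Hom: "category (Hom_Com2Ring TYPE('u) (GSet G) (GSet H))"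
  using category_Hom_Com2Ring[OF G.symmetric_monoidal_GSet H.symmetric_monoidal_GSet] .

lemma is_functor_pullback_functor:
  "is_functor (functor_category H G) (Hom_Com2Ring TYPE('u) (GSet G) (GSet H)) (pullback_functor H G)"
proof (rule is_functorI[OF category_functor_category[OF H.G.cat G.G.cat]])
  fix \<alpha> f f' assume "\<alpha> \<in> hom (functor_category H G) f f'"
  then show "farr (pullback_functor H G) \<alpha> \<in> hom (Hom_Com2Ring TYPE('u) (GSet G) (GSet H))
      (fobj (pullback_functor H G) f) (fobj (pullback_functor H G) f')"
    using pullback2_in_Hom[of \<alpha> f f'] naturalD(1,2)[of H G \<alpha>] by (auto simp: hom_iff)
next
  fix f assume "f \<in> Obj (functor_category H G)"
  then have f: "is_functor H G f" by simp
  have "pull_2cell H (ntrans_id H G f) X = ntrans_id H S (comp_functor H X f)" if "is_functor G S X" for X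
    using functor_Ident[OF that functor_fobj[OF f]]
    by (intro ntrans_eqI[where A = "Obj H"]) (simp_all del: H.set_smcat_simps)
  then have "pullback2 H G (ntrans_id H G f) = ntrans_id (GSet G) (GSet H) (pullback1 H G f)"
    by (intro ntrans_eqI[where A = "Obj (GSet G)"]) simp_all
  then show "farr (pullback_functor H G) (Ident (functor_category H G) f) =
      Ident (Hom_Com2Ring TYPE('u) (GSet G) (GSet H)) (fobj (pullback_functor H G) f)"
    using f natural_id[OF H.G.cat G.G.cat f] by simp
next
  fix \<alpha> \<beta> f g k assume "\<alpha> \<in> hom (functor_category H G) f g" "\<beta> \<in> hom (functor_category H G) g k"
  then have \<alpha>: "natural H G \<alpha>" "nsrc \<alpha> = f" "ntgt \<alpha> = g" and \<beta>: "natural H G \<beta>" "nsrc \<beta> = g" "ntgt \<beta> = k"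
    by (auto simp: hom_iff)
  have "pull_2cell H (ntrans_comp H G \<beta> \<alpha>) X = ntrans_comp H S (pull_2cell H \<beta> X) (pull_2cell H \<alpha> X)"
    if "is_functor G S X" for X
    using functor_Comp[OF that naturalD(4)[OF \<alpha>(1)] naturalD(4)[OF \<beta>(1), unfolded \<beta>(2) \<alpha>(3)[symmetric]]]
    by (intro ntrans_eqI[where A = "Obj H"]) (simp_all del: H.set_smcat_simps)
  then have "pullback2 H G (ntrans_comp H G \<beta> \<alpha>) = ntrans_comp (GSet G) (GSet H) (pullback2 H G \<beta>) (pullback2 H G \<alpha>)"
    by (intro ntrans_eqI[where A = "Obj (GSet G)"]) simp_all
  then show "farr (pullback_functor H G) (\<beta> \<cdot>\<^bsub>functor_category H G\<^esub> \<alpha>) =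
      farr (pullback_functor H G) \<beta> \<cdot>\<^bsub>Hom_Com2Ring TYPE('u) (GSet G) (GSet H)\<^esub> farr (pullback_functor H G) \<alpha>"
    using natural_comp[OF H.G.cat G.G.cat \<alpha>(1) \<beta>(1)] \<alpha> \<beta> by simp
qed (auto simp: pullback_functor_def pullback1_in_Hom[simplified])

text \<open>
  A transformation \<open>t : f\<^sup>* \<Rightarrow> f'\<^sup>*\<close> is determined by the images of the universal elements
  \<open>Ident \<in> rep (f h) (f h)\<close>; these are arrows \<open>f h \<rightarrow> f' h\<close>.
\<close>

lemma pullback_full:
  assumes f: "is_functor H G f" and f': "is_functor H G f'"
    and t: "t \<in> hom (Hom_Com2Ring TYPE('u) (GSet G) (GSet H)) (pullback1 H G f) (pullback1 H G f')"
  shows "\<exists>\<alpha> \<in> hom (functor_category H G) f f'. pullback2 H G \<alpha> = t"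
proof -
  have t': "natural (GSet G) (GSet H) t" "nsrc t = pullback1 H G f" "ntgt t = pullback1 H G f'"
    using t monoidal_transformation_natural by (auto simp: hom_iff)
  note f_simps [simp] = f_simps[OF f] f_simps[OF f']
  have tX [simp]: "natural H S (ncomp t X)" "nsrc (ncomp t X) = comp_functor H X f"
      "ntgt (ncomp t X) = comp_functor H X f'" if "is_functor G S X" for X
    using naturalD(4)[OF t'(1), of X] t'(2,3) that by (simp_all add: hom_iff)
  define \<alpha> where "\<alpha> h = sfun (ncomp (ncomp t (G.rep (fobj f h))) h) (Ident G (fobj f h))" for h
  have \<alpha>: "\<alpha> h \<in> hom G (fobj f h) (fobj f' h)" if h: "h \<in> Obj H" for h
    using H.gmap_apply[OF tX(1)[OF G.is_functor_rep[of "fobj f h"]] h, of "Ident G (fobj f h)"] h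
    by (simp add: \<alpha>_def)
  \<comment> \<open>Naturality of \<open>t\<close> along the map \<open>rep (f h) \<rightarrow> X\<close> that corresponds to \<open>x\<close>.\<close>
  have key: "sfun (ncomp (ncomp t X) h) x = sfun (farr X (\<alpha> h)) x"
    if X: "is_functor G S X" and h: "h \<in> Obj H" and x: "x \<in> fobj X (fobj f h)" for X h x
  proof -
    let ?y = "G.yo X (fobj f h) x" and ?R = "G.rep (fobj f h)"
    have R: "is_functor G S ?R" using h by simp
    have y: "natural G S ?y" using X h x by simp
    have "ntrans_comp H S (ncomp t X) (pull_map H f ?y) = ntrans_comp H S (pull_map H f' ?y) (ncomp t ?R)"
      using naturalD(5)[OF t'(1), of ?y ?R X] t'(2,3) y by (simp add: hom_iff)
    then have "sfun (ncomp (ntrans_comp H S (ncomp t X) (pull_map H f ?y)) h) (Ident G (fobj f h)) =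
        sfun (ncomp (ntrans_comp H S (pull_map H f' ?y) (ncomp t ?R)) h) (Ident G (fobj f h))" by simp
    then have "sfun (ncomp (ncomp t X) h) (sfun (ncomp ?y (fobj f h)) (Ident G (fobj f h))) =
        sfun (ncomp ?y (fobj f' h)) (\<alpha> h)"
      using H.ncomp_comp_apply[OF natural_pull_map[OF f y] tX(1)[OF X] _ h, of "Ident G (fobj f h)"]
        H.ncomp_comp_apply[OF tX(1)[OF R] natural_pull_map[OF f' y] _ h, of "Ident G (fobj f h)"] X R h
      by (simp add: \<alpha>_def del: H.set_smcat_simps ntrans_comp_simps(3))
    then show ?thesis
      using G.yo_Ident[OF X _ x] \<alpha>[OF h] h by (simp del: H.set_smcat_simps)
  qed
  define A where "A = \<lparr>nsrc = f, ntgt = f', ncomp = restrict \<alpha> (Obj H)\<rparr>"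
  have A: "natural H G A"
  proof (rule naturalI)
    fix \<eta> h h' assume "\<eta> \<in> hom H h h'"
    then have \<eta>: "\<eta> \<in> Arr H" "h = Dom H \<eta>" "h' = Cod H \<eta>" by (auto simp: hom_iff)
    have h: "h \<in> Obj H" "h' \<in> Obj H" using \<eta> by auto
    have hom: "\<alpha> h \<in> Arr G" "Dom G (\<alpha> h) = fobj f h" "Cod G (\<alpha> h) = fobj f' h"
      "\<alpha> h' \<in> Arr G" "Dom G (\<alpha> h') = fobj f h'" "Cod G (\<alpha> h') = fobj f' h'"
      using \<alpha>[OF h(1)] \<alpha>[OF h(2)] by (auto simp: hom_iff)
    let ?R = "G.rep (fobj f h)"
    have R: "is_functor G S ?R" using h by simp
    have "sfun (ncomp (ncomp t ?R) h') (sfun (farr ?R (farr f \<eta>)) (Ident G (fobj f h))) =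
        sfun (farr ?R (farr f' \<eta>)) (\<alpha> h)"
      using H.gmap_equivariant[OF tX(1)[OF R] \<eta>(1), of "Ident G (fobj f h)"] R \<eta> h
      by (simp add: \<alpha>_def del: G.rep_simps(2))
    moreover have "sfun (farr ?R (farr f \<eta>)) (Ident G (fobj f h)) = farr f \<eta>" using \<eta> h by simp
    moreover have "sfun (farr ?R (farr f' \<eta>)) (\<alpha> h) = farr f' \<eta> \<cdot>\<^bsub>G\<^esub> \<alpha> h" using \<eta> h hom by (simp add: hom_iff)
    moreover have "sfun (ncomp (ncomp t ?R) h') (farr f \<eta>) = \<alpha> h' \<cdot>\<^bsub>G\<^esub> farr f \<eta>"
      using key[OF R h(2), of "farr f \<eta>"] \<eta> h hom by (simp add: hom_iff)
    ultimately show "ncomp A h' \<cdot>\<^bsub>G\<^esub> farr (nsrc A) \<eta> = farr (ntgt A) \<eta> \<cdot>\<^bsub>G\<^esub> ncomp A h"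
      using h by (simp add: A_def)
  qed (use f f' \<alpha> in \<open>auto simp: A_def\<close>)
  have "pull_2cell H A X = ncomp t X" if X: "is_functor G S X" for X
    by (rule H.gmap_eqI[OF natural_pull_2cell[OF A X] tX(1)[OF X]])
      (use X key[OF X] in \<open>simp_all add: A_def del: H.set_smcat_simps\<close>)
  then have "pullback2 H G A = t"
    using naturalD(3)[OF t'(1)] t'(2,3)
    by (intro ntrans_eqI[where A = "Obj (GSet G)"]) (simp_all add: A_def)
  then show ?thesis using A by (intro bexI[of _ A]) (simp_all add: hom_iff A_def)
qed

lemma pullback_faithful:
  assumes \<alpha>: "\<alpha> \<in> hom (functor_category H G) f f'" and \<beta>: "\<beta> \<in> hom (functor_category H G) f f'"
    and eq: "pullback2 H G \<alpha> = pullback2 H G \<beta>"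
  shows "\<alpha> = \<beta>"
proof -
  have \<alpha>': "natural H G \<alpha>" "nsrc \<alpha> = f" "ntgt \<alpha> = f'" and \<beta>': "natural H G \<beta>" "nsrc \<beta> = f" "ntgt \<beta> = f'"
    using \<alpha> \<beta> by (auto simp: hom_iff)
  note f_simps [simp] = f_simps[OF naturalD(1)[OF \<alpha>'(1)], unfolded \<alpha>'(2)]
  have "ncomp \<alpha> h = ncomp \<beta> h" if h: "h \<in> Obj H" for h
  proof -
    let ?R = "G.rep (fobj f h)"
    have R: "is_functor G S ?R" using h by simp
    have a: "ncomp \<alpha> h \<in> hom G (fobj f h) (fobj f' h)" "ncomp \<beta> h \<in> hom G (fobj f h) (fobj f' h)"
      using naturalD(4)[OF \<alpha>'(1) h] naturalD(4)[OF \<beta>'(1) h] \<alpha>' \<beta>' by simp_all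
    have "pull_2cell H \<alpha> ?R = pull_2cell H \<beta> ?R"
      using arg_cong[OF eq, of "\<lambda>r. ncomp r ?R"] R by simp
    then have "farr ?R (ncomp \<alpha> h) = farr ?R (ncomp \<beta> h)"
      using h pull_2cell_simps(3)[OF h] by metis
    then have "sfun (farr ?R (ncomp \<alpha> h)) (Ident G (fobj f h)) = sfun (farr ?R (ncomp \<beta> h)) (Ident G (fobj f h))"
      by simp
    then show ?thesis using a h by (simp add: hom_iff)
  qed
  then show ?thesis
    using naturalD(3)[OF \<alpha>'(1)] naturalD(3)[OF \<beta>'(1)] \<alpha>' \<beta>'
    by (intro ntrans_eqI[where A = "Obj H"]) simp_all
qed

end

lemma (in gsets) pullback1_id: "pullback1 G G (id_functor G) = id_smfunctor (GSet G)"
proof -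
  interpret P: gset_pair u G G by unfold_locales
  note id = is_functor_id[OF G.cat]
  have [simp]: "comp_functor G X (id_functor G) = X" if "is_functor G S X" for X
    using comp_functor_id_right[OF that G.cat] .
  have "pull_map G (id_functor G) t = t" if "natural G S t" for t
    using naturalD[OF that] by (intro ntrans_eqI[where A = "Obj G"]) simp_all
  then show ?thesis
    by (intro smfunctor_eqI[OF P.symmetric_monoidal_pullback1[OF id] symmetric_monoidal_functor_id[OF symmetric_monoidal_GSet]])
      simp_all
qed

locale gset_triple = H: gsets u H + G: gsets u G + K: gsets u K
  for u :: "'u itself" and H G K :: "('u, 'u) cat"
begin

sublocale HG: gset_pair u H G by unfold_locales
sublocale GK: gset_pair u G K by unfold_locales
sublocale HK: gset_pair u H K by unfold_locales

abbreviation "S \<equiv> set_smcat :: ('u set, 'u set_map) smcat"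

lemma comp_functor_assoc':
  assumes "is_functor H G f" "is_functor G K g" "is_functor K S X"
  shows "comp_functor H X (comp_functor H g f) = comp_functor H (comp_functor G X g) f"
  using comp_functor_assoc[OF assms H.G.cat G.G.cat] by simp

lemma pullback1_comp:
  assumes f: "is_functor H G f" and g: "is_functor G K g"
  shows "pullback1 H K (comp_functor H g f) = comp_smfunctor (GSet K) (GSet H) (pullback1 H G f) (pullback1 G K g)"
proof -
  note gf = is_functor_comp[OF f g H.G.cat]
  note [simp] = HG.f_simps[OF f] GK.f_simps[OF g] GK.natural_pull_map[OF g] GK.pull_gset[OF g] HG.pull_gset[OF f]
  have pm: "pull_map H (comp_functor H g f) t = pull_map H f (pull_map G g t)" if "natural K S t" for t
    using comp_functor_assoc'[OF f g naturalD(1)[OF that]] comp_functor_assoc'[OF f g naturalD(2)[OF that]]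
    by (intro ntrans_eqI[where A = "Obj H"]) simp_all
  have tensor_functor: "is_functor G S (functor_tensor G S X Y)" if "is_functor G S X" "is_functor G S Y" for X Y
    using G.E.tensor_simps(1)[of X Y] that by simp
  have tensor_functor': "is_functor H S (functor_tensor H S X Y)" if "is_functor H S X" "is_functor H S Y" for X Y
    using H.E.tensor_simps(1)[of X Y] that by simp
  have unit_functor: "is_functor G S (functor_unit G S)" using G.E.constraint_simps(1) by simp
  have unit_functor': "is_functor H S (functor_unit H S)" using H.E.constraint_simps(1) by simp
  have id: "ntrans_comp H S (ntrans_id H S X) (ntrans_id H S X) = ntrans_id H S X" if "is_functor H S X" for X
    using ntrans_comp_id_left[OF H.category_set_smcat natural_id[OF H.G.cat H.category_set_smcat that]] by simp
  show ?thesis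
  proof (rule smfunctor_eqI[OF HK.symmetric_monoidal_pullback1[OF gf] symmetric_monoidal_functor_comp[OF
          K.symmetric_monoidal_GSet G.symmetric_monoidal_GSet H.symmetric_monoidal_GSet
          GK.symmetric_monoidal_pullback1[OF g] HG.symmetric_monoidal_pullback1[OF f]]])
    fix X Y assume "X \<in> Obj (GSet K)" "Y \<in> Obj (GSet K)"
    then have XY: "is_functor K S X" "is_functor K S Y" by auto
    then show "Mu (pullback1 H K (comp_functor H g f)) X Y =
        Mu (comp_smfunctor (GSet K) (GSet H) (pullback1 H G f) (pullback1 G K g)) X Y"
      using natural_id[OF G.G.cat H.category_set_smcat tensor_functor, of "comp_functor G X g" "comp_functor G Y g"]
        id[OF tensor_functor', of "comp_functor H (comp_functor G X g) f" "comp_functor H (comp_functor G Y g) f"]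
        HG.pull_gset[OF f]
      by (simp add: comp_functor_assoc'[OF f g] HG.pull_map_id[OF f] HG.pull_tensor[OF f])
  qed (use natural_id[OF G.G.cat H.category_set_smcat unit_functor] id[OF unit_functor'] HG.pull_map_id[OF f]
      HG.pull_unit[OF f] in \<open>simp_all add: comp_functor_assoc'[OF f g] pm\<close>)
qed

lemma pullback2_hcomp:
  assumes s: "natural H G s" and t: "natural G K t"
  shows "pullback2 H K (HComp2 Gpd H G K t s) =
    HComp2 (Com2Ring TYPE('u)) (GSet K) (GSet G) (GSet H) (pullback2 H G s) (pullback2 G K t)"
proof -
  note f = naturalD(1)[OF s] and f' = naturalD(2)[OF s] and g = naturalD(1)[OF t] and g' = naturalD(2)[OF t]
  have "pull_2cell H (HComp2 Gpd H G K t s) X =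
      ntrans_comp H S (pull_2cell H s (comp_functor G X (ntgt t))) (pull_map H (nsrc s) (pull_2cell G t X))"
    if X: "is_functor K S X" for X
  proof (rule ntrans_eqI[where A = "Obj H"])
    fix h assume h: "h \<in> Obj H"
    have fh: "fobj (nsrc s) h \<in> Obj G" "fobj (ntgt s) h \<in> Obj G" using functor_fobj[OF f h] functor_fobj[OF f' h] by auto
    note sh = naturalD(4)[OF s h]
    have "farr X (ncomp t (fobj (ntgt s) h) \<cdot>\<^bsub>K\<^esub> farr (nsrc t) (ncomp s h)) =
        farr X (farr (ntgt t) (ncomp s h)) \<cdot>\<^bsub>S\<^esub> farr X (ncomp t (fobj (nsrc s) h))"
      using naturalD(5)[OF t sh] functor_Comp[OF X naturalD(4)[OF t fh(1)] functor_farr[OF g' sh]] by simp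
    then show "ncomp (pull_2cell H (HComp2 Gpd H G K t s) X) h =
        ncomp (ntrans_comp H S (pull_2cell H s (comp_functor G X (ntgt t))) (pull_map H (nsrc s) (pull_2cell G t X))) h"
      using h fh sh by (simp add: hcomp_components_def hom_iff del: H.set_smcat_simps)
  qed (simp_all add: comp_functor_assoc'[OF f g X] comp_functor_assoc'[OF f' g' X])
  then show ?thesis
    by (intro ntrans_eqI[where A = "Obj (GSet K)"])
      (simp_all add: GK.natural_pull_2cell[OF t] GK.pull_gset[OF g'] pullback1_comp[OF f g] pullback1_comp[OF f' g'] hcomp_components_def)
qed

end

lemma (in universe) two_functor_two_Spec_GSet:
  "two_functor (Gpd :: (('u, 'u) cat, 'u gfun, 'u gtrans) two_cat) (Af2Sch TYPE('u)) two_Spec_GSet"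
proof -
  have gsets: "gsets G" if "small_groupoid G" for G :: "('u, 'u) cat"
    using that inaccessible by unfold_locales (simp_all add: small_groupoid_def)
  have pair: "gset_pair H G" if "small_groupoid H" "small_groupoid G" for H G :: "('u, 'u) cat"
    using gsets that by (simp add: gset_pair_def)
  have triple: "gset_triple H G K" if "small_groupoid H" "small_groupoid G" "small_groupoid K"
    for H G K :: "('u, 'u) cat"
    using gsets that by (simp add: gset_triple_def)
  show ?thesis
    unfolding two_functor_def two_Spec_GSet_def two_Spec_def
  proof (intro conjI ballI)
    show "two_category (Gpd :: (('u, 'u) cat, 'u gfun, 'u gtrans) two_cat)" by (rule two_category_Gpd)
    show "two_category (Af2Sch TYPE('u) :: (('u gset, 'u gset_map) smcat, _, _) two_cat)"
      unfolding Af2Sch_def by (rule two_category_one_opposite[OF two_category_Com2Ring])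
  next
    fix A :: "('u, 'u) cat" assume "A \<in> Cell0 Gpd"
    then have A: "small_groupoid A" by simp
    show "two_obj \<lparr>two_obj = GSet, two_hom = pullback_functor\<rparr> A \<in> Cell0 (Af2Sch TYPE('u))"
      using gsets.commutative_2_ring_GSet[OF gsets[OF A]] by (simp add: Af2Sch_def one_opposite_def)
    show "fobj (two_hom \<lparr>two_obj = GSet, two_hom = pullback_functor\<rparr> A A) (Ident1 Gpd A) =
        Ident1 (Af2Sch TYPE('u)) (two_obj \<lparr>two_obj = GSet, two_hom = pullback_functor\<rparr> A)"
      using gsets.pullback1_id[OF gsets[OF A]] is_functor_id[OF small_groupoid_category[OF A]]
      by (simp add: Af2Sch_def one_opposite_def)
  next
    fix A B :: "('u, 'u) cat" assume "A \<in> Cell0 Gpd" "B \<in> Cell0 Gpd"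
    then have AB: "small_groupoid A" "small_groupoid B" by auto
    show "is_functor (HomCat Gpd A B)
        (HomCat (Af2Sch TYPE('u)) (two_obj \<lparr>two_obj = GSet, two_hom = pullback_functor\<rparr> A)
          (two_obj \<lparr>two_obj = GSet, two_hom = pullback_functor\<rparr> B))
        (two_hom \<lparr>two_obj = GSet, two_hom = pullback_functor\<rparr> A B)"
      using gset_pair.is_functor_pullback_functor[OF pair[OF AB]] by (simp add: Af2Sch_def one_opposite_def)
  next
    fix A B C :: "('u, 'u) cat" and f g
    assume "A \<in> Cell0 Gpd" "B \<in> Cell0 Gpd" "C \<in> Cell0 Gpd"
    then have ABC: "small_groupoid A" "small_groupoid B" "small_groupoid C" by auto
    assume "f \<in> Obj (HomCat Gpd A B)" "g \<in> Obj (HomCat Gpd B C)"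
    then have fg: "is_functor A B f" "is_functor B C g" by auto
    then show "fobj (two_hom \<lparr>two_obj = GSet, two_hom = pullback_functor\<rparr> A C) (HComp1 Gpd A B C g f) =
        HComp1 (Af2Sch TYPE('u)) (two_obj \<lparr>two_obj = GSet, two_hom = pullback_functor\<rparr> A)
          (two_obj \<lparr>two_obj = GSet, two_hom = pullback_functor\<rparr> B)
          (two_obj \<lparr>two_obj = GSet, two_hom = pullback_functor\<rparr> C)
          (fobj (two_hom \<lparr>two_obj = GSet, two_hom = pullback_functor\<rparr> B C) g)
          (fobj (two_hom \<lparr>two_obj = GSet, two_hom = pullback_functor\<rparr> A B) f)"
      using gset_triple.pullback1_comp[OF triple[OF ABC] fg] is_functor_comp[OF fg small_groupoid_category[OF ABC(1)]]
      by (simp add: Af2Sch_def one_opposite_def)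
  next
    fix A B C :: "('u, 'u) cat" and s t
    assume "A \<in> Cell0 Gpd" "B \<in> Cell0 Gpd" "C \<in> Cell0 Gpd"
    then have ABC: "small_groupoid A" "small_groupoid B" "small_groupoid C" by auto
    assume "s \<in> Arr (HomCat Gpd A B)" "t \<in> Arr (HomCat Gpd B C)"
    then have st: "natural A B s" "natural B C t" by auto
    have "natural A C (HComp2 Gpd A B C t s)"
      using HComp2_Gpd_in_hom[OF small_groupoid_category small_groupoid_category small_groupoid_category, OF ABC st]
      by (simp add: hom_iff del: Gpd_simps(5))
    then show "farr (two_hom \<lparr>two_obj = GSet, two_hom = pullback_functor\<rparr> A C) (HComp2 Gpd A B C t s) =
        HComp2 (Af2Sch TYPE('u)) (two_obj \<lparr>two_obj = GSet, two_hom = pullback_functor\<rparr> A)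
          (two_obj \<lparr>two_obj = GSet, two_hom = pullback_functor\<rparr> B)
          (two_obj \<lparr>two_obj = GSet, two_hom = pullback_functor\<rparr> C)
          (farr (two_hom \<lparr>two_obj = GSet, two_hom = pullback_functor\<rparr> B C) t)
          (farr (two_hom \<lparr>two_obj = GSet, two_hom = pullback_functor\<rparr> A B) s)"
      using gset_triple.pullback2_hcomp[OF triple[OF ABC] st] st
      by (simp add: Af2Sch_def one_opposite_def del: Gpd_simps(5))
  qed
qed

section \<open>Reconstruction of a functor of groupoids\<close>

locale gset_morphism = gset_pair u H G for u :: "'u itself" and H G :: "('u, 'u) cat" +
  fixes F :: "('u gset, 'u gset_map) sm_endo"
  assumes groupoid_G: "groupoid G"
    and F_monoidal: "symmetric_monoidal_functor (GSet G) (GSet H) F"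
    and F_cocontinuous: "cocontinuous TYPE('u) (GSet G) (GSet H) F"
begin

sublocale F: sm_functor "GSet G" "GSet H" F
  by unfold_locales (rule F_monoidal)

text \<open>
  The argument works with points of the fibres \<open>F X h\<close>.  Here \<open>app t h\<close> is the effect of \<open>F t\<close> on them, and
  \<open>mu X Y h\<close> is the structure bijection \<open>F X h \<times> F Y h \<rightarrow> F (X \<times> Y) h\<close>.
\<close>

definition app :: "'u gset_map \<Rightarrow> 'u \<Rightarrow> 'u \<Rightarrow> 'u" where
  "app t h p = sfun (ncomp (farr F t) h) p"

definition mu :: "'u gset \<Rightarrow> 'u gset \<Rightarrow> 'u \<Rightarrow> 'u \<Rightarrow> 'u" where
  "mu X Y h z = sfun (ncomp (Mu F X Y) h) z"

abbreviation fib :: "'u gset \<Rightarrow> 'u \<Rightarrow> 'u set" where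
  "fib X h \<equiv> fobj (fobj F X) h"

lemma F_gset [simp]: "is_functor G S X \<Longrightarrow> is_functor H S (fobj F X)"
  using F.ftor_simps(1)[of X] by simp

lemma F_map [simp]:
  "natural G S t \<Longrightarrow> natural H S (farr F t)" "natural G S t \<Longrightarrow> nsrc (farr F t) = fobj F (nsrc t)"
  "natural G S t \<Longrightarrow> ntgt (farr F t) = fobj F (ntgt t)"
  using F.ftor_simps(2-4)[of t] by simp_all

lemma app_in: "natural G S t \<Longrightarrow> h \<in> Obj H \<Longrightarrow> p \<in> fib (nsrc t) h \<Longrightarrow> app t h p \<in> fib (ntgt t) h"
  using H.gmap_apply[of "farr F t" h p] by (simp add: app_def)

lemma app_comp:
  assumes "natural G S s" "natural G S t" "nsrc t = ntgt s" "h \<in> Obj H" "p \<in> fib (nsrc s) h"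
  shows "app (ntrans_comp G S t s) h p = app t h (app s h p)"
  using assms F.farr_Comp[of s t] H.ncomp_comp_apply[of "farr F s" "farr F t" h p]
  by (simp add: app_def del: ntrans_comp_simps(3))

lemma app_equivariant:
  "natural G S t \<Longrightarrow> \<eta> \<in> Arr H \<Longrightarrow> p \<in> fib (nsrc t) (Dom H \<eta>) \<Longrightarrow>
     app t (Cod H \<eta>) (sfun (farr (fobj F (nsrc t)) \<eta>) p) = sfun (farr (fobj F (ntgt t)) \<eta>) (app t (Dom H \<eta>) p)"
  using H.gmap_equivariant[of "farr F t" \<eta> p] by (simp add: app_def)

lemma app_id: "is_functor G S X \<Longrightarrow> h \<in> Obj H \<Longrightarrow> p \<in> fib X h \<Longrightarrow> app (ntrans_id G S X) h p = p"
  using F.ftor_simps(5)[of X] by (simp add: app_def)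

lemma tensor_gset [simp]: "is_functor G S X \<Longrightarrow> is_functor G S Y \<Longrightarrow> is_functor G S (functor_tensor G S X Y)"
  using G.E.tensor_simps(1)[of X Y] by simp

lemma tensor_gset_H [simp]: "is_functor H S X \<Longrightarrow> is_functor H S Y \<Longrightarrow> is_functor H S (functor_tensor H S X Y)"
  using H.E.tensor_simps(1)[of X Y] by simp

lemma unit_gset [simp]: "is_functor G S (functor_unit G S)"
  using G.E.constraint_simps(1) by simp

lemma iso_bij:
  assumes "is_iso (GSet H) t" and t: "natural H S t" and h: "h \<in> Obj H"
  shows "bij_betw (sfun (ncomp t h)) (fobj (nsrc t) h) (fobj (ntgt t) h)"
proof -
  have iso: "is_iso (functor_category H S) t"
    using assms(1) unfolding GSet_def by (simp add: is_iso_functor_smcat)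
  have E: "category (functor_category H S)"
    by (rule category_functor_category[OF H.G.cat H.category_set_smcat])
  have "is_iso S (ncomp t h)"
    using functor_is_iso[OF is_functor_evaluation[OF H.G.cat H.category_set_smcat h] _ iso E, of "nsrc t" "ntgt t"] t
    by (simp add: hom_iff)
  moreover have "ncomp t h \<in> hom S (fobj (nsrc t) h) (fobj (ntgt t) h)"
    by (rule naturalD(4)[OF t h])
  ultimately show ?thesis
    using set_iso_bij by (simp only: H.hom_set_smcat H.is_iso_set_smcat)
qed

lemma mu_bij:
  assumes X: "is_functor G S X" and Y: "is_functor G S Y" and h: "h \<in> Obj H"
  shows "bij_betw (mu X Y h) (uprod (fib X h) (fib Y h)) (fib (functor_tensor G S X Y) h)"
  using iso_bij[OF F.Mu_simps(4), of X Y h] F.Mu_simps(1-3)[of X Y] assms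
  by (simp add: mu_def[abs_def])

abbreviation "point \<equiv> (SOME x. True) :: 'u"

text \<open>
  The unit constraint is an isomorphism, so \<open>base h\<close> is the only point of \<open>F 1\<close> over \<open>h\<close>.
\<close>

definition base :: "'u \<Rightarrow> 'u" where
  "base h = sfun (ncomp (Eps F) h) point"

lemma upoint_eq: "upoint = {point}"
  by (simp add: upoint_def)

lemma fib_unit: "h \<in> Obj H \<Longrightarrow> fib (functor_unit G S) h = {base h}"
  using iso_bij[OF F.Mu_simps(8), of h] F.Mu_simps(5-7)
  by (simp add: bij_betw_def base_def upoint_eq)

definition bang :: "'u gset \<Rightarrow> 'u gset_map" where
  "bang X = gmap G X (functor_unit G S) (\<lambda>a x. point)"

definition proj1 :: "'u gset \<Rightarrow> 'u gset \<Rightarrow> 'u gset_map" where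
  "proj1 X Y = gmap G (functor_tensor G S X Y) X (\<lambda>a. ufst)"

definition proj2 :: "'u gset \<Rightarrow> 'u gset \<Rightarrow> 'u gset_map" where
  "proj2 X Y = gmap G (functor_tensor G S X Y) Y (\<lambda>a. usnd)"

lemma gset_tensor_act:
  assumes "is_functor G S X" "is_functor G S Y" "f \<in> Arr G" "x \<in> fobj X (Dom G f)" "y \<in> fobj Y (Dom G f)"
  shows "sfun (farr (functor_tensor G S X Y) f) (upair x y) = upair (sfun (farr X f) x) (sfun (farr Y f) y)"
  using assms G.gset_farr[of X f] G.gset_farr[of Y f] by simp

lemma natural_bang [simp]: "is_functor G S X \<Longrightarrow> natural G S (bang X)"
  unfolding bang_def by (rule G.natural_gmap) (simp_all add: upoint_eq)

lemma natural_proj [simp]: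
  assumes "is_functor G S X" "is_functor G S Y"
  shows "natural G S (proj1 X Y)" "natural G S (proj2 X Y)"
  unfolding proj1_def proj2_def
  by (rule G.natural_gmap; use assms in \<open>auto simp: gset_tensor_act G.gset_act simp del: functor_tensor_simps(2) elim!: H.uprodE\<close>)+

lemma bang_proj_simps [simp]:
  "nsrc (bang X) = X" "ntgt (bang X) = functor_unit G S"
  "nsrc (proj1 X Y) = functor_tensor G S X Y" "ntgt (proj1 X Y) = X"
  "nsrc (proj2 X Y) = functor_tensor G S X Y" "ntgt (proj2 X Y) = Y"
  by (simp_all add: bang_def proj1_def proj2_def)

lemma app_bang: "is_functor G S X \<Longrightarrow> h \<in> Obj H \<Longrightarrow> p \<in> fib X h \<Longrightarrow> app (bang X) h p = base h"
  using app_in[of "bang X" h p] fib_unit by simp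

lemma natural_id_S [simp]: "is_functor G S X \<Longrightarrow> natural G S (ntrans_id G S X)"
  using natural_id[OF G.G.cat H.category_set_smcat] .

text \<open>
  The product projections arise from the unit constraints, as in any cartesian monoidal category; hence
  \<open>F\<close> carries them to projections, with \<open>mu\<close> as the pairing.
\<close>

lemma proj_eq:
  assumes X: "is_functor G S X" and Y: "is_functor G S Y"
  shows "proj1 X Y = ntrans_comp G S (Runit (GSet G) X) (ntrans_id G S X \<boxtimes>\<^bsub>GSet G\<^esub> bang Y)"
    and "proj2 X Y = ntrans_comp G S (Lunit (GSet G) Y) (bang X \<boxtimes>\<^bsub>GSet G\<^esub> ntrans_id G S Y)"
proof -
  have R: "natural G S (Runit (GSet G) X)" "natural G S (Lunit (GSet G) Y)"
    using G.E.constraint_simps(8)[of X] G.E.constraint_simps(5)[of Y] X Y by simp_all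
  have T: "natural G S (ntrans_id G S X \<boxtimes>\<^bsub>GSet G\<^esub> bang Y)" "natural G S (bang X \<boxtimes>\<^bsub>GSet G\<^esub> ntrans_id G S Y)"
    using G.E.tensor_simps(2)[of "ntrans_id G S X" "bang Y"] G.E.tensor_simps(2)[of "bang X" "ntrans_id G S Y"] X Y
    by simp_all
  show "proj1 X Y = ntrans_comp G S (Runit (GSet G) X) (ntrans_id G S X \<boxtimes>\<^bsub>GSet G\<^esub> bang Y)"
    by (rule G.gmap_eqI[OF natural_proj(1)[OF X Y] G.natural_comp_S[OF T(1) R(1)]])
      (auto simp: GSet_def proj1_def bang_def upoint_eq elim!: H.uprodE)
  show "proj2 X Y = ntrans_comp G S (Lunit (GSet G) Y) (bang X \<boxtimes>\<^bsub>GSet G\<^esub> ntrans_id G S Y)"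
    by (rule G.gmap_eqI[OF natural_proj(2)[OF X Y] G.natural_comp_S[OF T(2) R(2)]])
      (auto simp: GSet_def proj2_def bang_def upoint_eq elim!: H.uprodE)
qed

lemma mu_natural:
  assumes s: "natural G S s" and t: "natural G S t" and h: "h \<in> Obj H"
    and p: "p \<in> fib (nsrc s) h" and q: "q \<in> fib (nsrc t) h"
  shows "app (s \<boxtimes>\<^bsub>GSet G\<^esub> t) h (mu (nsrc s) (nsrc t) h (upair p q)) =
    mu (ntgt s) (ntgt t) h (upair (app s h p) (app t h q))"
proof -
  let ?T = "farr F s \<boxtimes>\<^bsub>GSet H\<^esub> farr F t" and ?st = "s \<boxtimes>\<^bsub>GSet G\<^esub> t"
  note gs = naturalD(1,2)[OF s] naturalD(1,2)[OF t]
  have T: "natural H S ?T" "nsrc ?T = functor_tensor H S (fobj F (nsrc s)) (fobj F (nsrc t))"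
    "ntgt ?T = functor_tensor H S (fobj F (ntgt s)) (fobj F (ntgt t))"
    using H.E.tensor_simps(2-4)[of "farr F s" "farr F t"] s t by simp_all
  have st: "natural G S ?st" "nsrc ?st = functor_tensor G S (nsrc s) (nsrc t)"
    using G.E.tensor_simps(2,3)[of s t] s t by simp_all
  have M: "natural H S (Mu F (nsrc s) (nsrc t))" "nsrc (Mu F (nsrc s) (nsrc t)) = functor_tensor H S (fobj F (nsrc s)) (fobj F (nsrc t))"
    "ntgt (Mu F (nsrc s) (nsrc t)) = fobj F (functor_tensor G S (nsrc s) (nsrc t))"
    using F.Mu_simps(1-3)[of "nsrc s" "nsrc t"] gs by simp_all
  have M': "natural H S (Mu F (ntgt s) (ntgt t))" "nsrc (Mu F (ntgt s) (ntgt t)) = functor_tensor H S (fobj F (ntgt s)) (fobj F (ntgt t))"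
    using F.Mu_simps(1-3)[of "ntgt s" "ntgt t"] gs by simp_all
  have "ntrans_comp H S (Mu F (ntgt s) (ntgt t)) ?T = ntrans_comp H S (farr F ?st) (Mu F (nsrc s) (nsrc t))"
    using F.Mu_natural[of s t] s t by simp
  then have "sfun (ncomp (ntrans_comp H S (Mu F (ntgt s) (ntgt t)) ?T) h) (upair p q) =
      sfun (ncomp (ntrans_comp H S (farr F ?st) (Mu F (nsrc s) (nsrc t))) h) (upair p q)" by simp
  moreover have "sfun (ncomp (ntrans_comp H S (Mu F (ntgt s) (ntgt t)) ?T) h) (upair p q) =
      mu (ntgt s) (ntgt t) h (upair (app s h p) (app t h q))"
    using H.ncomp_comp_apply[OF T(1) M'(1) _ h, of "upair p q"] T(2,3) M'(2) p q h
      H.tensor_GSet_apply[of "farr F s" "farr F t" h p q] s t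
    by (simp add: mu_def app_def del: ntrans_comp_simps(3))
  moreover have "sfun (ncomp (ntrans_comp H S (farr F ?st) (Mu F (nsrc s) (nsrc t))) h) (upair p q) =
      app ?st h (mu (nsrc s) (nsrc t) h (upair p q))"
    using H.ncomp_comp_apply[OF M(1) F_map(1)[OF st(1)] _ h, of "upair p q"] M(2,3) st F_map(2)[OF st(1)] p q h
    by (simp add: mu_def app_def del: ntrans_comp_simps(3))
  ultimately show ?thesis by simp
qed

lemma mu_in:
  "is_functor G S X \<Longrightarrow> is_functor G S Y \<Longrightarrow> h \<in> Obj H \<Longrightarrow> p \<in> fib X h \<Longrightarrow> q \<in> fib Y h \<Longrightarrow>
     mu X Y h (upair p q) \<in> fib (functor_tensor G S X Y) h"
  using mu_bij[of X Y h] by (auto simp: bij_betw_def)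

lemma mu_surj:
  assumes "is_functor G S X" "is_functor G S Y" "h \<in> Obj H" "w \<in> fib (functor_tensor G S X Y) h"
  obtains p q where "p \<in> fib X h" "q \<in> fib Y h" "w = mu X Y h (upair p q)"
proof -
  have "w \<in> mu X Y h ` uprod (fib X h) (fib Y h)" using mu_bij[OF assms(1-3)] assms(4) by (simp add: bij_betw_def)
  then show ?thesis using that by (auto elim!: H.uprodE)
qed

lemma mu_unit:
  assumes X: "is_functor G S X" and h: "h \<in> Obj H" and p: "p \<in> fib X h"
  shows "app (Runit (GSet G) X) h (mu X (functor_unit G S) h (upair p (base h))) = p"
    and "app (Lunit (GSet G) X) h (mu (functor_unit G S) X h (upair (base h) p)) = p"
proof -
  let ?I = "functor_unit G S" and ?FX = "fobj F X"
  have FX: "is_functor H S ?FX" using X by simp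
  have idFX: "natural H S (ntrans_id H S ?FX)" by (rule natural_id[OF H.G.cat H.category_set_smcat FX])
  have eps: "natural H S (Eps F)" "nsrc (Eps F) = functor_unit H S" "ntgt (Eps F) = fobj F ?I"
    using F.Mu_simps(5-7) by simp_all
  have id_p: "sfun (ncomp (ntrans_id H S ?FX) h) p = p" using h p by simp
  {
    have R: "natural G S (Runit (GSet G) X)" "nsrc (Runit (GSet G) X) = functor_tensor G S X ?I"
      using G.E.constraint_simps(8,9)[of X] X by simp_all
    have M: "natural H S (Mu F X ?I)" "nsrc (Mu F X ?I) = functor_tensor H S ?FX (fobj F ?I)"
      "ntgt (Mu F X ?I) = fobj F (functor_tensor G S X ?I)"
      using F.Mu_simps(1-3)[of X ?I] X by simp_all
    let ?T = "ntrans_id H S ?FX \<boxtimes>\<^bsub>GSet H\<^esub> Eps F"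
    have T: "natural H S ?T" "nsrc ?T = functor_tensor H S ?FX (functor_unit H S)" "ntgt ?T = functor_tensor H S ?FX (fobj F ?I)"
      using H.E.tensor_simps(2-4)[of "ntrans_id H S ?FX" "Eps F"] idFX eps by simp_all
    have z: "upair p point \<in> fobj (nsrc ?T) h" using T(2) h p by (simp add: upoint_eq)
    have Tz: "sfun (ncomp ?T h) (upair p point) = upair p (base h)"
      using H.tensor_GSet_apply[OF idFX eps(1) h, of p point] h p id_p eps(2) by (simp add: upoint_eq base_def)
    have MT: "natural H S (ntrans_comp H S (Mu F X ?I) ?T)" using H.natural_comp_S[OF T(1) M(1)] M T by simp
    have "ntrans_comp H S (farr F (Runit (GSet G) X)) (ntrans_comp H S (Mu F X ?I) ?T) = Runit (GSet H) ?FX"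
      using F.Mu_Runit[of X] X by simp
    then have "sfun (ncomp (ntrans_comp H S (farr F (Runit (GSet G) X)) (ntrans_comp H S (Mu F X ?I) ?T)) h) (upair p point)
        = sfun (ncomp (Runit (GSet H) ?FX) h) (upair p point)" by simp
    also have "\<dots> = p" using h p by (simp add: GSet_def upoint_eq)
    finally show "app (Runit (GSet G) X) h (mu X ?I h (upair p (base h))) = p"
      using H.ncomp_comp_apply[OF MT F_map(1)[OF R(1)] _ h, of "upair p point"] H.ncomp_comp_apply[OF T(1) M(1) _ h z]
        M T R F_map(2)[OF R(1)] z Tz by (simp add: app_def mu_def del: ntrans_comp_simps(3))
  }
  {
    have R: "natural G S (Lunit (GSet G) X)" "nsrc (Lunit (GSet G) X) = functor_tensor G S ?I X"
      using G.E.constraint_simps(5,6)[of X] X by simp_all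
    have M: "natural H S (Mu F ?I X)" "nsrc (Mu F ?I X) = functor_tensor H S (fobj F ?I) ?FX"
      "ntgt (Mu F ?I X) = fobj F (functor_tensor G S ?I X)"
      using F.Mu_simps(1-3)[of ?I X] X by simp_all
    let ?T = "Eps F \<boxtimes>\<^bsub>GSet H\<^esub> ntrans_id H S ?FX"
    have T: "natural H S ?T" "nsrc ?T = functor_tensor H S (functor_unit H S) ?FX" "ntgt ?T = functor_tensor H S (fobj F ?I) ?FX"
      using H.E.tensor_simps(2-4)[of "Eps F" "ntrans_id H S ?FX"] idFX eps by simp_all
    have z: "upair point p \<in> fobj (nsrc ?T) h" using T(2) h p by (simp add: upoint_eq)
    have Tz: "sfun (ncomp ?T h) (upair point p) = upair (base h) p"
      using H.tensor_GSet_apply[OF eps(1) idFX h, of point p] h p id_p eps(2) by (simp add: upoint_eq base_def)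
    have MT: "natural H S (ntrans_comp H S (Mu F ?I X) ?T)" using H.natural_comp_S[OF T(1) M(1)] M T by simp
    have "ntrans_comp H S (farr F (Lunit (GSet G) X)) (ntrans_comp H S (Mu F ?I X) ?T) = Lunit (GSet H) ?FX"
      using F.Mu_Lunit[of X] X by simp
    then have "sfun (ncomp (ntrans_comp H S (farr F (Lunit (GSet G) X)) (ntrans_comp H S (Mu F ?I X) ?T)) h) (upair point p)
        = sfun (ncomp (Lunit (GSet H) ?FX) h) (upair point p)" by simp
    also have "\<dots> = p" using h p by (simp add: GSet_def upoint_eq)
    finally show "app (Lunit (GSet G) X) h (mu ?I X h (upair (base h) p)) = p"
      using H.ncomp_comp_apply[OF MT F_map(1)[OF R(1)] _ h, of "upair point p"] H.ncomp_comp_apply[OF T(1) M(1) _ h z]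
        M T R F_map(2)[OF R(1)] z Tz by (simp add: app_def mu_def del: ntrans_comp_simps(3))
  }
qed

lemma app_proj:
  assumes X: "is_functor G S X" and Y: "is_functor G S Y" and h: "h \<in> Obj H"
    and p: "p \<in> fib X h" and q: "q \<in> fib Y h"
  shows "app (proj1 X Y) h (mu X Y h (upair p q)) = p" and "app (proj2 X Y) h (mu X Y h (upair p q)) = q"
proof -
  have R: "natural G S (Runit (GSet G) X)" "nsrc (Runit (GSet G) X) = functor_tensor G S X (functor_unit G S)"
    "natural G S (Lunit (GSet G) Y)" "nsrc (Lunit (GSet G) Y) = functor_tensor G S (functor_unit G S) Y"
    using G.E.constraint_simps(8,9)[of X] G.E.constraint_simps(5,6)[of Y] X Y by simp_all
  have T: "natural G S (ntrans_id G S X \<boxtimes>\<^bsub>GSet G\<^esub> bang Y)" "natural G S (bang X \<boxtimes>\<^bsub>GSet G\<^esub> ntrans_id G S Y)"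
    "nsrc (ntrans_id G S X \<boxtimes>\<^bsub>GSet G\<^esub> bang Y) = functor_tensor G S X Y"
    "ntgt (ntrans_id G S X \<boxtimes>\<^bsub>GSet G\<^esub> bang Y) = functor_tensor G S X (functor_unit G S)"
    "nsrc (bang X \<boxtimes>\<^bsub>GSet G\<^esub> ntrans_id G S Y) = functor_tensor G S X Y"
    "ntgt (bang X \<boxtimes>\<^bsub>GSet G\<^esub> ntrans_id G S Y) = functor_tensor G S (functor_unit G S) Y"
    using G.E.tensor_simps(2-4)[of "ntrans_id G S X" "bang Y"] G.E.tensor_simps(2-4)[of "bang X" "ntrans_id G S Y"] X Y
    by simp_all
  note w = mu_in[OF X Y h p q]
  show "app (proj1 X Y) h (mu X Y h (upair p q)) = p"
    using app_comp[OF T(1) R(1) _ h, of "mu X Y h (upair p q)"] T R w proj_eq(1)[OF X Y]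
      mu_natural[OF natural_id_S[OF X] natural_bang[OF Y] h, of p q] mu_unit(1)[OF X h p]
      app_id[OF X h p] app_bang[OF Y h q] p q by simp
  show "app (proj2 X Y) h (mu X Y h (upair p q)) = q"
    using app_comp[OF T(2) R(3) _ h, of "mu X Y h (upair p q)"] T R w proj_eq(2)[OF X Y]
      mu_natural[OF natural_bang[OF X] natural_id_S[OF Y] h, of p q] mu_unit(2)[OF Y h q]
      app_id[OF Y h q] app_bang[OF X h p] p q by simp
qed

text \<open>
  Since \<open>mu\<close> is onto, a point of \<open>F (X \<times> Y) h\<close> is the pair of its projections.
\<close>

lemma app_pairing:
  assumes X: "is_functor G S X" and Y: "is_functor G S Y" and h: "h \<in> Obj H"
    and z: "natural G S z" "ntgt z = functor_tensor G S X Y" and w: "w \<in> fib (nsrc z) h"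
  shows "app z h w = mu X Y h (upair (app (ntrans_comp G S (proj1 X Y) z) h w) (app (ntrans_comp G S (proj2 X Y) z) h w))"
proof -
  have "app z h w \<in> fib (functor_tensor G S X Y) h" using app_in[OF z(1) h w] z(2) by simp
  then obtain p q where pq: "p \<in> fib X h" "q \<in> fib Y h" "app z h w = mu X Y h (upair p q)"
    by (rule mu_surj[OF X Y h])
  then show ?thesis
    using app_comp[OF z(1) natural_proj(1)[OF X Y] _ h w] app_comp[OF z(1) natural_proj(2)[OF X Y] _ h w] z(2)
      app_proj[OF X Y h pq(1,2)] by simp
qed

text \<open>\<open>F\<close> preserves the presentation of \<open>X\<close> as a colimit of representables.\<close>

lemma generated:
  assumes X: "is_functor G S X" and h: "h \<in> Obj H" and p: "p \<in> fib X h"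
  obtains g x r where "g \<in> Obj G" "x \<in> fobj X g" "r \<in> fib (G.rep g) h" "app (G.yo X g x) h r = p"
proof -
  let ?J = "G.elements X" and ?D = "G.elements_diagram X"
  have J: "small_category ?J" and D: "is_functor ?J (GSet G) ?D"
    using G.small_category_elements[OF X] G.is_functor_elements_diagram[OF X] by auto
  have J': "category ?J" using J by (simp add: small_category_def)
  have "is_colimit ?J (GSet H) (comp_functor ?J F ?D) (fobj F X) (\<lambda>i. farr F (G.yo X (ufst i) (usnd i)))"
    using F_cocontinuous J D G.is_colimit_elements[OF X] unfolding cocontinuous_def preserves_colimits_def by blast
  then have "H.fibrewise_colimit ?J (comp_functor ?J F ?D) (fobj F X) (\<lambda>i. farr F (G.yo X (ufst i) (usnd i))) h"
    by (rule H.GSet_colimit_fibrewise[OF J is_functor_comp[OF D F.ftor J'] _ h])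
  from colimiting_surj[OF this p] obtain i r where ir: "i \<in> Obj ?J" "r \<in> fobj (fobj (comp_functor ?J F ?D) i) h"
    "sfun (ncomp (farr F (G.yo X (ufst i) (usnd i))) h) r = p" by blast
  obtain a x where i: "i = upair a x" "a \<in> Obj G" "x \<in> fobj X a" using ir(1) by (rule G.elements_ObjE)
  then show ?thesis using that[of a x r] ir by (simp add: app_def)
qed

end

context gset_morphism
begin

lemma inverse_arrow:
  assumes "f \<in> hom G a b"
  obtains g where "g \<in> hom G b a" "g \<cdot>\<^bsub>G\<^esub> f = Ident G a" "f \<cdot>\<^bsub>G\<^esub> g = Ident G b"
  using groupoid_G assms is_isoE[of G f a b] by (auto simp: groupoid_def hom_iff)

lemma gset_act_inject:
  assumes X: "is_functor G S X" and f: "f \<in> Arr G" and y: "y \<in> fobj X (Dom G f)" "y' \<in> fobj X (Dom G f)"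
    and eq: "sfun (farr X f) y = sfun (farr X f) y'"
  shows "y = y'"
proof -
  obtain g where g: "g \<in> hom G (Cod G f) (Dom G f)" "g \<cdot>\<^bsub>G\<^esub> f = Ident G (Dom G f)"
    using inverse_arrow[OF arr_in_hom[OF f]] by blast
  have "sfun (farr X g) (sfun (farr X f) v) = v" if "v \<in> fobj X (Dom G f)" for v
  proof -
    have "g \<in> Arr G" "Dom G g = Cod G f" using g(1) by (auto simp: hom_iff)
    then have "sfun (farr X g) (sfun (farr X f) v) = sfun (farr X (g \<cdot>\<^bsub>G\<^esub> f)) v"
      using G.gset_act_Comp[OF X f _ _ that] by simp
    also have "\<dots> = v" unfolding g(2) using G.gset_act_Ident[OF X G.G.Dom_Obj[OF f] that] .
    finally show ?thesis .
  qed
  from this[OF y(1)] this[OF y(2)] show ?thesis unfolding eq by (rule trans[OF sym])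
qed

definition twopoint :: "'u \<Rightarrow> 'u \<Rightarrow> 'u gset" where
  "twopoint a b = gset G (\<lambda>_. {a, b}) (\<lambda>f y. y)"

definition pick :: "'u \<Rightarrow> 'u \<Rightarrow> 'u \<Rightarrow> 'u gset_map" where
  "pick a b c = gmap G (functor_unit G S) (twopoint a b) (\<lambda>_ _. c)"

lemma twopoint_gset [simp]: "is_functor G S (twopoint a b)"
  unfolding twopoint_def by (rule G.is_functor_gset) (auto intro: H.small_finite)

lemma twopoint_simps [simp]:
  "g \<in> Obj G \<Longrightarrow> fobj (twopoint a b) g = {a, b}"
  "f \<in> Arr G \<Longrightarrow> farr (twopoint a b) f = set_arr {a, b} {a, b} (\<lambda>y. y)"
  by (simp_all add: twopoint_def)

lemma pick_simps [simp]:
  "c \<in> {a, b} \<Longrightarrow> natural G S (pick a b c)"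
  "nsrc (pick a b c) = functor_unit G S" "ntgt (pick a b c) = twopoint a b"
proof -
  show "natural G S (pick a b c)" if "c \<in> {a, b}"
    unfolding pick_def by (rule G.natural_gmap) (use that in \<open>auto simp: upoint_eq\<close>)
qed (simp_all add: pick_def)

text \<open>
  The two points of \<open>1 + 1\<close> remain distinct in every fibre of \<open>F (1 + 1)\<close>, because \<open>F\<close> preserves this
  coproduct.
\<close>

lemma points_separated:
  assumes ab: "a \<noteq> b" and h: "h \<in> Obj H"
  shows "app (pick a b a) h (base h) \<noteq> app (pick a b b) h (base h)"
proof
  assume eq: "app (pick a b a) h (base h) = app (pick a b b) h (base h)"
  define J :: "('u, 'u) cat" where
    "J = \<lparr>Obj = {a, b}, Arr = {a, b}, Dom = (\<lambda>k. k), Cod = (\<lambda>k. k), Ident = (\<lambda>i. i), Comp = (\<lambda>k' k. k)\<rparr>"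
  have J_simps [simp]: "Obj J = {a, b}" "Arr J = {a, b}" "Dom J k = k" "Cod J k = k" "Ident J k = k" "k' \<cdot>\<^bsub>J\<^esub> k = k" for k k'
    by (simp_all add: J_def)
  have J: "small_category J" and J': "category J"
    by (auto simp: small_category_def category_def hom_iff intro: H.small_finite)
  define D :: "('u, 'u, 'u gset, 'u gset_map) ftor" where
    "D = \<lparr>fobj = (\<lambda>i\<in>{a, b}. functor_unit G S), farr = (\<lambda>k\<in>{a, b}. ntrans_id G S (functor_unit G S))\<rparr>"
  have D_simps [simp]: "fobj D i = functor_unit G S" "farr D i = ntrans_id G S (functor_unit G S)"
    if "i \<in> {a, b}" for i using that by (auto simp: D_def)
  have id2: "ntrans_comp G S (ntrans_id G S (functor_unit G S)) (ntrans_id G S (functor_unit G S)) = ntrans_id G S (functor_unit G S)"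
    using ntrans_comp_id_left[OF H.category_set_smcat natural_id_S[OF unit_gset]] by simp
  have D: "is_functor J (GSet G) D"
    by (rule is_functorI[OF J']) (auto simp: hom_iff id2, auto simp: D_def)
  have cocone: "is_cocone J (GSet G) D (twopoint a b) (pick a b)"
    using ntrans_comp_id_right[OF H.category_set_smcat pick_simps(1), of _ a b]
    by (intro is_coconeI) (auto simp: hom_iff)
  have "is_colimit J (GSet G) D (twopoint a b) (pick a b)"
  proof (rule G.GSet_colimitI[OF J' D cocone])
    fix g assume g: "g \<in> Obj G"
    show "G.fibrewise_colimit J D (twopoint a b) (pick a b) g"
    proof (rule colimitingI)
      fix y assume "y \<in> fobj (twopoint a b) g"
      then show "\<exists>i\<in>Obj J. \<exists>x\<in>fobj (fobj D i) g. sfun (ncomp (pick a b i) g) x = y"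
        using g by (intro bexI[of _ y] bexI[of _ point]) (auto simp: pick_def upoint_eq)
    next
      fix P :: "'u \<Rightarrow> 'u \<Rightarrow> bool" and i j x y
      assume "i \<in> Obj J" "j \<in> Obj J" "x \<in> fobj (fobj D i) g" "y \<in> fobj (fobj D j) g"
        "sfun (ncomp (pick a b i) g) x = sfun (ncomp (pick a b j) g) y"
      then show "P i x = P j y" using g by (auto simp: pick_def upoint_eq)
    qed
  qed
  then have "is_colimit J (GSet H) (comp_functor J F D) (fobj F (twopoint a b)) (\<lambda>i. farr F (pick a b i))"
    using F_cocontinuous J D unfolding cocontinuous_def preserves_colimits_def by blast
  then have fc: "H.fibrewise_colimit J (comp_functor J F D) (fobj F (twopoint a b)) (\<lambda>i. farr F (pick a b i)) h"
    by (rule H.GSet_colimit_fibrewise[OF J is_functor_comp[OF D F.ftor J'] _ h])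
  have "(a = a) = (b = a)"
    by (rule colimiting_predicate[OF fc, of "\<lambda>i _. i = a" a b "base h" "base h"])
      (use fib_unit[OF h] eq in \<open>auto simp: app_def\<close>)
  then show False using ab by simp
qed

text \<open>
  If \<open>x \<noteq> x'\<close>, the graphs of the maps \<open>rep g \<rightarrow> X\<close> given by \<open>x\<close> and \<open>x'\<close> are disjoint, because \<open>G\<close> is a
  groupoid; so a map from \<open>rep g \<times> X\<close> to \<open>1 + 1\<close> separates them.
\<close>

lemma app_yo_inject:
  assumes X: "is_functor G S X" and g: "g \<in> Obj G" and x: "x \<in> fobj X g" "x' \<in> fobj X g"
    and h: "h \<in> Obj H" and p: "p \<in> fib (G.rep g) h"
    and eq: "app (G.yo X g x) h p = app (G.yo X g x') h p"
  shows "x = x'"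
proof (rule ccontr)
  assume ne: "x \<noteq> x'"
  obtain a b :: 'u where ab: "a \<noteq> b" by (rule H.two_points)
  let ?R = "G.rep g" let ?T = "functor_tensor G S ?R X" and ?W = "twopoint a b"
  have R: "is_functor G S ?R" using g by simp
  have T: "is_functor G S ?T" using R X by simp
  define \<chi> where "\<chi> = gmap G ?T ?W (\<lambda>d z. if usnd z = sfun (farr X (ufst z)) x then a else b)"
  have \<chi>: "natural G S \<chi>"
    unfolding \<chi>_def
  proof (rule G.natural_gmap[OF T twopoint_gset])
    fix f z assume f: "f \<in> Arr G" and "z \<in> fobj ?T (Dom G f)"
    then obtain \<phi> y where z: "z = upair \<phi> y" "\<phi> \<in> hom G g (Dom G f)" "y \<in> fobj X (Dom G f)"
      by (auto elim!: H.uprodE)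
    have "\<phi> \<in> Arr G" "Dom G \<phi> = g" "Cod G \<phi> = Dom G f" using z by (auto simp: hom_iff)
    note \<phi> = this
    have y': "sfun (farr X \<phi>) x \<in> fobj X (Dom G f)" using G.gset_act[OF X \<phi>(1), of x] \<phi> x by simp
    have "sfun (farr ?T f) z = upair (f \<cdot>\<^bsub>G\<^esub> \<phi>) (sfun (farr X f) y)"
      using gset_tensor_act[OF R X f, of \<phi> y] z f by simp
    moreover have "sfun (farr X f) y = sfun (farr X (f \<cdot>\<^bsub>G\<^esub> \<phi>)) x \<longleftrightarrow> y = sfun (farr X \<phi>) x"
      using G.gset_act_Comp[OF X \<phi>(1) f, of x] gset_act_inject[OF X f z(3) y'] \<phi> x by auto
    ultimately show "(if usnd (sfun (farr ?T f) z) = sfun (farr X (ufst (sfun (farr ?T f) z))) x then a else b) =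
        sfun (farr ?W f) (if usnd z = sfun (farr X (ufst z)) x then a else b)"
      using z f by simp
  qed simp
  have \<chi>_simps: "nsrc \<chi> = ?T" "ntgt \<chi> = ?W" by (simp_all add: \<chi>_def)
  have pick: "G.yo ?W g c = ntrans_comp G S (pick a b c) (bang ?R)" if c: "c \<in> {a, b}" for c
  proof (rule G.gmap_eqI)
    show "natural G S (G.yo ?W g c)" using g c by simp
    show "natural G S (ntrans_comp G S (pick a b c) (bang ?R))"
      using G.natural_comp_S[OF natural_bang[OF R] pick_simps(1)[OF c]] by simp
    fix d \<phi> assume d: "d \<in> Obj G" and "\<phi> \<in> fobj (nsrc (G.yo ?W g c)) d"
    then have \<phi>: "\<phi> \<in> hom G g d" by simp
    then show "sfun (ncomp (G.yo ?W g c) d) \<phi> = sfun (ncomp (ntrans_comp G S (pick a b c) (bang ?R)) d) \<phi>"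
      using d g c by (auto simp: pick_def bang_def upoint_eq hom_iff)
  qed simp_all
  have app_pick: "app (G.yo ?W g c) h p = app (pick a b c) h (base h)" if c: "c \<in> {a, b}" for c
    using app_comp[OF natural_bang[OF R] pick_simps(1)[OF c] _ h, of p] pick[OF c] p app_bang[OF R h p] by simp
  \<comment> \<open>The graph of \<open>v\<close> is the map \<open>rep g \<rightarrow> rep g \<times> X\<close> that corresponds to \<open>(1, v)\<close>.\<close>
  let ?Z = "\<lambda>v. G.yo ?T g (upair (Ident G g) v)"
  have Z: "natural G S (?Z v)" "app (?Z v) h p = mu ?R X h (upair (app (G.yo ?R g (Ident G g)) h p) (app (G.yo X g v) h p))"
    "app (G.yo ?W g (if v = x then a else b)) h p = app \<chi> h (app (?Z v) h p)"
    if v: "v \<in> fobj X g" for v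
  proof -
    have e: "upair (Ident G g) v \<in> fobj ?T g" using v g by simp
    show Zn: "natural G S (?Z v)" using G.natural_yo[OF T g e] .
    have "ntrans_comp G S (proj1 ?R X) (?Z v) = G.yo ?R g (Ident G g)"
      "ntrans_comp G S (proj2 ?R X) (?Z v) = G.yo X g v"
      using G.comp_yo[OF natural_proj(1)[OF R X] g, of "upair (Ident G g) v"]
        G.comp_yo[OF natural_proj(2)[OF R X] g, of "upair (Ident G g) v"] e g by (simp_all add: proj1_def proj2_def)
    then show "app (?Z v) h p = mu ?R X h (upair (app (G.yo ?R g (Ident G g)) h p) (app (G.yo X g v) h p))"
      using app_pairing[OF R X h Zn] p by simp
    have "ntrans_comp G S \<chi> (?Z v) = G.yo ?W g (if v = x then a else b)"
      using G.comp_yo[OF \<chi> g, of "upair (Ident G g) v"] e g v x(1) G.gset_act_Ident[OF X g x(1)]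
      unfolding \<chi>_simps by (simp add: \<chi>_def)
    then show "app (G.yo ?W g (if v = x then a else b)) h p = app \<chi> h (app (?Z v) h p)"
      using app_comp[OF Zn \<chi> _ h, of p] \<chi>_simps p by simp
  qed
  have "app (G.yo ?W g a) h p = app (G.yo ?W g b) h p"
    using Z(2,3)[OF x(1)] Z(2,3)[OF x(2)] eq ne by auto
  then show False
    using points_separated[OF ab h] app_pick by simp
qed

text \<open>
  Any two points of the fibres of representables are related by an arrow of \<open>G\<close>: their pair is the image of a
  point over some \<open>k\<close>, with two maps out of \<open>rep k\<close>, and these maps are invertible.
\<close>

lemma connecting_arrow:
  assumes g: "g \<in> Obj G" "g' \<in> Obj G" and h: "h \<in> Obj H"
    and p: "p \<in> fib (G.rep g) h" and q: "q \<in> fib (G.rep g') h"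
  obtains \<phi> where "\<phi> \<in> hom G g' g" "app (G.yo (G.rep g') g \<phi>) h p = q"
proof -
  let ?R = "G.rep g" and ?R' = "G.rep g'"
  let ?T = "functor_tensor G S ?R ?R'"
  have R: "is_functor G S ?R" "is_functor G S ?R'" using g by simp_all
  have T: "is_functor G S ?T" using R by simp
  obtain k z r where k: "k \<in> Obj G" "z \<in> fobj ?T k" "r \<in> fib (G.rep k) h"
    and z: "app (G.yo ?T k z) h r = mu ?R ?R' h (upair p q)"
    using generated[OF T h mu_in[OF R h p q]] by blast
  obtain \<alpha> \<beta> where \<alpha>\<beta>: "z = upair \<alpha> \<beta>" "\<alpha> \<in> hom G g k" "\<beta> \<in> hom G g' k"
    using k(1,2) by (auto elim!: H.uprodE)
  have zn: "natural G S (G.yo ?T k z)" using G.natural_yo[OF T k(1,2)] .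
  have r: "r \<in> fib (nsrc (G.yo ?T k z)) h" using k by simp
  have "ntrans_comp G S (proj1 ?R ?R') (G.yo ?T k z) = G.yo ?R k \<alpha>" "ntrans_comp G S (proj2 ?R ?R') (G.yo ?T k z) = G.yo ?R' k \<beta>"
    using G.comp_yo[OF natural_proj(1)[OF R] k(1), of z] G.comp_yo[OF natural_proj(2)[OF R] k(1), of z] k \<alpha>\<beta>
    by (simp_all add: proj1_def proj2_def)
  then have r_p: "app (G.yo ?R k \<alpha>) h r = p" and r_q: "app (G.yo ?R' k \<beta>) h r = q"
    using app_comp[OF zn natural_proj(1)[OF R] _ h r] app_comp[OF zn natural_proj(2)[OF R] _ h r] z app_proj[OF R h p q]
    by simp_all
  obtain \<alpha>' where \<alpha>': "\<alpha>' \<in> hom G k g" "\<alpha> \<cdot>\<^bsub>G\<^esub> \<alpha>' = Ident G k" using inverse_arrow[OF \<alpha>\<beta>(2)] by blast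
  let ?\<phi> = "\<alpha>' \<cdot>\<^bsub>G\<^esub> \<beta>"
  have \<phi>: "?\<phi> \<in> hom G g' g" using Comp_in_hom[OF G.G.cat \<alpha>\<beta>(3) \<alpha>'(1)] .
  have "\<alpha> \<cdot>\<^bsub>G\<^esub> ?\<phi> = \<beta>" using Comp_cancel_left[OF G.G.cat \<alpha>\<beta>(3) \<alpha>'(1) \<alpha>\<beta>(2) \<alpha>'(2)] .
  then have "ntrans_comp G S (G.yo ?R' g ?\<phi>) (G.yo ?R k \<alpha>) = G.yo ?R' k \<beta>"
    using G.yo_rep_Comp[OF \<phi> \<alpha>\<beta>(2)] by simp
  moreover have "natural G S (G.yo ?R k \<alpha>)" "natural G S (G.yo ?R' g ?\<phi>)"
    using R k(1) g \<alpha>\<beta>(2) \<phi> by simp_all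
  ultimately have "app (G.yo ?R' g ?\<phi>) h p = q"
    using app_comp[of "G.yo ?R k \<alpha>" "G.yo ?R' g ?\<phi>" h r] r_p r_q h k(3) by simp
  then show ?thesis using that[OF \<phi>] by blast
qed

lemma generator_exists:
  assumes h: "h \<in> Obj H" shows "\<exists>g p. g \<in> Obj G \<and> p \<in> fib (G.rep g) h"
  using generated[OF unit_gset h, of "base h"] fib_unit[OF h] by blast

text \<open>
  By \<open>\<theta>_bij\<close> below, any point of the fibre of any representable identifies the fibre of \<open>F\<close> over \<open>h\<close> with
  an evaluation functor, so an arbitrary choice will do.
\<close>

definition obj_of :: "'u \<Rightarrow> 'u" where
  "obj_of h = (SOME g. g \<in> Obj G \<and> (\<exists>p. p \<in> fib (G.rep g) h))"

definition gen :: "'u \<Rightarrow> 'u" where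
  "gen h = (SOME p. p \<in> fib (G.rep (obj_of h)) h)"

lemma obj_of_gen:
  assumes "h \<in> Obj H" shows obj_of: "obj_of h \<in> Obj G" and gen: "gen h \<in> fib (G.rep (obj_of h)) h"
proof -
  have "obj_of h \<in> Obj G \<and> (\<exists>p. p \<in> fib (G.rep (obj_of h)) h)"
    unfolding obj_of_def by (rule someI_ex) (use generator_exists[OF assms] in blast)
  then show "obj_of h \<in> Obj G" "gen h \<in> fib (G.rep (obj_of h)) h"
    unfolding gen_def by (auto intro: someI_ex)
qed

text \<open>
  Naturality of \<open>\<theta>\<close> in \<open>h\<close> forces this arrow: it is the connecting arrow from \<open>gen h'\<close> to the transport of
  \<open>gen h\<close> along \<open>\<eta> : h \<rightarrow> h'\<close>.
\<close>

definition arrow_of :: "'u \<Rightarrow> 'u" where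
  "arrow_of \<eta> = (SOME \<phi>. \<phi> \<in> hom G (obj_of (Dom H \<eta>)) (obj_of (Cod H \<eta>)) \<and>
     app (G.yo (G.rep (obj_of (Dom H \<eta>))) (obj_of (Cod H \<eta>)) \<phi>) (Cod H \<eta>) (gen (Cod H \<eta>)) =
     sfun (farr (fobj F (G.rep (obj_of (Dom H \<eta>)))) \<eta>) (gen (Dom H \<eta>)))"

lemma arrow_of:
  assumes \<eta>: "\<eta> \<in> hom H h h'"
  shows "arrow_of \<eta> \<in> hom G (obj_of h) (obj_of h')"
    and "app (G.yo (G.rep (obj_of h)) (obj_of h') (arrow_of \<eta>)) h' (gen h') = sfun (farr (fobj F (G.rep (obj_of h))) \<eta>) (gen h)"
proof -
  have h: "h \<in> Obj H" "h' \<in> Obj H" using hom_Obj[OF H.G.cat \<eta>] by auto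
  have \<eta>': "\<eta> \<in> Arr H" "Dom H \<eta> = h" "Cod H \<eta> = h'" using \<eta> by (auto simp: hom_iff)
  have R: "is_functor H S (fobj F (G.rep (obj_of h)))" using obj_of[OF h(1)] by simp
  have "sfun (farr (fobj F (G.rep (obj_of h))) \<eta>) (gen h) \<in> fib (G.rep (obj_of h)) h'"
    using H.gset_act[OF R \<eta>'(1), of "gen h"] \<eta>'(2,3) gen[OF h(1)] by simp
  from connecting_arrow[OF obj_of[OF h(2)] obj_of[OF h(1)] h(2) gen[OF h(2)] this]
  have "\<exists>\<phi>. \<phi> \<in> hom G (obj_of (Dom H \<eta>)) (obj_of (Cod H \<eta>)) \<and>
     app (G.yo (G.rep (obj_of (Dom H \<eta>))) (obj_of (Cod H \<eta>)) \<phi>) (Cod H \<eta>) (gen (Cod H \<eta>)) =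
     sfun (farr (fobj F (G.rep (obj_of (Dom H \<eta>)))) \<eta>) (gen (Dom H \<eta>))"
    unfolding \<eta>'(2,3) by blast
  from someI_ex[OF this, folded arrow_of_def]
  show "arrow_of \<eta> \<in> hom G (obj_of h) (obj_of h')"
    "app (G.yo (G.rep (obj_of h)) (obj_of h') (arrow_of \<eta>)) h' (gen h') = sfun (farr (fobj F (G.rep (obj_of h))) \<eta>) (gen h)"
    unfolding \<eta>'(2,3) by auto
qed

lemma arrow_of_unique:
  assumes \<eta>: "\<eta> \<in> hom H h h'" and \<phi>: "\<phi> \<in> hom G (obj_of h) (obj_of h')"
    and "app (G.yo (G.rep (obj_of h)) (obj_of h') \<phi>) h' (gen h') = sfun (farr (fobj F (G.rep (obj_of h))) \<eta>) (gen h)"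
  shows "arrow_of \<eta> = \<phi>"
proof -
  have h: "h \<in> Obj H" "h' \<in> Obj H" using hom_Obj[OF H.G.cat \<eta>] by auto
  show ?thesis
    using app_yo_inject[OF G.is_functor_rep[OF obj_of[OF h(1)]] obj_of[OF h(2)] _ _ h(2) gen[OF h(2)], of "arrow_of \<eta>" \<phi>]
      arrow_of[OF \<eta>] assms(3) \<phi> obj_of[OF h(2)] by simp
qed

text \<open>The map \<open>x \<mapsto> F(x) (gen h)\<close>, where \<open>x \<in> X (obj_of h)\<close> is viewed as a map \<open>rep (obj_of h) \<rightarrow> X\<close>.\<close>

definition \<theta> :: "'u gset \<Rightarrow> 'u \<Rightarrow> 'u \<Rightarrow> 'u" where
  "\<theta> X h x = app (G.yo X (obj_of h) x) h (gen h)"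

lemma \<theta>_in: "is_functor G S X \<Longrightarrow> h \<in> Obj H \<Longrightarrow> x \<in> fobj X (obj_of h) \<Longrightarrow> \<theta> X h x \<in> fib X h"
  using app_in[of "G.yo X (obj_of h) x" h "gen h"] obj_of[of h] gen[of h] by (simp add: \<theta>_def)

lemma \<theta>_map:
  assumes t: "natural G S t" and h: "h \<in> Obj H" and x: "x \<in> fobj (nsrc t) (obj_of h)"
  shows "\<theta> (ntgt t) h (sfun (ncomp t (obj_of h)) x) = app t h (\<theta> (nsrc t) h x)"
proof -
  have y: "natural G S (G.yo (nsrc t) (obj_of h) x)" using naturalD(1)[OF t] obj_of[OF h] x by simp
  show ?thesis
    using app_comp[OF y t _ h, of "gen h"] gen[OF h] G.comp_yo[OF t obj_of[OF h] x] by (simp add: \<theta>_def)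
qed

lemma \<theta>_equivariant:
  assumes X: "is_functor G S X" and \<eta>: "\<eta> \<in> hom H h h'" and x: "x \<in> fobj X (obj_of h)"
  shows "\<theta> X h' (sfun (farr X (arrow_of \<eta>)) x) = sfun (farr (fobj F X) \<eta>) (\<theta> X h x)"
proof -
  have h: "h \<in> Obj H" "h' \<in> Obj H" using hom_Obj[OF H.G.cat \<eta>] by auto
  have \<eta>': "\<eta> \<in> Arr H" "Dom H \<eta> = h" "Cod H \<eta> = h'" using \<eta> by (auto simp: hom_iff)
  let ?y = "G.yo X (obj_of h) x" and ?R = "G.rep (obj_of h)"
  note m = arrow_of[OF \<eta>]
  have y: "natural G S ?y" "natural G S (G.yo ?R (obj_of h') (arrow_of \<eta>))" using X obj_of h x m by simp_all
  have "ntrans_comp G S ?y (G.yo ?R (obj_of h') (arrow_of \<eta>)) = G.yo X (obj_of h') (sfun (farr X (arrow_of \<eta>)) x)"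
    using G.comp_yo[OF y(1) obj_of[OF h(2)], of "arrow_of \<eta>"] m obj_of[OF h(2)] by simp
  then have "\<theta> X h' (sfun (farr X (arrow_of \<eta>)) x) = app ?y h' (app (G.yo ?R (obj_of h') (arrow_of \<eta>)) h' (gen h'))"
    using app_comp[OF y(2,1) _ h(2), of "gen h'"] gen[OF h(2)] by (simp add: \<theta>_def)
  also have "\<dots> = sfun (farr (fobj F X) \<eta>) (\<theta> X h x)"
    using app_equivariant[OF y(1) \<eta>'(1), of "gen h"] gen[OF h(1)] \<eta>' m by (simp add: \<theta>_def)
  finally show ?thesis .
qed

text \<open>
  A point of \<open>F X h\<close> comes from a representable \<open>rep g\<close>, and its preimage there is connected to \<open>gen h\<close>.
\<close>

lemma \<theta>_bij:
  assumes X: "is_functor G S X" and h: "h \<in> Obj H"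
  shows "bij_betw (\<theta> X h) (fobj X (obj_of h)) (fib X h)"
proof (rule bij_betw_imageI)
  show "inj_on (\<theta> X h) (fobj X (obj_of h))"
    using app_yo_inject[OF X obj_of[OF h] _ _ h gen[OF h]] by (intro inj_onI) (simp add: \<theta>_def)
  show "\<theta> X h ` fobj X (obj_of h) = fib X h"
  proof (intro equalityI subsetI)
    fix p assume "p \<in> fib X h"
    then obtain g x r where g: "g \<in> Obj G" "x \<in> fobj X g" "r \<in> fib (G.rep g) h" "app (G.yo X g x) h r = p"
      using generated[OF X h] by blast
    obtain \<phi> where \<phi>: "\<phi> \<in> hom G g (obj_of h)" "app (G.yo (G.rep g) (obj_of h) \<phi>) h (gen h) = r"
      using connecting_arrow[OF obj_of[OF h] g(1) h gen[OF h] g(3)] by blast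
    have y: "natural G S (G.yo X g x)" "natural G S (G.yo (G.rep g) (obj_of h) \<phi>)" using X g \<phi> obj_of[OF h] by simp_all
    have "ntrans_comp G S (G.yo X g x) (G.yo (G.rep g) (obj_of h) \<phi>) = G.yo X (obj_of h) (sfun (farr X \<phi>) x)"
      using G.comp_yo[OF y(1) obj_of[OF h], of \<phi>] \<phi> obj_of[OF h] by simp
    then have "\<theta> X h (sfun (farr X \<phi>) x) = p"
      using app_comp[OF y(2,1) _ h, of "gen h"] gen[OF h] \<phi>(2) g(4) by (simp add: \<theta>_def)
    moreover have "sfun (farr X \<phi>) x \<in> fobj X (obj_of h)"
      using G.gset_act[OF X, of \<phi> x] \<phi>(1) g(2) by (simp add: hom_iff)
    ultimately show "p \<in> \<theta> X h ` fobj X (obj_of h)" by blast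
  qed (use \<theta>_in[OF X h] in auto)
qed

lemma \<theta>_tensor:
  assumes X: "is_functor G S X" and Y: "is_functor G S Y" and h: "h \<in> Obj H"
    and x: "x \<in> fobj X (obj_of h)" and y: "y \<in> fobj Y (obj_of h)"
  shows "\<theta> (functor_tensor G S X Y) h (upair x y) = mu X Y h (upair (\<theta> X h x) (\<theta> Y h y))"
proof -
  let ?T = "functor_tensor G S X Y" and ?z = "upair x y"
  have T: "is_functor G S ?T" and z: "?z \<in> fobj ?T (obj_of h)" using X Y x y obj_of[OF h] by simp_all
  have n: "natural G S (G.yo ?T (obj_of h) ?z)" using G.natural_yo[OF T obj_of[OF h] z] .
  have "ntrans_comp G S (proj1 X Y) (G.yo ?T (obj_of h) ?z) = G.yo X (obj_of h) x"
    "ntrans_comp G S (proj2 X Y) (G.yo ?T (obj_of h) ?z) = G.yo Y (obj_of h) y"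
    using G.comp_yo[OF natural_proj(1)[OF X Y] obj_of[OF h], of ?z] G.comp_yo[OF natural_proj(2)[OF X Y] obj_of[OF h], of ?z] z
      obj_of[OF h] by (simp_all add: proj1_def proj2_def)
  then show ?thesis using app_pairing[OF X Y h n] gen[OF h] by (simp add: \<theta>_def)
qed

definition recon :: "'u gfun" where
  "recon = \<lparr>fobj = restrict obj_of (Obj H), farr = restrict arrow_of (Arr H)\<rparr>"

lemma is_functor_recon: "is_functor H G recon"
proof (rule is_functorI[OF H.G.cat])
  fix \<eta> h h' assume \<eta>: "\<eta> \<in> hom H h h'"
  then show "farr recon \<eta> \<in> hom G (fobj recon h) (fobj recon h')"
    using arrow_of(1)[OF \<eta>] hom_Obj[OF H.G.cat \<eta>] by (simp add: recon_def hom_iff)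
next
  fix h assume h: "h \<in> Obj H"
  note id = Ident_in_hom[OF H.G.cat h]
  have R: "is_functor G S (G.rep (obj_of h))" using obj_of[OF h] by simp
  have "ntrans_id G S (G.rep (obj_of h)) = G.yo (G.rep (obj_of h)) (obj_of h) (Ident G (obj_of h))"
    using G.yoneda[OF natural_id_S[OF R] _ obj_of[OF h]] obj_of[OF h] by simp
  then have "arrow_of (Ident H h) = Ident G (obj_of h)"
    using arrow_of_unique[OF id, of "Ident G (obj_of h)"] app_id[OF R h gen[OF h]] obj_of[OF h]
      H.gset_act_Ident[OF F_gset[OF R] h gen[OF h]] by simp
  then show "farr recon (Ident H h) = Ident G (fobj recon h)"
    using h id by (simp add: recon_def hom_iff)
next
  fix \<eta> \<zeta> h h' h'' assume \<eta>: "\<eta> \<in> hom H h h'" and \<zeta>: "\<zeta> \<in> hom H h' h''"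
  have h: "h \<in> Obj H" "h' \<in> Obj H" "h'' \<in> Obj H" using hom_Obj[OF H.G.cat] \<eta> \<zeta> by auto
  have \<eta>\<zeta>: "\<eta> \<in> Arr H" "Dom H \<eta> = h" "Cod H \<eta> = h'" "\<zeta> \<in> Arr H" "Dom H \<zeta> = h'" "Cod H \<zeta> = h''"
    using \<eta> \<zeta> by (auto simp: hom_iff)
  let ?R = "G.rep (obj_of h)"
  have R: "is_functor G S ?R" using obj_of[OF h(1)] by simp
  note m = arrow_of[OF \<eta>] and n = arrow_of[OF \<zeta>]
  \<comment> \<open>The defining property of \<open>arrow_of\<close> in terms of \<open>\<theta>\<close>.\<close>
  have \<theta>_arrow: "\<theta> ?R h' (arrow_of \<eta>) = sfun (farr (fobj F ?R) \<eta>) (gen h)"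
    using m(2) by (simp add: \<theta>_def)
  have "\<theta> ?R h'' (arrow_of \<zeta> \<cdot>\<^bsub>G\<^esub> arrow_of \<eta>) = sfun (farr (fobj F ?R) \<zeta>) (\<theta> ?R h' (arrow_of \<eta>))"
    using \<theta>_equivariant[OF R \<zeta>, of "arrow_of \<eta>"] m(1) n(1) obj_of[OF h(2)] by (simp add: hom_iff)
  also have "\<dots> = sfun (farr (fobj F ?R) (\<zeta> \<cdot>\<^bsub>H\<^esub> \<eta>)) (gen h)"
    using H.gset_act_Comp[OF F_gset[OF R] \<eta>\<zeta>(1,4), of "gen h"] \<eta>\<zeta> gen[OF h(1)] \<theta>_arrow by simp
  finally have "arrow_of (\<zeta> \<cdot>\<^bsub>H\<^esub> \<eta>) = arrow_of \<zeta> \<cdot>\<^bsub>G\<^esub> arrow_of \<eta>"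
    using arrow_of_unique[OF Comp_in_hom[OF H.G.cat \<eta> \<zeta>] Comp_in_hom[OF G.G.cat m(1) n(1)]] by (simp add: \<theta>_def)
  then show "farr recon (\<zeta> \<cdot>\<^bsub>H\<^esub> \<eta>) = farr recon \<zeta> \<cdot>\<^bsub>G\<^esub> farr recon \<eta>"
    using \<eta>\<zeta> by (simp add: recon_def)
qed (use obj_of in \<open>auto simp: recon_def\<close>)

lemma recon_simps [simp]: "h \<in> Obj H \<Longrightarrow> fobj recon h = obj_of h" "\<eta> \<in> Arr H \<Longrightarrow> farr recon \<eta> = arrow_of \<eta>"
  by (simp_all add: recon_def)

definition comparison_at :: "'u gset \<Rightarrow> 'u gset_map" where
  "comparison_at X = gmap H (comp_functor H X recon) (fobj F X) (\<theta> X)"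

definition comparison :: "('u gset, 'u gset_map) sm_trans" where
  "comparison = \<lparr>nsrc = pullback1 H G recon, ntgt = F, ncomp = (\<lambda>X \<in> Obj (GSet G). comparison_at X)\<rparr>"

lemma comparison_at_simps [simp]:
  "nsrc (comparison_at X) = comp_functor H X recon" "ntgt (comparison_at X) = fobj F X"
  "h \<in> Obj H \<Longrightarrow> x \<in> fobj X (obj_of h) \<Longrightarrow> sfun (ncomp (comparison_at X) h) x = \<theta> X h x"
  by (simp_all add: comparison_at_def)

lemma comparison_simps [simp]:
  "nsrc comparison = pullback1 H G recon" "ntgt comparison = F"
  "is_functor G S X \<Longrightarrow> ncomp comparison X = comparison_at X"
  by (simp_all add: comparison_def)

lemma natural_comparison_at:
  assumes X: "is_functor G S X"
  shows "natural H S (comparison_at X)"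
  unfolding comparison_at_def
proof (rule H.natural_gmap[OF pull_gset[OF is_functor_recon X] F_gset[OF X]])
  fix \<eta> x assume \<eta>: "\<eta> \<in> Arr H" and x: "x \<in> fobj (comp_functor H X recon) (Dom H \<eta>)"
  then show "\<theta> X (Cod H \<eta>) (sfun (farr (comp_functor H X recon) \<eta>) x) = sfun (farr (fobj F X) \<eta>) (\<theta> X (Dom H \<eta>) x)"
    using \<theta>_equivariant[OF X arr_in_hom[OF \<eta>]] by simp
qed (use \<theta>_in[OF X] in simp)

lemma is_iso_comparison_at:
  assumes X: "is_functor G S X"
  shows "is_iso (GSet H) (comparison_at X)"
proof -
  note n = natural_comparison_at[OF X]
  have "is_iso S (ncomp (comparison_at X) h)" if h: "h \<in> Obj H" for h
  proof -
    have "ncomp (comparison_at X) h = set_arr (fobj X (obj_of h)) (fib X h) (\<theta> X h)"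
      using h by (simp add: comparison_at_def)
    then show ?thesis
      using set_is_iso[of "ncomp (comparison_at X) h" "TYPE('u)"] naturalD(4)[OF n h] \<theta>_bij[OF X h] h
      by (simp add: H.hom_set_smcat H.is_iso_set_smcat)
  qed
  then show ?thesis
    using is_iso_functor_category[OF H.G.cat H.category_set_smcat n]
    unfolding GSet_def by (simp add: is_iso_functor_smcat)
qed

lemma monoidal_comparison: "monoidal_transformation (GSet G) (GSet H) comparison"
proof -
  note r = is_functor_recon
  have nat: "natural (GSet G) (GSet H) comparison"
  proof (rule naturalI)
    fix t X Y assume "t \<in> hom (GSet G) X Y"
    then have t: "natural G S t" "nsrc t = X" "ntgt t = Y" and XY: "is_functor G S X" "is_functor G S Y"
      by (auto simp: hom_iff naturalD)
    have "ntrans_comp H S (comparison_at Y) (pull_map H recon t) = ntrans_comp H S (farr F t) (comparison_at X)"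
    proof (rule H.gmap_eqI)
      show "natural H S (ntrans_comp H S (comparison_at Y) (pull_map H recon t))"
        by (rule H.natural_comp_S[OF natural_pull_map[OF r t(1)] natural_comparison_at[OF XY(2)]]) (simp add: t)
      show "natural H S (ntrans_comp H S (farr F t) (comparison_at X))"
        by (rule H.natural_comp_S[OF natural_comparison_at[OF XY(1)] F_map(1)[OF t(1)]]) (simp add: t)
      fix h x assume h: "h \<in> Obj H" and "x \<in> fobj (nsrc (ntrans_comp H S (comparison_at Y) (pull_map H recon t))) h"
      then have x: "x \<in> fobj X (obj_of h)" using t by simp
      then show "sfun (ncomp (ntrans_comp H S (comparison_at Y) (pull_map H recon t)) h) x =
          sfun (ncomp (ntrans_comp H S (farr F t) (comparison_at X)) h) x"
        using H.ncomp_comp_apply[OF natural_pull_map[OF r t(1)] natural_comparison_at[OF XY(2)] _ h, of x]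
          H.ncomp_comp_apply[OF natural_comparison_at[OF XY(1)] F_map(1)[OF t(1)] _ h, of x]
          \<theta>_map[OF t(1) h, of x] G.gmap_apply[OF t(1) obj_of[OF h], of x] t h
        by (simp add: app_def del: ntrans_comp_simps(3))
    qed (use t in simp_all)
    then show "ncomp comparison Y \<cdot>\<^bsub>GSet H\<^esub> farr (nsrc comparison) t = farr (ntgt comparison) t \<cdot>\<^bsub>GSet H\<^esub> ncomp comparison X"
      using t XY by simp
  qed (use is_functor_pullback1[OF r] F.ftor natural_comparison_at in \<open>simp_all add: hom_iff\<close>, simp add: comparison_def)
  have tensor: "ntrans_comp H S (comparison_at (functor_tensor G S X Y))
        (ntrans_id H S (functor_tensor H S (comp_functor H X recon) (comp_functor H Y recon))) =
      ntrans_comp H S (Mu F X Y) (comparison_at X \<boxtimes>\<^bsub>GSet H\<^esub> comparison_at Y)"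
    if X: "is_functor G S X" and Y: "is_functor G S Y" for X Y
  proof -
    let ?T = "functor_tensor G S X Y" and ?cc = "comparison_at X \<boxtimes>\<^bsub>GSet H\<^esub> comparison_at Y"
    note c = natural_comparison_at[OF X] natural_comparison_at[OF Y]
    have T: "is_functor G S ?T" using X Y by simp
    have cc: "natural H S ?cc" "nsrc ?cc = functor_tensor H S (comp_functor H X recon) (comp_functor H Y recon)"
      "ntgt ?cc = functor_tensor H S (fobj F X) (fobj F Y)"
      using H.E.tensor_simps(2-4)[of "comparison_at X" "comparison_at Y"] c by simp_all
    have M: "natural H S (Mu F X Y)" "nsrc (Mu F X Y) = functor_tensor H S (fobj F X) (fobj F Y)"
      "ntgt (Mu F X Y) = fobj F ?T"
      using F.Mu_simps(1-3)[of X Y] X Y by simp_all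
    have "comparison_at ?T = ntrans_comp H S (Mu F X Y) ?cc"
    proof (rule H.gmap_eqI[OF natural_comparison_at[OF T] H.natural_comp_S[OF cc(1) M(1)]])
      fix h z assume h: "h \<in> Obj H" and "z \<in> fobj (nsrc (comparison_at ?T)) h"
      then obtain x y where z: "z = upair x y" "x \<in> fobj X (obj_of h)" "y \<in> fobj Y (obj_of h)"
        using obj_of[OF h] by (auto elim!: H.uprodE)
      then show "sfun (ncomp (comparison_at ?T) h) z = sfun (ncomp (ntrans_comp H S (Mu F X Y) ?cc) h) z"
        using H.ncomp_comp_apply[OF cc(1) M(1) _ h, of z] cc M h \<theta>_tensor[OF X Y h z(2,3)] obj_of[OF h]
          H.tensor_GSet_apply[OF c h, of x y]
        by (simp add: mu_def del: ntrans_comp_simps(3))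
    qed (use cc M in \<open>simp_all add: pull_tensor[OF r]\<close>)
    moreover have "ntrans_comp H S (comparison_at ?T)
        (ntrans_id H S (functor_tensor H S (comp_functor H X recon) (comp_functor H Y recon))) = comparison_at ?T"
      using ntrans_comp_id_right[OF H.category_set_smcat natural_comparison_at[OF T]] by (simp add: pull_tensor[OF r])
    ultimately show ?thesis by simp
  qed
  have "comparison_at (functor_unit G S) = Eps F"
  proof (rule H.gmap_eqI[OF natural_comparison_at[OF unit_gset]])
    show "natural H S (Eps F)" "nsrc (comparison_at (functor_unit G S)) = nsrc (Eps F)"
      "ntgt (comparison_at (functor_unit G S)) = ntgt (Eps F)"
      using F.Mu_simps(5-7) by (simp_all add: pull_unit[OF r])
    fix h x assume h: "h \<in> Obj H" and "x \<in> fobj (nsrc (comparison_at (functor_unit G S))) h"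
    then have "x = point" "point \<in> fobj (functor_unit G S) (obj_of h)" using obj_of[OF h] by (simp_all add: upoint_eq)
    then show "sfun (ncomp (comparison_at (functor_unit G S)) h) x = sfun (ncomp (Eps F) h) x"
      using \<theta>_in[OF unit_gset h, of point] fib_unit[OF h] h by (simp add: base_def)
  qed
  moreover have "ntrans_comp H S (comparison_at (functor_unit G S)) (ntrans_id H S (functor_unit H S)) = comparison_at (functor_unit G S)"
    using ntrans_comp_id_right[OF H.category_set_smcat natural_comparison_at[OF unit_gset]] by (simp add: pull_unit[OF r])
  ultimately show ?thesis
    unfolding monoidal_transformation_def using nat tensor by simp
qed

text \<open>
  The comparison maps \<open>\<theta>\<close> form a monoidal transformation with invertible components.
\<close>

lemma F_isomorphic_pullback:
  "\<exists>f \<in> Obj (functor_category H G). \<exists>e \<in> hom (Hom_Com2Ring TYPE('u) (GSet G) (GSet H)) (pullback1 H G f) F.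
     is_iso (Hom_Com2Ring TYPE('u) (GSet G) (GSet H)) e"
proof -
  note nat = monoidal_transformation_natural[OF monoidal_comparison]
  obtain s where s: "natural (GSet G) (GSet H) s" "nsrc s = ntgt comparison" "ntgt s = nsrc comparison"
    "ntrans_comp (GSet G) (GSet H) s comparison = ntrans_id (GSet G) (GSet H) (nsrc comparison)"
    "ntrans_comp (GSet G) (GSet H) comparison s = ntrans_id (GSet G) (GSet H) (ntgt comparison)"
    using natural_inverse[OF G.category_GSet H.category_GSet nat] is_iso_comparison_at by auto
  note P = pullback1_in_Hom[OF is_functor_recon]
  interpret c: monoidal_trans "GSet G" "GSet H" comparison
    by unfold_locales (use P F_monoidal monoidal_comparison in simp_all)
  have s': "monoidal_transformation (GSet G) (GSet H) s"
    by (rule monoidal_transformation_inverse[OF c.monoidal_trans_axioms s])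
  have "comparison \<in> hom (Hom_Com2Ring TYPE('u) (GSet G) (GSet H)) (pullback1 H G recon) F"
    "s \<in> hom (Hom_Com2Ring TYPE('u) (GSet G) (GSet H)) F (pullback1 H G recon)"
    using P F_monoidal F_cocontinuous monoidal_comparison s s' by (simp_all add: hom_iff)
  then have "is_iso (Hom_Com2Ring TYPE('u) (GSet G) (GSet H)) comparison"
    using s(4,5) by (intro is_isoI[of comparison _ "pullback1 H G recon" F s]) simp_all
  then show ?thesis
    using is_functor_recon \<open>comparison \<in> _\<close> by auto
qed

end

lemma (in gset_pair) is_equivalence_pullback_functor:
  assumes "groupoid G"
  shows "is_equivalence (functor_category H G) (Hom_Com2Ring TYPE('u) (GSet G) (GSet H)) (pullback_functor H G)"
proof (rule is_equivalenceI[OF category_functor_category[OF H.G.cat G.G.cat] category_Hom is_functor_pullback_functor])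
  fix f f' t assume "f \<in> Obj (functor_category H G)" "f' \<in> Obj (functor_category H G)"
    "t \<in> hom (Hom_Com2Ring TYPE('u) (GSet G) (GSet H)) (fobj (pullback_functor H G) f) (fobj (pullback_functor H G) f')"
  then obtain \<alpha> where "\<alpha> \<in> hom (functor_category H G) f f'" "pullback2 H G \<alpha> = t"
    using pullback_full[of f f' t] by auto
  then show "\<exists>s\<in>hom (functor_category H G) f f'. farr (pullback_functor H G) s = t"
    by (intro bexI[of _ \<alpha>]) (auto simp: hom_iff)
next
  fix f f' \<alpha> \<beta> assume "\<alpha> \<in> hom (functor_category H G) f f'" "\<beta> \<in> hom (functor_category H G) f f'"
    "farr (pullback_functor H G) \<alpha> = farr (pullback_functor H G) \<beta>"
  then show "\<alpha> = \<beta>" using pullback_faithful[of \<alpha> f f' \<beta>] by (simp add: hom_iff)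
next
  fix F assume F: "F \<in> Obj (Hom_Com2Ring TYPE('u) (GSet G) (GSet H))"
  interpret gset_morphism u H G F
    by unfold_locales (use F assms in simp_all)
  show "\<exists>f\<in>Obj (functor_category H G). \<exists>e\<in>hom (Hom_Com2Ring TYPE('u) (GSet G) (GSet H)) (fobj (pullback_functor H G) f) F.
      is_iso (Hom_Com2Ring TYPE('u) (GSet G) (GSet H)) e"
    using F_isomorphic_pullback by auto
qed

theorem corollary5p0p2:
  assumes "inaccessible_universe TYPE('u)"
  shows "fully_faithful_two_functor (Gpd :: (('u, 'u) cat, 'u gfun, 'u gtrans) two_cat)
           (Af2Sch TYPE('u)) two_Spec_GSet \<and>
         (\<forall>(H :: ('u, 'u) cat) (G :: ('u, 'u) cat). small_groupoid H \<and> small_groupoid G \<longrightarrow>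
            is_equivalence (HomCat Gpd H G) (HomCat (Com2Ring TYPE('u)) (GSet G) (GSet H))
              (pullback_functor H G))"
proof -
  interpret universe "TYPE('u)" using assms by unfold_locales
  have equiv: "is_equivalence (HomCat Gpd H G) (HomCat (Com2Ring TYPE('u)) (GSet G) (GSet H)) (pullback_functor H G)"
    if "small_groupoid H" "small_groupoid G" for H G :: "('u, 'u) cat"
  proof -
    interpret gset_pair "TYPE('u)" H G
      by unfold_locales (use that in \<open>simp_all add: small_groupoid_def\<close>)
    show ?thesis using is_equivalence_pullback_functor that by (simp add: small_groupoid_def)
  qed
  have "is_equivalence (HomCat Gpd H G) (HomCat (Af2Sch TYPE('u)) (two_obj two_Spec_GSet H) (two_obj two_Spec_GSet G))
      (two_hom two_Spec_GSet H G)" if "small_groupoid H" "small_groupoid G" for H G :: "('u, 'u) cat"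
    using equiv[OF that] by (simp add: Af2Sch_def one_opposite_def two_Spec_GSet_def two_Spec_def)
  then show ?thesis
    unfolding fully_faithful_two_functor_def using two_functor_two_Spec_GSet equiv by simp
qed

end
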